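(* Let $m\ge 3$ and $n\ge 1$. Assume that $P_m(\partial_t,\partial_x)$ and $P_{m-1}(\partial_t,\partial_x)$ are strictly hyperbolic homogeneous operators of order $m$ and $m-1$ on $\mathbb{R}_t\times\mathbb{R}^n_x$, normalized by $c_{m,0}=1$ and $c_{m-1,0}>0$, and that the polynomials $P_{m-1}(\lambda,\xi')$ and $P_m(\lambda,\xi')$ (in $\lambda$) strictly interlace for any $\xi'\in S^{n-1}$. Let $s_0\ge m-1$, $q\in[1,2]$ and $$u_j\in H^{s_0-j}\cap L^q,\qquad j=0,\ldots,m-1 .$$ (a) Let $Q=Q_1=P_m+P_{m-1}$. Then the solution $u$ to the Cauchy problem $$Q(\partial_t,\partial_x)u=0\quad (t\ge 0,\ x\in\mathbb{R}^n),\qquad \partial_t^ju(0,x)=u_j(x),\quad j=0,\ldots,m-1,$$ satisfies $$\|\partial_t^ku(t,\cdot)\|_{\dot H^s}\le C(1+t)^{-\frac n2\left(\frac1q-\frac12\right)-\frac{k+s-(m-2)}2}\sum_{j=m-2,\,m-1}\big(\|u_j\|_{L^q}+\|u_j\|_{H^{k+s-j}}\big)+C\sum_{j=0}^{m-3}(1+t)^{-\frac n2\left(\frac1q-\frac12\right)-\frac{k+s-j}2}\big(\|u_j\|_{L^q}+\|u_j\|_{H^{k+s-j}}\big)$$ for any $k+s\le s_0$ such that $k+s\ge m-2$ if $q=2$, or $n(1/q-1/2)+k+s>m-2$ otherwise, with $C>0$ independent of the initial data. (b) Assume, moreover, that $P_{m-2}(\partial_t,\partial_x)$ is a strictly hyperbolic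 homogeneous operator of order $m-2$ with $c_{m-2,0}>0$, and that $P_{m-2}(\lambda,\xi')$ and $P_{m-1}(\lambda,\xi')$ strictly interlace for any $\xi'\in S^{n-1}$. Let $Q=Q_2=P_m+P_{m-1}+P_{m-2}$. Then the solution $u$ to the same Cauchy problem with this $Q$ satisfies $$\|\partial_t^ku(t,\cdot)\|_{\dot H^s}\le C(1+t)^{-\frac n2\left(\frac1q-\frac12\right)-\frac{k+s-(m-3)}2}\sum_{j=m-3}^{m-1}\big(\|u_j\|_{L^q}+\|u_j\|_{H^{k+s-j}}\big)+C\sum_{j=0}^{m-4}(1+t)^{-\frac n2\left(\frac1q-\frac12\right)-\frac{k+s-j}2}\big(\|u_j\|_{L^q}+\|u_j\|_{H^{k+s-j}}\big)$$ for any $k+s\le s_0$ such that $k+s\ge m-3$ if $q=2$, or $n(1/q-1/2)+k+s>m-3$ otherwise, with $C>0$ independent of the initial data.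
   Context: A homogeneous operator of order $r$ is $P_r(\partial_t,\partial_x)=\sum_{k+|\alpha|=r}c_{k,\alpha}\partial_t^k\partial_x^\alpha$ with constant coefficients and $c_{r,0}>0$; its symbol is $P_r(\lambda,\xi)=\sum_{k+|\alpha|=r}c_{k,\alpha}\lambda^k\xi^\alpha$, $\xi\in\mathbb{R}^n$ (no factors of $i$). It is hyperbolic if, for every $\xi'\in S^{n-1}=\{\xi\in\mathbb{R}^n:|\xi|=1\}$, the polynomial $\lambda\mapsto P_r(\lambda,\xi')$ has only real roots, and strictly hyperbolic if in addition these roots are distinct for every $\xi'\in S^{n-1}$. If $p_{r-1}$, $p_r$ are polynomials of degree $r-1$, $r$ with real roots $\tilde\lambda_1\le\dots\le\tilde\lambda_{r-1}$ and $\lambda_1\le\dots\le\lambda_r$, they strictly interlace if $\lambda_1<\tilde\lambda_1<\lambda_2<\tilde\lambda_2<\dots<\tilde\lambda_{r-1}<\lambda_r$. Here $k\ge 0$ is an integer and $s\ge0$ is real. $\hat f$ is the Fourier transform in $x$, $\|f\|_{H^\sigma}=\|(1+|\xi|^2)^{\sigma/2}\hat f\|_{L^2}$ (the same formula is used when $\sigma<0$), $\|f\|_{\dot H^s}=\||\xi|^s\hat f\|_{L^2}$, $L^q=L^q(\mathbb{R}^n)$. Empty sums are zero. *)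

theory Defs
  imports "HOL-Analysis.Analysis" "HOL-Computational_Algebra.Polynomial"
begin

text \<open>Elements of \<open>L\<^sup>p\<close> are represented by Borel functions. The norms below are real numbers given
  by Bochner integrals, hence meaningful only together with the corresponding membership.\<close>

definition Lp :: "real \<Rightarrow> ((real^'n) \<Rightarrow> complex) set" where
  "Lp p = {f. f \<in> borel_measurable lborel \<and> integrable lborel (\<lambda>x. norm (f x) powr p)}"

definition Lp_norm :: "real \<Rightarrow> ((real^'n) \<Rightarrow> complex) \<Rightarrow> real" where
  "Lp_norm p f = (LINT x|lborel. norm (f x) powr p) powr (1 / p)"

text \<open>The Fourier transform on \<open>L\<^sup>2\<close>: the limit in \<open>L\<^sup>2\<close>, as \<open>R\<close> tends to infinity, of the integrals
  over balls of radius \<open>R\<close>. The limit is expressed by \<open>nn_integral\<close>, which, unlike the Bochner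
  integral, does not vanish on functions that fail to be square integrable.\<close>

definition fourier_ball :: "real \<Rightarrow> ((real^'n) \<Rightarrow> complex) \<Rightarrow> (real^'n) \<Rightarrow> complex" where
  "fourier_ball R f \<xi> = (LINT x:cball 0 R|lborel. cis (- (x \<bullet> \<xi>)) * f x)"

definition is_fourier :: "((real^'n) \<Rightarrow> complex) \<Rightarrow> ((real^'n) \<Rightarrow> complex) \<Rightarrow> bool" where
  "is_fourier f g \<longleftrightarrow> f \<in> Lp 2 \<and> g \<in> Lp 2 \<and>
     ((\<lambda>R. \<integral>\<^sup>+ \<xi>. ennreal ((norm (fourier_ball R f \<xi> - g \<xi>))\<^sup>2) \<partial>lborel) \<longlongrightarrow> 0) at_top"

definition fourier :: "((real^'n) \<Rightarrow> complex) \<Rightarrow> (real^'n) \<Rightarrow> complex" where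
  "fourier f = (SOME g. is_fourier f g)"

definition bessel_weighted :: "real \<Rightarrow> ((real^'n) \<Rightarrow> complex) \<Rightarrow> (real^'n) \<Rightarrow> complex" where
  "bessel_weighted \<sigma> g \<xi> = complex_of_real ((1 + (norm \<xi>)\<^sup>2) powr (\<sigma> / 2)) * g \<xi>"

definition riesz_weighted :: "real \<Rightarrow> ((real^'n) \<Rightarrow> complex) \<Rightarrow> (real^'n) \<Rightarrow> complex" where
  "riesz_weighted s g \<xi> = complex_of_real (norm \<xi> powr s) * g \<xi>"

text \<open>The set \<open>sobolev \<sigma>\<close> is \<open>H\<^sup>\<sigma>\<close> for \<open>\<sigma> \<ge> 0\<close>, and \<open>hom_sobolev s\<close> consists of the functions in \<open>L\<^sup>2\<close>
  with finite homogeneous norm of order \<open>s\<close>. The norms are also used, with \<open>\<sigma> < 0\<close>, for functions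
  in \<open>L\<^sup>2\<close>.\<close>

definition sobolev :: "real \<Rightarrow> ((real^'n) \<Rightarrow> complex) set" where
  "sobolev \<sigma> = {f. is_fourier f (fourier f) \<and> bessel_weighted \<sigma> (fourier f) \<in> Lp 2}"

definition sobolev_norm :: "real \<Rightarrow> ((real^'n) \<Rightarrow> complex) \<Rightarrow> real" where
  "sobolev_norm \<sigma> f = Lp_norm 2 (bessel_weighted \<sigma> (fourier f))"

definition hom_sobolev :: "real \<Rightarrow> ((real^'n) \<Rightarrow> complex) set" where
  "hom_sobolev s = {f. is_fourier f (fourier f) \<and> riesz_weighted s (fourier f) \<in> Lp 2}"

definition hom_sobolev_norm :: "real \<Rightarrow> ((real^'n) \<Rightarrow> complex) \<Rightarrow> real" where
  "hom_sobolev_norm s f = Lp_norm 2 (riesz_weighted s (fourier f))"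

text \<open>An operator \<open>\<Sum> c k \<alpha> \<partial>\<^sub>t\<^sup>k \<partial>\<^sub>x\<^sup>\<alpha>\<close> is given by its finitely supported family of coefficients.
  They may be complex; hyperbolicity forces them to be real.\<close>

type_synonym 'n mindex = "'n \<Rightarrow> nat"
type_synonym 'n operator = "nat \<Rightarrow> 'n mindex \<Rightarrow> complex"

definition msize :: "'n::finite mindex \<Rightarrow> nat" where
  "msize \<alpha> = (\<Sum>i\<in>UNIV. \<alpha> i)"

definition mpow :: "real^'n \<Rightarrow> 'n mindex \<Rightarrow> real" where
  "mpow \<xi> \<alpha> = (\<Prod>i\<in>UNIV. (\<xi> $ i) ^ \<alpha> i)"

definition homogeneous_op :: "nat \<Rightarrow> 'n::finite operator \<Rightarrow> bool" where
  "homogeneous_op r c \<longleftrightarrow>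
     (\<forall>k \<alpha>. c k \<alpha> \<noteq> 0 \<longrightarrow> k + msize \<alpha> = r) \<and> c r (\<lambda>_. 0) \<in> \<real> \<and> Re (c r (\<lambda>_. 0)) > 0"

definition symbol :: "'n::finite operator \<Rightarrow> real^'n \<Rightarrow> complex poly" where
  "symbol c \<xi> = (\<Sum>(k, \<alpha>) | c k \<alpha> \<noteq> 0. monom (c k \<alpha> * complex_of_real (mpow \<xi> \<alpha>)) k)"

definition hyperbolic :: "nat \<Rightarrow> 'n::finite operator \<Rightarrow> bool" where
  "hyperbolic r c \<longleftrightarrow> homogeneous_op r c \<and>
     (\<forall>\<xi>\<in>sphere 0 1. \<forall>z. poly (symbol c \<xi>) z = 0 \<longrightarrow> z \<in> \<real>)"

definition strictly_hyperbolic :: "nat \<Rightarrow> 'n::finite operator \<Rightarrow> bool" where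
  "strictly_hyperbolic r c \<longleftrightarrow> hyperbolic r c \<and>
     (\<forall>\<xi>\<in>sphere 0 1. \<forall>z. poly (symbol c \<xi>) z = 0 \<longrightarrow> order z (symbol c \<xi>) = 1)"

text \<open>The list \<open>xs\<close> consists of all roots of \<open>p\<close>, with multiplicity, in nondecreasing order.\<close>

definition real_roots :: "complex poly \<Rightarrow> real list \<Rightarrow> bool" where
  "real_roots p xs \<longleftrightarrow> p \<noteq> 0 \<and> sorted xs \<and>
     p = smult (lead_coeff p) (\<Prod>x\<leftarrow>xs. [:- complex_of_real x, 1:])"

definition strictly_interlace :: "complex poly \<Rightarrow> complex poly \<Rightarrow> bool" where
  "strictly_interlace p q \<longleftrightarrow> (\<exists>xs ys. real_roots p xs \<and> real_roots q ys \<and>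
     length ys = length xs + 1 \<and> (\<forall>i<length xs. ys ! i < xs ! i \<and> xs ! i < ys ! (i + 1)))"

definition partial_deriv :: "'n \<Rightarrow> ((real^'n) \<Rightarrow> complex) \<Rightarrow> (real^'n) \<Rightarrow> complex" where
  "partial_deriv i f x = vector_derivative (\<lambda>h. f (x + h *\<^sub>R axis i 1)) (at 0)"

definition schwartz :: "((real^'n) \<Rightarrow> complex) \<Rightarrow> bool" where
  "schwartz \<phi> \<longleftrightarrow> (\<forall>is. (\<forall>x. foldr partial_deriv is \<phi> differentiable (at x)) \<and>
     (\<forall>N::nat. bounded (range (\<lambda>x. (1 + norm x) ^ N * norm (foldr partial_deriv is \<phi> x)))))"

text \<open>The derivatives are taken in an arbitrary order, which is immaterial for smooth functions.\<close>

definition multi_deriv :: "'n mindex \<Rightarrow> ((real^'n) \<Rightarrow> complex) \<Rightarrow> (real^'n) \<Rightarrow> complex" where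
  "multi_deriv \<alpha> \<phi> = foldr partial_deriv (SOME is. \<forall>i. count_list is i = \<alpha> i) \<phi>"

definition pairing :: "(real \<Rightarrow> (real^'n) \<Rightarrow> complex) \<Rightarrow> ((real^'n) \<Rightarrow> complex) \<Rightarrow> real \<Rightarrow> complex" where
  "pairing u \<phi> t = (LINT x|lborel. u t x * \<phi> x)"

definition time_deriv :: "nat \<Rightarrow> (real \<Rightarrow> complex) \<Rightarrow> real \<Rightarrow> complex" where
  "time_deriv k = (\<lambda>g t. vector_derivative g (at t within {0..})) ^^ k"

text \<open>\<open>Q u = 0\<close>, for \<open>Q\<close> of order \<open>m\<close>, holds in the space of tempered distributions on \<open>\<real>\<^sup>n\<close> for every
  \<open>t \<ge> 0\<close>: derivatives in \<open>x\<close> are moved to the test function, derivatives in \<open>t\<close> (one-sided at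
  \<open>t = 0\<close>) act on the pairing. The derivative of order \<open>m\<close> in \<open>t\<close> need not be a function of \<open>x\<close>.\<close>

definition satisfies_pde :: "nat \<Rightarrow> 'n::finite operator \<Rightarrow> (real \<Rightarrow> (real^'n) \<Rightarrow> complex) \<Rightarrow> bool" where
  "satisfies_pde m Q u \<longleftrightarrow> (\<forall>\<phi>. schwartz \<phi> \<longrightarrow> (\<forall>t\<ge>0.
     (\<forall>k<m. time_deriv k (pairing u \<phi>) differentiable (at t within {0..})) \<and>
     (\<Sum>(k, \<alpha>) | Q k \<alpha> \<noteq> 0.
        Q k \<alpha> * (- 1) ^ msize \<alpha> * time_deriv k (pairing u (multi_deriv \<alpha> \<phi>)) t) = 0))"

text \<open>\<open>u\<close> belongs to \<open>C\<^sup>j([0,\<infinity>), H\<^sup>\<sigma>\<^sup>-\<^sup>j)\<close> for every integer \<open>0 \<le> j \<le> \<sigma>\<close>, and \<open>U j = \<partial>\<^sub>t\<^sup>j u\<close> for these \<open>j\<close>.\<close>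

definition time_derivatives ::
    "real \<Rightarrow> (real \<Rightarrow> (real^'n) \<Rightarrow> complex) \<Rightarrow> (nat \<Rightarrow> real \<Rightarrow> (real^'n) \<Rightarrow> complex) \<Rightarrow> bool" where
  "time_derivatives \<sigma> u U \<longleftrightarrow> U 0 = u \<and>
     (\<forall>j. real j \<le> \<sigma> \<longrightarrow> (\<forall>t\<ge>0. U j t \<in> sobolev (\<sigma> - real j) \<and>
        ((\<lambda>\<tau>. sobolev_norm (\<sigma> - real j) (\<lambda>x. U j \<tau> x - U j t x)) \<longlongrightarrow> 0) (at t within {0..}))) \<and>
     (\<forall>j. real (Suc j) \<le> \<sigma> \<longrightarrow> (\<forall>t\<ge>0.
        ((\<lambda>\<tau>. sobolev_norm (\<sigma> - real (Suc j))
            (\<lambda>x. (U j \<tau> x - U j t x) / complex_of_real (\<tau> - t) - U (Suc j) t x)) \<longlongrightarrow> 0)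
          (at t within {0..})))"

text \<open>Meant for \<open>\<sigma> \<ge> m - 1\<close>, so that the initial values of \<open>\<partial>\<^sub>t\<^sup>j u\<close>, \<open>j < m\<close>, are elements of \<open>L\<^sup>2\<close>.\<close>

definition cauchy_solution ::
    "real \<Rightarrow> nat \<Rightarrow> 'n::finite operator \<Rightarrow> (nat \<Rightarrow> (real^'n) \<Rightarrow> complex) \<Rightarrow>
     (real \<Rightarrow> (real^'n) \<Rightarrow> complex) \<Rightarrow> (nat \<Rightarrow> real \<Rightarrow> (real^'n) \<Rightarrow> complex) \<Rightarrow> bool" where
  "cauchy_solution \<sigma> m Q u0 u U \<longleftrightarrow> time_derivatives \<sigma> u U \<and> satisfies_pde m Q u \<and>
     (\<forall>j<m. AE x in lborel. U j 0 x = u0 j x)"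

end

theory Submission
 imports Defs "HOL-Probability.Probability" "HOL-Computational_Algebra.Fundamental_Theorem_Algebra"
begin

text \<open>
The Fourier transform in \<open>x\<close> turns the equation into an ordinary differential equation for each frequency
\<open>xi = rho * omega\<close>, and the theorem is a pointwise estimate of its solutions followed by an integration.

\<^emph>\<open>Energy.\<close> With \<open>Y k = y k / (\<i> rho)^k\<close> the equation reads \<open>- rho^2 P(Y) + P2(Y) + \<i> rho P1(Y) = 0\<close>, where the
symbols act as linear forms with real coefficients on the vector of the \<open>Y k\<close>. The Bezoutian of two polynomials
defines a Hermitian form which is positive definite if they interlace (\<open>bez_interlacing_coercive\<close>), and along
solutions the sum of the forms of \<open>(P, P1)\<close> and, divided by \<open>rho^2\<close>, of \<open>(P1, P2)\<close> has the derivative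
\<open>- 2 * |P1(Y)|^2\<close>. Coercivity is an open condition, so that the same argument works for \<open>exp (sigma * t) * y\<close> with
\<open>sigma\<close> a small multiple of \<open>rho^2 / (1 + rho^2)\<close>. This gives the decay at the rate \<open>exp (- sigma * t)\<close>
(\<open>energy_decay\<close>): exponential decay at high frequencies, and heat-like decay at low frequencies.

\<^emph>\<open>Low frequencies.\<close> For small \<open>rho\<close> the characteristic polynomial has one root (or two roots, in the presence of
\<open>P2\<close>) with real part bounded away from zero, while the remaining \<open>N\<close> roots are of size \<open>rho\<close>. The solution splits
accordingly. The fast part decays exponentially. To the slow part the energy estimate applies, and its data are
controlled by \<open>N\<close> initial values only; hence the exponent \<open>min j (N - 1)\<close> in \<open>low_frequency_bound\<close>, which produces the
two kinds of terms in the theorem. All constants are uniform in \<open>omega\<close> since the sphere is compact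
(\<open>frequency_estimates\<close>).

\<^emph>\<open>Integration.\<close> At low frequencies one needs the \<open>L^2\<close> norm of \<open>|xi|^a * exp (- c * |xi|^2 * t)\<close> times the Fourier
transform of a function in \<open>L^q\<close>. Since the weight is Gaussian, a Schur type estimate with a Gaussian kernel takes the
place of the Hausdorff-Young inequality (\<open>is_fourier_gauss_bound\<close>); negative \<open>a\<close> are handled by a superposition of
Gaussians of dyadic widths (\<open>low_frequency_integral\<close>).

\<^emph>\<open>Identification.\<close> It has to be shown that a distributional solution solves the differential equation at almost
every frequency. Against a polynomial multiple of a modulated Gaussian, the transform of \<open>u\<close> and its formal time
derivatives of all orders pair to smooth functions of time, whose Taylor series converges because Gaussians decay
faster than any exponential. So the transform of the solution agrees with the power series solution of the differential
equation when tested with modulated Gaussians, hence almost everywhere (\<open>solution_modes\<close>).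
\<close>

section \<open>The Bezoutian form of interlacing polynomials\<close>

text \<open>The real part of the Hermitian form attached to the coefficients of \<open>(x^a * y^b - x^b * y^a) / (x - y)\<close>, the
elementary Bezoutian of two monomials; \<open>bez\<close> is its bilinear extension to polynomials.\<close>

definition bez_term :: "(nat => complex) => nat => nat => real" where
 "bez_term V a b = (\<Sum>i<a-b. Re (V (b+i) * cnj (V (a-1-i))))"

definition bez :: "nat => (nat => real) => (nat => real) => (nat => complex) => real" where
 "bez n p r V = (\<Sum>a\<le>n. \<Sum>b<a. (p a * r b - p b * r a) * bez_term V a b)"

definition lin :: "nat => (nat => real) => (nat => complex) => complex" where
 "lin n p V = (\<Sum>k\<le>n. of_real (p k) * V k)"

definition sq :: "nat => (nat => complex) => real" where
 "sq n V = (\<Sum>k<n. (cmod (V k))^2)"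

lemma sum_symmetrize:
 fixes f :: "nat => nat => 'a::comm_monoid_add"
 shows "(\<Sum>a\<le>n. \<Sum>b\<le>n. f a b) = (\<Sum>a\<le>n. (\<Sum>b<a. f a b + f b a) + f a a)"
proof (induction n)
 case (Suc n)
 have "(\<Sum>a\<le>Suc n. \<Sum>b\<le>Suc n. f a b)
   = (\<Sum>a\<le>n. \<Sum>b\<le>n. f a b) + (\<Sum>a\<le>n. f a (Suc n)) + ((\<Sum>b\<le>n. f (Suc n) b) + f (Suc n) (Suc n))"
  by (simp add: sum.distrib ac_simps)
 also have "... = (\<Sum>a\<le>Suc n. (\<Sum>b<a. f a b + f b a) + f a a)"
  by (simp add: Suc sum.distrib lessThan_Suc_atMost ac_simps)
 finally show ?case .
qed simp

lemma bez_term_self [simp]: "bez_term V a a = 0"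
 by (simp add: bez_term_def)

lemma bez_term_step: "bez_term V (Suc a) a = (cmod (V a))^2"
 by (simp add: bez_term_def complex_norm_square[symmetric] cmod_def power2_eq_square)

lemma bez_term_diff:
 assumes "b < a"
 shows "bez_term V (Suc a) b - bez_term V a (Suc b) = 2 * Re (V a * cnj (V b))"
proof -
 define d where "d = a - b - 1"
 have a: "a = Suc (b + d)" using assms by (simp add: d_def)
 have 1: "bez_term V (Suc a) b = (\<Sum>i<Suc (Suc d). Re (V (b+i) * cnj (V (Suc (b+d) - i))))"
  by (simp add: bez_term_def a Suc_diff_le)
 have 2: "bez_term V a (Suc b) = (\<Sum>i<d. Re (V (b + Suc i) * cnj (V (Suc (b+d) - Suc i))))"
  by (simp add: bez_term_def a)
 have "bez_term V (Suc a) b = Re (V b * cnj (V a)) + (bez_term V a (Suc b) + Re (V a * cnj (V b)))"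
  unfolding 1 2 by (subst sum.lessThan_Suc_shift) (simp add: a)
 then show ?thesis by (simp add: mult.commute)
qed

text \<open>If \<open>p = (x - y) * c\<close> then the Bezoutian of \<open>p\<close> and \<open>c\<close> is the product \<open>c(x) * c(x')\<close>: a square.\<close>

lemma bez_linear_factor:
 fixes c p :: "nat => real"
 assumes c: "!!k. k >= n ==> c k = 0"
  and p: "!!a. p a = (if a = 0 then 0 else c (a - 1)) - y * c a"
 shows "bez n p c V = (cmod (lin n c V))^2"
proof -
 have e: "(p a * c b - p b * c a) = (if a = 0 then 0 else c (a-1) * c b) - (if b = 0 then 0 else c (b-1) * c a)" for a b
  by (simp add: p algebra_simps)
 have "bez n p c V = (\<Sum>a\<le>n. \<Sum>b<a. (if a = 0 then 0 else c (a-1) * c b) * bez_term V a b)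
   - (\<Sum>a\<le>n. \<Sum>b<a. (if b = 0 then 0 else c (b-1) * c a) * bez_term V a b)"
  unfolding bez_def e left_diff_distrib sum_subtractf ..
 also have "(\<Sum>a\<le>n. \<Sum>b<a. (if a = 0 then 0 else c (a-1) * c b) * bez_term V a b)
   = (\<Sum>a\<le>n. \<Sum>b\<le>a. c a * c b * bez_term V (Suc a) b)"
 proof (cases n)
  case (Suc k)
  show ?thesis unfolding Suc
   by (subst sum.atMost_Suc_shift) (use c[of "Suc k"] Suc in \<open>simp add: lessThan_Suc_atMost\<close>)
 qed (use c in auto)
 also have "(\<Sum>a\<le>n. \<Sum>b<a. (if b = 0 then 0 else c (b-1) * c a) * bez_term V a b)
   = (\<Sum>a\<le>n. \<Sum>b<a. c a * c b * bez_term V a (Suc b))"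
 proof (rule sum.cong[OF refl])
  fix a
  show "(\<Sum>b<a. (if b = 0 then 0 else c (b-1) * c a) * bez_term V a b)
   = (\<Sum>b<a. c a * c b * bez_term V a (Suc b))"
  proof (cases a)
   case (Suc k)
   have "(\<Sum>b<Suc k. (if b = 0 then 0 else c (b-1) * c a) * bez_term V a b)
    = (\<Sum>b<k. c a * c b * bez_term V a (Suc b))"
    by (subst sum.lessThan_Suc_shift) (simp add: mult.commute)
   then show ?thesis using Suc by simp
  qed simp
 qed
 also have "(\<Sum>a\<le>n. \<Sum>b\<le>a. c a * c b * bez_term V (Suc a) b) - (\<Sum>a\<le>n. \<Sum>b<a. c a * c b * bez_term V a (Suc b))
  = (\<Sum>a\<le>n. (\<Sum>b<a. c a * c b * (2 * Re (V a * cnj (V b)))) + c a * c a * (cmod (V a))^2)"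
  unfolding sum_subtractf[symmetric]
 proof (rule sum.cong[OF refl])
  fix a
  have "(\<Sum>b\<le>a. c a * c b * bez_term V (Suc a) b) = (\<Sum>b<a. c a * c b * bez_term V (Suc a) b) + c a * c a * (cmod (V a))^2"
   by (simp add: lessThan_Suc_atMost[symmetric] bez_term_step)
  moreover have "(\<Sum>b<a. c a * c b * bez_term V (Suc a) b) - (\<Sum>b<a. c a * c b * bez_term V a (Suc b))
   = (\<Sum>b<a. c a * c b * (2 * Re (V a * cnj (V b))))"
   unfolding sum_subtractf[symmetric] by (rule sum.cong) (auto simp: bez_term_diff right_diff_distrib[symmetric])
  ultimately show "(\<Sum>b\<le>a. c a * c b * bez_term V (Suc a) b) - (\<Sum>b<a. c a * c b * bez_term V a (Suc b))
   = (\<Sum>b<a. c a * c b * (2 * Re (V a * cnj (V b)))) + c a * c a * (cmod (V a))^2" by simp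
 qed
 also have "... = Re (\<Sum>a\<le>n. \<Sum>b\<le>n. (of_real (c a) * V a) * cnj (of_real (c b) * V b))"
  unfolding sum_symmetrize
  by (auto intro!: sum.cong simp: cmod_power2 algebra_simps)
   (auto simp: power2_eq_square)
 also have "... = Re (lin n c V * cnj (lin n c V))"
  unfolding lin_def cnj_sum sum_product ..
 also have "... = (cmod (lin n c V))^2"
  by (simp add: complex_norm_square[symmetric] flip: of_real_power)
 finally show ?thesis .
qed

lemma bez_sum_right:
 "bez n p (%k. \<Sum>j\<in>J. A j * r j k) V = (\<Sum>j\<in>J. A j * bez n p (r j) V)"
proof (induction J rule: infinite_finite_induct)
 case (insert x F)
 have "bez n p (%k. A x * r x k + s k) V = A x * bez n p (r x) V + bez n p s V" for s
  unfolding bez_def sum_distrib_left sum.distrib[symmetric] 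
  by (intro sum.cong refl) (simp add: algebra_simps)
 then show ?case using insert by simp
qed (simp_all add: bez_def)

lemma poly_eqI_at_points:
 fixes f g :: "real poly"
 assumes "!!i. i < n ==> poly f (y i) = poly g (y i)" "inj_on y {..<n}" "degree f < n" "degree g < n"
 shows "f = g"
proof (rule poly_eqI_degree[of "y ` {..<n}"])
 show "card (y ` {..<n}) > degree f" "card (y ` {..<n}) > degree g"
  using assms by (simp_all add: card_image)
qed (use assms in auto)

text \<open>By Lagrange interpolation \<open>R\<close> is a combination of the quotients of \<open>P\<close> by its linear factors, with positive weights
exactly because of the interlacing. Hence the form is a positive combination of squares of linearly independent forms.\<close>

lemma bez_interlacing_coercive:
 fixes x y :: "nat => real"
 assumes ab: "a > 0" "b > 0"
  and P: "P = smult a (\<Prod>i<n. [:- y i, 1:])"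
  and R: "R = smult b (\<Prod>i<n-1. [:- x i, 1:])"
  and il: "!!i. i < n - 1 ==> y i < x i & x i < y (Suc i)"
  and n: "n >= 1"
 shows "EX delta>0. ALL V. bez n (coeff P) (coeff R) V >= delta * sq n V"
proof -
 have mono: "y i < y j" if "i < j" "j < n" for i j
  using that
 proof (induction j)
  case (Suc j)
  have "y j < y (Suc j)" using il[of j] Suc.prems by force
  with Suc show ?case by (cases "i = j") auto
 qed simp
 have inj: "inj_on y {..<n}"
  by (rule inj_onI) (metis lessThan_iff linorder_neqE_nat mono order_less_irrefl)
 define Pj where "Pj j = smult a (\<Prod>i\<in>{..<n}-{j}. [:- y i, 1:])" for j
 have PPj: "P = [:- y j, 1:] * Pj j" if "j < n" for j
  unfolding P Pj_def using that by (subst prod.remove[of _ j]) auto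
 have evalPj: "poly (Pj j) t = a * (\<Prod>i\<in>{..<n}-{j}. (t - y i))" for j t
  by (simp add: Pj_def poly_prod)
 have zero: "poly (Pj j) (y i) = 0" if "i < n" "i ~= j" for i j
  using that by (auto simp: evalPj)
 have nz: "poly (Pj j) (y j) ~= 0" if "j < n" for j
  using that inj ab by (auto simp: evalPj inj_on_def)
 have degPj: "degree (Pj j) = n - 1" if "j < n" for j
  using that ab by (simp add: Pj_def degree_prod_eq_sum_degree)
 have degR: "degree R <= n - 1"
  unfolding R using degree_prod_sum_le[of "{..<n-1}" "%i. [:- x i, 1:]"] by (simp add: o_def)
 define A where "A j = poly R (y j) / poly (Pj j) (y j)" for j
 have Apos: "A j > 0" if j: "j < n" for j
 proof -
  have "(\<Prod>i\<in>{..<n}-{j}. (y j - y i)) = (\<Prod>i<n-1. (y j - y (if i < j then i else Suc i)))"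
   by (rule prod.reindex_bij_witness[of _ "%i. if i < j then i else Suc i" "%i. if i < j then i else i - 1"])
    (use j in \<open>auto split: if_splits\<close>)
  then have "poly R (y j) * poly (Pj j) (y j) = (a * b) * (\<Prod>i<n-1. (y j - x i) * (y j - y (if i < j then i else Suc i)))"
   by (simp add: R evalPj poly_prod prod.distrib mult_ac)
  moreover have "(\<Prod>i<n-1. (y j - x i) * (y j - y (if i < j then i else Suc i))) > 0"
  proof (rule prod_pos)
   fix i assume "i : {..<n-1}"
   then have i: "i < n - 1" by simp
   show "0 < (y j - x i) * (y j - y (if i < j then i else Suc i))"
   proof (cases "i < j")
    case True
    have "x i < y (Suc i)" using il[OF i] by simp
    also have "y (Suc i) <= y j" using True mono[of "Suc i" j] j by (cases "Suc i = j") auto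
    finally show ?thesis using True mono[of i j] j by simp
   next
    case False
    have "y j <= y i" using False mono[of j i] i by (cases "i = j") force+
    also have "y i < x i" using il[OF i] by simp
    finally have "y j - x i < 0" by simp
    moreover have "y j < y (Suc i)" using False mono[of j "Suc i"] i by simp
    ultimately show ?thesis using False by (simp add: mult_neg_neg)
   qed
  qed
  ultimately have "poly R (y j) * poly (Pj j) (y j) > 0" using ab by simp
  then show ?thesis unfolding A_def by (simp add: zero_less_divide_iff zero_less_mult_iff)
 qed
 have lagrange: "f = (\<Sum>j<n. smult (poly f (y j) / poly (Pj j) (y j)) (Pj j))" if "degree f < n" for f
 proof (rule poly_eqI_at_points[OF _ inj that])
  fix i assume i: "i < n"
  have "poly (\<Sum>j<n. smult (poly f (y j) / poly (Pj j) (y j)) (Pj j)) (y i)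
   = (\<Sum>j<n. if j = i then poly f (y i) else 0)"
   unfolding poly_sum by (rule sum.cong) (use i nz zero in auto)
  then show "poly f (y i) = poly (\<Sum>j<n. smult (poly f (y j) / poly (Pj j) (y j)) (Pj j)) (y i)"
   using i by simp
 next
  show "degree (\<Sum>j<n. smult (poly f (y j) / poly (Pj j) (y j)) (Pj j)) < n"
  proof (rule le_less_trans[of _ "n-1"])
   show "degree (\<Sum>j<n. smult (poly f (y j) / poly (Pj j) (y j)) (Pj j)) <= n - 1"
    by (rule degree_sum_le) (use degPj in \<open>auto intro: order.trans[OF degree_smult_le]\<close>)
  qed (use n in auto)
 qed
 have coR: "coeff R = (%k. \<Sum>j<n. A j * coeff (Pj j) k)"
 proof
  fix k
  have "R = (\<Sum>j<n. smult (A j) (Pj j))" using lagrange[of R] degR n by (simp add: A_def)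
  then show "coeff R k = (\<Sum>j<n. A j * coeff (Pj j) k)"
   by (metis (mono_tags, lifting) coeff_smult coeff_sum sum.cong)
 qed
 define L where "L j V = lin n (coeff (Pj j)) V" for j V
 have bezj: "bez n (coeff P) (coeff (Pj j)) V = (cmod (L j V))^2" if "j < n" for j V
  unfolding L_def
 proof (rule bez_linear_factor[where y = "y j"])
  show "coeff (Pj j) k = 0" if "n <= k" for k
   using that degPj[OF \<open>j<n\<close>] n by (intro coeff_eq_0) auto
  show "coeff P k = (if k = 0 then 0 else coeff (Pj j) (k - 1)) - y j * coeff (Pj j) k" for k
   unfolding PPj[OF \<open>j<n\<close>] by (cases k) auto
 qed
 have bez_eq: "bez n (coeff P) (coeff R) V = (\<Sum>j<n. A j * (cmod (L j V))^2)" for V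
  unfolding coR bez_sum_right using bezj by simp
 define kappa where "kappa k j = y j ^ k / poly (Pj j) (y j)" for k j
 have Vk: "V k = (\<Sum>j<n. of_real (kappa k j) * L j V)" if k: "k < n" for k V
 proof -
  have m: "monom 1 k = (\<Sum>j<n. smult (kappa k j) (Pj j))"
   using lagrange[of "monom 1 k"] k by (simp add: degree_monom_eq poly_monom kappa_def)
  have "(\<Sum>j<n. of_real (kappa k j) * L j V) = (\<Sum>j<n. \<Sum>i\<le>n. of_real (kappa k j * coeff (Pj j) i) * V i)"
   unfolding L_def lin_def sum_distrib_left by (simp add: mult.assoc)
  also have "... = (\<Sum>i\<le>n. of_real (coeff (\<Sum>j<n. smult (kappa k j) (Pj j)) i) * V i)"
   by (subst sum.swap) (simp add: coeff_sum sum_distrib_right)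
  also have "... = (\<Sum>i\<le>n. if k = i then V i else 0)"
   unfolding m[symmetric] by (rule sum.cong) auto
  also have "... = V k" using k by simp
  finally show ?thesis by simp
 qed
 define K where "K = 1 + (\<Sum>k<n. \<Sum>j<n. (kappa k j)^2)"
 have K: "K > 0" unfolding K_def by (intro add_pos_nonneg sum_nonneg) auto
 define Am where "Am = Min (A ` {..<n})"
 have Am: "Am > 0" "!!j. j < n ==> Am <= A j"
  unfolding Am_def using n Apos by (auto simp: lessThan_empty_iff)
 have S1: "sq n V <= K * (\<Sum>j<n. (cmod (L j V))^2)" for V
 proof -
  have "(cmod (V k))^2 <= (\<Sum>j<n. (kappa k j)^2) * (\<Sum>j<n. (cmod (L j V))^2)" if "k < n" for k
  proof -
   have "cmod (V k) <= (\<Sum>j<n. \<bar>kappa k j\<bar> * cmod (L j V))"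
    unfolding Vk[OF that, of V] by (rule order.trans[OF norm_sum]) (simp add: norm_mult)
   then have "(cmod (V k))^2 <= (\<Sum>j<n. \<bar>kappa k j\<bar> * cmod (L j V))^2" by (simp add: power_mono)
   also have "... <= (\<Sum>j<n. \<bar>kappa k j\<bar>\<^sup>2) * (\<Sum>j<n. (cmod (L j V))^2)"
    by (rule Cauchy_Schwarz_ineq_sum)
   finally show ?thesis by simp
  qed
  then have "sq n V <= (\<Sum>k<n. (\<Sum>j<n. (kappa k j)^2) * (\<Sum>j<n. (cmod (L j V))^2))"
   unfolding sq_def by (intro sum_mono) auto
  also have "... <= K * (\<Sum>j<n. (cmod (L j V))^2)"
   unfolding sum_distrib_right[symmetric] K_def by (intro mult_right_mono sum_nonneg) auto
  finally show ?thesis .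
 qed
 show ?thesis
 proof (intro exI[of _ "Am / K"] conjI allI)
  show "Am / K > 0" using Am K by simp
  fix V
  have "Am / K * sq n V <= Am * (\<Sum>j<n. (cmod (L j V))^2)"
   using mult_left_mono[OF S1[of V], of "Am / K"] Am K by (simp add: field_simps)
  also have "... <= bez n (coeff P) (coeff R) V"
   unfolding bez_eq sum_distrib_left using Am by (intro sum_mono mult_right_mono) auto
  finally show "Am / K * sq n V <= bez n (coeff P) (coeff R) V" .
 qed
qed

lemma sq_nonneg [simp]: "sq n V >= 0"
 by (simp add: sq_def sum_nonneg)

lemma bez_term_bound:
 assumes "a <= n"
 shows "\<bar>bez_term V a b\<bar> <= real n * sq n V"
proof -
 have "\<bar>bez_term V a b\<bar> <= (\<Sum>i<a-b. sq n V)"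
  unfolding bez_term_def
 proof (rule order.trans[OF sum_abs], rule sum_mono)
  fix i assume i: "i : {..<a-b}"
  have h: "b + i < n" "a - 1 - i < n" using i assms by auto
  have le: "(cmod (V k))^2 <= sq n V" if "k < n" for k
   unfolding sq_def by (rule member_le_sum) (use that in auto)
  have "\<bar>Re (V (b+i) * cnj (V (a-1-i)))\<bar> <= cmod (V (b+i)) * cmod (V (a-1-i))"
   using abs_Re_le_cmod[of "V (b+i) * cnj (V (a-1-i))"] by (simp add: norm_mult)
  also have "... <= ((cmod (V (b+i)))^2 + (cmod (V (a-1-i)))^2) / 2"
   using sum_squares_bound[of "cmod (V (b+i))" "cmod (V (a-1-i))"] by simp
  also have "... <= sq n V" using le[OF h(1)] le[OF h(2)] by simp
  finally show "\<bar>Re (V (b+i) * cnj (V (a-1-i)))\<bar> <= sq n V" .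
 qed
 also have "... = real (a - b) * sq n V" by simp
 also have "... <= real n * sq n V" using assms by (intro mult_right_mono) auto
 finally show ?thesis .
qed

lemma bez_diff_bound:
 assumes M: "!!k. \<bar>p k\<bar> <= M" "!!k. \<bar>r k\<bar> <= M" "!!k. \<bar>p' k\<bar> <= M" "!!k. \<bar>r' k\<bar> <= M"
  and e: "!!k. \<bar>p k - p' k\<bar> <= e" "!!k. \<bar>r k - r' k\<bar> <= e"
 shows "\<bar>bez n p r V - bez n p' r' V\<bar> <= 4 * (real n + 1) ^ 3 * M * e * sq n V"
proof -
 have e0: "e >= 0" "M >= 0" using e(1)[of 0] M(1)[of 0] by auto
 have c: "\<bar>(p a * r b - p b * r a) - (p' a * r' b - p' b * r' a)\<bar> <= 4 * M * e" for a b
 proof -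
  have "(p a * r b - p b * r a) - (p' a * r' b - p' b * r' a)
   = (p a - p' a) * r b + p' a * (r b - r' b) - (p b - p' b) * r a - p' b * (r a - r' a)"
   by (simp add: algebra_simps)
  also have "\<bar>...\<bar> <= \<bar>p a - p' a\<bar> * \<bar>r b\<bar> + \<bar>p' a\<bar> * \<bar>r b - r' b\<bar> + \<bar>p b - p' b\<bar> * \<bar>r a\<bar> + \<bar>p' b\<bar> * \<bar>r a - r' a\<bar>"
   unfolding abs_mult[symmetric] by linarith
  also have "... <= e * M + M * e + e * M + M * e"
   by (intro add_mono mult_mono) (use M e e0 in auto)
  finally show ?thesis by (simp add: algebra_simps)
 qed
 have "bez n p r V - bez n p' r' V
  = (\<Sum>a\<le>n. \<Sum>b<a. ((p a * r b - p b * r a) - (p' a * r' b - p' b * r' a)) * bez_term V a b)"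
  unfolding bez_def sum_subtractf[symmetric] left_diff_distrib ..
 also have "\<bar>...\<bar> <= (\<Sum>a\<le>n. \<Sum>b<a. 4 * M * e * (real n * sq n V))"
  by (intro order.trans[OF sum_abs] sum_mono order.trans[OF sum_abs])
   (auto simp: abs_mult intro!: mult_mono c bez_term_bound simp: e0)
 also have "... <= (\<Sum>a\<le>n. real n * (4 * M * e * (real n * sq n V)))"
  by (rule sum_mono) (auto intro!: mult_right_mono simp: e0)
 also have "... = 4 * M * e * sq n V * ((real n + 1) * real n * real n)" by (simp add: algebra_simps)
 also have "... <= 4 * M * e * sq n V * ((real n + 1) * (real n + 1) * (real n + 1))"
  by (intro mult_left_mono mult_mono) (auto simp: e0)
 finally show ?thesis by (simp add: power3_eq_cube algebra_simps)
qed

lemma bez_bound: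
 assumes M: "!!k. \<bar>p k\<bar> <= M" "!!k. \<bar>r k\<bar> <= M"
 shows "\<bar>bez n p r V\<bar> <= 4 * (real n + 1) ^ 3 * M * M * sq n V"
proof -
 have "M >= 0" using M(1)[of 0] by auto
 then show ?thesis
 using bez_diff_bound[of p M r "%_. 0" "%_. 0" M n V] M by (simp add: bez_def)
qed

text \<open>The shift \<open>Z k' = \<i> rho Z (Suc k)\<close> multiplies the Bezoutian by \<open>x - x'\<close>, which cancels its denominator.\<close>

lemma bez_has_derivative:
 fixes Z :: "nat => real => complex"
 assumes Z: "!!k. (Z k has_vector_derivative \<i> * of_real rho * Z (Suc k) t) (at t)"
 shows "((%t. bez n p r (%k. Z k t)) has_real_derivative
  - 2 * rho * Im (lin n p (%k. Z k t) * cnj (lin n r (%k. Z k t)))) (at t)"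
proof -
 have tm: "((%t. bez_term (%k. Z k t) a b) has_real_derivative
  - 2 * rho * Im (Z a t * cnj (Z b t))) (at t)" if ab: "b < a" for a b
 proof -
  define T where "T i = Z (b+i) t * cnj (Z (a-i) t)" for i
  have d: "((%t. Re (Z (b+i) t * cnj (Z (a-1-i) t))) has_real_derivative
    Re (\<i> * of_real rho * (T (Suc i) - T i))) (at t)" if i: "i < a - b" for i
  proof -
   have "((%t. Re (Z (b+i) t * cnj (Z (a-1-i) t))) has_vector_derivative
    Re (Z (b+i) t * cnj (\<i> * of_real rho * Z (Suc (a-1-i)) t) + \<i> * of_real rho * Z (Suc (b+i)) t * cnj (Z (a-1-i) t))) (at t)"
    by (rule bounded_linear.has_vector_derivative[OF bounded_linear_Re]
       has_vector_derivative_mult has_vector_derivative_cnj Z)+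
   moreover have "Suc (a-1-i) = a - i" "a - 1 - i = a - Suc i" using i by auto
   ultimately show ?thesis
    by (simp add: has_real_derivative_iff_has_vector_derivative T_def algebra_simps)
  qed
  have "((%t. bez_term (%k. Z k t) a b) has_real_derivative
    (\<Sum>i<a-b. Re (\<i> * of_real rho * (T (Suc i) - T i)))) (at t)"
   unfolding bez_term_def by (rule DERIV_sum) (use d in auto)
  also have "(\<Sum>i<a-b. Re (\<i> * of_real rho * (T (Suc i) - T i))) = Re (\<i> * of_real rho * (T (a-b) - T 0))"
   unfolding Re_sum[symmetric] sum_distrib_left[symmetric] sum_lessThan_telescope ..
  also have "... = - 2 * rho * Im (Z a t * cnj (Z b t))"
   using ab by (simp add: T_def algebra_simps)
  finally show ?thesis .
 qed
 have "((%t. bez n p r (%k. Z k t)) has_real_derivative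
  (\<Sum>a\<le>n. \<Sum>b<a. (p a * r b - p b * r a) * (- 2 * rho * Im (Z a t * cnj (Z b t))))) (at t)"
  unfolding bez_def by (intro DERIV_sum DERIV_cmult tm) auto
 also have "(\<Sum>a\<le>n. \<Sum>b<a. (p a * r b - p b * r a) * (- 2 * rho * Im (Z a t * cnj (Z b t))))
  = - 2 * rho * (\<Sum>a\<le>n. \<Sum>b<a. (p a * r b - p b * r a) * Im (Z a t * cnj (Z b t)))"
  unfolding sum_distrib_left by (intro sum.cong refl) (simp add: algebra_simps)
 also have "(\<Sum>a\<le>n. \<Sum>b<a. (p a * r b - p b * r a) * Im (Z a t * cnj (Z b t)))
  = Im (\<Sum>a\<le>n. \<Sum>b\<le>n. (of_real (p a) * Z a t) * cnj (of_real (r b) * Z b t))"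
  unfolding sum_symmetrize by (auto intro!: sum.cong simp: algebra_simps)
 also have "... = Im (lin n p (%k. Z k t) * cnj (lin n r (%k. Z k t)))"
  unfolding lin_def cnj_sum sum_product ..
 finally show ?thesis .
qed

section \<open>Decay of the energy of a single mode\<close>

text \<open>If \<open>Y k\<close> is the rescaled \<open>k\<close>-th derivative of \<open>y\<close>, then \<open>bshift a Y k\<close> is that of the product of \<open>y\<close> with an
exponential (Leibniz rule).\<close>

definition bshift :: "complex => (nat => complex) => nat => complex" where
 "bshift a Y k = (\<Sum>j\<le>k. of_nat (k choose j) * a ^ (k - j) * Y j)"

lemma bshift_Suc: "bshift a Y (Suc k) = a * bshift a Y k + bshift a (%j. Y (Suc j)) k"
proof -
 have "a * bshift a Y k = (\<Sum>j\<le>Suc k. of_nat (k choose j) * a ^ (Suc k - j) * Y j)"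
  unfolding bshift_def sum_distrib_left by (auto intro!: sum.cong simp: Suc_diff_le binomial_eq_0 algebra_simps)
 also have "... = a ^ Suc k * Y 0 + (\<Sum>j\<le>k. of_nat (k choose Suc j) * a ^ (k - j) * Y (Suc j))"
  by (subst sum.atMost_Suc_shift) simp
 finally have 1: "a * bshift a Y k = a ^ Suc k * Y 0 + (\<Sum>j\<le>k. of_nat (k choose Suc j) * a ^ (k - j) * Y (Suc j))" .
 have "bshift a Y (Suc k) = a ^ Suc k * Y 0 + (\<Sum>j\<le>k. of_nat (Suc k choose Suc j) * a ^ (k - j) * Y (Suc j))"
  unfolding bshift_def by (subst sum.atMost_Suc_shift) simp
 also have "... = a ^ Suc k * Y 0 + ((\<Sum>j\<le>k. of_nat (k choose Suc j) * a ^ (k - j) * Y (Suc j)) + bshift a (%j. Y (Suc j)) k)"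
  unfolding bshift_def sum.distrib[symmetric] by (simp add: algebra_simps)
 finally show ?thesis unfolding 1 by simp
qed

lemma bshift_lincomb: "bshift a (%j. c * Y j + Z j) k = c * bshift a Y k + bshift a Z k"
 by (simp add: bshift_def sum.distrib sum_distrib_left algebra_simps)

lemma bshift_inverse: "bshift (- a) (bshift a Y) k = Y k"
proof (induction k arbitrary: Y)
 case (Suc k)
 have "bshift (- a) (bshift a Y) (Suc k) = - a * Y k + bshift (- a) (%j. bshift a Y (Suc j)) k"
  by (simp add: bshift_Suc Suc)
 also have "(%j. bshift a Y (Suc j)) = (%j. a * bshift a Y j + bshift a (%j. Y (Suc j)) j)"
  by (simp add: bshift_Suc)
 also have "bshift (- a) ... k = a * Y k + Y (Suc k)"
  by (simp add: bshift_lincomb Suc)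
 finally show ?case by simp
qed (simp add: bshift_def)

lemma sum_squared_bound: "(\<Sum>j<n. f j)^2 <= real n * (\<Sum>j<n. (f j)^2)" for f :: "nat => real"
 using Cauchy_Schwarz_ineq_sum[of "%_. 1" f "{..<n}"] by simp

lemma bshift_sq_bound:
 assumes "cmod a <= 1" "n <= m"
 shows "sq n (bshift a Y) <= (real m)^2 * 4 ^ m * sq n Y"
proof -
 have "(cmod (bshift a Y k))^2 <= 4 ^ m * real m * sq n Y" if "k < n" for k
 proof -
  have "cmod (bshift a Y k) <= (\<Sum>j\<le>k. 2 ^ m * cmod (Y j))"
   unfolding bshift_def
  proof (rule order.trans[OF norm_sum sum_mono])
   fix j assume "j : {..k}"
   have "real (k choose j) <= real (2 ^ k)" by (rule of_nat_mono) (rule binomial_le_pow2)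
   also have "... <= 2 ^ m" using that assms by (simp add: power_increasing)
   finally have "real (k choose j) * cmod a ^ (k-j) <= 2 ^ m * 1"
    by (intro mult_mono power_le_one) (use assms in auto)
   then show "cmod (of_nat (k choose j) * a ^ (k - j) * Y j) <= 2 ^ m * cmod (Y j)"
    by (simp add: norm_mult norm_power mult_right_mono)
  qed
  also have "... <= (\<Sum>j<n. 2 ^ m * cmod (Y j))"
   by (rule sum_mono2) (use that in auto)
  finally have "(cmod (bshift a Y k))^2 <= (\<Sum>j<n. 2 ^ m * cmod (Y j))^2" by (simp add: power_mono)
  also have "... <= real n * (\<Sum>j<n. (2 ^ m * cmod (Y j))^2)" by (rule sum_squared_bound)
  also have "(\<Sum>j<n. (2 ^ m * cmod (Y j))^2) = 4 ^ m * sq n Y"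
   by (simp add: sq_def sum_distrib_left power_mult_distrib power_mult[symmetric] mult.commute[of m] power_mult)
  also have "real n * (4 ^ m * sq n Y) <= real m * (4 ^ m * sq n Y)"
   using assms by (intro mult_right_mono) auto
  finally show ?thesis by (simp add: algebra_simps)
 qed
 then have "sq n (bshift a Y) <= (\<Sum>k<n. 4 ^ m * real m * sq n Y)"
  unfolding sq_def[of n "bshift a Y"] by (intro sum_mono) auto
 also have "... = real n * (4 ^ m * real m * sq n Y)" by simp
 also have "... <= real m * (4 ^ m * real m * sq n Y)"
  using assms by (intro mult_right_mono) auto
 finally show ?thesis by (simp add: power2_eq_square algebra_simps)
qed

text \<open>The coefficients of the Taylor shift \<open>f(x + a)\<close>.\<close>

definition shc :: "nat => (nat => real) => complex => nat => complex" where
 "shc n f a j = (\<Sum>k\<le>n. of_real (f k) * of_nat (k choose j) * a ^ (k - j))"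

lemma lin_bshift: "lin n f (bshift a Z) = (\<Sum>j\<le>n. shc n f a j * Z j)"
proof -
 have b: "bshift a Z k = (\<Sum>j\<le>n. of_nat (k choose j) * a ^ (k - j) * Z j)" if "k <= n" for k
  unfolding bshift_def by (rule sum.mono_neutral_left) (use that in \<open>auto simp: binomial_eq_0\<close>)
 have "lin n f (bshift a Z) = (\<Sum>k\<le>n. \<Sum>j\<le>n. of_real (f k) * of_nat (k choose j) * a ^ (k - j) * Z j)"
  unfolding lin_def by (rule sum.cong) (auto simp: b sum_distrib_left mult.assoc)
 also have "... = (\<Sum>j\<le>n. shc n f a j * Z j)"
  unfolding shc_def sum_distrib_right by (rule sum.swap)
 finally show ?thesis .
qed

text \<open>A shift along the imaginary axis by \<open>tau\<close> changes the real parts of real coefficients only to second order. With \<open>tau\<close> of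
the order of \<open>rho\<close>, the change of the lowest symbol is thus absorbed by \<open>rho^2 * p\<close>, even for small \<open>rho\<close>.\<close>

lemma shc_bounds:
 assumes M: "!!k. \<bar>f k\<bar> <= M" and f0: "!!k. k > n ==> f k = 0" and tau: "0 <= tau" "tau <= 1"
 defines "K \<equiv> (real n + 1) * 2 ^ n"
 shows "\<bar>Im (shc n f (\<i> * of_real tau) j)\<bar> <= K * M * tau"
  and "\<bar>Re (shc n f (\<i> * of_real tau) j) - f j\<bar> <= K * M * tau\<^sup>2"
proof -
 have M0: "M >= 0" using M[of 0] by linarith
 define g where "g k = of_real (f k) * of_nat (k choose j) * (\<i> * of_real tau) ^ (k - j)" for k
 have ng: "cmod (g k) <= M * 2 ^ n * tau ^ (k - j)" if "k <= n" for k
 proof -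
  have "real (k choose j) <= real (2 ^ k)" by (rule of_nat_mono) (rule binomial_le_pow2)
  also have "... <= 2 ^ n" using that by (simp add: power_increasing)
  finally have "\<bar>f k\<bar> * real (k choose j) <= M * 2 ^ n"
   by (intro mult_mono M) (use M0 in auto)
  then show ?thesis
   using tau by (simp add: g_def norm_mult norm_power mult_right_mono)
 qed
 have Im: "\<bar>Im (g k)\<bar> <= M * 2 ^ n * tau" if "k <= n" for k
 proof (cases "k <= j")
  case True
  then have "Im (g k) = 0" by (cases "k = j") (auto simp: g_def binomial_eq_0)
  then show ?thesis using M0 tau by simp
 next
  case False
  have "\<bar>Im (g k)\<bar> <= cmod (g k)" by (rule abs_Im_le_cmod)
  also have "... <= M * 2 ^ n * tau ^ (k - j)" by (rule ng[OF that])
  also have "... <= M * 2 ^ n * tau"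
   using False tau M0 power_decreasing[of 1 "k-j" tau] by (intro mult_left_mono) auto
  finally show ?thesis .
 qed
 have Re: "\<bar>Re (g k) - (if k = j then f j else 0)\<bar> <= M * 2 ^ n * tau\<^sup>2" if "k <= n" for k
 proof -
  consider "k < j" | "k = j" | "k = Suc j" | "k - j >= 2" by linarith
  then show ?thesis
  proof cases
   case 4
   have "\<bar>Re (g k)\<bar> <= cmod (g k)" by (rule abs_Re_le_cmod)
   also have "... <= M * 2 ^ n * tau ^ (k - j)" by (rule ng[OF that])
   also have "... <= M * 2 ^ n * tau\<^sup>2"
    using 4 tau M0 power_decreasing[of 2 "k-j" tau] by (intro mult_left_mono) auto
   finally show ?thesis using 4 by auto
  qed (use M0 tau in \<open>auto simp: g_def binomial_eq_0\<close>)
 qed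
 have "\<bar>Im (shc n f (\<i> * of_real tau) j)\<bar> <= (\<Sum>k\<le>n. M * 2 ^ n * tau)"
  unfolding shc_def g_def[symmetric] Im_sum
  by (rule order.trans[OF sum_abs sum_mono]) (use Im in auto)
 then show "\<bar>Im (shc n f (\<i> * of_real tau) j)\<bar> <= K * M * tau"
  by (simp add: K_def algebra_simps)
 have "f j = (\<Sum>k\<le>n. if k = j then f j else 0)" using f0[of j] by auto
 then have "Re (shc n f (\<i> * of_real tau) j) - f j = (\<Sum>k\<le>n. Re (g k) - (if k = j then f j else 0))"
  unfolding shc_def g_def[symmetric] Re_sum sum_subtractf by simp
 also have "\<bar>...\<bar> <= (\<Sum>k\<le>n. M * 2 ^ n * tau\<^sup>2)"
  by (rule order.trans[OF sum_abs sum_mono]) (use Re in auto)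
 finally show "\<bar>Re (shc n f (\<i> * of_real tau) j) - f j\<bar> <= K * M * tau\<^sup>2"
  by (simp add: K_def algebra_simps)
qed

lemma shc_top: "shc n f a n = of_real (f n)"
proof -
 have "shc n f a n = (\<Sum>k\<le>n. if k = n then of_real (f n) else 0)"
  unfolding shc_def by (rule sum.cong) (auto simp: binomial_eq_0)
 then show ?thesis by simp
qed

lemma shc_beyond: "j > n ==> shc n f a j = 0"
 by (auto simp: shc_def binomial_eq_0 intro!: sum.neutral)

text \<open>The two cases of the theorem are treated together: \<open>theta = 0\<close> is the case without \<open>p2\<close>. The triples for all
directions of the frequency share the constants \<open>M\<close> and \<open>delta\<close>.\<close>

definition coercive_triple ::
  "nat => real => real => real => (nat => real) => (nat => real) => (nat => real) => bool" where
 "coercive_triple m M delta theta p p1 p2 \<longleftrightarrow>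
  (ALL k. \<bar>p k\<bar> <= M & \<bar>p1 k\<bar> <= M & \<bar>p2 k\<bar> <= M) &
  (ALL k>m. p k = 0) & (ALL k>=m. p1 k = 0) & (ALL k>=m-1. p2 k = 0) &
  (ALL V. delta * sq m V <= bez m p p1 V) &
  (theta = 0 & (ALL k. p2 k = 0) \<or> theta = 1 & (ALL V. delta * sq (m-1) V <= bez (m-1) p1 p2 V))"

definition mode_solution ::
  "nat => (nat => real) => (nat => real) => (nat => real) => real => (nat => real => complex) => bool" where
 "mode_solution m p p1 p2 rho Y \<longleftrightarrow>
  (ALL k t. (Y k has_vector_derivative \<i> * of_real rho * Y (Suc k) t) (at t)) &
  (ALL t. (\<Sum>k\<le>m. (of_real (p2 k) - of_real (rho\<^sup>2 * p k) + \<i> * of_real (rho * p1 k)) * Y k t) = 0)"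

definition mode_energy :: "nat => real => real => (nat => complex) => real" where
 "mode_energy m theta rho V = sq m V + theta / rho\<^sup>2 * sq (m-1) V"

lemma lower_bound_from_diff: "\<bar>a - b\<bar> <= e ==> 2 * e <= b ==> e <= a" for a b e :: real
 by linarith

lemma lin_extend: "(!!k. k > n ==> f k = 0) ==> n <= m ==> lin n f V = lin m f V"
 unfolding lin_def by (rule sum.mono_neutral_left) auto

text \<open>Put \<open>sigma = c * rho^2 / (1 + rho^2)\<close>. Multiplication of the solution by \<open>exp (sigma * t)\<close> replaces the polynomials by
shifted ones whose Bezoutians stay coercive for small \<open>c\<close>. Their sum does not increase in time and is comparable to the
energy.\<close>

lemma energy_decay:
 fixes m :: nat and M delta :: real
 assumes m: "m >= 1" and delta: "delta > 0" and M: "M >= 0"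
 shows "EX C>0. EX c>0. ALL p p1 p2 theta rho Y. coercive_triple m M delta theta p p1 p2 & rho > 0 &
  mode_solution m p p1 p2 rho Y -->
  (ALL t>=0. mode_energy m theta rho (%k. Y k t)
    <= C * exp (- 2 * (c * rho\<^sup>2 / (1 + rho\<^sup>2)) * t) * mode_energy m theta rho (%k. Y k 0))"
proof -
 define K where "K = (real m + 1) * 2 ^ m"
 define M' where "M' = M + 3 * K * M + 1"
 define B where "B = 4 * (real m + 1) ^ 3 * M' * (3 * K * M)"
 (* With this c the shift perturbs the Bezoutians by at most half of their lower bounds. *)
 define c where "c = min 1 (delta / (2 * (B + 1)))"
 define K2 where "K2 = (real m)^2 * 4 ^ m"
 define C1 where "C1 = 4 * (real m + 1) ^ 3 * M' * M'"
 have K: "K >= 0" by (simp add: K_def)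
 have M': "M' > 0" "M <= M'" using M K by (simp_all add: M'_def add_nonneg_pos)
 have B: "B >= 0" using K M M' by (simp add: B_def)
 have c: "c > 0" "c <= 1" using delta B by (simp_all add: c_def)
 have Bc: "B * c <= delta / 2"
 proof -
  have "B * c <= B * (delta / (2 * (B + 1)))" using B by (intro mult_left_mono) (auto simp: c_def)
  also have "... <= delta / 2" using B delta by (simp add: field_simps)
  finally show ?thesis .
 qed
 have K2: "K2 > 0" using m by (simp add: K2_def)
 have C1: "C1 > 0" using M' by (simp add: C1_def)
 define C where "C = K2 * K2 * C1 * 2 / delta"
 have C: "C > 0" using K2 C1 delta by (simp add: C_def)
 have main: "mode_energy m theta rho (%k. Y k t)
    <= C * exp (- 2 * (c * rho\<^sup>2 / (1 + rho\<^sup>2)) * t) * mode_energy m theta rho (%k. Y k 0)"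
  if T: "coercive_triple m M delta theta p p1 p2" and rho: "rho > 0" and S: "mode_solution m p p1 p2 rho Y" and t: "t >= 0"
  for p p1 p2 theta rho Y t
 proof -
  define tau where "tau = c * rho / (1 + rho\<^sup>2)"
  define \<sigma> where "\<sigma> = tau * rho"
  have d: "1 + rho\<^sup>2 > 0" by (simp add: add_pos_nonneg)
  have "tau > 0" using c rho d by (simp add: tau_def)
  have t1: "tau / rho <= c"
  proof -
   have "tau / rho = c / (1 + rho\<^sup>2)" using rho by (simp add: tau_def)
   also have "... <= c" using c d mult_left_mono[of 1 "1 + rho\<^sup>2" c] by (simp add: divide_le_eq)
   finally show ?thesis .
  qed
  have t2: "tau * rho <= c"
   using c rho d by (simp add: tau_def field_simps power2_eq_square)
  have t3: "tau <= c"
  proof -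
   have "rho <= 1 + rho\<^sup>2" using sum_squares_bound[of rho 1] rho by (simp add: power2_eq_square)
   then show ?thesis using c d mult_left_mono[of rho "1+rho\<^sup>2" c] by (simp add: tau_def field_simps)
  qed
  have t4: "tau\<^sup>2 <= c"
   using mult_mono[OF t3, of tau 1] c t3 \<open>tau > 0\<close> by (simp add: power2_eq_square)
  have t5: "tau\<^sup>2 / rho\<^sup>2 <= c"
  proof -
   have "(tau / rho) * (tau / rho) <= c * 1"
   proof (rule mult_mono[OF t1])
    show "tau / rho <= 1" using t1 c by linarith
   qed (use c \<open>tau > 0\<close> rho in auto)
   then show ?thesis by (simp add: power2_eq_square)
  qed
  have tau1: "0 <= tau" "tau <= 1" using t3 c \<open>tau > 0\<close> by auto
  from T have pM: "!!k. \<bar>p k\<bar> <= M" "!!k. \<bar>p1 k\<bar> <= M" "!!k. \<bar>p2 k\<bar> <= M"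
   and p0: "!!k. k > m ==> p k = 0" "!!k. k >= m ==> p1 k = 0" "!!k. k >= m - 1 ==> p2 k = 0"
   and co1: "!!V. delta * sq m V <= bez m p p1 V"
   and co2: "theta = 0 & (ALL k. p2 k = 0) \<or> theta = 1 & (ALL V. delta * sq (m-1) V <= bez (m-1) p1 p2 V)"
   unfolding coercive_triple_def by blast+
  from S have Y': "!!k t. (Y k has_vector_derivative \<i> * of_real rho * Y (Suc k) t) (at t)"
   and eq: "!!t. (\<Sum>k\<le>m. (of_real (p2 k) - of_real (rho\<^sup>2 * p k) + \<i> * of_real (rho * p1 k)) * Y k t) = 0"
   unfolding mode_solution_def by blast+
  let ?a = "\<i> * of_real tau"
  define sp where "sp = shc m p ?a"
  define s1 where "s1 = shc m p1 ?a"
  define s2 where "s2 = shc m p2 ?a"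
  have p0': "!!k. k > m ==> p1 k = 0" "!!k. k > m ==> p2 k = 0" using p0 by auto
  note bp = shc_bounds[where f=p and n=m, OF pM(1) p0(1) tau1, folded K_def sp_def]
  note b1 = shc_bounds[where f=p1 and n=m, OF pM(2) p0'(1) tau1, folded K_def s1_def]
  note b2 = shc_bounds[where f=p2 and n=m, OF pM(3) p0'(2) tau1, folded K_def s2_def]
  define ph where "ph j = Re (sp j) + Im (s1 j) / rho - (Re (s2 j) - p2 j) / rho\<^sup>2" for j
  define qh where "qh j = Re (s1 j) - rho * Im (sp j) + Im (s2 j) / rho" for j
  have KMc: "K * M >= 0" using K M by simp
  have eph: "\<bar>ph j - p j\<bar> <= 3 * K * M * c" for j
  proof -
   have "\<bar>Re (sp j) - p j\<bar> <= K * M * c"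
    using bp(2)[of j] mult_left_mono[OF t4 KMc] by linarith
   moreover have "\<bar>Im (s1 j) / rho\<bar> <= K * M * c"
    using divide_right_mono[OF b1(1)[of j], of rho] mult_left_mono[OF t1 KMc] rho by simp
   moreover have "\<bar>(Re (s2 j) - p2 j) / rho\<^sup>2\<bar> <= K * M * c"
    using divide_right_mono[OF b2(2)[of j], of "rho\<^sup>2"] mult_left_mono[OF t5 KMc] rho by simp
   ultimately show ?thesis unfolding ph_def by linarith
  qed
  have eqh: "\<bar>qh j - p1 j\<bar> <= 3 * K * M * c" for j
  proof -
   have "\<bar>Re (s1 j) - p1 j\<bar> <= K * M * c"
    using b1(2)[of j] mult_left_mono[OF t4 KMc] by linarith
   moreover have "\<bar>rho * Im (sp j)\<bar> <= K * M * c"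
   proof -
    have "\<bar>rho * Im (sp j)\<bar> = rho * \<bar>Im (sp j)\<bar>" using rho by (simp add: abs_mult)
    also have "... <= rho * (K * M * tau)" using rho by (intro mult_left_mono bp(1)) auto
    also have "... = K * M * (tau * rho)" by simp
    also have "... <= K * M * c" by (rule mult_left_mono[OF t2 KMc])
    finally show ?thesis .
   qed
   moreover have "\<bar>Im (s2 j) / rho\<bar> <= K * M * c"
    using divide_right_mono[OF b2(1)[of j], of rho] mult_left_mono[OF t1 KMc] rho by simp
   ultimately show ?thesis unfolding qh_def by linarith
  qed
  have cc: "3 * K * M * c <= 3 * K * M" using KMc c mult_left_mono[of c 1 "3 * (K * M)"] by (simp add: algebra_simps)
  have hM: "\<bar>ph j\<bar> <= M'" "\<bar>qh j\<bar> <= M'" "\<bar>p j\<bar> <= M'" "\<bar>p1 j\<bar> <= M'" "\<bar>p2 j\<bar> <= M'" for j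
   using eph[of j] eqh[of j] pM[of j] cc M'(2) unfolding M'_def by linarith+
  have qh0: "qh j = 0" if "j >= m" for j
  proof (cases "j = m")
   case True
   then show ?thesis using p0 by (simp add: qh_def sp_def s1_def s2_def shc_top)
  next
   case False
   with that show ?thesis by (simp add: qh_def sp_def s1_def s2_def shc_beyond)
  qed
  have nn: "4 * (real n + 1) ^ 3 * M' * (3 * K * M * c) <= delta / 2" if "n <= m" for n
  proof -
   have "4 * (real n + 1) ^ 3 * M' * (3 * K * M * c) <= 4 * (real m + 1) ^ 3 * M' * (3 * K * M * c)"
    using that KMc c M' by (intro mult_right_mono mult_left_mono power_mono) auto
   also have "... = B * c" by (simp add: B_def)
   finally show ?thesis using Bc by linarith
  qed
  have coh1: "delta / 2 * sq m V <= bez m ph qh V" for V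
  proof -
   have "\<bar>bez m ph qh V - bez m p p1 V\<bar> <= 4 * (real m + 1) ^ 3 * M' * (3 * K * M * c) * sq m V"
    by (rule bez_diff_bound) (rule hM eph eqh)+
   also have "... <= delta / 2 * sq m V" by (intro mult_right_mono nn) auto
   finally show ?thesis by (rule lower_bound_from_diff) (use co1[of V] in simp)
  qed
  have coh2: "theta / rho\<^sup>2 * (delta / 2 * sq (m-1) V) <= theta / rho\<^sup>2 * bez (m-1) qh p2 V" for V
  proof (cases "theta = 0")
   case False
   then have theta: "theta = 1" and c2: "delta * sq (m-1) V <= bez (m-1) p1 p2 V" using co2 by auto
   have "0 <= 3 * K * M * c" using KMc c by simp
   then have "\<bar>bez (m-1) qh p2 V - bez (m-1) p1 p2 V\<bar> <= 4 * (real (m-1) + 1) ^ 3 * M' * (3 * K * M * c) * sq (m-1) V"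
    by (intro bez_diff_bound) (auto intro: hM eqh)
   also have "... <= delta / 2 * sq (m-1) V" by (intro mult_right_mono nn) auto
   finally have "delta / 2 * sq (m-1) V <= bez (m-1) qh p2 V"
    by (rule lower_bound_from_diff) (use c2 in simp)
   then show ?thesis using theta by (intro mult_left_mono) auto
  qed simp
  have theta0: "theta / rho\<^sup>2 >= 0" using co2 by auto
  define W where "W t = bshift (- ?a) (%k. Y k t)" for t
  define Z where "Z k t = of_real (exp (\<sigma> * t)) * W t k" for k t
  have W': "((%t. W t k) has_vector_derivative \<i> * of_real rho * bshift (- ?a) (%k. Y (Suc k) t) k) (at t)" for k t
  proof -
   have "((%t. W t k) has_vector_derivative
    (\<Sum>j\<le>k. of_nat (k choose j) * (- ?a) ^ (k - j) * (\<i> * of_real rho * Y (Suc j) t))) (at t)"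
    unfolding W_def bshift_def
    by (intro has_vector_derivative_sum has_vector_derivative_mult_right Y')
   then show ?thesis by (simp add: bshift_def sum_distrib_left algebra_simps)
  qed
  have Z': "(Z k has_vector_derivative \<i> * of_real rho * Z (Suc k) t) (at t)" for k t
  proof -
   have "((%t. complex_of_real (exp (\<sigma> * t))) has_vector_derivative of_real (exp (\<sigma> * t) * \<sigma>)) (at t)"
    by (rule has_vector_derivative_of_real)
     (auto simp: has_real_derivative_iff_has_vector_derivative[symmetric] intro!: derivative_eq_intros)
   from has_vector_derivative_mult[OF this W'[of k t]]
   have "(Z k has_vector_derivative of_real (exp (\<sigma> * t)) * (\<i> * of_real rho * bshift (- ?a) (%k. Y (Suc k) t) k)
     + of_real (exp (\<sigma> * t) * \<sigma>) * W t k) (at t)"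
    unfolding Z_def[abs_def] .
   moreover have "W t (Suc k) = - ?a * W t k + bshift (- ?a) (%k. Y (Suc k) t) k"
    unfolding W_def by (rule bshift_Suc)
   moreover have "of_real (exp (\<sigma> * t)) * (\<i> * of_real rho * bshift (- ?a) (%k. Y (Suc k) t) k)
     + of_real (exp (\<sigma> * t) * \<sigma>) * W t k = \<i> * of_real rho * (of_real (exp (\<sigma> * t)) * (- ?a * W t k + bshift (- ?a) (%k. Y (Suc k) t) k))"
    by (simp add: \<sigma>_def algebra_simps)
   ultimately show ?thesis by (simp add: Z_def)
  qed
  have YW: "(%k. Y k t) = bshift ?a (W t)" for t
   unfolding W_def using bshift_inverse[of "- ?a"] by (auto simp: fun_eq_iff)
  define Eh where "Eh t = bez m ph qh (%k. Z k t) + theta / rho\<^sup>2 * bez (m-1) qh p2 (%k. Z k t)" for t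
  have E': "(Eh has_real_derivative - 2 * (cmod (lin m qh (%k. Z k t)))^2) (at t)" for t
  proof -
   define a where "a = lin m ph (%k. Z k t)"
   define b where "b = lin m qh (%k. Z k t)"
   define e where "e = lin m p2 (%k. Z k t)"
   have l1: "lin (m-1) qh (%k. Z k t) = b" unfolding b_def by (rule lin_extend) (auto intro: qh0)
   have l2: "lin (m-1) p2 (%k. Z k t) = e" unfolding e_def by (rule lin_extend) (auto intro: p0)
   have thetae: "theta * e = e"
    using co2 by (auto simp: e_def lin_def)
   have D: "(Eh has_real_derivative (- 2 * rho * Im (a * cnj b) + theta / rho\<^sup>2 * (- 2 * rho * Im (b * cnj e)))) (at t)"
   proof -
    have D2: "((%t. bez (m-1) qh p2 (%k. Z k t)) has_real_derivative - 2 * rho * Im (b * cnj e)) (at t)"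
     using bez_has_derivative[where Z=Z and n="m-1" and p=qh and r=p2 and t=t and rho=rho, OF Z'] unfolding l1 l2 .
    have D1: "((%t. bez m ph qh (%k. Z k t)) has_real_derivative - 2 * rho * Im (a * cnj b)) (at t)"
     unfolding a_def b_def by (rule bez_has_derivative[where Z=Z, OF Z'])
    show ?thesis unfolding Eh_def[abs_def] by (intro DERIV_add DERIV_cmult D1 D2)
   qed
   have "0 = of_real (exp (\<sigma> * t)) * (\<Sum>k\<le>m. (of_real (p2 k) - of_real (rho\<^sup>2 * p k) + \<i> * of_real (rho * p1 k)) * Y k t)"
    using eq[of t] by simp
   also have "(\<Sum>k\<le>m. (of_real (p2 k) - of_real (rho\<^sup>2 * p k) + \<i> * of_real (rho * p1 k)) * Y k t)
    = lin m p2 (%k. Y k t) - of_real (rho\<^sup>2) * lin m p (%k. Y k t) + \<i> * of_real rho * lin m p1 (%k. Y k t)"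
    by (simp add: lin_def sum_distrib_left sum.distrib[symmetric] sum_subtractf[symmetric] algebra_simps)
   also have "... = (\<Sum>j\<le>m. (s2 j - of_real (rho\<^sup>2) * sp j + \<i> * of_real rho * s1 j) * W t j)"
    unfolding YW lin_bshift s1_def s2_def sp_def
    by (simp add: sum_distrib_left sum.distrib[symmetric] sum_subtractf[symmetric] algebra_simps)
   also have "... = (\<Sum>j\<le>m. (of_real (p2 j) - of_real (rho\<^sup>2) * of_real (ph j) + \<i> * of_real rho * of_real (qh j)) * W t j)"
    by (intro sum.cong refl arg_cong2[where f="(*)"] complex_eqI)
     (use rho in \<open>simp_all add: ph_def qh_def field_simps power2_eq_square\<close>)
   also have "of_real (exp (\<sigma> * t)) * ... = e - of_real (rho\<^sup>2) * a + \<i> * of_real rho * b"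
    unfolding a_def b_def e_def lin_def Z_def
    by (simp add: sum_distrib_left sum.distrib[symmetric] sum_subtractf[symmetric] algebra_simps)
   finally have ee: "e = of_real (rho\<^sup>2) * a - \<i> * of_real rho * b" by (simp add: algebra_simps)
   have "theta / rho\<^sup>2 * (- 2 * rho * Im (b * cnj e)) = - 2 / rho * Im (b * cnj (of_real theta * e))"
    using rho by (simp add: field_simps power2_eq_square)
   then have s1: "theta / rho\<^sup>2 * (- 2 * rho * Im (b * cnj e)) = - 2 / rho * Im (b * cnj e)" by (simp only: thetae)
   have s2: "Im (b * cnj e) = - rho\<^sup>2 * Im (a * cnj b) + rho * (cmod b)^2"
    unfolding ee cmod_power2 by (simp add: algebra_simps power2_eq_square)
   have s3: "- 2 / rho * (- rho\<^sup>2 * I + rho * J) = 2 * rho * I - 2 * J" for I J :: real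
    using rho by (simp add: field_simps power2_eq_square)
   have "theta / rho\<^sup>2 * (- 2 * rho * Im (b * cnj e)) = 2 * rho * Im (a * cnj b) - 2 * (cmod b)^2"
    unfolding s1 unfolding s2 s3 ..
   then have "- 2 * rho * Im (a * cnj b) + theta / rho\<^sup>2 * (- 2 * rho * Im (b * cnj e)) = - 2 * (cmod b)^2"
    by linarith
   with D show ?thesis by (simp add: b_def)
  qed
  have mono: "Eh t <= Eh 0"
   by (rule DERIV_nonpos_imp_nonincreasing[OF t]) (use E' in fastforce)
  have sqZ: "sq n (%k. Z k t) = exp (2 * \<sigma> * t) * sq n (W t)" for n t
   by (simp add: sq_def Z_def norm_mult power_mult_distrib sum_distrib_left exp_double[symmetric] mult.assoc)
  have lower: "delta / 2 * exp (2 * \<sigma> * t) * mode_energy m theta rho (W t) <= Eh t"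
  proof -
   have "delta / 2 * exp (2 * \<sigma> * t) * mode_energy m theta rho (W t)
    = delta / 2 * sq m (%k. Z k t) + theta / rho\<^sup>2 * (delta / 2 * sq (m-1) (%k. Z k t))"
    by (simp add: mode_energy_def sqZ algebra_simps)
   also have "... <= Eh t" unfolding Eh_def by (intro add_mono coh1 coh2)
   finally show ?thesis .
  qed
  have upper: "Eh 0 <= C1 * mode_energy m theta rho (W 0)"
  proof -
   have Z0: "(%k. Z k 0) = W 0" by (simp add: Z_def)
   have "bez m ph qh (W 0) <= C1 * sq m (W 0)"
    using bez_bound[of ph M' qh m "W 0"] hM unfolding C1_def by auto
   moreover have "bez (m-1) qh p2 (W 0) <= C1 * sq (m-1) (W 0)"
   proof -
    have "bez (m-1) qh p2 (W 0) <= 4 * (real (m-1) + 1) ^ 3 * M' * M' * sq (m-1) (W 0)"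
     using bez_bound[of qh M' p2 "m-1" "W 0"] hM by auto
    also have "... <= C1 * sq (m-1) (W 0)"
     unfolding C1_def using M' by (intro mult_right_mono mult_left_mono power_mono) auto
    finally show ?thesis .
   qed
   ultimately have "Eh 0 <= C1 * sq m (W 0) + theta / rho\<^sup>2 * (C1 * sq (m-1) (W 0))"
    unfolding Eh_def Z0 by (intro add_mono mult_left_mono theta0)
   then show ?thesis by (simp add: mode_energy_def algebra_simps)
  qed
  have a1: "cmod (\<i> * of_real tau) <= 1" "cmod (- (\<i> * of_real tau)) <= 1" using tau1 by (simp_all add: norm_mult)
  have ener: "mode_energy m theta rho (bshift a V) <= K2 * mode_energy m theta rho V" if "cmod a <= 1" for a V
  proof -
   have "mode_energy m theta rho (bshift a V) <= K2 * sq m V + theta / rho\<^sup>2 * (K2 * sq (m-1) V)"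
    unfolding mode_energy_def K2_def by (intro add_mono mult_left_mono theta0 bshift_sq_bound that) auto
   then show ?thesis by (simp add: mode_energy_def algebra_simps)
  qed
  have "delta / 2 * exp (2 * \<sigma> * t) * mode_energy m theta rho (%k. Y k t)
   <= delta / 2 * exp (2 * \<sigma> * t) * (K2 * mode_energy m theta rho (W t))"
   unfolding YW[of t] using delta by (intro mult_left_mono ener a1) auto
  also have "... = K2 * (delta / 2 * exp (2 * \<sigma> * t) * mode_energy m theta rho (W t))" by simp
  also have "... <= K2 * (C1 * mode_energy m theta rho (W 0))"
   using lower mono upper K2 by (intro mult_left_mono) auto
  also have "... <= K2 * (C1 * (K2 * mode_energy m theta rho (%k. Y k 0)))"
   unfolding W_def using K2 C1 by (intro mult_left_mono ener a1) auto
  finally have "mode_energy m theta rho (%k. Y k t) <= C * inverse (exp (2 * \<sigma> * t)) * mode_energy m theta rho (%k. Y k 0)"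
   using delta by (simp add: C_def field_simps)
  also have "inverse (exp (2 * \<sigma> * t)) = exp (- 2 * (c * rho\<^sup>2 / (1 + rho\<^sup>2)) * t)"
   by (simp add: exp_minus[symmetric] \<sigma>_def tau_def power2_eq_square)
  finally show ?thesis .
 qed
 show ?thesis using C c main by blast
qed

section \<open>Polynomials acting on sequences\<close>

text \<open>With \<open>y k\<close> the \<open>k\<close>-th derivative of a function, this is the differential operator \<open>f(d/dt)\<close>.\<close>

definition act :: "complex poly => (nat => complex) => nat => complex" where
 "act f y l = (\<Sum>i\<le>degree f. coeff f i * y (l + i))"

lemma act_le: "degree f <= n ==> act f y l = (\<Sum>i\<le>n. coeff f i * y (l + i))"
 unfolding act_def by (rule sum.mono_neutral_left) (auto intro: coeff_eq_0)

lemma act_0 [simp]: "act 0 y l = 0" by (simp add: act_def)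

lemma act_pCons: "act (pCons a f) y l = a * y l + act f y (Suc l)"
proof -
 have "act (pCons a f) y l = (\<Sum>i\<le>Suc (degree f). coeff (pCons a f) i * y (l + i))"
  by (rule act_le) (rule degree_pCons_le)
 also have "... = a * y l + act f y (Suc l)"
  unfolding act_def by (subst sum.atMost_Suc_shift) simp
 finally show ?thesis .
qed

lemma act_add: "act (f + g) y l = act f y l + act g y l"
proof -
 define n where "n = max (degree f) (degree g)"
 have "degree (f + g) <= n" "degree f <= n" "degree g <= n"
  by (auto simp: n_def intro: degree_add_le)
 then show ?thesis by (simp add: act_le sum.distrib algebra_simps)
qed

lemma act_smult: "act (smult a f) y l = a * act f y l"
 by (cases "a = 0") (simp_all add: act_def sum_distrib_left mult.assoc)

lemma act_diff: "act (f - g) y l = act f y l - act g y l"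
 using act_add[of f "smult (-1) g" y l] act_smult[of "-1" g y l] by simp

lemma act_1 [simp]: "act 1 y l = y l" by (simp add: act_def)

lemma act_mult: "act (f * g) y l = act f (act g y) l"
proof (induction f arbitrary: l)
 case (pCons a f)
 have "act (pCons a f * g) y l = a * act g y l + act (pCons 0 (f * g)) y l"
  by (simp add: mult_pCons_left act_add act_smult)
 then show ?case by (simp add: act_pCons pCons)
qed simp

lemma act_dvd:
 assumes "Q dvd f" "!!l. act Q y l = 0"
 shows "act f y l = 0"
proof -
 obtain h where "f = h * Q" using assms(1) by (metis dvdE mult.commute)
 moreover have "act Q y = (%_. 0)" using assms(2) by auto
 ultimately show ?thesis by (simp add: act_mult) (simp add: act_def)
qed

lemma act_bound:
 assumes "!!i. cmod (coeff f i) <= K" "degree f <= N" "!!i. cmod (y (l + i)) <= A (l + i) * E"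
 shows "cmod (act f y l) <= (\<Sum>i\<le>N. K * A (l + i)) * E"
 unfolding act_le[OF assms(2)] sum_distrib_right
proof (rule order.trans[OF norm_sum sum_mono])
 fix i
 have "K >= 0" using assms(1)[of 0] norm_ge_zero order.trans by blast
 then show "cmod (coeff f i * y (l + i)) <= K * A (l + i) * E"
  using mult_mono[OF assms(1)[of i] assms(3)[of i]] by (simp add: norm_mult)
qed

definition smooth_seq :: "(nat => real => complex) => bool" where
 "smooth_seq y \<longleftrightarrow> (ALL k t. (y k has_vector_derivative y (Suc k) t) (at t))"

lemma smooth_seq_act:
 assumes "smooth_seq y"
 shows "smooth_seq (%k t. act f (%k. y k t) k)"
 unfolding smooth_seq_def act_def
 using assms unfolding smooth_seq_def
 by (auto intro!: has_vector_derivative_sum has_vector_derivative_mult_right)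

section \<open>Separation of small and large roots\<close>

lemma prod_list_ge_power:
 fixes e :: real
 assumes "!!x. x :# A ==> e <= f x" "e >= 0"
 shows "e ^ size A <= (\<Prod>x\<in>#A. f x)"
 using assms(1)
proof (induction A)
 case (add a A)
 have "e * e ^ size A <= f a * (\<Prod>x\<in>#A. f x)"
 proof (rule mult_mono)
  show ea: "e <= f a" using add.prems by simp
  then show "0 <= f a" using assms(2) by linarith
 qed (use add assms(2) in auto)
 then show ?case by simp
qed simp

text \<open>The value of a monic polynomial is the product of the distances to its roots, so one of them is close if the value is
small.\<close>

lemma root_near:
 fixes Q :: "complex poly"
 assumes "lead_coeff Q = 1" "degree Q >= 1"
 shows "EX mu. poly Q mu = 0 & cmod (mu - nu) ^ degree Q <= cmod (poly Q nu)"
proof -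
 have Q0: "Q ~= 0" using assms by auto
 obtain A where A: "size A = degree Q" "Q = smult (lead_coeff Q) (\<Prod>x\<in>#A. [:-x, 1:])"
  using alg_closed_imp_factorization[OF Q0] by blast
 have A': "Q = (\<Prod>x\<in>#A. [:-x, 1:])" using A(2) assms by simp
 have ev: "poly Q z = (\<Prod>x\<in>#A. z - x)" for z
  by (subst A') (simp add: poly_prod_mset image_mset.compositionality o_def)
 have ne: "set_mset A ~= {}" using A(1) assms(2) by auto
 define e where "e = Min ((%x. cmod (nu - x)) ` set_mset A)"
 have "e : (%x. cmod (nu - x)) ` set_mset A" unfolding e_def using ne by (intro Min_in) auto
 then obtain mu where mu: "mu :# A" "e = cmod (nu - mu)" by auto
 have "e ^ size A <= (\<Prod>x\<in>#A. cmod (nu - x))"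
 proof (rule prod_list_ge_power)
  show "e <= cmod (nu - x)" if "x :# A" for x
   unfolding e_def using that by (intro Min_le) auto
 qed (simp add: mu(2))
 also have "... = cmod (poly Q nu)" unfolding ev
  by (induction A) (auto simp: norm_mult)
 finally have "cmod (mu - nu) ^ degree Q <= cmod (poly Q nu)"
  using mu A(1) by (simp add: norm_minus_commute)
 moreover have "poly Q mu = 0" unfolding ev using mu(1) by (auto simp: prod_mset_zero_iff image_iff)
 ultimately show ?thesis by blast
qed

lemma linear_factor_coeffs:
 fixes Q R :: "complex poly"
 assumes "Q = [:-mu, 1:] * R"
 shows "coeff Q (Suc i) = coeff R i - mu * coeff R (Suc i)" "coeff Q 0 = - mu * coeff R 0"
 unfolding assms by (simp_all add: algebra_simps)

text \<open>A simple form of the continuity of roots, with the deflated polynomial; it can be iterated over a list of limit roots.\<close>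

lemma tendsto_root_quotient:
 fixes Q :: "'x => complex poly" and Q0 R0 :: "complex poly"
 assumes lim: "!!i. ((%x. coeff (Q x) i) \<longlongrightarrow> coeff Q0 i) F"
  and mon: "!!x. lead_coeff (Q x) = 1 & degree (Q x) = n"
  and n: "n >= 1" and Q0: "Q0 = [:-nu, 1:] * R0" "degree Q0 = n"
 shows "EX mu R. (mu \<longlongrightarrow> nu) F & (ALL x. Q x = [:-mu x, 1:] * R x & lead_coeff (R x) = 1 & degree (R x) = n - 1)
  & (ALL i. ((%x. coeff (R x) i) \<longlongrightarrow> coeff R0 i) F)"
proof -
 have "ALL x. EX mu. poly (Q x) mu = 0 & cmod (mu - nu) ^ n <= cmod (poly (Q x) nu)"
 proof
  fix x
  show "EX mu. poly (Q x) mu = 0 & cmod (mu - nu) ^ n <= cmod (poly (Q x) nu)"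
   using root_near[of "Q x" nu] mon[of x] n by auto
 qed
 then obtain mu where mu: "!!x. poly (Q x) (mu x) = 0" "!!x. cmod (mu x - nu) ^ n <= cmod (poly (Q x) nu)"
  by metis
 have "((%x. \<Sum>i\<le>n. coeff (Q x) i * nu ^ i) \<longlongrightarrow> (\<Sum>i\<le>n. coeff Q0 i * nu ^ i)) F"
  by (intro tendsto_intros lim)
 then have "((%x. poly (Q x) nu) \<longlongrightarrow> poly Q0 nu) F"
  unfolding poly_altdef using mon Q0 by simp
 then have "((%x. poly (Q x) nu) \<longlongrightarrow> 0) F" using Q0 by simp
 then have "((%x. root n (cmod (poly (Q x) nu))) \<longlongrightarrow> root n 0) F"
  by (intro tendsto_real_root tendsto_norm_zero)
 moreover have "cmod (mu x - nu) <= root n (cmod (poly (Q x) nu))" for x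
  using mu(2)[of x] n real_root_le_mono[of n "cmod (mu x - nu) ^ n" "cmod (poly (Q x) nu)"]
  by (simp add: real_root_power_cancel)
 ultimately have "((%x. mu x - nu) \<longlongrightarrow> 0) F"
  using Lim_null_comparison[of "%x. mu x - nu" "%x. root n (cmod (poly (Q x) nu))" F] by (simp add: always_eventually)
 then have limmu: "(mu \<longlongrightarrow> nu) F" by (rule Lim_null[THEN iffD2])
 have "ALL x. EX R. Q x = [:-mu x, 1:] * R" using mu(1) unfolding poly_eq_0_iff_dvd dvd_def by blast
 then obtain R where R: "!!x. Q x = [:-mu x, 1:] * R x" by metis
 have RR: "lead_coeff (R x) = 1 & degree (R x) = n - 1" for x
 proof -
  have "R x ~= 0" using R[of x] mon[of x] by auto
  then have "degree (Q x) = 1 + degree (R x)" unfolding R[of x] by (subst degree_mult_eq) auto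
  moreover have lc: "lead_coeff (R x) = lead_coeff (Q x)" unfolding R[of x] lead_coeff_mult by simp
  moreover have "lead_coeff (R x) = 1" by (rule trans[OF lc conjunct1[OF mon]])
  ultimately show ?thesis using mon[of x] by simp
 qed
 have limR: "((%x. coeff (R x) i) \<longlongrightarrow> coeff R0 i) F" for i
 proof (induction "n - i" arbitrary: i)
  case 0
  have "coeff (R x) i = 0" for x using 0 RR[of x] n by (intro coeff_eq_0) auto
  moreover have "degree R0 < n"
  proof -
   have "R0 ~= 0" using Q0 n by auto
   then have "degree Q0 = 1 + degree R0" unfolding Q0(1) by (subst degree_mult_eq) auto
   then show ?thesis using Q0(2) by simp
  qed
  then have "coeff R0 i = 0" using 0 by (intro coeff_eq_0) auto
  ultimately show ?case by simp
 next
  case (Suc k)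
  have "((%x. coeff (R x) (Suc i)) \<longlongrightarrow> coeff R0 (Suc i)) F" by (rule Suc(1)) (use Suc(2) in simp)
  then have "((%x. coeff (Q x) (Suc i) + mu x * coeff (R x) (Suc i)) \<longlongrightarrow> coeff Q0 (Suc i) + nu * coeff R0 (Suc i)) F"
   by (intro tendsto_intros lim limmu)
  moreover have "coeff (R x) i = coeff (Q x) (Suc i) + mu x * coeff (R x) (Suc i)" for x
   using linear_factor_coeffs(1)[OF R[of x]] by simp
  moreover have "coeff R0 i = coeff Q0 (Suc i) + nu * coeff R0 (Suc i)"
   using linear_factor_coeffs(1)[OF Q0(1)] by simp
  ultimately show ?case by simp
 qed
 show ?thesis using limmu R RR limR by blast
qed

text \<open>The scaling \<open>rho^(N - i)\<close> of the lower coefficients says that \<open>N\<close> roots have size \<open>rho\<close>; it survives the division by a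
linear factor whose root stays away from zero.\<close>

lemma quotient_scaled_bound:
 fixes K b :: real
 assumes b: "b > 0" and K: "K >= 0"
 shows "EX K'>=0. ALL Q R mu rho. Q = [:-mu, 1:] * R & cmod mu >= b & 0 < rho & rho <= 1 &
  (ALL i<=N. cmod (coeff Q i) <= K * rho ^ (N - i)) --> (ALL i<=N. cmod (coeff R i) <= K' * rho ^ (N - i))"
proof -
 have ex: "EX K'>=0. ALL Q R mu rho. Q = [:-mu, 1:] * R & cmod mu >= b & 0 < rho & rho <= 1 &
  (ALL i<=N. cmod (coeff Q i) <= K * rho ^ (N - i)) --> cmod (coeff R i) <= K' * rho ^ (N - i)" if "i <= N" for i
  using that
 proof (induction i)
  case 0
  show ?case
  proof (intro exI[of _ "K / b"] conjI allI impI; (elim conjE)?)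
   fix Q R mu rho assume h: "Q = [:-mu, 1:] * R" "cmod mu >= b" "0 < rho" "ALL i<=N. cmod (coeff Q i) <= K * rho ^ (N - i)"
   have "b * cmod (coeff R 0) <= cmod mu * cmod (coeff R 0)" using h by (intro mult_right_mono) auto
   also have "... = cmod (coeff Q 0)" using linear_factor_coeffs(2)[OF h(1)] by (simp add: norm_mult)
   also have "... <= K * rho ^ (N - 0)" using h(4) by blast
   finally show "cmod (coeff R 0) <= K / b * rho ^ (N - 0)" using b by (simp add: field_simps)
  qed (use b K in auto)
 next
  case (Suc i)
  then obtain K' where K': "K' >= 0" "!!Q R mu rho. Q = [:-mu, 1:] * R & cmod mu >= b & 0 < rho & rho <= 1 &
  (ALL i<=N. cmod (coeff Q i) <= K * rho ^ (N - i)) ==> cmod (coeff R i) <= K' * rho ^ (N - i)" by auto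
  show ?case
  proof (intro exI[of _ "(K' + K) / b"] conjI allI impI; (elim conjE)?)
   fix Q R mu rho assume h: "Q = [:-mu, 1:] * R" "cmod mu >= b" "0 < rho" "rho <= 1" "ALL i<=N. cmod (coeff Q i) <= K * rho ^ (N - i)"
   have "b * cmod (coeff R (Suc i)) <= cmod mu * cmod (coeff R (Suc i))" using h by (intro mult_right_mono) auto
   also have "... = cmod (coeff R i - coeff Q (Suc i))" using linear_factor_coeffs(1)[OF h(1)] by (simp add: norm_mult)
   also have "... <= cmod (coeff R i) + cmod (coeff Q (Suc i))" by (rule norm_triangle_ineq4)
   also have "... <= K' * rho ^ (N - i) + K * rho ^ (N - Suc i)"
    using h Suc.prems by (intro add_mono K'(2)) auto
   also have "... <= K' * rho ^ (N - Suc i) + K * rho ^ (N - Suc i)"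
    using K K' h power_decreasing[of "N - Suc i" "N - i" rho] by (intro add_mono mult_left_mono) auto
   finally show "cmod (coeff R (Suc i)) <= (K' + K) / b * rho ^ (N - Suc i)" using b by (simp add: field_simps)
  qed (use b K K' in auto)
 qed
 then obtain K' where K': "!!i. i <= N ==> K' i >= 0"
  "!!i Q R mu rho. i <= N ==> Q = [:-mu, 1:] * R & cmod mu >= b & 0 < rho & rho <= 1 &
  (ALL i<=N. cmod (coeff Q i) <= K * rho ^ (N - i)) ==> cmod (coeff R i) <= K' i * rho ^ (N - i)"
  by metis
 have "K' i <= (\<Sum>i\<le>N. K' i)" if "i <= N" for i
  by (rule member_le_sum) (use that K' in auto)
 then have "cmod (coeff R i) <= (\<Sum>i\<le>N. K' i) * rho ^ (N - i)"
  if "i <= N" "Q = [:-mu, 1:] * R & cmod mu >= b & 0 < rho & rho <= 1 &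
  (ALL i<=N. cmod (coeff Q i) <= K * rho ^ (N - i))" for i Q R mu rho
  using K'(2)[OF that] that by (meson mult_right_mono order.trans zero_le_power order_less_imp_le)
 then show ?thesis using K'(1) by (intro exI[of _ "\<Sum>i\<le>N. K' i"]) (auto intro!: sum_nonneg)
qed

text \<open>Removes successively the roots that tend to the nonzero limit roots; what remains carries the roots of size \<open>rho\<close>.\<close>

lemma slow_fast_factorization:
 fixes Q :: "'x => complex poly" and rho :: "'x => real"
 assumes lim: "!!i. ((%x. coeff (Q x) i) \<longlongrightarrow> coeff ((\<Prod>nu\<leftarrow>nus. [:-nu, 1:]) * monom 1 N) i) F"
  and mon: "!!x. lead_coeff (Q x) = 1 & degree (Q x) = N + length nus"
  and rho: "eventually (%x. 0 < rho x & rho x <= 1) F"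
  and K: "K >= 0" "eventually (%x. ALL i<=N. cmod (coeff (Q x) i) <= K * rho x ^ (N - i)) F"
  and nu: "!!nu. nu : set nus ==> Re nu < - c & cmod nu < B" and c: "c > 0"
 shows "EX R mus K'. K' >= 0 & eventually (%x. Q x = (\<Prod>mu\<leftarrow>mus x. [:-mu, 1:]) * R x & length (mus x) = length nus
  & (ALL mu:set (mus x). Re mu <= - c & cmod mu <= B)
  & (ALL i<=N. cmod (coeff (R x) i) <= K' * rho x ^ (N - i)) & degree (R x) = N & lead_coeff (R x) = 1) F"
 using lim mon K nu
proof (induction nus arbitrary: Q K)
 case Nil
 have "coeff (Q x) N = 1 & degree (Q x) = N" for x using Nil(2)[of x] by auto
 then show ?case
  using Nil(3,4) by (intro exI[of _ Q] exI[of _ "%_. []"] exI[of _ K]) simp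
next
 case (Cons nu nus)
 let ?R0 = "(\<Prod>nu\<leftarrow>nus. [:-nu, 1:]) * monom 1 N :: complex poly"
 have degp: "degree (\<Prod>nu\<leftarrow>nus. [:-nu, 1:]) = length nus & (\<Prod>nu\<leftarrow>nus. [:-nu, 1:]) ~= 0" for nus :: "complex list"
  by (induction nus) (auto simp: degree_mult_eq simp del: mult_pCons_left)
 have deg0: "degree ([:-nu, 1:] * ?R0) = N + length (nu # nus)"
  using degp[of "nu # nus"] degp[of nus] by (simp add: degree_mult_eq degree_monom_eq monom_eq_0_iff mult.assoc[symmetric] del: mult_pCons_left)
 have lim0: "((%x. coeff (Q x) i) \<longlongrightarrow> coeff ([:-nu, 1:] * ?R0) i) F" for i
  using Cons.prems(1)[of i] by (simp add: mult.assoc del: mult_pCons_left)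
 obtain mu R where mu: "(mu \<longlongrightarrow> nu) F"
  and R: "!!x. Q x = [:-mu x, 1:] * R x" "!!x. lead_coeff (R x) = 1 & degree (R x) = N + length nus"
  and limR: "!!i. ((%x. coeff (R x) i) \<longlongrightarrow> coeff ?R0 i) F"
  using tendsto_root_quotient[of Q "[:-nu, 1:] * ?R0" F "N + length (nu # nus)" nu ?R0, OF lim0 Cons.prems(2) _ refl deg0]
  by (simp del: mult_pCons_left) blast
 have nuc: "Re nu < - c" "cmod nu < B" using Cons.prems(5)[of nu] by auto
 have ev1: "eventually (%x. Re (mu x) < - c) F"
  using order_tendstoD(2)[OF tendsto_Re[OF mu] nuc(1)] .
 have ev2: "eventually (%x. cmod (mu x) < B) F"
  using order_tendstoD(2)[OF tendsto_norm[OF mu] nuc(2)] .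
 obtain K' where K': "K' >= 0" "!!Q R mu rho. Q = [:-mu, 1:] * R & cmod mu >= c & 0 < rho & rho <= 1 &
  (ALL i<=N. cmod (coeff Q i) <= K * rho ^ (N - i)) ==> (ALL i<=N. cmod (coeff R i) <= K' * rho ^ (N - i))"
  using quotient_scaled_bound[OF c Cons.prems(3), of N] by metis
 have evR: "eventually (%x. ALL i<=N. cmod (coeff (R x) i) <= K' * rho x ^ (N - i)) F"
  using ev1 Cons.prems(4) rho
 proof eventually_elim
  case (elim x)
  have "c <= cmod (mu x)" using elim(1) abs_Re_le_cmod[of "mu x"] by linarith
  then show ?case using K'(2)[of "Q x" "mu x" "R x" "rho x"] R(1) elim by blast
 qed
 from Cons.IH[OF limR R(2) K'(1) evR] Cons.prems(5)
 obtain S mus K'' where S: "K'' >= 0" "eventually (%x. R x = (\<Prod>mu\<leftarrow>mus x. [:-mu, 1:]) * S x & length (mus x) = length nus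
  & (ALL mu:set (mus x). Re mu <= - c & cmod mu <= B)
  & (ALL i<=N. cmod (coeff (S x) i) <= K'' * rho x ^ (N - i)) & degree (S x) = N & lead_coeff (S x) = 1) F"
  by auto
 show ?case
 proof (rule exI[of _ S], rule exI[of _ "%x. mu x # mus x"], rule exI[of _ K''], intro conjI S(1))
  show "eventually (%x. Q x = (\<Prod>mu\<leftarrow>mu x # mus x. [:-mu, 1:]) * S x & length (mu x # mus x) = length (nu # nus)
  & (ALL mu:set (mu x # mus x). Re mu <= - c & cmod mu <= B)
  & (ALL i<=N. cmod (coeff (S x) i) <= K'' * rho x ^ (N - i)) & degree (S x) = N & lead_coeff (S x) = 1) F"
   using S(2) ev1 ev2
  proof eventually_elim
   case (elim x)
   then show ?case using R(1)[of x] by (auto simp: mult.assoc simp del: mult_pCons_left)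
  qed
 qed
qed

section \<open>Exponential decay of the fast part\<close>

lemma damped_scalar:
 fixes f h :: "real => complex"
 assumes f: "!!t. (f has_vector_derivative mu * f t + h t) (at t)"
  and mu: "Re mu <= - c" and c: "c' < c"
  and h: "!!t. t >= 0 ==> cmod (h t) <= H * exp (- c' * t)" and t: "t >= 0"
 shows "cmod (f t) <= exp (- c' * t) * (cmod (f 0) + H / (c - c'))"
proof -
 define a where "a = - Re mu - c'"
 have a: "a >= c - c'" "a > 0" using mu c by (auto simp: a_def)
 have H: "H >= 0" using order.trans[OF norm_ge_zero h[of 0]] by simp
 define g where "g t = exp (- mu * of_real t) * f t" for t
 have eder: "((%t. exp (- mu * of_real t)) has_vector_derivative (- mu * exp (- mu * of_real t))) (at t)" for t
  by (rule has_vector_derivative_real_field)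
   (auto intro!: derivative_eq_intros)
 have g': "(g has_vector_derivative exp (- mu * of_real t) * h t) (at t)" for t
  using has_vector_derivative_mult[OF eder f, of t] unfolding g_def by (simp add: algebra_simps)
 have ge: "cmod (exp (- mu * of_real t) * h t) <= H * exp (a * t)" if "t >= 0" for t
 proof -
  have "cmod (exp (- mu * of_real t) * h t) = exp (- Re mu * t) * cmod (h t)"
   by (simp add: norm_mult)
  also have "... <= exp (- Re mu * t) * (H * exp (- c' * t))" by (intro mult_left_mono h that) auto
  also have "... = H * exp (a * t)" by (simp add: a_def exp_add[symmetric] algebra_simps)
  finally show ?thesis .
 qed
 have "cmod (g t - g 0) <= H / a * exp (a * t) - H / a * exp (a * 0)"
 proof (cases "t = 0")
  case False
  show ?thesis
  proof (rule differentiable_bound_general[where f' = "%t. exp (- mu * of_real t) * h t" and \<phi>' = "%t. H * exp (a * t)"])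
   show "0 < t" using t False by simp
   show "continuous_on {0..t} g"
    using g' by (meson continuous_at_imp_continuous_on has_vector_derivative_continuous)
   show "continuous_on {0..t} (%t. H / a * exp (a * t))" by (intro continuous_intros)
   show "((%t. H / a * exp (a * t)) has_vector_derivative H * exp (a * x)) (at x)" for x
    unfolding has_real_derivative_iff_has_vector_derivative[symmetric]
    using a by (auto intro!: derivative_eq_intros)
  qed (use g' ge in auto)
 qed simp
 also have "... <= H / (c - c') * exp (a * t)"
 proof -
  have "H / a <= H / (c - c')" using a c H by (intro divide_left_mono) auto
  then have "H / a * exp (a * t) <= H / (c - c') * exp (a * t)" by (intro mult_right_mono) auto
  moreover have "H / a >= 0" using a H by simp
  ultimately show ?thesis by simp
 qed
 finally have "cmod (g t) <= cmod (f 0) + H / (c - c') * exp (a * t)"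
  using norm_triangle_ineq2[of "g t" "g 0"] by (simp add: g_def)
 moreover have "f t = exp (mu * of_real t) * g t" by (simp add: g_def exp_minus field_simps)
 then have "cmod (f t) = exp (Re mu * t) * cmod (g t)" by (simp add: norm_mult)
 ultimately have "cmod (f t) <= exp (Re mu * t) * (cmod (f 0) + H / (c - c') * exp (a * t))"
  by (simp add: mult_left_mono)
 also have "... = exp (Re mu * t) * cmod (f 0) + H / (c - c') * exp (- c' * t)"
  by (simp add: a_def exp_add[symmetric] algebra_simps)
 also have "... <= exp (- c' * t) * cmod (f 0) + H / (c - c') * exp (- c' * t)"
 proof (intro add_right_mono mult_right_mono)
  have "Re mu * t <= - c' * t" using mu c t by (intro mult_right_mono) auto
  then show "exp (Re mu * t) <= exp (- c' * t)" by simp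
 qed simp
 finally show ?thesis by (simp add: algebra_simps)
qed

text \<open>Induction on the number of roots: applying one first order factor leaves an equation with one root less, and undoing it
is the scalar estimate. The rate \<open>c/2\<close> in place of \<open>c\<close> avoids the polynomial
factors that multiple roots would produce.\<close>

lemma fast_decay:
 fixes c B :: real
 assumes c: "c > 0" and B: "B >= 0"
 shows "EX C::nat => real. (ALL k. C k >= 0) & (ALL mus f. length mus = d & (ALL mu:set mus. Re mu <= - c & cmod mu <= B) &
  smooth_seq f & (ALL l t. act (\<Prod>mu\<leftarrow>mus. [:-mu, 1:]) (%k. f k t) l = 0) -->
  (ALL k. ALL t>=0. cmod (f k t) <= C k * (exp (- (c/2) * t) * (\<Sum>i<d. cmod (f i 0)))))"
proof (induction d)
 case 0
 show ?case by (rule exI[of _ "%_. 0"]) auto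
next
 case (Suc d)
 then obtain C where C: "!!k. C k >= 0" and CC: "!!mus f k t. length mus = d ==> (ALL mu:set mus. Re mu <= - c & cmod mu <= B) ==>
  smooth_seq f ==> (ALL l t. act (\<Prod>mu\<leftarrow>mus. [:-mu, 1:]) (%k. f k t) l = 0) ==> t >= 0 ==>
  cmod (f k t) <= C k * (exp (- (c/2) * t) * (\<Sum>i<d. cmod (f i 0)))" by metis
 define D where "D = rec_nat (1 + C 0 * (1 + B) / (c/2)) (%k x. B * x + C k * (1 + B))"
 have D0: "D 0 = 1 + C 0 * (1 + B) / (c/2)" and DS: "D (Suc k) = B * D k + C k * (1 + B)" for k
  by (simp_all add: D_def)
 have Dnn: "D k >= 0" for k
  by (induction k) (use C B c in \<open>auto simp: D0 DS intro!: add_nonneg_nonneg\<close>)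
 show ?case
 proof (intro exI[of _ D] conjI allI impI Dnn; elim conjE)
  fix mus f k and t :: real
  assume h: "length mus = Suc d" "ALL mu:set mus. Re mu <= - c & cmod mu <= B" "smooth_seq f"
   "ALL l t. act (\<Prod>mu\<leftarrow>mus. [:-mu, 1:]) (%k. f k t) l = 0" and t: "t >= 0"
  obtain mu mus' where mus: "mus = mu # mus'" "length mus' = d" using h(1) by (cases mus) auto
  define g where "g k t = act [:-mu, 1:] (%k. f k t) k" for k t
  define X where "X = (\<Sum>i<Suc d. cmod (f i 0))"
  have ge: "g k t = f (Suc k) t - mu * f k t" for k t by (simp add: g_def act_pCons)
  have gs: "(\<Sum>i<d. cmod (g i 0)) <= (1 + B) * X"
  proof -
   have "(\<Sum>i<d. cmod (g i 0)) <= (\<Sum>i<d. cmod (f (Suc i) 0) + B * cmod (f i 0))"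
   proof (rule sum_mono)
    fix i
    have "cmod (g i 0) <= cmod (f (Suc i) 0) + cmod mu * cmod (f i 0)"
     unfolding ge norm_mult[symmetric] by (rule norm_triangle_ineq4)
    also have "... <= cmod (f (Suc i) 0) + B * cmod (f i 0)"
     using h(2) mus by (intro add_left_mono mult_right_mono) auto
    finally show "cmod (g i 0) <= cmod (f (Suc i) 0) + B * cmod (f i 0)" .
   qed
   also have "... = (\<Sum>i<d. cmod (f (Suc i) 0)) + B * (\<Sum>i<d. cmod (f i 0))"
    by (simp add: sum.distrib sum_distrib_left)
   also have "... <= X + B * X"
   proof (intro add_mono mult_left_mono B)
    show "(\<Sum>i<d. cmod (f (Suc i) 0)) <= X" unfolding X_def by (subst sum.lessThan_Suc_shift) simp
    show "(\<Sum>i<d. cmod (f i 0)) <= X" unfolding X_def by simp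
   qed
   finally show ?thesis by (simp add: algebra_simps)
  qed
  have gb: "cmod (g k t) <= C k * (1 + B) * X * exp (- (c/2) * t)" if "t >= 0" for k t
  proof -
   have "cmod (g k t) <= C k * (exp (- (c/2) * t) * (\<Sum>i<d. cmod (g i 0)))"
   proof (rule CC[OF mus(2)])
    show "ALL mu:set mus'. Re mu <= - c & cmod mu <= B" using h(2) mus by simp
    show "smooth_seq g" unfolding g_def using h(3) by (rule smooth_seq_act)
    show "ALL l t. act (\<Prod>mu\<leftarrow>mus'. [:-mu, 1:]) (%k. g k t) l = 0"
    proof (intro allI)
     fix l t
     have "act ((\<Prod>mu\<leftarrow>mus'. [:-mu, 1:]) * [:-mu, 1:]) (%k. f k t) l = 0"
      using h(4) mus by (simp add: mult.commute del: mult_pCons_left mult_pCons_right)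
     then show "act (\<Prod>mu\<leftarrow>mus'. [:-mu, 1:]) (%k. g k t) l = 0"
      unfolding act_mult g_def .
    qed
   qed (rule that)
   also have "... <= C k * (exp (- (c/2) * t) * ((1 + B) * X))"
    using C by (intro mult_left_mono gs) auto
   finally show ?thesis by (simp add: algebra_simps)
  qed
  have X0: "X >= 0" by (simp add: X_def sum_nonneg)
  have "cmod (f k t) <= D k * (exp (- (c/2) * t) * X)"
  proof (induction k)
   case 0
   have "cmod (f 0 t) <= exp (- (c/2) * t) * (cmod (f 0 0) + (C 0 * (1 + B) * X) / (c - c/2))"
   proof (rule damped_scalar[where mu = mu and h = "g 0"])
    show "(f 0 has_vector_derivative mu * f 0 t + g 0 t) (at t)" for t
     using h(3) unfolding smooth_seq_def by (simp add: ge)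
   qed (use h(2) mus c gb t in auto)
   also have "... <= exp (- (c/2) * t) * (X + (C 0 * (1 + B) * X) / (c - c/2))"
   proof -
    have "cmod (f 0 0) <= X" unfolding X_def by (rule member_le_sum) auto
    then show ?thesis by (intro mult_left_mono) auto
   qed
   also have "... = D 0 * (exp (- (c/2) * t) * X)" by (simp add: D0 algebra_simps)
   finally show ?case .
  next
   case (Suc k)
   have "f (Suc k) t = mu * f k t + g k t" by (simp add: ge)
   then have "cmod (f (Suc k) t) <= cmod mu * cmod (f k t) + cmod (g k t)"
    unfolding norm_mult[symmetric] by (simp add: norm_triangle_ineq)
   also have "... <= B * (D k * (exp (- (c/2) * t) * X)) + C k * (1 + B) * X * exp (- (c/2) * t)"
    using h(2) mus B by (intro add_mono mult_mono Suc gb t) auto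
   finally show ?case by (simp add: DS algebra_simps)
  qed
  then show "cmod (f k t) <= D k * (exp (- (c/2) * t) * (\<Sum>i<Suc d. cmod (f i 0)))" by (simp add: X_def)
 qed
qed

section \<open>Splitting into a slow and a fast part\<close>

text \<open>Each factor vanishes at one of the roots and is congruent to 1 modulo \<open>R\<close>. Thus the polynomial is divisible by the fast
factor, and its difference to 1 is divisible by the slow factor \<open>R\<close>.\<close>

definition slow_projector :: "complex poly => complex list => complex poly" where
 "slow_projector R mus = (\<Prod>mu\<leftarrow>mus. 1 - smult (1 / poly R mu) R)"

lemma slow_projector_dvd:
 assumes "ALL mu:set mus. poly R mu ~= 0"
 shows "(\<Prod>mu\<leftarrow>mus. [:-mu, 1:]) dvd slow_projector R mus"
 using assms
proof (induction mus)
 case (Cons mu mus)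
 have "[:-mu, 1:] dvd 1 - smult (1 / poly R mu) R"
  using Cons.prems unfolding poly_eq_0_iff_dvd[symmetric] by simp
 from mult_dvd_mono[OF this Cons.IH] Cons.prems show ?case
  by (simp add: slow_projector_def del: mult_pCons_left)
qed (simp add: slow_projector_def)

lemma slow_projector_bounds:
 fixes K b :: real
 assumes K: "K >= 0" and b: "b > 0"
 shows "EX A' G :: nat => real. (ALL k. A' k >= 0 & G k >= 0) & (ALL R mus y f E. length mus = d & (ALL mu:set mus. cmod (poly R mu) >= b) &
  degree R <= N & (ALL i. cmod (coeff R i) <= K) & E >= 0 -->
  ((ALL k. cmod (f k) <= A k * E) --> (ALL k. cmod (act (slow_projector R mus) f k) <= A' k * E)) &
  ((ALL k. cmod (act R y k) <= A k * E) --> (ALL k. cmod (y k - act (slow_projector R mus) y k) <= G k * E)))"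
proof (induction d)
 case 0
 have "x <= \<bar>A k\<bar> * E" if "x <= A k * E" "E >= 0" for x k and E :: real
  using that mult_right_mono[OF abs_ge_self, of E "A k"] by linarith
 then show ?case
  by (intro exI[of _ "%k. \<bar>A k\<bar>"] exI[of _ "%_. 0"]) (simp add: slow_projector_def)
next
 case (Suc d)
 then obtain A' G where nn0: "ALL k. A' k >= 0 & G k >= 0"
  and AG0: "ALL R mus y f E. length mus = d & (ALL mu:set mus. cmod (poly R mu) >= b) &
  degree R <= N & (ALL i. cmod (coeff R i) <= K) & E >= 0 -->
  ((ALL k. cmod (f k) <= A k * E) --> (ALL k. cmod (act (slow_projector R mus) f k) <= A' k * E)) &
  ((ALL k. cmod (act R y k) <= A k * E) --> (ALL k. cmod (y k - act (slow_projector R mus) y k) <= G k * E))"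
  by - (elim exE conjE, rule that, assumption+)
 have nn: "!!k. A' k >= 0 & G k >= 0" using nn0 by (rule spec)
 note AG = AG0[THEN spec, THEN spec, THEN spec, THEN spec, THEN spec, THEN mp]
 define A'' where "A'' k = A' k + 1 / b * (\<Sum>i\<le>N. K * A' (k + i))" for k
 define G'' where "G'' k = G k + 1 / b * A' k" for k
 show ?case
 proof (rule exI[of _ A''], rule exI[of _ G''], intro conjI allI impI; (elim conjE)?)
  show "A'' k >= 0" "G'' k >= 0" for k
   using nn K b by (auto simp: A''_def G''_def intro!: add_nonneg_nonneg divide_nonneg_pos mult_nonneg_nonneg sum_nonneg)
 next
  fix R mus and y f :: "nat => complex" and E :: real and k
  assume h: "length mus = Suc d" "ALL mu:set mus. cmod (poly R mu) >= b" "degree R <= N" "ALL i. cmod (coeff R i) <= K" "0 <= E"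
  obtain mu mus' where mus: "mus = mu # mus'" "length mus' = d" using h(1) by (cases mus) auto
  have h': "length mus' = d & (ALL mu:set mus'. cmod (poly R mu) >= b) &
  degree R <= N & (ALL i. cmod (coeff R i) <= K) & E >= 0" using h mus by auto
  have r: "cmod (1 / poly R mu) <= 1 / b" using h(2) mus b by (simp add: norm_divide frac_le)
  have S: "slow_projector R mus = (1 - smult (1 / poly R mu) R) * slow_projector R mus'"
   by (simp add: slow_projector_def mus)
  { assume f: "ALL k. cmod (f k) <= A k * E"
   then have f': "cmod (act (slow_projector R mus') f k) <= A' k * E" for k using conjunct1[OF AG[OF h', of f], THEN mp, OF f] by blast
   have "cmod (act (slow_projector R mus) f k)
    <= cmod (act (slow_projector R mus') f k) + cmod (1 / poly R mu) * cmod (act R (act (slow_projector R mus') f) k)"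
    unfolding S act_mult act_diff act_smult act_1 norm_mult[symmetric] by (rule norm_triangle_ineq4)
   also have "... <= A' k * E + 1 / b * ((\<Sum>i\<le>N. K * A' (k + i)) * E)"
    using b h by (intro add_mono mult_mono r f' act_bound) auto
   finally show "cmod (act (slow_projector R mus) f k) <= A'' k * E" by (simp add: A''_def algebra_simps)
  }
  { assume f: "ALL k. cmod (act R y k) <= A k * E"
   then have f': "cmod (act (slow_projector R mus') (act R y) k) <= A' k * E" for k
    using conjunct1[OF AG[OF h', of "act R y"], THEN mp, OF f] by blast
   have g': "cmod (y k - act (slow_projector R mus') y k) <= G k * E"
    using conjunct2[OF AG[OF h'], THEN mp, OF f] by blast
   have "y k - act (slow_projector R mus) y k
    = (y k - act (slow_projector R mus') y k) + (1 / poly R mu) * act (slow_projector R mus') (act R y) k"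
    unfolding S left_diff_distrib mult_1_left act_diff mult_smult_left act_smult
    by (simp add: act_mult[symmetric] mult.commute)
   then have "cmod (y k - act (slow_projector R mus) y k)
    <= cmod (y k - act (slow_projector R mus') y k) + cmod (1 / poly R mu) * cmod (act (slow_projector R mus') (act R y) k)"
    unfolding norm_mult[symmetric] by (simp only: norm_triangle_ineq)
   also have "... <= G k * E + 1 / b * (A' k * E)"
    using b by (intro add_mono mult_mono r f' g') auto
   finally show "cmod (y k - act (slow_projector R mus) y k) <= G'' k * E" by (simp add: G''_def algebra_simps)
  }
 qed
qed

text \<open>The slow part is \<open>slow_projector R mus\<close> applied to \<open>y\<close>: it is annihilated by \<open>R\<close>, and the difference by the product
over \<open>mus\<close>. The difference is small because it contains the factor \<open>R\<close>, whose coefficients are small.\<close>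

lemma slow_fast_split:
 fixes K b c B :: real
 assumes K: "K >= 0" and b: "b > 0" and c: "c > 0" and B: "B >= 0"
 shows "EX C :: nat => real. (ALL k. C k >= 0) & (ALL R mus rho y. length mus = d &
  (ALL mu:set mus. Re mu <= - c & cmod mu <= B & cmod (poly R mu) >= b) & degree R = N &
  (ALL i<=N. cmod (coeff R i) <= K * rho ^ (N - i)) & 0 < rho & rho <= 1 & smooth_seq y &
  (ALL l t. act ((\<Prod>mu\<leftarrow>mus. [:-mu, 1:]) * R) (%k. y k t) l = 0) -->
  (EX w. smooth_seq w & (ALL l t. act R (%k. w k t) l = 0) &
   (ALL k. ALL t>=0. cmod (y k t - w k t) <= C k * (exp (- (c/2) * t) * (\<Sum>l<N+d. rho ^ (N - l) * cmod (y l 0))))))"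
proof -
 obtain A where A: "!!k. A k >= 0" and AA: "!!mus f k t. length mus = d ==> (ALL mu:set mus. Re mu <= - c & cmod mu <= B) ==>
  smooth_seq f ==> (ALL l t. act (\<Prod>mu\<leftarrow>mus. [:-mu, 1:]) (%k. f k t) l = 0) ==> t >= 0 ==>
  cmod (f k t) <= A k * (exp (- (c/2) * t) * (\<Sum>i<d. cmod (f i 0)))"
  using fast_decay[OF c B, of d] by metis
 define D where "D = real d * (real (N + 1) * K)"
 have D: "D >= 0" using K by (simp add: D_def)
 obtain A' G where G0: "ALL k. A' k >= 0 & G k >= 0" and GG0: "ALL R mus y f E. length mus = d & (ALL mu:set mus. cmod (poly R mu) >= b) &
  degree R <= N & (ALL i. cmod (coeff R i) <= K) & E >= 0 -->
  ((ALL k. cmod (f k) <= A k * E) --> (ALL k. cmod (act (slow_projector R mus) f k) <= A' k * E)) &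
  ((ALL k. cmod (act R y k) <= A k * E) --> (ALL k. cmod (y k - act (slow_projector R mus) y k) <= G k * E))"
  using slow_projector_bounds[OF K b, of d N A] by - (elim exE conjE, rule that, assumption+)
 have G: "!!k. G k >= 0" using G0 by blast
 note GG = GG0[THEN spec, THEN spec, THEN spec, THEN spec, THEN spec, THEN mp, THEN conjunct2, THEN mp, THEN spec]
 show ?thesis
 proof (rule exI[of _ "%k. G k * D"], intro conjI allI impI; (elim conjE)?)
  show "G k * D >= 0" for k using G D by simp
 next
  fix R mus rho y
  assume h: "length mus = d" "ALL mu:set mus. Re mu <= - c & cmod mu <= B & cmod (poly R mu) >= b" "degree R = N"
  "ALL i<=N. cmod (coeff R i) <= K * rho ^ (N - i)" "0 < rho" "rho <= 1" "smooth_seq y"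
  "ALL l t. act ((\<Prod>mu\<leftarrow>mus. [:-mu, 1:]) * R) (%k. y k t) l = 0"
  let ?F = "\<Prod>mu\<leftarrow>mus. [:-mu, 1:]"
  define X where "X = (\<Sum>l<N+d. rho ^ (N - l) * cmod (y l 0))"
  have X: "X >= 0" using h by (simp add: X_def sum_nonneg)
  define w where "w k t = act (slow_projector R mus) (%k. y k t) k" for k t
  define f where "f k t = act R (%k. y k t) k" for k t
  have coR: "cmod (coeff R i) <= K" for i
  proof (cases "i <= N")
   case True
   then have "cmod (coeff R i) <= K * rho ^ (N - i)" using h by blast
   also have "... <= K * 1" using h K by (intro mult_left_mono power_le_one) auto
   finally show ?thesis by simp
  next
   case False
   then show ?thesis using h(3) K by (simp add: coeff_eq_0)
  qed
  have "(\<Sum>i<d. cmod (f i 0)) <= (\<Sum>i<d. real (N + 1) * K * X)"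
  proof (rule sum_mono)
   fix i assume i: "i : {..<d}"
   have "cmod (f i 0) <= (\<Sum>j\<le>N. K * X)"
    unfolding f_def act_def h(3)
   proof (rule order.trans[OF norm_sum sum_mono])
    fix j assume j: "j : {..N}"
    have "cmod (coeff R j * y (i + j) 0) <= K * rho ^ (N - j) * cmod (y (i + j) 0)"
     unfolding norm_mult using h(4) j by (intro mult_right_mono) auto
    also have "... <= K * rho ^ (N - (i + j)) * cmod (y (i + j) 0)"
     using h K by (intro mult_right_mono mult_left_mono power_decreasing) auto
    also have "... = K * (rho ^ (N - (i + j)) * cmod (y (i + j) 0))" by simp
    also have "... <= K * X"
     unfolding X_def using i j K h by (intro mult_left_mono member_le_sum) auto
    finally show "cmod (coeff R j * y (i + j) 0) <= K * X" .
   qed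
   then show "cmod (f i 0) <= real (N + 1) * K * X" by simp
  qed
  then have fs: "(\<Sum>i<d. cmod (f i 0)) <= D * X" by (simp add: D_def algebra_simps)
  have fb: "cmod (f k t) <= A k * (exp (- (c/2) * t) * (D * X))" if "t >= 0" for k t
  proof -
   have "cmod (f k t) <= A k * (exp (- (c/2) * t) * (\<Sum>i<d. cmod (f i 0)))"
   proof (rule AA[OF h(1)])
    show "smooth_seq f" unfolding f_def by (rule smooth_seq_act[OF h(7)])
    show "ALL l t. act ?F (%k. f k t) l = 0" unfolding f_def act_mult[symmetric] using h(8) by blast
   qed (use h that in auto)
   also have "... <= A k * (exp (- (c/2) * t) * (D * X))"
    using A by (intro mult_left_mono fs) auto
   finally show ?thesis .
  qed
  have nz: "ALL mu:set mus. poly R mu ~= 0" using h(2) b by auto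
  show "EX w. smooth_seq w & (ALL l t. act R (%k. w k t) l = 0) &
   (ALL k. ALL t>=0. cmod (y k t - w k t) <= G k * D * (exp (- (c/2) * t) * (\<Sum>l<N+d. rho ^ (N - l) * cmod (y l 0))))"
  proof (intro exI[of _ w] conjI allI impI)
   show "smooth_seq w" unfolding w_def by (rule smooth_seq_act[OF h(7)])
   show "act R (%k. w k t) l = 0" for l t
    unfolding w_def act_mult[symmetric]
   proof (rule act_dvd)
    show "?F * R dvd R * slow_projector R mus"
     using mult_dvd_mono[OF slow_projector_dvd[OF nz] dvd_refl[of R]] by (simp add: mult.commute)
   qed (use h(8) in blast)
   fix k and t :: real assume t: "t >= 0"
   have "cmod (y k t - w k t) <= G k * (exp (- (c/2) * t) * (D * X))"
    unfolding w_def
    by (rule GG) (use h D X coR fb[OF t] in \<open>auto simp: f_def\<close>)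
   then show "cmod (y k t - w k t) <= G k * D * (exp (- (c/2) * t) * (\<Sum>l<N+d. rho ^ (N - l) * cmod (y l 0)))"
    by (simp add: X_def algebra_simps)
  qed
 qed
qed

section \<open>The equation at a fixed frequency\<close>

text \<open>The coefficients of the ordinary differential equation at the frequency \<open>rho * omega\<close>, given the coefficients of the
three symbols at \<open>omega\<close>.\<close>

definition mode_coeff :: "nat => (nat => real) => (nat => real) => (nat => real) => real => nat => complex" where
 "mode_coeff m p p1 p2 rho k = (\<i> * of_real rho) ^ (m - k) * of_real (p k)
  + (\<i> * of_real rho) ^ (m - 1 - k) * of_real (p1 k) + (\<i> * of_real rho) ^ (m - 2 - k) * of_real (p2 k)"

definition mode_ode where
 "mode_ode m p p1 p2 rho y \<longleftrightarrow> smooth_seq y &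
  (ALL l t. (\<Sum>k\<le>m. mode_coeff m p p1 p2 rho k * y (l + k) t) = 0)"

text \<open>Dividing the \<open>k\<close>-th derivative by \<open>(\<i> rho)^k\<close> leaves powers of \<open>rho\<close> only in front of the three symbols.\<close>

lemma mode_ode_rescale:
 assumes ode: "mode_ode m p p1 p2 rho y" and rho: "rho > 0" and m: "m >= 2"
  and p0: "!!k. k >= m ==> p1 k = 0" "!!k. k >= m - 1 ==> p2 k = 0"
 defines "Y \<equiv> %k t. y k t / (\<i> * of_real rho) ^ k"
 shows "(\<Sum>k\<le>m. (of_real (p2 k) - of_real (rho\<^sup>2 * p k) + \<i> * of_real (rho * p1 k)) * Y (l + k) t) = 0"
  and "mode_solution m p p1 p2 rho Y"
proof -
 let ?z = "\<i> * complex_of_real rho"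
 have z: "?z ~= 0" using rho by simp
 have zz: "?z ^ 2 = - of_real (rho\<^sup>2)" by (simp add: power_mult_distrib)
 have c: "mode_coeff m p p1 p2 rho k * ?z ^ k = ?z ^ (m - 2) * (of_real (p2 k) - of_real (rho\<^sup>2 * p k) + \<i> * of_real (rho * p1 k))"
  if "k <= m" for k
 proof -
  have "?z ^ (m - k) * ?z ^ k = ?z ^ (m - 2) * ?z ^ 2"
  proof -
   have "(m - k) + k = (m - 2) + 2" using that m by simp
   then show ?thesis by (simp only: power_add[symmetric])
  qed
  moreover have "?z ^ (m - 1 - k) * of_real (p1 k) * ?z ^ k = ?z ^ (m - 2) * ?z * of_real (p1 k)"
  proof (cases "k <= m - 1")
   case True
   then have "(m - 1 - k) + k = (m - 2) + 1" using m by simp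
   then have "?z ^ (m - 1 - k) * ?z ^ k = ?z ^ (m - 2) * ?z ^ 1" by (simp only: power_add[symmetric])
   then show ?thesis by (simp add: algebra_simps)
  qed (use p0 in simp)
  moreover have "?z ^ (m - 2 - k) * of_real (p2 k) * ?z ^ k = ?z ^ (m - 2) * of_real (p2 k)"
  proof (cases "k <= m - 2")
   case True
   then have "(m - 2 - k) + k = m - 2" by simp
   then have "?z ^ (m - 2 - k) * ?z ^ k = ?z ^ (m - 2)" by (simp only: power_add[symmetric])
   then show ?thesis by (simp add: algebra_simps)
  qed (use p0(2)[of k] in simp)
  moreover have "mode_coeff m p p1 p2 rho k * ?z ^ k = (?z ^ (m - k) * ?z ^ k) * of_real (p k)
   + ?z ^ (m - 1 - k) * of_real (p1 k) * ?z ^ k + ?z ^ (m - 2 - k) * of_real (p2 k) * ?z ^ k"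
   unfolding mode_coeff_def by (simp add: algebra_simps)
  ultimately have "mode_coeff m p p1 p2 rho k * ?z ^ k = (?z ^ (m - 2) * ?z ^ 2) * of_real (p k) + ?z ^ (m - 2) * ?z * of_real (p1 k) + ?z ^ (m - 2) * of_real (p2 k)"
   by (simp only:)
  then show ?thesis unfolding zz by (simp add: algebra_simps)
 qed
 show eq: "(\<Sum>k\<le>m. (of_real (p2 k) - of_real (rho\<^sup>2 * p k) + \<i> * of_real (rho * p1 k)) * Y (l + k) t) = 0" for l t
 proof -
  have "0 = (\<Sum>k\<le>m. mode_coeff m p p1 p2 rho k * y (l + k) t)" using ode by (simp add: mode_ode_def)
  also have "... = (\<Sum>k\<le>m. ?z ^ l * ?z ^ (m - 2) * ((of_real (p2 k) - of_real (rho\<^sup>2 * p k) + \<i> * of_real (rho * p1 k)) * Y (l + k) t))"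
  proof (rule sum.cong[OF refl])
   fix k assume "k : {..m}"
   then have k: "k <= m" by simp
   have "y (l + k) t = ?z ^ (l + k) * Y (l + k) t" using z by (simp add: Y_def)
   then have "mode_coeff m p p1 p2 rho k * y (l + k) t = ?z ^ l * (mode_coeff m p p1 p2 rho k * ?z ^ k) * Y (l + k) t"
    by (simp add: power_add)
   then show "mode_coeff m p p1 p2 rho k * y (l + k) t = ?z ^ l * ?z ^ (m - 2) * ((of_real (p2 k) - of_real (rho\<^sup>2 * p k) + \<i> * of_real (rho * p1 k)) * Y (l + k) t)"
    unfolding c[OF k] by simp
  qed
  also have "... = ?z ^ l * ?z ^ (m - 2) * (\<Sum>k\<le>m. (of_real (p2 k) - of_real (rho\<^sup>2 * p k) + \<i> * of_real (rho * p1 k)) * Y (l + k) t)"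
   by (simp only: sum_distrib_left)
  finally have F: "0 = ?z ^ l * ?z ^ (m - 2) * (\<Sum>k\<le>m. (of_real (p2 k) - of_real (rho\<^sup>2 * p k) + \<i> * of_real (rho * p1 k)) * Y (l + k) t)" .
  moreover have "?z ^ l * ?z ^ (m - 2) ~= 0" using z by simp
  ultimately show ?thesis using mult_eq_0_iff[THEN iffD1, OF F[symmetric]] by blast
 qed
 have "(Y k has_vector_derivative ?z * Y (Suc k) t) (at t)" for k t
 proof -
  have "(Y k has_vector_derivative y (Suc k) t / ?z ^ k) (at t)"
   unfolding Y_def using ode unfolding mode_ode_def smooth_seq_def
   by (intro has_vector_derivative_divide) auto
  then show ?thesis using z by (simp add: Y_def)
 qed
 then show "mode_solution m p p1 p2 rho Y"
  unfolding mode_solution_def using eq[of 0] by simp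
qed

lemma recurrence_bound:
 fixes K :: real
 assumes K: "K >= 0"
 shows "EX D :: nat => real. (ALL k. D k >= 1) & (ALL W a. (ALL i<N. cmod (a i) <= K) &
  (ALL l. W (N + l) = (\<Sum>i<N. a i * W (i + l))) --> (ALL k. cmod (W k) <= D k * (\<Sum>i<N. cmod (W i))))"
proof -
 have "EX D>=1. ALL W a. (ALL i<N. cmod (a i) <= K) &
  (ALL l. W (N + l) = (\<Sum>i<N. a i * W (i + l))) --> cmod (W k) <= D * (\<Sum>i<N. cmod (W i))" for k
 proof (induction k rule: less_induct)
  case (less k)
  show ?case
  proof (cases "k < N")
   case True
   have "cmod (W k) <= (\<Sum>i<N. cmod (W i))" for W :: "nat => complex"
    by (rule member_le_sum) (use True in auto)
   then show ?thesis by (intro exI[of _ 1]) auto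
  next
   case False
   define l where "l = k - N"
   have k: "k = N + l" using False by (simp add: l_def)
   have "ALL i. EX D>=1. i < k --> (ALL W a. (ALL i<N. cmod (a i) <= K) &
    (ALL l. W (N + l) = (\<Sum>i<N. a i * W (i + l))) --> cmod (W i) <= D * (\<Sum>i<N. cmod (W i)))"
   proof
    fix i
    show "EX D>=1. i < k --> (ALL W a. (ALL i<N. cmod (a i) <= K) &
     (ALL l. W (N + l) = (\<Sum>i<N. a i * W (i + l))) --> cmod (W i) <= D * (\<Sum>i<N. cmod (W i)))"
    proof (cases "i < k")
     case True
     from less[OF this] show ?thesis by - (elim exE conjE, rule exI, rule conjI, assumption, rule impI, assumption)
    qed (auto intro: exI[of _ 1])
   qed
   from choice[OF this] obtain D where D0: "ALL i. D i >= 1 & (i < k --> (ALL W a. (ALL i<N. cmod (a i) <= K) &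
    (ALL l. W (N + l) = (\<Sum>i<N. a i * W (i + l))) --> cmod (W i) <= D i * (\<Sum>i<N. cmod (W i))))"
    by - (elim exE, rule that, assumption)
   have D: "!!i. D i >= 1" using D0 by blast
   note DD = D0[THEN spec, THEN conjunct2, THEN mp, THEN spec, THEN spec, THEN mp]
   show ?thesis
   proof (rule exI[of _ "1 + (\<Sum>i<N. K * D (i + l))"], intro conjI allI impI)
    have "D i >= 0" for i using D[of i] by linarith
    then show "1 + (\<Sum>i<N. K * D (i + l)) >= 1" using K by (auto intro!: sum_nonneg)
    fix W :: "nat => complex" and a
    assume h: "(ALL i<N. cmod (a i) <= K) & (ALL l. W (N + l) = (\<Sum>i<N. a i * W (i + l)))"
    have "cmod (W k) <= (\<Sum>i<N. K * (D (i + l) * (\<Sum>i<N. cmod (W i))))"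
     unfolding k conjunct2[OF h, rule_format]
    proof (rule order.trans[OF norm_sum sum_mono])
     fix i assume "i : {..<N}"
     then show "cmod (a i * W (i + l)) <= K * (D (i + l) * (\<Sum>i<N. cmod (W i)))"
      unfolding norm_mult using h K by (intro mult_mono DD[OF _ h]) (auto simp: k)
    qed
    also have "... = (\<Sum>i<N. K * D (i + l)) * (\<Sum>i<N. cmod (W i))"
     by (simp add: sum_distrib_right mult.assoc)
    also have "... <= (1 + (\<Sum>i<N. K * D (i + l))) * (\<Sum>i<N. cmod (W i))"
     by (intro mult_right_mono) (auto intro: sum_nonneg)
    finally show "cmod (W k) <= (1 + (\<Sum>i<N. K * D (i + l))) * (\<Sum>i<N. cmod (W i))" .
   qed
  qed
 qed
 then have "ALL k. EX D>=1. ALL W a. (ALL i<N. cmod (a i) <= K) &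
  (ALL l. W (N + l) = (\<Sum>i<N. a i * W (i + l))) --> cmod (W k) <= D * (\<Sum>i<N. cmod (W i))" by blast
 from choice[OF this] obtain D where D: "ALL k. D k >= 1 & (ALL W a. (ALL i<N. cmod (a i) <= K) &
  (ALL l. W (N + l) = (\<Sum>i<N. a i * W (i + l))) --> cmod (W k) <= D k * (\<Sum>i<N. cmod (W i)))"
  by - (elim exE, rule that, assumption)
 show ?thesis
  by (rule exI[of _ D]) (use D in blast)
qed

lemma sq_le_sum_squared: "sq n V <= (\<Sum>k<n. cmod (V k))^2"
proof (induction n)
 case (Suc n)
 have "0 <= (\<Sum>k<n. cmod (V k)) * cmod (V n)" by (intro mult_nonneg_nonneg sum_nonneg) auto
 then show ?case using Suc by (simp add: sq_def power2_sum)
qed (simp add: sq_def)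

lemma sum_squared_le_sq: "(\<Sum>k<n. cmod (V k))^2 <= real n * sq n V"
 unfolding sq_def by (rule sum_squared_bound)

text \<open>For \<open>rho \<ge> rho0\<close> the rate in the energy estimate is bounded below, and the extra term of the energy is comparable to the
main one. Derivatives of order at least \<open>m\<close> are recovered from the equation.\<close>

lemma high_frequency_bound:
 fixes m :: nat and M delta rho0 :: real
 assumes m: "m >= 2" and delta: "delta > 0" and M: "M >= 0" and rho0: "rho0 > 0"
 shows "EX c>0. EX C :: nat => real. (ALL k. C k >= 0) & (ALL p p1 p2 theta rho y. coercive_triple m M delta theta p p1 p2 & p m = 1 &
  rho >= rho0 & mode_ode m p p1 p2 rho y -->
  (ALL k. ALL t>=0. cmod (y k t) <= C k * (exp (- c * t) * (\<Sum>j<m. rho ^ k / rho ^ j * cmod (y j 0)))))"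
proof -
 obtain C c where C: "C > 0" and c: "c > 0" and E0: "ALL p p1 p2 theta rho Y. coercive_triple m M delta theta p p1 p2 & rho > 0 &
  mode_solution m p p1 p2 rho Y -->
  (ALL t>=0. mode_energy m theta rho (%k. Y k t)
    <= C * exp (- 2 * (c * rho\<^sup>2 / (1 + rho\<^sup>2)) * t) * mode_energy m theta rho (%k. Y k 0))"
 proof -
  have "m >= 1" using m by simp
  from energy_decay[OF this delta M] that show thesis by - (elim exE conjE, assumption | rule that)+
 qed
 note E = E0[THEN spec, THEN spec, THEN spec, THEN spec, THEN spec, THEN spec, THEN mp, THEN spec, THEN mp]
 define K where "K = M * (1 + 1 / rho0 + 1 / rho0\<^sup>2)"
 have K: "K >= 0" using M rho0 by (simp add: K_def)
 obtain D where D0: "ALL k. D k >= 1" and DD0: "ALL W a. (ALL i<m. cmod (a i) <= K) &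
  (ALL l. W (m + l) = (\<Sum>i<m. a i * W (i + l))) --> (ALL k. cmod (W k) <= D k * (\<Sum>i<m. cmod (W i)))"
  using recurrence_bound[OF K, of m] by - (elim exE conjE, rule that, assumption+)
 have D: "!!k. D k >= 1" using D0 by blast
 note DD = DD0[THEN spec, THEN spec, THEN mp, OF conjI, THEN spec]
 define c' where "c' = c * rho0\<^sup>2 / (1 + rho0\<^sup>2)"
 have dpos: "1 + x\<^sup>2 > 0" for x :: real by (simp add: add_pos_nonneg)
 have c': "c' > 0" using c rho0 dpos by (simp add: c'_def)
 define C' where "C' = sqrt (real m * (C * (1 + 1 / rho0\<^sup>2)))"
 have C': "C' >= 0" using C by (simp add: C'_def)
 show ?thesis
 proof (rule exI[of _ c'], intro conjI c', rule exI[of _ "%k. D k * C'"], intro conjI allI impI; (elim conjE)?)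
  show "D k * C' >= 0" for k using D[of k] C' by simp
 next
  fix p p1 p2 theta rho y k and t :: real
  assume T: "coercive_triple m M delta theta p p1 p2" and pm: "p m = 1" and rho: "rho >= rho0" and ode: "mode_ode m p p1 p2 rho y" and t: "t >= 0"
  have rhop: "rho > 0" using rho rho0 by linarith
  from T have pM: "!!k. \<bar>p k\<bar> <= M" "!!k. \<bar>p1 k\<bar> <= M" "!!k. \<bar>p2 k\<bar> <= M"
   and p0: "!!k. k >= m ==> p1 k = 0" "!!k. k >= m - 1 ==> p2 k = 0" and theta: "theta = 0 \<or> theta = 1"
   unfolding coercive_triple_def by blast+
  define Y where "Y k t = y k t / (\<i> * of_real rho) ^ k" for k t
  note resc = mode_ode_rescale[OF ode rhop m p0, folded Y_def]
  let ?q = "%k. of_real (p2 k) - of_real (rho\<^sup>2 * p k) + \<i> * of_real (rho * p1 k) :: complex"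
  define a where "a i = ?q i / of_real (rho\<^sup>2)" for i
  have nY: "cmod (Y k t) = cmod (y k t) / rho ^ k" for k t
   using rhop by (simp add: Y_def norm_divide norm_power norm_mult)
  have rec: "ALL l. Y (m + l) t = (\<Sum>i<m. a i * Y (i + l) t)" for t
  proof
   fix l
   have "0 = (\<Sum>k\<le>m. ?q k * Y (l + k) t)" using resc(1) by simp
   also have "... = (\<Sum>k<m. ?q k * Y (l + k) t) - of_real (rho\<^sup>2) * Y (m + l) t"
    using p0(1)[of m] p0(2)[of m] pm m by (simp add: lessThan_Suc_atMost[symmetric] add.commute)
   finally show "Y (m + l) t = (\<Sum>i<m. a i * Y (i + l) t)"
    using rhop by (simp add: a_def sum_divide_distrib[symmetric] add.commute divide_simps mult.commute)
  qed
  have ak: "ALL i<m. cmod (a i) <= K"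
  proof (intro allI impI)
   fix i
   have "cmod (?q i) <= \<bar>p2 i\<bar> + rho\<^sup>2 * \<bar>p i\<bar> + rho * \<bar>p1 i\<bar>"
   proof -
    have "cmod (?q i) <= cmod (of_real (p2 i)) + cmod (of_real (rho\<^sup>2 * p i)) + cmod (\<i> * of_real (rho * p1 i))"
     by (intro norm_triangle_le add_mono norm_triangle_ineq4) auto
    then show ?thesis using rhop by (simp add: norm_mult norm_power abs_mult)
   qed
   also have "... <= M + rho\<^sup>2 * M + rho * M" using pM rhop by (intro add_mono mult_left_mono) auto
   finally have "cmod (a i) <= (M + rho\<^sup>2 * M + rho * M) / rho\<^sup>2"
    using rhop by (simp add: a_def norm_divide norm_power divide_right_mono)
   also have "... = M * (1 + 1 / rho + 1 / rho\<^sup>2)" using rhop by (simp add: field_simps power2_eq_square)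
   also have "... <= K" unfolding K_def
    using rho rho0 M by (intro mult_left_mono add_mono divide_left_mono power_mono) auto
   finally show "cmod (a i) <= K" .
  qed
  have Yk: "cmod (Y k t) <= D k * (\<Sum>i<m. cmod (Y i t))" for k using DD[OF ak rec] .
  have frac: "1 / rho\<^sup>2 <= 1 / rho0\<^sup>2" using rho rho0 by (intro divide_left_mono power_mono) auto
  have sig: "c' <= c * rho\<^sup>2 / (1 + rho\<^sup>2)"
  proof -
   have e: "c * x\<^sup>2 / (1 + x\<^sup>2) = c - c / (1 + x\<^sup>2)" for x :: real
   proof -
    have "c * x\<^sup>2 / (1 + x\<^sup>2) = (c * (1 + x\<^sup>2) - c) / (1 + x\<^sup>2)" by (simp add: algebra_simps)
    also have "... = c - c / (1 + x\<^sup>2)" using dpos[of x] by (simp add: diff_divide_distrib)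
    finally show ?thesis .
   qed
   have "c / (1 + rho\<^sup>2) <= c / (1 + rho0\<^sup>2)"
    using rho rho0 c by (intro divide_left_mono add_left_mono power_mono mult_pos_pos dpos) auto
   then show ?thesis unfolding c'_def e by simp
  qed
  have "(\<Sum>i<m. cmod (Y i t))^2 <= real m * sq m (%k. Y k t)" by (rule sum_squared_le_sq)
  also have "... <= real m * mode_energy m theta rho (%k. Y k t)"
   using theta by (intro mult_left_mono) (auto simp: mode_energy_def)
  also have "... <= real m * (C * exp (- 2 * (c * rho\<^sup>2 / (1 + rho\<^sup>2)) * t) * mode_energy m theta rho (%k. Y k 0))"
   by (intro mult_left_mono E[OF conjI[OF T conjI[OF rhop resc(2)]] t]) auto
  also have "... <= real m * (C * exp (- 2 * c' * t) * ((1 + 1 / rho0\<^sup>2) * (\<Sum>i<m. cmod (Y i 0))^2))"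
  proof (intro mult_left_mono mult_mono)
   show "exp (- 2 * (c * rho\<^sup>2 / (1 + rho\<^sup>2)) * t) <= exp (- 2 * c' * t)"
    using mult_right_mono[OF sig t] by simp
   have sm: "sq (m-1) (%k. Y k 0) <= sq m (%k. Y k 0)" unfolding sq_def by (rule sum_mono2) auto
   have "mode_energy m theta rho (%k. Y k 0) <= sq m (%k. Y k 0) + 1 / rho0\<^sup>2 * sq m (%k. Y k 0)"
    unfolding mode_energy_def
   proof (intro add_left_mono mult_mono sm)
    show "theta / rho\<^sup>2 <= 1 / rho0\<^sup>2" using theta frac by auto
   qed auto
   also have "... = (1 + 1 / rho0\<^sup>2) * sq m (%k. Y k 0)" by (simp add: algebra_simps)
   also have "... <= (1 + 1 / rho0\<^sup>2) * (\<Sum>i<m. cmod (Y i 0))^2"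
    by (intro mult_left_mono sq_le_sum_squared) auto
   finally show "mode_energy m theta rho (%k. Y k 0) <= (1 + 1 / rho0\<^sup>2) * (\<Sum>i<m. cmod (Y i 0))^2" .
   show "0 <= mode_energy m theta rho (%k. Y k 0)" using theta by (auto simp: mode_energy_def)
  qed (use C in auto)
  also have "... = (C' * exp (- c' * t) * (\<Sum>i<m. cmod (Y i 0)))^2"
  proof -
   have "C'\<^sup>2 = real m * (C * (1 + 1 / rho0\<^sup>2))" unfolding C'_def using C by (intro real_sqrt_pow2) simp
   moreover have "(exp (- c' * t))^2 = exp (2 * (- c' * t))" by (rule exp_double[symmetric])
   moreover have "2 * (- c' * t) = - 2 * c' * t" by simp
   ultimately show ?thesis unfolding power_mult_distrib by (simp only: mult_ac)
  qed
  finally have S: "(\<Sum>i<m. cmod (Y i t)) <= C' * exp (- c' * t) * (\<Sum>i<m. cmod (Y i 0))"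
   by (rule power2_le_imp_le) (use C' in \<open>simp add: sum_nonneg\<close>)
  have "cmod (y k t) = rho ^ k * cmod (Y k t)" using rhop by (simp add: nY)
  also have "... <= rho ^ k * (D k * (C' * exp (- c' * t) * (\<Sum>i<m. cmod (Y i 0))))"
  proof (rule mult_left_mono)
   have "D k >= 0" using D[of k] by linarith
   then show "cmod (Y k t) <= D k * (C' * exp (- c' * t) * (\<Sum>i<m. cmod (Y i 0)))"
    by (rule order.trans[OF Yk mult_left_mono[OF S]])
  qed (use rhop in simp)
  also have "... = D k * C' * (exp (- c' * t) * (\<Sum>j<m. rho ^ k / rho ^ j * cmod (y j 0)))"
   by (simp add: nY sum_distrib_left algebra_simps)
  finally show "cmod (y k t) <= D k * C' * (exp (- c' * t) * (\<Sum>j<m. rho ^ k / rho ^ j * cmod (y j 0)))" .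
 qed
qed

section \<open>Low frequencies\<close>

lemma energy_decay':
 fixes m :: nat and M delta :: real
 assumes m: "m >= 1" and delta: "delta > 0" and M: "M >= 0"
 obtains C c where "C > 0" "c > 0" "ALL p p1 p2 theta rho Y t. coercive_triple m M delta theta p p1 p2 --> rho > 0 -->
  mode_solution m p p1 p2 rho Y --> t >= 0 -->
  mode_energy m theta rho (%k. Y k t)
    <= C * exp (- 2 * (c * rho\<^sup>2 / (1 + rho\<^sup>2)) * t) * mode_energy m theta rho (%k. Y k 0)"
proof -
 obtain C c where C: "C > 0" "c > 0" and E0: "ALL p p1 p2 theta rho Y. coercive_triple m M delta theta p p1 p2 & rho > 0 &
  mode_solution m p p1 p2 rho Y -->
  (ALL t>=0. mode_energy m theta rho (%k. Y k t)
    <= C * exp (- 2 * (c * rho\<^sup>2 / (1 + rho\<^sup>2)) * t) * mode_energy m theta rho (%k. Y k 0))"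
 proof -
  from energy_decay[OF assms] that show thesis by - (elim exE conjE, assumption | rule that)+
 qed
 note E = E0[THEN spec, THEN spec, THEN spec, THEN spec, THEN spec, THEN spec, THEN mp, THEN spec, THEN mp, OF conjI, OF _ conjI]
 show thesis by (rule that[OF C], intro allI impI, rule E)
qed

lemma recurrence_bound':
 fixes K :: real
 assumes K: "K >= 0"
 obtains D :: "nat => real" where "ALL k. D k >= 1"
  "ALL W a k. (ALL i<N. cmod (a i) <= K) -->
  (ALL l. W (N + l) = (\<Sum>i<N. a i * W (i + l))) --> cmod (W k) <= D k * (\<Sum>i<N. cmod (W i))"
proof -
 obtain D where D0: "ALL k. D k >= 1" and DD0: "ALL W a. (ALL i<N. cmod (a i) <= K) &
  (ALL l. W (N + l) = (\<Sum>i<N. a i * W (i + l))) --> (ALL k. cmod (W k) <= D k * (\<Sum>i<N. cmod (W i)))"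
  using recurrence_bound[OF K, of N] by - (elim exE conjE, rule that, assumption+)
 note DD = DD0[THEN spec, THEN spec, THEN mp, OF conjI, THEN spec]
 show thesis by (rule that[OF D0], intro allI impI, rule DD)
qed

text \<open>A solution of the slow equation satisfies a recurrence of order \<open>N\<close> with bounded coefficients after rescaling, so that its
energy is controlled by the first \<open>N\<close> initial values.\<close>

lemma slow_part_decay:
 fixes m N :: nat and M delta K theta :: real
 assumes m: "m >= 2" and delta: "delta > 0" and M: "M >= 0" and K: "K >= 0"
  and theta: "theta = 0 & N <= m \<or> theta = 1 & N <= m - 1"
 obtains c D where "c > 0" "ALL k. D k >= (0::real)"
  "ALL p p1 p2 rho w R k t. coercive_triple m M delta theta p p1 p2 --> 0 < rho --> rho <= 1 --> mode_ode m p p1 p2 rho w -->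
   degree R = N --> lead_coeff R = 1 --> (ALL i<=N. cmod (coeff R i) <= K * rho ^ (N - i)) -->
   (ALL l t. act R (%k. w k t) l = 0) --> t >= 0 -->
   cmod (w k t) <= D k * (rho ^ k * exp (- c * rho\<^sup>2 * t) * (\<Sum>i<N. cmod (w i 0) / rho ^ i))"
proof -
 have m1: "m >= 1" using m by simp
 obtain C c where C: "C > 0" and c: "c > 0" and E0: "ALL p p1 p2 theta rho Y t. coercive_triple m M delta theta p p1 p2 --> rho > 0 -->
  mode_solution m p p1 p2 rho Y --> t >= 0 -->
  mode_energy m theta rho (%k. Y k t)
    <= C * exp (- 2 * (c * rho\<^sup>2 / (1 + rho\<^sup>2)) * t) * mode_energy m theta rho (%k. Y k 0)"
  using energy_decay'[OF m1 delta M] .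
 note E = E0[THEN spec, THEN spec, THEN spec, THEN spec, THEN spec, THEN spec, THEN spec, THEN mp, THEN mp, THEN mp, THEN mp]
 obtain D where D1: "ALL k. D k >= 1" and DD0: "ALL W a k. (ALL i<N. cmod (a i) <= K) -->
  (ALL l. W (N + l) = (\<Sum>i<N. a i * W (i + l))) --> cmod (W k) <= D k * (\<Sum>i<N. cmod (W i))"
  using recurrence_bound'[OF K] .
 note DD = DD0[THEN spec, THEN spec, THEN spec, THEN mp, THEN mp]
 have D: "D k >= 1" for k using D1 by blast
 have D0: "D k >= 0" for k using D[of k] by linarith
 define Dm where "Dm = (\<Sum>k<m. D k)"
 have Dm: "Dm >= 0" unfolding Dm_def by (intro sum_nonneg D0)
 define A where "A = sqrt (real N * (C * 2)) * Dm"
 have A: "A >= 0" using C Dm by (simp add: A_def)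
 show thesis
 proof (rule that[of "c / 2" "%k. D k * A"]; (intro allI impI)?)
  show "c / 2 > 0" using c by simp
  show "D k * A >= 0" for k using D0 A by simp
 next
  fix p p1 p2 rho w R k and t :: real
  assume T: "coercive_triple m M delta theta p p1 p2" and rho: "0 < rho" "rho <= 1" and ode: "mode_ode m p p1 p2 rho w"
   and R: "degree R = N" "lead_coeff R = 1" "ALL i<=N. cmod (coeff R i) <= K * rho ^ (N - i)"
   and Rw0: "ALL l t. act R (%k. w k t) l = 0" and t: "t >= 0"
  have Rw: "act R (%k. w k t) l = 0" for l t using Rw0 by blast
  from T have p0: "!!k. k >= m ==> p1 k = 0" "!!k. k >= m - 1 ==> p2 k = 0"
   unfolding coercive_triple_def by blast+
  let ?z = "\<i> * complex_of_real rho"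
  have z: "?z ~= 0" using rho by simp
  define W where "W k t = w k t / ?z ^ k" for k t
  note resc = mode_ode_rescale(2)[OF ode rho(1) m p0, folded W_def]
  have nW: "cmod (W k t) = cmod (w k t) / rho ^ k" for k t
   using rho by (simp add: W_def norm_divide norm_power norm_mult)
  define a where "a i = - coeff R i / ?z ^ (N - i)" for i
  have ak: "ALL i<N. cmod (a i) <= K"
  proof (intro allI impI)
   fix i assume "i < N"
   then have "cmod (coeff R i) <= K * rho ^ (N - i)" using R by simp
   then show "cmod (a i) <= K" using rho
    by (simp add: a_def norm_divide norm_power norm_mult divide_le_eq)
  qed
  have rec: "ALL l. W (N + l) t = (\<Sum>i<N. a i * W (i + l) t)" for t
  proof
   fix l
   have "0 = (\<Sum>i<N. coeff R i * w (l + i) t) + w (l + N) t"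
    using Rw[of t l] R by (simp add: act_def lessThan_Suc_atMost[symmetric])
   then have "w (N + l) t = (\<Sum>i<N. - coeff R i * w (l + i) t)"
    by (simp add: sum_negf eq_neg_iff_add_eq_0 add.commute)
   then have "W (N + l) t = (\<Sum>i<N. - coeff R i * w (l + i) t / ?z ^ (N + l))"
    by (simp add: W_def sum_divide_distrib)
   also have "... = (\<Sum>i<N. a i * W (i + l) t)"
   proof (rule sum.cong[OF refl])
    fix i assume "i : {..<N}"
    then have "N + l = (N - i) + (i + l)" by simp
    then have "?z ^ (N + l) = ?z ^ (N - i) * ?z ^ (i + l)" by (simp only: power_add[symmetric])
    then show "- coeff R i * w (l + i) t / ?z ^ (N + l) = a i * W (i + l) t"
     by (simp add: a_def W_def add.commute)
   qed
   finally show "W (N + l) t = (\<Sum>i<N. a i * W (i + l) t)" .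
  qed
  have Wk: "cmod (W k t) <= D k * (\<Sum>i<N. cmod (W i t))" for k t using DD[OF ak rec] .
  define kappa where "kappa = (if theta = 0 then 1 else rho\<^sup>2)"
  have kappa: "kappa > 0" using rho by (simp add: kappa_def)
  have sqm: "a <= b ==> sq a V <= sq b V" for a b V unfolding sq_def by (rule sum_mono2) auto
  have low: "sq N V <= kappa * mode_energy m theta rho V" for V
  proof (cases "theta = 0")
   case True
   then show ?thesis using theta sqm[of N m V] by (simp add: kappa_def mode_energy_def)
  next
   case False
   then have "theta = 1" "N <= m - 1" using theta by auto
   then have "kappa * mode_energy m theta rho V = rho\<^sup>2 * sq m V + sq (m-1) V"
    using rho by (simp add: kappa_def mode_energy_def field_simps)
   then show ?thesis using sqm[OF \<open>N <= m - 1\<close>, of V] by (simp add: add_increasing)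
  qed
  have upp: "kappa * mode_energy m theta rho V <= 2 * sq m V" for V
  proof (cases "theta = 0")
   case True
   then show ?thesis by (simp add: kappa_def mode_energy_def)
  next
   case False
   then have "theta = 1" using theta by auto
   then have "kappa * mode_energy m theta rho V = rho\<^sup>2 * sq m V + sq (m-1) V"
    using rho by (simp add: kappa_def mode_energy_def field_simps)
   also have "... <= 1 * sq m V + sq m V"
    using rho by (intro add_mono mult_right_mono sqm power_le_one) auto
   finally show ?thesis by simp
  qed
  define S0 where "S0 = (\<Sum>i<N. cmod (W i 0))"
  have S0: "S0 >= 0" by (simp add: S0_def sum_nonneg)
  define \<sigma> where "\<sigma> = c * rho\<^sup>2 / (1 + rho\<^sup>2)"
  have "(\<Sum>i<N. cmod (W i t))^2 <= real N * sq N (%k. W k t)" by (rule sum_squared_le_sq)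
  also have "... <= real N * (kappa * mode_energy m theta rho (%k. W k t))" by (intro mult_left_mono low) auto
  also have "... <= real N * (kappa * (C * exp (- 2 * \<sigma> * t) * mode_energy m theta rho (%k. W k 0)))"
   unfolding \<sigma>_def using kappa by (intro mult_left_mono E[OF T rho(1) resc t]) auto
  also have "... = real N * (C * exp (- 2 * \<sigma> * t)) * (kappa * mode_energy m theta rho (%k. W k 0))" by simp
  also have "... <= real N * (C * exp (- 2 * \<sigma> * t)) * (2 * (Dm * S0)^2)"
  proof (rule mult_left_mono)
   have "(\<Sum>k<m. cmod (W k 0)) <= (\<Sum>k<m. D k * S0)" unfolding S0_def by (intro sum_mono Wk)
   also have "... = Dm * S0" by (simp add: Dm_def sum_distrib_right)
   finally have "sq m (%k. W k 0) <= (Dm * S0)^2"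
    by (intro order.trans[OF sq_le_sum_squared power_mono]) (auto intro: sum_nonneg)
   then show "kappa * mode_energy m theta rho (%k. W k 0) <= 2 * (Dm * S0)^2" using upp[of "%k. W k 0"] by linarith
  qed (use C in auto)
  also have "... = (A * exp (- \<sigma> * t) * S0)^2"
  proof -
   have 1: "A\<^sup>2 = real N * (C * 2) * Dm\<^sup>2" unfolding A_def power_mult_distrib using C by (simp add: real_sqrt_pow2)
   have 2: "(exp (- \<sigma> * t))^2 = exp (2 * (- \<sigma> * t))" by (rule exp_double[symmetric])
   have 3: "2 * (- \<sigma> * t) = - 2 * \<sigma> * t" by simp
   show ?thesis unfolding power_mult_distrib 1 2 3 by (simp only: mult_ac)
  qed
  finally have S: "(\<Sum>i<N. cmod (W i t)) <= A * exp (- \<sigma> * t) * S0"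
   by (rule power2_le_imp_le) (use A S0 in simp)
  have sig: "exp (- \<sigma> * t) <= exp (- (c / 2) * rho\<^sup>2 * t)"
  proof -
   have r: "rho\<^sup>2 <= 1" using rho by (simp add: power_le_one)
   have "c / 2 * rho\<^sup>2 <= c * rho\<^sup>2 / (1 + rho\<^sup>2)"
   proof -
    have "c * rho\<^sup>2 / 2 <= c * rho\<^sup>2 / (1 + rho\<^sup>2)"
     using c r by (intro divide_left_mono mult_pos_pos add_pos_nonneg) auto
    then show ?thesis by simp
   qed
   then have "c / 2 * rho\<^sup>2 * t <= \<sigma> * t" unfolding \<sigma>_def using t by (rule mult_right_mono)
   then show ?thesis by simp
  qed
  have "cmod (w k t) = rho ^ k * cmod (W k t)" using rho by (simp add: nW)
  also have "... <= rho ^ k * (D k * (A * exp (- (c / 2) * rho\<^sup>2 * t) * S0))"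
  proof (rule mult_left_mono)
   have "A * exp (- \<sigma> * t) * S0 <= A * exp (- (c / 2) * rho\<^sup>2 * t) * S0"
    using A S0 sig by (intro mult_right_mono mult_left_mono) auto
   then have "D k * (\<Sum>i<N. cmod (W i t)) <= D k * (A * exp (- (c / 2) * rho\<^sup>2 * t) * S0)"
    using S D0[of k] by (intro mult_left_mono) auto
   then show "cmod (W k t) <= D k * (A * exp (- (c / 2) * rho\<^sup>2 * t) * S0)"
    using Wk[of k t] by linarith
  qed (use rho in simp)
  finally show "cmod (w k t) <= D k * A * (rho ^ k * exp (- (c / 2) * rho\<^sup>2 * t) * (\<Sum>i<N. cmod (w i 0) / rho ^ i))"
   unfolding S0_def nW by (simp only: mult_ac)
 qed
qed

definition mode_poly :: "nat => (nat => real) => (nat => real) => (nat => real) => real => complex poly" where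
 "mode_poly m p p1 p2 rho = (\<Sum>k\<le>m. monom (mode_coeff m p p1 p2 rho k) k)"

lemma coeff_mode_poly: "coeff (mode_poly m p p1 p2 rho) k = (if k <= m then mode_coeff m p p1 p2 rho k else 0)"
 by (auto simp: mode_poly_def coeff_sum)

lemma degree_mode_poly_le: "degree (mode_poly m p p1 p2 rho) <= m"
 by (rule degree_le) (simp add: coeff_mode_poly)

lemma mode_poly_monic:
 assumes "p m = 1" "p1 m = 0" "p2 m = 0"
 shows "degree (mode_poly m p p1 p2 rho) = m" "lead_coeff (mode_poly m p p1 p2 rho) = 1"
proof -
 have 1: "coeff (mode_poly m p p1 p2 rho) m = 1" by (simp add: coeff_mode_poly mode_coeff_def assms)
 then show d: "degree (mode_poly m p p1 p2 rho) = m"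
  by (metis degree_mode_poly_le le_antisym le_degree zero_neq_one)
 show "lead_coeff (mode_poly m p p1 p2 rho) = 1" unfolding d by (rule 1)
qed

lemma act_mode_poly: "act (mode_poly m p p1 p2 rho) y l = (\<Sum>k\<le>m. mode_coeff m p p1 p2 rho k * y (l + k))"
 unfolding act_le[OF degree_mode_poly_le] by (simp add: coeff_mode_poly)

lemma cmod_add3: "cmod a <= x ==> cmod b <= y ==> cmod c <= z ==> cmod (a + b + c) <= x + y + z"
 by (meson add_mono norm_triangle_mono)

lemma mode_coeff_bounds:
 fixes rho M :: real
 assumes rho: "0 < rho" "rho <= 1" and pM: "!!k. \<bar>p k\<bar> <= M" "!!k. \<bar>p1 k\<bar> <= M" "!!k. \<bar>p2 k\<bar> <= M"
  and p0: "!!k. k >= m ==> p1 k = 0" "!!k. k >= m - 1 ==> p2 k = 0" and m: "m >= 2"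
 shows "N <= m - 1 ==> N <= m - 2 \<or> (ALL k. p2 k = 0) ==> k <= N ==> cmod (mode_coeff m p p1 p2 rho k) <= 3 * M * rho ^ (N - k)"
  and "p m = 1 ==> k <= m ==> cmod (mode_coeff m p p1 p2 rho k - ((if k = m then 1 else 0)
   + (if k = m - 1 then of_real (p1 (m - 1)) else 0) + (if k = m - 2 then of_real (p2 (m - 2)) else 0))) <= 3 * M * rho"
proof -
 have M: "M >= 0" using pM(1)[of 0] by linarith
 have t: "cmod ((\<i> * of_real rho) ^ e * of_real x) <= M * rho ^ e'" if "e' <= e" "\<bar>x\<bar> <= M" for e e' x
 proof -
  have "cmod ((\<i> * of_real rho) ^ e * of_real x) = rho ^ e * \<bar>x\<bar>"
   using rho by (simp add: norm_mult norm_power)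
  also have "... <= rho ^ e' * M" using that rho by (intro mult_mono power_decreasing) auto
  finally show ?thesis by (simp add: mult.commute)
 qed
 show "cmod (mode_coeff m p p1 p2 rho k) <= 3 * M * rho ^ (N - k)"
  if N: "N <= m - 1" "N <= m - 2 \<or> (ALL k. p2 k = 0)" and "k <= N"
 proof -
  have "cmod ((\<i> * of_real rho) ^ (m - 2 - k) * of_real (p2 k)) <= M * rho ^ (N - k)"
   using N(2)
  proof
   assume "ALL k. p2 k = 0" then show ?thesis using M rho by simp
  next
   assume "N <= m - 2"
   then have "N - k <= m - 2 - k" by (rule diff_le_mono)
   then show ?thesis by (rule t[OF _ pM(3)])
  qed
  moreover have "cmod ((\<i> * of_real rho) ^ (m - k) * of_real (p k)) <= M * rho ^ (N - k)"
   "cmod ((\<i> * of_real rho) ^ (m - 1 - k) * of_real (p1 k)) <= M * rho ^ (N - k)"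
   using N by (auto intro!: t[OF _ pM(1)] t[OF _ pM(2)])
  ultimately have "cmod (mode_coeff m p p1 p2 rho k) <= M * rho ^ (N - k) + M * rho ^ (N - k) + M * rho ^ (N - k)"
   unfolding mode_coeff_def by (intro cmod_add3)
  then show ?thesis by simp
 qed
 show "cmod (mode_coeff m p p1 p2 rho k - ((if k = m then 1 else 0)
   + (if k = m - 1 then of_real (p1 (m - 1)) else 0) + (if k = m - 2 then of_real (p2 (m - 2)) else 0))) <= 3 * M * rho"
  if pm: "p m = 1" and k: "k <= m"
 proof -
  have Mrho: "M * rho >= 0" using M rho by simp
  have 1: "cmod ((\<i> * of_real rho) ^ (m - k) * of_real (p k) - (if k = m then 1 else 0)) <= M * rho"
   using t[of 1 "m - k" "p k"] pM(1)[of k] pm k Mrho by (cases "k = m") auto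
  have 2: "cmod ((\<i> * of_real rho) ^ (m - 1 - k) * of_real (p1 k) - (if k = m - 1 then of_real (p1 (m - 1)) else 0)) <= M * rho"
  proof (cases "k >= m")
   case True
   then show ?thesis using p0(1)[of k] m Mrho by auto
  next
   case False
   then show ?thesis using t[of 1 "m - 1 - k" "p1 k"] pM(2)[of k] Mrho by (cases "k = m - 1") auto
  qed
  have 3: "cmod ((\<i> * of_real rho) ^ (m - 2 - k) * of_real (p2 k) - (if k = m - 2 then of_real (p2 (m - 2)) else 0)) <= M * rho"
  proof (cases "k >= m - 1")
   case True
   then have "k ~= m - 2" using m by linarith
   then show ?thesis using p0(2)[OF True] Mrho by simp
  next
   case False
   then show ?thesis using t[of 1 "m - 2 - k" "p2 k"] pM(3)[of k] Mrho by (cases "k = m - 2") auto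
  qed
  have e: "a + b + c - (a' + b' + c') = (a - a') + (b - b') + (c - c')" for a b c a' b' c' :: complex by simp
  show ?thesis unfolding mode_coeff_def by (subst e, rule order.trans[OF cmod_add3[OF 1 2 3]]) simp
 qed
qed

text \<open>At points away from zero the leading term dominates, which keeps \<open>slow_projector\<close> well defined.\<close>

lemma monic_eval_lower_bound:
 fixes R :: "complex poly"
 assumes R: "degree R = N" "lead_coeff R = 1" "ALL i<=N. cmod (coeff R i) <= K * rho ^ (N - i)"
  and rho: "0 < rho" "rho <= 1" and K: "K >= 0" and B: "B >= 1" and mu: "c <= cmod mu" "cmod mu <= B" and c: "c >= 0"
  and small: "rho * (real N * K * B ^ N) <= c ^ N / 2"
 shows "c ^ N / 2 <= cmod (poly R mu)"
proof -
 have "poly R mu = (\<Sum>i<N. coeff R i * mu ^ i) + mu ^ N"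
  using R(1,2) unfolding poly_altdef by (simp add: lessThan_Suc_atMost[symmetric])
 then have "cmod (poly R mu) >= cmod (mu ^ N) - cmod (\<Sum>i<N. coeff R i * mu ^ i)"
  by (metis add.commute norm_diff_ineq)
 moreover have "cmod (\<Sum>i<N. coeff R i * mu ^ i) <= (\<Sum>i<N. rho * (K * B ^ N))"
 proof (rule order.trans[OF norm_sum sum_mono])
  fix i assume i: "i : {..<N}"
  have "cmod (coeff R i * mu ^ i) <= (K * rho ^ (N - i)) * B ^ i"
   unfolding norm_mult norm_power using R i mu K rho by (intro mult_mono power_mono) auto
  also have "... <= (K * rho ^ 1) * B ^ N"
   using i rho K B by (intro mult_mono mult_left_mono power_decreasing power_increasing) auto
  finally show "cmod (coeff R i * mu ^ i) <= rho * (K * B ^ N)" by (simp add: mult_ac)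
 qed
 moreover have "cmod (mu ^ N) >= c ^ N" unfolding norm_power using mu c by (intro power_mono) auto
 ultimately show ?thesis using small by (simp add: algebra_simps)
qed

text \<open>As \<open>rho\<close> tends to zero the characteristic polynomial tends to \<open>x^m + c1 * x^(m-1) + c2 * x^(m-2)\<close>, whose nonzero roots
are the limits of the fast roots. The constants are uniform over all admissible coefficients because the limit is taken
along the filter of all parameters \<open>(p, p1, p2, rho)\<close> with \<open>rho\<close> tending to zero.\<close>

lemma mode_poly_factorization:
 fixes m N :: nat and M c1 c2 :: real
 assumes m: "m = N + length nus" "m >= 2" and N: "N >= 1" and M: "M >= 0"
  and nu: "!!nu. nu : set nus ==> Re nu < 0" and ne: "nus ~= []"
  and fac: "(\<Prod>nu\<leftarrow>nus. [:-nu, 1:]) * monom 1 N = monom 1 m + monom (of_real c1) (m-1) + monom (of_real c2) (m-2)"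
 obtains rho0 c B b K where "0 < rho0" "rho0 <= 1" "c > 0" "B >= 0" "b > 0" "K >= 0"
  "ALL p p1 p2 rho. (ALL k. \<bar>p k\<bar> <= M) --> (ALL k. \<bar>p1 k\<bar> <= M) --> (ALL k. \<bar>p2 k\<bar> <= M) -->
   (ALL k>=m. p1 k = 0) --> (ALL k>=m - 1. p2 k = 0) --> N <= m - 2 \<or> (ALL k. p2 k = 0) -->
   p m = 1 --> p1 (m-1) = c1 --> p2 (m-2) = c2 --> 0 < rho --> rho <= rho0 -->
   (EX R mus. mode_poly m p p1 p2 rho = (\<Prod>mu\<leftarrow>mus. [:-mu, 1:]) * R & length mus = length nus
  & (ALL mu:set mus. Re mu <= - c & cmod mu <= B & b <= cmod (poly R mu))
  & (ALL i<=N. cmod (coeff R i) <= K * rho ^ (N - i)) & degree R = N & lead_coeff R = 1)"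
proof -
 have Nm: "N <= m - 1" using m ne by (cases nus) auto
 define good where "good x = (case x of (p, p1, p2, rho) => (ALL k. \<bar>p k\<bar> <= M) & (ALL k. \<bar>p1 k\<bar> <= M) & (ALL k. \<bar>p2 k\<bar> <= M) &
   (ALL k>=m. p1 k = 0) & (ALL k>=m - 1. p2 k = 0) & (N <= m - 2 \<or> (ALL k. p2 k = 0)) &
   p m = 1 & p1 (m-1) = c1 & p2 (m-2) = c2 & 0 < rho & rho <= (1::real))" for x :: "(nat => real) \<times> (nat => real) \<times> (nat => real) \<times> real"
 define r where "r x = snd (snd (snd x))" for x :: "(nat => real) \<times> (nat => real) \<times> (nat => real) \<times> real"
 define Q0 where "Q0 = (\<Prod>nu\<leftarrow>nus. [:-nu, 1:]) * monom (1::complex) N"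
 define Q where "Q x = (if good x then (case x of (p, p1, p2, rho) => mode_poly m p p1 p2 rho) else Q0)" for x
 define F where "F = filtercomap r (at_right (0::real))"
 have Q0c: "coeff Q0 k = (if k = m then 1 else 0) + (if k = m - 1 then of_real c1 else 0) + (if k = m - 2 then of_real c2 else 0)" for k
  unfolding Q0_def fac by (auto simp: coeff_add)
 have Q0deg: "degree Q0 = m" "lead_coeff Q0 = 1"
 proof -
  have "m ~= m - 1" "m ~= m - 2" using m by linarith+
  then have 1: "coeff Q0 m = 1" unfolding Q0c by simp
  show "degree Q0 = m"
  proof (rule antisym)
   show "degree Q0 <= m" by (rule degree_le) (auto simp: Q0c)
   show "m <= degree Q0" by (rule le_degree) (simp add: 1)
  qed
  then show "lead_coeff Q0 = 1" by (simp add: 1)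
 qed
 have mon: "lead_coeff (Q x) = 1 & degree (Q x) = N + length nus" for x
 proof (cases "good x")
  case True
  obtain p p1 p2 rho where x: "x = (p, p1, p2, rho)" by (cases x)
  have pm: "p m = 1" "p1 m = 0" "p2 m = 0" using True unfolding good_def x by auto
  have Qx: "Q x = mode_poly m p p1 p2 rho" using True by (simp add: Q_def x)
  show ?thesis using mode_poly_monic[of p m p1 p2, OF pm] unfolding Qx m(1)[symmetric] by blast
 next
  case False
  then have Qx: "Q x = Q0" by (simp add: Q_def)
  show ?thesis using Q0deg unfolding Qx m(1)[symmetric] by blast
 qed
 have rlim: "filterlim r (at_right 0) F" unfolding F_def by (rule filterlim_filtercomap)
 then have r0: "(r \<longlongrightarrow> 0) F" by (simp add: filterlim_at)
 have ev01: "eventually (%x. 0 < r x & r x <= 1) F"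
 proof -
  have "eventually (%y::real. 0 < y & y <= 1) (at_right 0)"
   unfolding eventually_at_right_field by (rule exI[of _ 1]) auto
  then show ?thesis using rlim by (rule eventually_compose_filterlim)
 qed
 have lim: "((%x. coeff (Q x) i) \<longlongrightarrow> coeff Q0 i) F" for i
 proof -
  have b: "cmod (coeff (Q x) i - coeff Q0 i) <= 3 * M * r x" if "0 < r x" for x
  proof (cases "good x")
   case True
   obtain p p1 p2 rho where x: "x = (p, p1, p2, rho)" by (cases x)
   show ?thesis
   proof (cases "i <= m")
    case i: True
    have pp: "coeff Q0 i = (if i = m then 1 else 0) + (if i = m - 1 then of_real (p1 (m - 1)) else 0) + (if i = m - 2 then of_real (p2 (m - 2)) else 0)"
    proof -
     have "p1 (m - 1) = c1" "p2 (m - 2) = c2" using True unfolding x good_def by auto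
     then show ?thesis by (simp only: Q0c)
    qed
    have "cmod (mode_coeff m p p1 p2 rho i - coeff Q0 i) <= 3 * M * rho"
     unfolding pp by (rule mode_coeff_bounds(2)[OF _ _ _ _ _ _ _ m(2) _ i]) (use True x in \<open>auto simp: good_def\<close>)
    moreover have "coeff (Q x) i = mode_coeff m p p1 p2 rho i" using True i unfolding Q_def x by (simp add: coeff_mode_poly)
    ultimately show ?thesis by (simp add: r_def x)
   next
    case False
    have "degree (Q x) < i" "degree Q0 < i"
     using mon[of x] Q0deg(1) m(1) False by linarith+
    then have "coeff (Q x) i = 0" "coeff Q0 i = 0" by (auto intro: coeff_eq_0)
    then show ?thesis using M that by simp
   qed
  next
   case False
   then show ?thesis using M that by (simp add: Q_def)
  qed
  have "((%x. coeff (Q x) i - coeff Q0 i) \<longlongrightarrow> 0) F"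
  proof (rule Lim_null_comparison)
   show "eventually (%x. norm (coeff (Q x) i - coeff Q0 i) <= 3 * M * r x) F"
    using ev01 by eventually_elim (use b in auto)
   show "((%x. 3 * M * r x) \<longlongrightarrow> 0) F" using tendsto_mult_left[OF r0, of "3 * M"] by simp
  qed
  then show ?thesis by (rule Lim_null[THEN iffD2])
 qed
 define K where "K = 3 * M + cmod (coeff Q0 N)"
 have K: "K >= 0" using M by (simp add: K_def)
 have evK: "eventually (%x. ALL i<=N. cmod (coeff (Q x) i) <= K * r x ^ (N - i)) F"
  using ev01
 proof eventually_elim
  case (elim x)
  obtain p p1 p2 rho where x: "x = (p, p1, p2, rho)" by (cases x)
  show ?case
  proof (intro allI impI)
   fix i assume i: "i <= N"
   show "cmod (coeff (Q x) i) <= K * r x ^ (N - i)"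
   proof (cases "good x")
    case True
    have "cmod (mode_coeff m p p1 p2 rho i) <= 3 * M * rho ^ (N - i)"
     by (rule mode_coeff_bounds(1)[OF _ _ _ _ _ _ _ m(2) Nm _ i]) (use True x in \<open>auto simp: good_def\<close>)
    also have "... <= K * rho ^ (N - i)" using elim x by (intro mult_right_mono) (auto simp: K_def r_def)
    also have "mode_coeff m p p1 p2 rho i = coeff (Q x) i"
     using True i Nm unfolding Q_def x by (simp add: coeff_mode_poly)
    finally show ?thesis by (simp add: r_def x)
   next
    case False
    have "coeff Q0 i = 0" if "i < N" unfolding Q0_def using that by (subst mult.commute) (simp add: coeff_monom_mult)
    then show ?thesis using False i elim M by (cases "i = N") (auto simp: Q_def K_def)
   qed
  qed
 qed
 define c where "c = Min ((%nu. - Re nu) ` set nus) / 2"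
 have minpos: "Min ((%nu. - Re nu) ` set nus) > 0" using ne nu by (subst Min_gr_iff) auto
 have c: "c > 0" using minpos by (simp add: c_def)
 have cnu: "Re nu < - c" if "nu : set nus" for nu
 proof -
  have "Min ((%nu. - Re nu) ` set nus) <= - Re nu" using that by (intro Min_le) auto
  then show ?thesis using minpos by (simp add: c_def)
 qed
 define B where "B = 1 + Max (cmod ` set nus)"
 have Bnu: "cmod nu < B" if "nu : set nus" for nu
 proof -
  have "cmod nu <= Max (cmod ` set nus)" using that by (intro Max_ge) auto
  then show ?thesis by (simp add: B_def)
 qed
 have B: "B >= 1"
 proof -
  obtain nu where "nu : set nus" using ne by (cases nus) auto
  then have "cmod nu <= Max (cmod ` set nus)" by (intro Max_ge) auto
  then show ?thesis unfolding B_def using norm_ge_zero[of nu] by linarith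
 qed
 from slow_fast_factorization[OF lim[unfolded Q0_def] mon ev01 K evK, of c B] cnu Bnu c
 obtain R mus K' where K': "K' >= 0" and ev: "eventually (%x. Q x = (\<Prod>mu\<leftarrow>mus x. [:-mu, 1:]) * R x & length (mus x) = length nus
  & (ALL mu:set (mus x). Re mu <= - c & cmod mu <= B)
  & (ALL i<=N. cmod (coeff (R x) i) <= K' * r x ^ (N - i)) & degree (R x) = N & lead_coeff (R x) = 1) F"
  by blast
 from ev[unfolded F_def eventually_filtercomap] obtain P where P: "eventually P (at_right 0)"
  "!!x. P (r x) ==> Q x = (\<Prod>mu\<leftarrow>mus x. [:-mu, 1:]) * R x & length (mus x) = length nus
  & (ALL mu:set (mus x). Re mu <= - c & cmod mu <= B)
  & (ALL i<=N. cmod (coeff (R x) i) <= K' * r x ^ (N - i)) & degree (R x) = N & lead_coeff (R x) = 1" by blast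
 from P(1) obtain b0 where b0: "b0 > 0" "!!y. 0 < y ==> y < b0 ==> P y"
  unfolding eventually_at_right_field by blast
 define E where "E = real N * K' * B ^ N"
 have E: "E >= 0" using K' B by (simp add: E_def)
 define rho0 where "rho0 = min (min 1 (b0 / 2)) (c ^ N / (2 * (E + 1)))"
 have rho0: "0 < rho0" "rho0 <= 1" using b0 c E by (auto simp: rho0_def)
 show thesis
 proof (rule that[of rho0 c B "c ^ N / 2" K']; (intro allI impI)?)
  fix p p1 p2 rho
  assume h: "ALL k. \<bar>p k\<bar> <= M" "ALL k. \<bar>p1 k\<bar> <= M" "ALL k. \<bar>p2 k\<bar> <= M"
   "ALL k>=m. p1 k = 0" "ALL k>=m - 1. p2 k = 0" "N <= m - 2 \<or> (ALL k. p2 k = 0)"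
   "p m = 1" "p1 (m-1) = c1" "p2 (m-2) = c2" "0 < rho" "rho <= rho0"
  define x where "x = (p, p1, p2, rho)"
  have rx: "r x = rho" by (simp add: r_def x_def)
  have "good x" using h rho0 by (auto simp: good_def x_def)
  then have Qx: "Q x = mode_poly m p p1 p2 rho" by (simp add: Q_def x_def)
  have "rho < b0" using h(11) b0 by (simp add: rho0_def)
  then have "P (r x)" using b0(2)[of rho] h(10) rx by simp
  note Px = P(2)[OF this, unfolded Qx rx]
  have small: "rho * (real N * K' * B ^ N) <= c ^ N / 2"
  proof -
   have "rho * E <= c ^ N / (2 * (E + 1)) * E" using h(11) E by (intro mult_right_mono) (auto simp: rho0_def)
   also have "... = c ^ N / 2 * (E / (E + 1))" by simp
   also have "... <= c ^ N / 2 * 1" using E c by (intro mult_left_mono) auto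
   finally show ?thesis by (simp add: E_def)
  qed
  have "c ^ N / 2 <= cmod (poly (R x) mu)" if "mu : set (mus x)" for mu
  proof (rule monic_eval_lower_bound[where K=K' and rho=rho and B=B])
   have "Re mu <= - c" using Px that by blast
   then show "c <= cmod mu" using abs_Re_le_cmod[of mu] by linarith
  qed (use Px that small h rho0 K' B c in auto)
  with Px show "EX R mus. mode_poly m p p1 p2 rho = (\<Prod>mu\<leftarrow>mus. [:-mu, 1:]) * R & length mus = length nus
  & (ALL mu:set mus. Re mu <= - c & cmod mu <= B & c ^ N / 2 <= cmod (poly R mu))
  & (ALL i<=N. cmod (coeff R i) <= K' * rho ^ (N - i)) & degree R = N & lead_coeff R = 1"
   by (intro exI[of _ "R x"] exI[of _ "mus x"]) auto
 qed (use rho0 c B K' in auto)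
qed

text \<open>Since the slow part only sees \<open>N\<close> initial values, those of order at least \<open>N\<close> enter with the weight of order \<open>N - 1\<close>; the
fast part contributes the exponentially small term.\<close>

lemma low_frequency_bound:
 fixes m N :: nat and M delta c1 c2 theta :: real
 assumes m: "m = N + length nus" "m >= 2" and N: "N >= 1" and delta: "delta > 0" and M: "M >= 0"
  and nu: "!!nu. nu : set nus ==> Re nu < 0"
  and theta: "theta = 0 & length nus = 1 \<or> theta = 1 & length nus = 2"
  and fac: "(\<Prod>nu\<leftarrow>nus. [:-nu, 1:]) * monom 1 N = monom 1 m + monom (of_real c1) (m-1) + monom (of_real c2) (m-2)"
 obtains rho0 c C where "0 < rho0" "rho0 <= 1" "c > 0" "ALL k. C k >= (0::real)"
  "ALL p p1 p2 rho y k t. coercive_triple m M delta theta p p1 p2 --> p m = 1 --> p1 (m-1) = c1 --> p2 (m-2) = c2 -->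
   0 < rho --> rho <= rho0 --> mode_ode m p p1 p2 rho y --> t >= 0 -->
   cmod (y k t) <= C k * (rho ^ k * exp (- c * rho\<^sup>2 * t) * (\<Sum>j<m. cmod (y j 0) / rho ^ (min j (N-1)))
     + exp (- c * t) * (\<Sum>j<m. cmod (y j 0)))"
proof -
 have ne: "nus ~= []" using theta by auto
 obtain rho0 c B b K where rho0: "0 < rho0" "rho0 <= 1" and c: "c > 0" and B: "B >= 0" and b: "b > 0" and K: "K >= 0"
  and Fac0: "ALL p p1 p2 rho. (ALL k. \<bar>p k\<bar> <= M) --> (ALL k. \<bar>p1 k\<bar> <= M) --> (ALL k. \<bar>p2 k\<bar> <= M) -->
   (ALL k>=m. p1 k = 0) --> (ALL k>=m - 1. p2 k = 0) --> N <= m - 2 \<or> (ALL k. p2 k = 0) -->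
   p m = 1 --> p1 (m-1) = c1 --> p2 (m-2) = c2 --> 0 < rho --> rho <= rho0 -->
   (EX R mus. mode_poly m p p1 p2 rho = (\<Prod>mu\<leftarrow>mus. [:-mu, 1:]) * R & length mus = length nus
  & (ALL mu:set mus. Re mu <= - c & cmod mu <= B & b <= cmod (poly R mu))
  & (ALL i<=N. cmod (coeff R i) <= K * rho ^ (N - i)) & degree R = N & lead_coeff R = 1)"
  using mode_poly_factorization[OF m N M nu ne fac] .
 note Fac = Fac0[THEN spec, THEN spec, THEN spec, THEN spec, THEN mp, THEN mp, THEN mp, THEN mp, THEN mp, THEN mp, THEN mp, THEN mp, THEN mp, THEN mp, THEN mp]
 have theta': "theta = 0 & N <= m \<or> theta = 1 & N <= m - 1" using theta m by auto
 obtain c' D where c': "c' > 0" and D1: "ALL k. D k >= (0::real)" and slow0: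
  "ALL p p1 p2 rho w R k t. coercive_triple m M delta theta p p1 p2 --> 0 < rho --> rho <= 1 --> mode_ode m p p1 p2 rho w -->
   degree R = N --> lead_coeff R = 1 --> (ALL i<=N. cmod (coeff R i) <= K * rho ^ (N - i)) -->
   (ALL l t. act R (%k. w k t) l = 0) --> t >= 0 -->
   cmod (w k t) <= D k * (rho ^ k * exp (- c' * rho\<^sup>2 * t) * (\<Sum>i<N. cmod (w i 0) / rho ^ i))"
  using slow_part_decay[OF m(2) delta M K theta'] .
 note slow = slow0[THEN spec, THEN spec, THEN spec, THEN spec, THEN spec, THEN spec, THEN spec, THEN spec, THEN mp, THEN mp, THEN mp, THEN mp, THEN mp, THEN mp, THEN mp, THEN mp, THEN mp]
 have D: "D k >= 0" for k using D1 by blast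
 define d where "d = length nus"
 obtain G where G0: "ALL k. G k >= 0" and GG: "ALL R mus rho y. length mus = d &
  (ALL mu:set mus. Re mu <= - c & cmod mu <= B & cmod (poly R mu) >= b) & degree R = N &
  (ALL i<=N. cmod (coeff R i) <= K * rho ^ (N - i)) & 0 < rho & rho <= 1 & smooth_seq y &
  (ALL l t. act ((\<Prod>mu\<leftarrow>mus. [:-mu, 1:]) * R) (%k. y k t) l = 0) -->
  (EX w. smooth_seq w & (ALL l t. act R (%k. w k t) l = 0) &
   (ALL k. ALL t>=0. cmod (y k t - w k t) <= G k * (exp (- (c/2) * t) * (\<Sum>l<N+d. rho ^ (N - l) * cmod (y l 0)))))"
  using slow_fast_split[OF K b c B, of d N] by - (elim exE conjE, rule that, assumption+)
 have G: "G k >= 0" for k using G0 by blast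
 define H where "H = (\<Sum>i<N. 1 + G i)"
 have H: "H >= 0" unfolding H_def by (intro sum_nonneg add_nonneg_nonneg G) auto
 define cc where "cc = min c' (c / 2)"
 have cc: "cc > 0" "cc <= c'" "cc <= c / 2" using c c' by (auto simp: cc_def)
 show thesis
 proof (rule that[OF rho0 cc(1), of "%k. D k * H + G k"]; intro allI impI)
  show "D k * H + G k >= 0" for k using D G H by simp
 next
  fix p p1 p2 rho y k and t :: real
  assume T: "coercive_triple m M delta theta p p1 p2" and pm: "p m = 1" "p1 (m-1) = c1" "p2 (m-2) = c2"
   and rho: "0 < rho" "rho <= rho0" and ode: "mode_ode m p p1 p2 rho y" and t: "t >= 0"
  have rho1: "rho <= 1" using rho rho0 by linarith
  from T have pM: "!!k. \<bar>p k\<bar> <= M" "!!k. \<bar>p1 k\<bar> <= M" "!!k. \<bar>p2 k\<bar> <= M"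
   and p0: "!!k. k >= m ==> p1 k = 0" "!!k. k >= m - 1 ==> p2 k = 0"
   and p2z: "theta = 0 & (ALL k. p2 k = 0) \<or> theta = 1"
   unfolding coercive_triple_def by blast+
  have Nz: "N <= m - 2 \<or> (ALL k. p2 k = 0)" using p2z theta m by auto
  obtain R mus where RQ: "mode_poly m p p1 p2 rho = (\<Prod>mu\<leftarrow>mus. [:-mu, 1:]) * R" and lm: "length mus = length nus"
  and mus: "ALL mu:set mus. Re mu <= - c & cmod mu <= B & b <= cmod (poly R mu)"
  and R: "ALL i<=N. cmod (coeff R i) <= K * rho ^ (N - i)" "degree R = N" "lead_coeff R = 1"
  proof -
   have "ALL k. \<bar>p k\<bar> <= M" "ALL k. \<bar>p1 k\<bar> <= M" "ALL k. \<bar>p2 k\<bar> <= M"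
    "ALL k>=m. p1 k = 0" "ALL k>=m - 1. p2 k = 0" using pM p0 by blast+
   from Fac[OF this Nz pm rho] that show thesis by - (elim exE conjE, assumption | rule that)+
  qed
  have sy: "smooth_seq y" and Qy: "act (mode_poly m p p1 p2 rho) (%k. y k t) l = 0" for l t
   using ode by (simp_all add: mode_ode_def act_mode_poly)
  have "EX w. smooth_seq w & (ALL l t. act R (%k. w k t) l = 0) &
   (ALL k. ALL t>=0. cmod (y k t - w k t) <= G k * (exp (- (c/2) * t) * (\<Sum>l<N+d. rho ^ (N - l) * cmod (y l 0))))"
   by (rule GG[THEN spec[of _ R], THEN spec[of _ mus], THEN spec[of _ rho], THEN spec[of _ y], THEN mp])
    (use lm mus R rho rho1 sy Qy RQ in \<open>simp add: d_def\<close>)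
  then obtain w where sw: "smooth_seq w" and Rw: "!!l t. act R (%k. w k t) l = 0"
   and yw: "!!k t. t >= 0 ==> cmod (y k t - w k t) <= G k * (exp (- (c/2) * t) * (\<Sum>l<N+d. rho ^ (N - l) * cmod (y l 0)))"
   by blast
  have odew: "mode_ode m p p1 p2 rho w"
   unfolding mode_ode_def
  proof (intro conjI sw allI)
   fix l t
   have "act (mode_poly m p p1 p2 rho) (%k. w k t) l = 0"
    by (rule act_dvd[OF _ Rw]) (simp add: RQ)
   then show "(\<Sum>k\<le>m. mode_coeff m p p1 p2 rho k * w (l + k) t) = 0" by (simp add: act_mode_poly)
  qed
  define X where "X = (\<Sum>l<m. rho ^ (N - l) * cmod (y l 0))"
  define \<Xi> where "\<Xi> = (\<Sum>j<m. cmod (y j 0) / rho ^ (min j (N-1)))"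
  define Y where "Y = (\<Sum>j<m. cmod (y j 0))"
  have Nd: "N + d = m" using m by (simp add: d_def)
  have X\<Xi>: "X / rho ^ (N - 1) <= \<Xi>"
   unfolding X_def \<Xi>_def sum_divide_distrib
  proof (rule sum_mono)
   fix l
   have "rho ^ (N - l) / rho ^ (N - 1) <= 1 / rho ^ (min l (N-1))"
   proof (cases "l <= N - 1")
    case True
    then have "N - l = (N - 1 - l) + 1" using N by simp
    then have "rho ^ (N - l) <= rho ^ (N - 1 - l)" using rho rho1 by (intro power_decreasing) auto
    also have "rho ^ (N - 1 - l) = rho ^ (N - 1) / rho ^ l" by (rule power_diff) (use True rho in auto)
    finally show ?thesis using True rho by (simp add: field_simps)
   next
    case False
    then show ?thesis using N by (simp add: min_def)
   qed
   from mult_right_mono[OF this, of "cmod (y l 0)"]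
   show "rho ^ (N - l) * cmod (y l 0) / rho ^ (N - 1) <= cmod (y l 0) / rho ^ (min l (N-1))"
    by simp
  qed
  have XY: "X <= Y" unfolding X_def Y_def
  proof (rule sum_mono)
   fix l
   have "rho ^ (N - l) <= 1" using rho rho1 by (simp add: power_le_one)
   then show "rho ^ (N - l) * cmod (y l 0) <= cmod (y l 0)" using mult_right_mono[of "rho ^ (N - l)" 1 "cmod (y l 0)"] by simp
  qed
  have nn: "X >= 0" "\<Xi> >= 0" "Y >= 0" using rho by (auto simp: X_def \<Xi>_def Y_def intro!: sum_nonneg)
  have w0: "(\<Sum>i<N. cmod (w i 0) / rho ^ i) <= H * \<Xi>"
   unfolding H_def sum_distrib_right
  proof (rule sum_mono)
   fix i assume i: "i : {..<N}"
   have "cmod (w i 0) <= cmod (y i 0) + cmod (y i 0 - w i 0)"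
    using norm_triangle_sub[of "w i 0" "y i 0"] by (simp add: norm_minus_commute)
   also have "... <= cmod (y i 0) + G i * X" using yw[of 0 i] by (simp add: X_def Nd)
   finally have "cmod (w i 0) / rho ^ i <= (cmod (y i 0) + G i * X) / rho ^ i"
    using rho by (intro divide_right_mono) auto
   also have "... = cmod (y i 0) / rho ^ i + G i * (X / rho ^ i)" by (simp add: add_divide_distrib)
   also have "... <= \<Xi> + G i * \<Xi>"
   proof (intro add_mono mult_left_mono G)
    have "cmod (y i 0) / rho ^ (min i (N-1)) <= \<Xi>" unfolding \<Xi>_def
     by (rule member_le_sum) (use i rho Nd in auto)
    moreover have "min i (N - 1) = i" using i by auto
    ultimately show "cmod (y i 0) / rho ^ i <= \<Xi>" by simp
    have "rho ^ (N - 1) <= rho ^ i" using i rho rho1 by (intro power_decreasing) auto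
    then have "X / rho ^ i <= X / rho ^ (N - 1)" using nn rho by (intro divide_left_mono) auto
    then show "X / rho ^ i <= \<Xi>" using X\<Xi> by linarith
   qed
   finally show "cmod (w i 0) / rho ^ i <= (1 + G i) * \<Xi>" by (simp add: algebra_simps)
  qed
  have e1: "exp (- c' * rho\<^sup>2 * t) <= exp (- cc * rho\<^sup>2 * t)"
  proof -
   have "cc * (rho\<^sup>2 * t) <= c' * (rho\<^sup>2 * t)" using cc t by (intro mult_right_mono) auto
   then show ?thesis by (simp add: mult.assoc)
  qed
  have e2: "exp (- (c / 2) * t) <= exp (- cc * t)"
   using mult_right_mono[OF cc(3) t] by simp
  have "cmod (w k t) <= D k * (rho ^ k * exp (- c' * rho\<^sup>2 * t) * (\<Sum>i<N. cmod (w i 0) / rho ^ i))"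
   by (rule slow[OF T rho(1) rho1 odew R(2,3,1) _ t]) (use Rw in blast)
  also have "... <= D k * (rho ^ k * exp (- cc * rho\<^sup>2 * t) * (H * \<Xi>))"
   using rho by (intro mult_left_mono mult_mono w0 e1 D) (auto intro!: sum_nonneg)
  finally have W: "cmod (w k t) <= D k * H * (rho ^ k * exp (- cc * rho\<^sup>2 * t) * \<Xi>)" by (simp only: mult_ac)
  have "cmod (y k t - w k t) <= G k * (exp (- (c/2) * t) * X)"
   using yw[OF t, of k] by (simp add: X_def Nd)
  also have "... <= G k * (exp (- cc * t) * Y)"
   using nn by (intro mult_left_mono mult_mono XY e2 G) auto
  finally have V: "cmod (y k t - w k t) <= G k * (exp (- cc * t) * Y)" .
  define a where "a = rho ^ k * exp (- cc * rho\<^sup>2 * t) * \<Xi>"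
  define e where "e = exp (- cc * t) * Y"
  have ae: "a >= 0" "e >= 0" using nn rho by (simp_all add: a_def e_def)
  have "cmod (y k t) <= cmod (w k t) + cmod (y k t - w k t)"
   using norm_triangle_ineq[of "w k t" "y k t - w k t"] by simp
  also have "... <= D k * H * a + G k * e" using W V by (simp add: a_def e_def)
  also have "... <= (D k * H + G k) * (a + e)"
   using ae D[of k] H G[of k] by (simp add: algebra_simps)
  finally show "cmod (y k t) <= (D k * H + G k) * (rho ^ k * exp (- cc * rho\<^sup>2 * t) * (\<Sum>j<m. cmod (y j 0) / rho ^ (min j (N-1)))
     + exp (- cc * t) * (\<Sum>j<m. cmod (y j 0)))"
   by (simp add: a_def e_def \<Xi>_def Y_def)
 qed
qed

section \<open>Symbols\<close>

definition sc :: "'n::finite operator => real^'n => nat => real" where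
 "sc P omega k = Re (coeff (symbol P omega) k)"

text \<open>The coefficient of \<open>d^k/dt^k\<close> in the equation at the frequency \<open>xi\<close>; the symbols of the statement, by contrast, carry no
powers of \<open>\<i>\<close>.\<close>

definition fsym :: "'n::finite operator => nat => real^'n => complex" where
 "fsym Q k xi = (\<Sum>(j, alpha) | Q j alpha ~= 0. if j = k then Q j alpha * \<i> ^ msize alpha * of_real (mpow xi alpha) else 0)"

definition opsupp :: "'n operator => (nat \<times> 'n mindex) set" where
 "opsupp Q = {(k, alpha). Q k alpha ~= 0}"

definition homog_coeffs :: "nat => 'n::finite operator => bool" where
 "homog_coeffs r P \<longleftrightarrow> (ALL k alpha. P k alpha ~= 0 --> k + msize alpha = r)"

lemma finite_opsupp:
 fixes P :: "'n::finite operator"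
 assumes "homog_coeffs r P"
 shows "finite (opsupp P)"
proof -
 have "finite (Pi\<^sub>E (UNIV :: 'n set) (%_. {..r}))" by (intro finite_PiE) auto
 then have fin: "finite {alpha :: 'n mindex. ALL i. alpha i <= r}"
  by (rule rev_finite_subset) (auto simp: PiE_def extensional_def)
 have "opsupp P \<subseteq> {..r} \<times> {alpha. ALL i. alpha i <= r}"
 proof (clarsimp simp: opsupp_def)
  fix k alpha assume "P k alpha ~= 0"
  then have e: "k + msize alpha = r" using assms by (simp add: homog_coeffs_def)
  have "alpha i <= msize alpha" for i unfolding msize_def by (rule member_le_sum) auto
  then show "k <= r & (ALL i. alpha i <= r)" using e by (metis le_add1 le_add2 order_trans)
 qed
 then show ?thesis by (rule finite_subset) (use fin in simp)
qed

lemma opsupp_sum_extend: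
 assumes "finite S" "opsupp Q \<subseteq> S" "!!k alpha. Q k alpha = 0 ==> f k alpha = 0"
 shows "(\<Sum>(k, alpha) | Q k alpha ~= 0. f k alpha) = (\<Sum>(k, alpha)\<in>S. f k alpha)"
 by (rule sum.mono_neutral_left) (use assms in \<open>auto simp: opsupp_def\<close>)

lemma fsym_extend:
 assumes "finite S" "opsupp Q \<subseteq> S"
 shows "fsym Q k xi = (\<Sum>(j, alpha)\<in>S. if j = k then Q j alpha * \<i> ^ msize alpha * of_real (mpow xi alpha) else 0)"
 unfolding fsym_def by (rule opsupp_sum_extend[OF assms]) auto

lemma fsym_add3:
 fixes P P1 P2 :: "'n::finite operator"
 assumes "finite (opsupp P)" "finite (opsupp P1)" "finite (opsupp P2)"
 shows "fsym (%k alpha. P k alpha + P1 k alpha + P2 k alpha) k xi = fsym P k xi + fsym P1 k xi + fsym P2 k xi"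
proof -
 let ?S = "opsupp P \<union> opsupp P1 \<union> opsupp P2"
 have fin: "finite ?S" using assms by simp
 have e: "fsym Q k xi = (\<Sum>(j, alpha)\<in>?S. if j = k then Q j alpha * \<i> ^ msize alpha * of_real (mpow xi alpha) else 0)"
  if "opsupp Q \<subseteq> ?S" for Q :: "'n operator" using fsym_extend[OF fin that] .
 have "opsupp (%k alpha. P k alpha + P1 k alpha + P2 k alpha) \<subseteq> ?S"
  by (auto simp: opsupp_def)
 then show ?thesis
  by (simp only: e Un_upper1 Un_upper2 le_supI1 sum.distrib[symmetric])
   (auto intro!: sum.cong simp: algebra_simps)
qed

lemma coeff_symbol:
 assumes "finite (opsupp P)"
 shows "coeff (symbol P omega) k = (\<Sum>(j, alpha)\<in>opsupp P. if j = k then P j alpha * of_real (mpow omega alpha) else 0)"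
 unfolding symbol_def coeff_sum opsupp_def by (rule sum.cong) auto

lemma mpow_scale: "mpow (rho *\<^sub>R omega) alpha = rho ^ msize alpha * mpow omega alpha"
 by (simp add: mpow_def msize_def power_mult_distrib prod.distrib power_sum)

lemma fsym_homog:
 fixes P :: "'n::finite operator"
 assumes h: "homog_coeffs r P"
 shows "fsym P k (rho *\<^sub>R omega) = (\<i> * of_real rho) ^ (r - k) * coeff (symbol P omega) k"
proof -
 have fin: "finite (opsupp P)" using finite_opsupp[OF h] .
 have "fsym P k (rho *\<^sub>R omega) = (\<Sum>(j, alpha)\<in>opsupp P. if j = k then P j alpha * \<i> ^ msize alpha * of_real (mpow (rho *\<^sub>R omega) alpha) else 0)"
  by (rule fsym_extend[OF fin order_refl])
 also have "... = (\<Sum>(j, alpha)\<in>opsupp P. (\<i> * of_real rho) ^ (r - k) * (if j = k then P j alpha * of_real (mpow omega alpha) else 0))"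
 proof (rule sum.cong[OF refl], clarify)
  fix j alpha assume "(j, alpha) : opsupp P"
  then have "j + msize alpha = r" using h by (auto simp: opsupp_def homog_coeffs_def)
  then have "r - j = msize alpha" by simp
  then show "(if j = k then P j alpha * \<i> ^ msize alpha * of_real (mpow (rho *\<^sub>R omega) alpha) else 0)
   = (\<i> * of_real rho) ^ (r - k) * (if j = k then P j alpha * of_real (mpow omega alpha) else 0)"
   by (auto simp: mpow_scale power_mult_distrib)
 qed
 also have "... = (\<i> * of_real rho) ^ (r - k) * coeff (symbol P omega) k"
  unfolding coeff_symbol[OF fin] sum_distrib_left by (rule sum.cong) auto
 finally show ?thesis .
qed

lemma coeff_symbol_high:
 assumes h: "homog_coeffs r P" and "k > r"
 shows "coeff (symbol P omega) k = 0"
 unfolding coeff_symbol[OF finite_opsupp[OF h]]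
 by (rule sum.neutral) (use assms in \<open>auto simp: opsupp_def homog_coeffs_def\<close>)

lemma coeff_symbol_top:
 fixes P :: "'n::finite operator"
 assumes h: "homog_coeffs r P"
 shows "coeff (symbol P omega) r = P r (%_. 0)"
proof -
 have fin: "finite (opsupp P)" using finite_opsupp[OF h] .
 have m0: "alpha = (%_. 0)" if "P r alpha ~= 0" for alpha
 proof
  fix i
  have "r + msize alpha = r" using h that unfolding homog_coeffs_def by blast
  then show "alpha i = 0" by (simp add: msize_def)
 qed
 have "coeff (symbol P omega) r = (\<Sum>x\<in>opsupp P. if x = (r, %_. 0) then P r (%_. 0) else 0)"
  unfolding coeff_symbol[OF fin]
 proof (rule sum.cong[OF refl], clarify)
  fix j alpha assume s: "(j, alpha) : opsupp P"
  show "(if j = r then P j alpha * of_real (mpow omega alpha) else 0) = (if (j, alpha) = (r, %_. 0) then P r (%_. 0) else 0)"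
  proof (cases "j = r")
   case True
   then have "alpha = (%_. 0)" using s m0 by (auto simp: opsupp_def)
   then show ?thesis using True by (simp add: mpow_def)
  qed simp
 qed
 also have "... = P r (%_. 0)"
  unfolding sum.delta[OF fin] by (simp add: opsupp_def)
 finally show ?thesis .
qed

lemma continuous_coeff_symbol:
 assumes "finite (opsupp P)"
 shows "continuous_on S (%omega. coeff (symbol P omega) k)"
proof -
 have "continuous_on S (%omega::real^'a. mpow omega alpha)" for alpha
  unfolding mpow_def by (intro continuous_intros)
 then have c: "continuous_on S (%omega::real^'a. complex_of_real (mpow omega alpha))" for alpha by (rule continuous_on_of_real)
 have "continuous_on S (%omega::real^'a. if j = k then P j alpha * complex_of_real (mpow omega alpha) else 0)" for j alpha
  by (cases "j = k") (simp_all add: continuous_on_mult_left[OF c])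
 then show ?thesis unfolding coeff_symbol[OF assms]
  by (intro continuous_on_sum) (simp only: case_prod_beta)
qed

lemma continuous_sc:
 assumes "finite (opsupp P)"
 shows "continuous_on S (%omega. sc P omega k)"
 unfolding sc_def by (rule continuous_on_Re[OF continuous_coeff_symbol[OF assms]])

section \<open>Uniformity over compact sets\<close>

text \<open>Positive constants that can be chosen locally, and may always be decreased, can be chosen globally.\<close>

lemma compact_uniform:
 fixes S :: "'a::metric_space set"
 assumes S: "compact S"
  and loc: "!!x. x : S ==> EX delta>0. EX \<epsilon>>0. ALL y:S. dist x y < \<epsilon> --> P delta y"
  and anti: "!!delta delta' y. P delta y ==> 0 < delta' ==> delta' <= delta ==> P delta' y"
 shows "EX delta>(0::real). ALL y:S. P delta y"
proof -
 have "ALL x:S. EX delta \<epsilon>. delta > 0 & \<epsilon> > 0 & (ALL y:S. dist x y < \<epsilon> --> P delta y)" using loc by blast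
 then obtain d where d: "ALL x:S. EX \<epsilon>. d x > 0 & \<epsilon> > 0 & (ALL y:S. dist x y < \<epsilon> --> P (d x) y)"
  unfolding bchoice_iff by blast
 then obtain e where de: "ALL x:S. d x > 0 & e x > 0 & (ALL y:S. dist x y < e x --> P (d x) y)"
  unfolding bchoice_iff by blast
 have "S \<subseteq> (\<Union>x\<in>S. ball x (e x))" using de by force
 from compactE_image[OF S _ this] obtain T where T: "T \<subseteq> S" "finite T" "S \<subseteq> (\<Union>x\<in>T. ball x (e x))"
  by blast
 show ?thesis
 proof (cases "T = {}")
  case True
  then show ?thesis using T by (intro exI[of _ 1]) auto
 next
  case False
  have pos: "Min (d ` T) > 0" using T False de by (subst Min_gr_iff) auto
  have "P (Min (d ` T)) y" if yS: "y : S" for y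
  proof -
   obtain x where x: "x : T" "y : ball x (e x)" using T(3) yS by blast
   then have "dist x y < e x" by simp
   with x have "P (d x) y" using de T yS by blast
   then show ?thesis by (rule anti[OF _ pos]) (use T x in auto)
  qed
  then show ?thesis using pos by blast
 qed
qed

lemma compact_bounded_family:
 fixes a :: "'a::metric_space => nat => real"
 assumes S: "compact S" and c: "!!k. continuous_on S (%x. a x k)" and z: "!!x k. x : S ==> k > n ==> a x k = 0"
 shows "EX M>=0. ALL x:S. ALL k. \<bar>a x k\<bar> <= M"
proof -
 have "EX B>=0. ALL x:S. \<bar>a x k\<bar> <= B" for k
 proof -
  have "compact ((%x. a x k) ` S)" using S c by (rule compact_continuous_image[rotated])
  then obtain B where "ALL y:(%x. a x k) ` S. norm y <= B" using compact_imp_bounded bounded_iff by blast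
  then show ?thesis by (intro exI[of _ "\<bar>B\<bar>"]) fastforce
 qed
 then obtain B where B: "!!k. B k >= 0" "!!k x. x : S ==> \<bar>a x k\<bar> <= B k" by metis
 have "\<bar>a x k\<bar> <= (\<Sum>k\<le>n. B k)" if "x : S" for x k
 proof (cases "k <= n")
  case True
  have "\<bar>a x k\<bar> <= B k" using B that by blast
  also have "... <= (\<Sum>k\<le>n. B k)" by (rule member_le_sum) (use True B in auto)
  finally show ?thesis .
 qed (use z that B in \<open>simp add: sum_nonneg\<close>)
 then show ?thesis using B by (intro exI[of _ "\<Sum>k\<le>n. B k"]) (auto intro: sum_nonneg)
qed

lemma bez_uniformly_coercive:
 fixes a b :: "'a::metric_space => nat => real"
 assumes S: "compact S"
  and c: "!!k. continuous_on S (%x. a x k)" "!!k. continuous_on S (%x. b x k)"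
  and z: "!!x k. x : S ==> k > n ==> a x k = 0" "!!x k. x : S ==> k > n ==> b x k = 0"
  and co: "!!x. x : S ==> EX delta>0. ALL V. bez n (a x) (b x) V >= delta * sq n V"
 shows "EX delta>0. ALL x:S. ALL V. delta * sq n V <= bez n (a x) (b x) V"
proof (rule compact_uniform[OF S])
 fix x assume x: "x : S"
 obtain delta where delta: "delta > 0" "!!V. bez n (a x) (b x) V >= delta * sq n V" using co[OF x] by blast
 have "EX M>=0. ALL x:S. ALL k. \<bar>a x k\<bar> <= M"
  by (rule compact_bounded_family[where n=n and a=a, OF S]) (fact c(1), fact z(1))
 then obtain M1 where M1: "M1 >= 0" "!!x k. x : S ==> \<bar>a x k\<bar> <= M1" by blast
 have "EX M>=0. ALL x:S. ALL k. \<bar>b x k\<bar> <= M"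
  by (rule compact_bounded_family[where n=n and a=b, OF S]) (fact c(2), fact z(2))
 then obtain M2 where M2: "M2 >= 0" "!!x k. x : S ==> \<bar>b x k\<bar> <= M2" by blast
 define M where "M = M1 + M2 + 1"
 have M: "M > 0" "!!x k. x : S ==> \<bar>a x k\<bar> <= M" "!!x k. x : S ==> \<bar>b x k\<bar> <= M"
 proof -
  show "M > 0" using M1(1) M2(1) by (simp add: M_def)
  show "\<bar>a x k\<bar> <= M" if "x : S" for x k using M1(2)[OF that, of k] M2(1) by (simp add: M_def)
  show "\<bar>b x k\<bar> <= M" if "x : S" for x k using M2(2)[OF that, of k] M1(1) by (simp add: M_def)
 qed
 define L where "L = 4 * (real n + 1) ^ 3 * M"
 have L: "L > 0" using M by (simp add: L_def)
 define e where "e = delta / (2 * L)"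
 have e: "e > 0" using delta L by (simp add: e_def)
 have "EX \<epsilon>>0. ALL y:S. dist x y < \<epsilon> --> \<bar>a y k - a x k\<bar> < e & \<bar>b y k - b x k\<bar> < e" for k
 proof -
  obtain e1 where e1: "e1 > 0" "!!y. y : S ==> dist y x < e1 ==> dist (a y k) (a x k) < e"
   using c(1)[of k] x e unfolding continuous_on_iff by blast
  obtain e2 where e2: "e2 > 0" "!!y. y : S ==> dist y x < e2 ==> dist (b y k) (b x k) < e"
   using c(2)[of k] x e unfolding continuous_on_iff by blast
  show ?thesis using e1 e2 by (intro exI[of _ "min e1 e2"]) (auto simp: dist_real_def dist_commute)
 qed
 then obtain ep where ep: "!!k. ep k > 0" "!!k y. y : S ==> dist x y < ep k ==> \<bar>a y k - a x k\<bar> < e & \<bar>b y k - b x k\<bar> < e"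
  by metis
 define \<epsilon> where "\<epsilon> = Min (ep ` {..n})"
 have \<epsilon>: "\<epsilon> > 0" "!!k. k <= n ==> \<epsilon> <= ep k" using ep by (auto simp: \<epsilon>_def)
 show "EX delta>0. EX \<epsilon>>0. ALL y:S. dist x y < \<epsilon> --> (ALL V. delta * sq n V <= bez n (a y) (b y) V)"
 proof (rule exI[of _ "delta / 2"], intro conjI, use delta in simp, rule exI[of _ \<epsilon>], intro conjI \<epsilon> ballI impI allI)
  fix y V assume y: "y : S" "dist x y < \<epsilon>"
  have cl: "\<bar>a y k - a x k\<bar> <= e & \<bar>b y k - b x k\<bar> <= e" for k
  proof (cases "k <= n")
   case True
   then show ?thesis using ep(2)[OF y(1), of k] \<epsilon>(2)[OF True] y(2) by force
  next
   case False
   then show ?thesis using z x y e by simp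
  qed
  have "\<bar>bez n (a y) (b y) V - bez n (a x) (b x) V\<bar> <= 4 * (real n + 1) ^ 3 * M * e * sq n V"
   by (rule bez_diff_bound) (use M x y cl in auto)
  also have "4 * (real n + 1) ^ 3 * M * e = delta / 2" using L by (simp add: L_def[symmetric] e_def)
  finally show "delta / 2 * sq n V <= bez n (a y) (b y) V"
   by (rule lower_bound_from_diff) (use delta(2)[of V] in simp)
 qed
next
 fix delta delta' :: real and y
 assume h: "ALL V. delta * sq n V <= bez n (a y) (b y) V" "0 < delta'" "delta' <= delta"
 show "ALL V. delta' * sq n V <= bez n (a y) (b y) V"
 proof
  fix V
  have "delta' * sq n V <= delta * sq n V" using h by (intro mult_right_mono) auto
  then show "delta' * sq n V <= bez n (a y) (b y) V" using h(1)[rule_format, of V] by linarith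
 qed
qed

section \<open>Symbols with interlacing roots\<close>

lemma prod_list_nth: "(\<Prod>x\<leftarrow>xs. f x) = (\<Prod>i<length xs. f (xs ! i))"
 for f :: "'a => 'b::comm_monoid_mult"
 by (simp add: prod.list_conv_set_nth atLeast0LessThan)

lemma map_poly_prod_linear:
 fixes n :: nat
 shows
 "(\<Prod>i<n. [:- complex_of_real (f i), 1:]) = map_poly of_real (\<Prod>i<n. [:- f i, 1:])"
proof (induction n)
 case (Suc n)
 have h: "map_poly complex_of_real (p * q) = map_poly of_real p * map_poly of_real q" for p q
  by (rule poly_eqI) (simp add: coeff_map_poly coeff_mult)
 have "map_poly complex_of_real [:- f n, 1:] = [:- complex_of_real (f n), 1:]"
  by (simp add: map_poly_pCons)
 then show ?case by (simp add: Suc h del: mult_pCons_left mult_pCons_right)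
qed (simp add: map_poly_pCons)

lemma real_roots_symbol:
 fixes P :: "'n::finite operator"
 assumes P: "homogeneous_op r P" and rr: "real_roots (symbol P omega) xs"
 shows "length xs = r"
  and "sc P omega = coeff (smult (Re (P r (%_. 0))) (\<Prod>i<r. [:- (xs ! i), 1:]))"
  and "coeff (symbol P omega) k = of_real (sc P omega k)"
proof -
 have h: "homog_coeffs r P" and cr: "P r (%_. 0) : \<real>" "Re (P r (%_. 0)) > 0"
  using P by (auto simp: homogeneous_op_def homog_coeffs_def)
 have deg: "degree (symbol P omega) = r"
 proof (rule antisym)
  show "degree (symbol P omega) <= r" by (rule degree_le) (use coeff_symbol_high[OF h] in auto)
  show "r <= degree (symbol P omega)" by (rule le_degree) (use coeff_symbol_top[OF h] cr in auto)
 qed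
 have lc: "lead_coeff (symbol P omega) = P r (%_. 0)" unfolding deg by (rule coeff_symbol_top[OF h])
 have eq: "symbol P omega = smult (P r (%_. 0)) (\<Prod>x\<leftarrow>xs. [:- complex_of_real x, 1:])"
  using rr unfolding real_roots_def lc by blast
 have "degree (\<Prod>x\<leftarrow>xs. [:- complex_of_real x, 1:]) = length xs & (\<Prod>x\<leftarrow>xs. [:- complex_of_real x, 1:]) ~= 0"
  by (induction xs) (auto simp: degree_mult_eq simp del: mult_pCons_left)
 then show len: "length xs = r"
 proof -
  have "P r (%_. 0) ~= 0" using cr by auto
  then show ?thesis using deg \<open>degree _ = length xs & _\<close> unfolding eq degree_smult_eq by simp
 qed
 have eq2: "symbol P omega = map_poly of_real (smult (Re (P r (%_. 0))) (\<Prod>i<r. [:- (xs ! i), 1:]))"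
  unfolding eq prod_list_nth len map_poly_prod_linear
  by (rule poly_eqI) (use cr in \<open>auto simp: coeff_map_poly elim!: Reals_cases\<close>)
 show s: "sc P omega = coeff (smult (Re (P r (%_. 0))) (\<Prod>i<r. [:- (xs ! i), 1:]))"
  unfolding sc_def eq2 by (auto simp: fun_eq_iff coeff_map_poly)
 show "coeff (symbol P omega) k = of_real (sc P omega k)"
  unfolding s eq2 by (simp add: coeff_map_poly)
qed

text \<open>At each direction this is \<open>bez_interlacing_coercive\<close>; coercivity with a given constant persists nearby by the continuity
of the coefficients.\<close>

lemma interlacing_symbols_coercive:
 fixes P P1 :: "'n::finite operator"
 assumes P: "homogeneous_op r P" and P1: "homogeneous_op (r - 1) P1" and r: "r >= 1"
  and il: "ALL omega:sphere 0 1. strictly_interlace (symbol P1 omega) (symbol P omega)"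
 shows "EX delta>0. ALL omega:sphere 0 1. ALL V. delta * sq r V <= bez r (sc P omega) (sc P1 omega) V"
  and "!!omega k. omega : sphere 0 1 ==> coeff (symbol P omega) k = of_real (sc P omega k)"
  and "!!omega k. omega : sphere 0 1 ==> coeff (symbol P1 omega) k = of_real (sc P1 omega k)"
proof -
 have h: "homog_coeffs r P" "homog_coeffs (r - 1) P1" and cr: "Re (P r (%_. 0)) > 0" "Re (P1 (r - 1) (%_. 0)) > 0"
  using P P1 by (auto simp: homogeneous_op_def homog_coeffs_def)
 note fin = finite_opsupp[OF h(1)] finite_opsupp[OF h(2)]
 have ex: "EX xs ys. real_roots (symbol P1 omega) xs & real_roots (symbol P omega) ys &
  length ys = length xs + 1 & (ALL i<length xs. ys ! i < xs ! i & xs ! i < ys ! (i + 1))" if "omega : sphere 0 1" for omega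
  using il that unfolding strictly_interlace_def by blast
 show "EX delta>0. ALL omega:sphere 0 1. ALL V. delta * sq r V <= bez r (sc P omega) (sc P1 omega) V"
 proof (rule bez_uniformly_coercive)
  show "compact (sphere (0::real^'n) 1)" by simp
  show "continuous_on (sphere 0 1) (%omega. sc P omega k)" "continuous_on (sphere 0 1) (%omega. sc P1 omega k)" for k
   by (intro continuous_sc fin)+
  show "sc P omega k = 0" "sc P1 omega k = 0" if "k > r" for omega k
   using that coeff_symbol_high[OF h(1), of k omega] coeff_symbol_high[OF h(2), of k omega] by (auto simp: sc_def)
  fix omega :: "real^'n" assume omega: "omega : sphere 0 1"
  obtain xs ys where xy: "real_roots (symbol P1 omega) xs" "real_roots (symbol P omega) ys"
   and len: "length ys = length xs + 1" and i: "ALL i<length xs. ys ! i < xs ! i & xs ! i < ys ! (i + 1)"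
   using ex[OF omega] by blast
  note rx = real_roots_symbol[OF P1 xy(1)] and ry = real_roots_symbol[OF P xy(2)]
  show "EX delta>0. ALL V. bez r (sc P omega) (sc P1 omega) V >= delta * sq r V"
   unfolding rx(2) ry(2)
   by (rule bez_interlacing_coercive[OF cr refl refl]) (use i rx(1) r in auto)
 qed
 show "coeff (symbol P omega) k = of_real (sc P omega k)" if "omega : sphere 0 1" for omega k
  using ex[OF that] real_roots_symbol(3)[OF P] by blast
 show "coeff (symbol P1 omega) k = of_real (sc P1 omega k)" if "omega : sphere 0 1" for omega k
  using ex[OF that] real_roots_symbol(3)[OF P1] by blast
qed

definition interlacing_operators ::
  "nat => real => 'n::finite operator => 'n operator => 'n operator => bool" where
 "interlacing_operators m theta P P1 P2 \<longleftrightarrow> m >= 3 & homogeneous_op m P & homogeneous_op (m - 1) P1 & P m (%_. 0) = 1 &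
  (ALL omega:sphere 0 1. strictly_interlace (symbol P1 omega) (symbol P omega)) &
  (theta = 0 & P2 = (%_ _. 0) \<or> theta = 1 & homogeneous_op (m - 2) P2 &
   (ALL omega:sphere 0 1. strictly_interlace (symbol P2 omega) (symbol P1 omega)))"

lemma quadratic_roots_negative:
 fixes c1 c2 :: real
 assumes "c1 > 0" "c2 > 0"
 obtains nu1 nu2 :: complex where "Re nu1 < 0" "Re nu2 < 0" "nu1 + nu2 = - of_real c1" "nu1 * nu2 = of_real c2"
proof -
 define s where "s = csqrt (of_real (c1\<^sup>2 - 4 * c2))"
 define nu1 nu2 where "nu1 = (- of_real c1 + s) / 2" "nu2 = (- of_real c1 - s) / 2"
 have s2: "s\<^sup>2 = of_real (c1\<^sup>2 - 4 * c2)" by (simp add: s_def)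
 have sum: "nu1 + nu2 = - of_real c1" by (simp add: nu1_nu2_def field_simps)
 have "nu1 * nu2 = ((of_real c1)^2 - s\<^sup>2) / 4" by (simp add: nu1_nu2_def field_simps power2_eq_square)
 then have prod: "nu1 * nu2 = of_real c2" by (simp add: s2)
 have neg: "Re nu < 0" if e: "nu * (- of_real c1 - nu) = of_real c2" for nu
 proof (rule ccontr)
  assume "\<not> Re nu < 0"
  then have x: "Re nu >= 0" by simp
  have re: "Re nu * (- c1 - Re nu) + Im nu * Im nu = c2" using arg_cong[OF e, of Re] by simp
  have im: "Im nu * (- c1 - 2 * Re nu) = 0" using arg_cong[OF e, of Im] by (simp add: algebra_simps)
  have "Im nu = 0" using im assms x by auto
  then have "Re nu * (- c1 - Re nu) = c2" using re by simp
  moreover have "Re nu * (- c1 - Re nu) <= 0" using x assms by (intro mult_nonneg_nonpos) auto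
  ultimately show False using assms by simp
 qed
 have "nu2 = - of_real c1 - nu1" "nu1 = - of_real c1 - nu2" using sum by (simp_all add: algebra_simps)
 then have "Re nu1 < 0" "Re nu2 < 0" using neg prod by (metis, metis mult.commute)
 then show thesis using sum prod by (rule that)
qed

section \<open>Estimates uniform in the direction of the frequency\<close>

lemma high_frequency_bound':
 fixes m :: nat and M delta rho0 :: real
 assumes m: "m >= 2" and delta: "delta > 0" and M: "M >= 0" and rho0: "rho0 > 0"
 obtains c C where "c > 0" "ALL k. C k >= (0::real)" "ALL p p1 p2 theta rho y k t. coercive_triple m M delta theta p p1 p2 --> p m = 1 -->
  rho >= rho0 --> mode_ode m p p1 p2 rho y --> t >= 0 -->
  cmod (y k t) <= C k * (exp (- c * t) * (\<Sum>j<m. rho ^ k / rho ^ j * cmod (y j 0)))"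
proof -
 obtain c C where c: "c > 0" "ALL k. C k >= (0::real)" and H: "ALL p p1 p2 theta rho y. coercive_triple m M delta theta p p1 p2 & p m = 1 &
  rho >= rho0 & mode_ode m p p1 p2 rho y -->
  (ALL k. ALL t>=0. cmod (y k t) <= C k * (exp (- c * t) * (\<Sum>j<m. rho ^ k / rho ^ j * cmod (y j 0))))"
 proof -
  from high_frequency_bound[OF assms] that show thesis by - (elim exE conjE, assumption | rule that)+
 qed
 show thesis
  by (rule that[OF c], intro allI impI, rule H[THEN spec, THEN spec, THEN spec, THEN spec, THEN spec, THEN spec, THEN mp, THEN spec, THEN spec, THEN mp])
   (intro conjI, assumption+)
qed

text \<open>The unit sphere is compact, so one pair of constants serves all directions of the frequency.\<close>

lemma interlacing_uniform_constants:
 fixes P P1 P2 :: "'n::finite operator"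
 assumes I: "interlacing_operators m theta P P1 P2"
 obtains M delta where "M >= 0" "delta > 0"
  "ALL omega:sphere 0 1. coercive_triple m M delta theta (sc P omega) (sc P1 omega) (sc P2 omega)"
  "ALL omega:sphere 0 1. ALL rho k. fsym (%k alpha. P k alpha + P1 k alpha + P2 k alpha) k (rho *\<^sub>R omega) = mode_coeff m (sc P omega) (sc P1 omega) (sc P2 omega) rho k"
proof -
 from I have m: "m >= 3" and P: "homogeneous_op m P" and P1: "homogeneous_op (m - 1) P1"
  and il1: "ALL omega:sphere 0 1. strictly_interlace (symbol P1 omega) (symbol P omega)"
  and P2: "theta = 0 & P2 = (%_ _. 0) \<or> theta = 1 & homogeneous_op (m - 2) P2 &
   (ALL omega:sphere 0 1. strictly_interlace (symbol P2 omega) (symbol P1 omega))"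
  unfolding interlacing_operators_def by blast+
 have m1: "m >= 1" "m - 1 >= 1" using m by auto
 have mm: "m - 1 - 1 = m - 2" by simp
 have h: "homog_coeffs m P" "homog_coeffs (m-1) P1" "homog_coeffs (m-2) P2"
  using P P1 P2 by (auto simp: homogeneous_op_def homog_coeffs_def)
 note fin = finite_opsupp[OF h(1)] finite_opsupp[OF h(2)] finite_opsupp[OF h(3)]
 have cS: "compact (sphere (0::real^'n) 1)" by simp
 have z: "sc P omega k = 0" if "k > m" for k omega using coeff_symbol_high[OF h(1) that, of omega] by (simp add: sc_def)
 have z1: "sc P1 omega k = 0" if "k >= m" for k omega
  using coeff_symbol_high[OF h(2), of k omega] that m by (simp add: sc_def)
 have z2: "sc P2 omega k = 0" if "k >= m - 1" for k omega
  using coeff_symbol_high[OF h(3), of k omega] that m by (simp add: sc_def)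
 have "EX M>=0. ALL omega:sphere 0 1. ALL k. \<bar>sc P omega k\<bar> <= M"
  by (rule compact_bounded_family[where n = m and a = "sc P", OF cS]) (rule continuous_sc[OF fin(1)], rule z)
 then obtain M0 where M0: "M0 >= 0" "ALL omega:sphere 0 1. ALL k. \<bar>sc P omega k\<bar> <= M0" by blast
 have "EX M>=0. ALL omega:sphere 0 1. ALL k. \<bar>sc P1 omega k\<bar> <= M"
  by (rule compact_bounded_family[where n = m and a = "sc P1", OF cS]) (rule continuous_sc[OF fin(2)], rule z1, simp)
 then obtain M1 where M1: "M1 >= 0" "ALL omega:sphere 0 1. ALL k. \<bar>sc P1 omega k\<bar> <= M1" by blast
 have "EX M>=0. ALL omega:sphere 0 1. ALL k. \<bar>sc P2 omega k\<bar> <= M"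
  by (rule compact_bounded_family[where n = m and a = "sc P2", OF cS]) (rule continuous_sc[OF fin(3)], rule z2, simp)
 then obtain M2 where M2: "M2 >= 0" "ALL omega:sphere 0 1. ALL k. \<bar>sc P2 omega k\<bar> <= M2" by blast
 define M where "M = M0 + M1 + M2"
 obtain delta1 where delta1: "delta1 > 0" "ALL omega:sphere 0 1. ALL V. delta1 * sq m V <= bez m (sc P omega) (sc P1 omega) V"
  using interlacing_symbols_coercive(1)[OF P P1 m1(1) il1] by blast
 obtain delta2 where delta2: "delta2 > 0" "theta = 1 --> (ALL omega:sphere 0 1. ALL V. delta2 * sq (m-1) V <= bez (m-1) (sc P1 omega) (sc P2 omega) V)"
 proof (cases "theta = 1")
  case True
  then have P2': "homogeneous_op (m - 1 - 1) P2" and il2: "ALL omega:sphere 0 1. strictly_interlace (symbol P2 omega) (symbol P1 omega)"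
   using P2 unfolding mm by auto
  from interlacing_symbols_coercive(1)[OF P1 P2' m1(2) il2] obtain d
   where "d > 0" "ALL omega:sphere 0 1. ALL V. d * sq (m-1) V <= bez (m-1) (sc P1 omega) (sc P2 omega) V" by blast
  then show thesis by (intro that[of d] impI)
 next
  case False
  then show thesis using that[of 1] by simp
 qed
 define delta where "delta = min delta1 delta2"
 have delta: "delta > 0" "delta <= delta1" "delta <= delta2" using delta1 delta2 by (auto simp: delta_def)
 have T: "coercive_triple m M delta theta (sc P omega) (sc P1 omega) (sc P2 omega)" if omega: "omega : sphere 0 1" for omega
  unfolding coercive_triple_def
 proof (intro conjI allI impI)
  fix k
  show "\<bar>sc P omega k\<bar> <= M" using M0(2)[rule_format, OF omega, of k] M1(1) M2(1) by (simp add: M_def)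
  show "\<bar>sc P1 omega k\<bar> <= M" using M1(2)[rule_format, OF omega, of k] M0(1) M2(1) by (simp add: M_def)
  show "\<bar>sc P2 omega k\<bar> <= M" using M2(2)[rule_format, OF omega, of k] M0(1) M1(1) by (simp add: M_def)
 next
  fix V
  have "delta * sq m V <= delta1 * sq m V" using delta by (intro mult_right_mono) auto
  then show "delta * sq m V <= bez m (sc P omega) (sc P1 omega) V" using delta1(2)[rule_format, OF omega, of V] by linarith
 next
  show "theta = 0 & (ALL k. sc P2 omega k = 0) \<or> theta = 1 & (ALL V. delta * sq (m - 1) V <= bez (m - 1) (sc P1 omega) (sc P2 omega) V)"
   using P2
  proof
   assume "theta = 0 & P2 = (%_ _. 0)"
   then show ?thesis by (simp add: sc_def symbol_def)
  next
   assume t: "theta = 1 & homogeneous_op (m - 2) P2 & (ALL omega:sphere 0 1. strictly_interlace (symbol P2 omega) (symbol P1 omega))"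
   have "delta * sq (m-1) V <= bez (m-1) (sc P1 omega) (sc P2 omega) V" for V
   proof -
    have "delta * sq (m-1) V <= delta2 * sq (m-1) V" using delta by (intro mult_right_mono) auto
    also have "... <= bez (m-1) (sc P1 omega) (sc P2 omega) V" using delta2(2) t omega by blast
    finally show ?thesis .
   qed
   then show ?thesis using t by blast
  qed
 qed (use z z1 z2 in auto)
 have F: "fsym (%k alpha. P k alpha + P1 k alpha + P2 k alpha) k (rho *\<^sub>R omega) = mode_coeff m (sc P omega) (sc P1 omega) (sc P2 omega) rho k"
  if omega: "omega : sphere 0 1" for omega rho k
 proof -
  have r: "coeff (symbol P omega) k = of_real (sc P omega k)" "coeff (symbol P1 omega) k = of_real (sc P1 omega k)"
   using interlacing_symbols_coercive(2,3)[OF P P1 m1(1) il1 omega] by auto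
  have r2: "coeff (symbol P2 omega) k = of_real (sc P2 omega k)"
   using P2
  proof
   assume "theta = 0 & P2 = (%_ _. 0)"
   then show ?thesis by (simp add: sc_def symbol_def)
  next
   assume t: "theta = 1 & homogeneous_op (m - 2) P2 & (ALL omega:sphere 0 1. strictly_interlace (symbol P2 omega) (symbol P1 omega))"
   then show ?thesis using interlacing_symbols_coercive(3)[OF P1, unfolded mm, OF _ m1(2) _ omega] by blast
  qed
  show ?thesis unfolding fsym_add3[OF fin] fsym_homog[OF h(1)] fsym_homog[OF h(2)] fsym_homog[OF h(3)] r r2
   by (simp add: mode_coeff_def)
 qed
 show thesis by (rule that[of M delta]) (use M0 M1 M2 delta T F in \<open>auto simp: M_def\<close>)
qed

text \<open>The number of roots of size \<open>rho\<close> at low frequencies.\<close>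

definition slow_order :: "nat => real => nat" where
 "slow_order m theta = (if theta = 0 then m - 1 else m - 2)"

theorem frequency_estimates:
 fixes P P1 P2 :: "'n::finite operator"
 assumes I: "interlacing_operators m theta P P1 P2"
 obtains rho0 c C where "0 < rho0" "rho0 <= 1" "c > 0" "ALL k. C k >= (0::real)"
  "ALL xi::real^'n. ALL y k t. 0 < norm xi --> norm xi <= rho0 --> smooth_seq y -->
   (ALL l t. (\<Sum>i\<le>m. fsym (%k alpha. P k alpha + P1 k alpha + P2 k alpha) i xi * y (l + i) t) = 0) --> t >= 0 -->
   cmod (y k t) <= C k * (norm xi ^ k * exp (- c * (norm xi)^2 * t) * (\<Sum>j<m. cmod (y j 0) / norm xi ^ (min j (slow_order m theta - 1)))
     + exp (- c * t) * (\<Sum>j<m. cmod (y j 0)))"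
  "ALL xi::real^'n. ALL y k t. rho0 <= norm xi --> smooth_seq y -->
   (ALL l t. (\<Sum>i\<le>m. fsym (%k alpha. P k alpha + P1 k alpha + P2 k alpha) i xi * y (l + i) t) = 0) --> t >= 0 -->
   cmod (y k t) <= C k * (exp (- c * t) * (\<Sum>j<m. norm xi ^ k / norm xi ^ j * cmod (y j 0)))"
proof -
 from I have m: "m >= 3" and P: "homogeneous_op m P" and P1: "homogeneous_op (m - 1) P1" and Pm: "P m (%_. 0) = 1"
  and P2: "theta = 0 & P2 = (%_ _. 0) \<or> theta = 1 & homogeneous_op (m - 2) P2"
  unfolding interlacing_operators_def by blast+
 have h: "homog_coeffs m P" "homog_coeffs (m-1) P1" "homog_coeffs (m-2) P2"
  using P P1 P2 by (auto simp: homogeneous_op_def homog_coeffs_def)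
 obtain M delta where M: "M >= 0" and delta: "delta > 0"
  and T: "ALL omega:sphere 0 1. coercive_triple m M delta theta (sc P omega) (sc P1 omega) (sc P2 omega)"
  and F: "ALL omega:sphere 0 1. ALL rho k. fsym (%k alpha. P k alpha + P1 k alpha + P2 k alpha) k (rho *\<^sub>R omega) = mode_coeff m (sc P omega) (sc P1 omega) (sc P2 omega) rho k"
  using interlacing_uniform_constants[OF I] .
 define N where "N = slow_order m theta"
 define c1 where "c1 = Re (P1 (m-1) (%_. 0))"
 define c2 where "c2 = Re (P2 (m-2) (%_. 0))"
 have c1: "c1 > 0" using P1 by (simp add: homogeneous_op_def c1_def)
 have N1: "N >= 1" 
 proof -
  have "m - 1 >= 1" "m - 2 >= 1" using m by linarith+
  then show ?thesis by (cases "theta = 0") (simp_all add: N_def slow_order_def)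
 qed
 have m2: "m >= 2" using m by simp
 obtain nus :: "complex list" where len: "m = N + length nus" and nu: "!!nu. nu : set nus ==> Re nu < 0"
  and theta: "theta = 0 & length nus = 1 \<or> theta = 1 & length nus = 2"
  and fac: "(\<Prod>nu\<leftarrow>nus. [:-nu, 1:]) * monom 1 N = monom 1 m + monom (of_real c1) (m-1) + monom (of_real c2) (m-2)"
  using P2
 proof
  assume t: "theta = 0 & P2 = (%_ _. 0)"
  then have N: "N = m - 1" and c20: "c2 = 0" by (auto simp: N_def slow_order_def c2_def)
  have e: "[:of_real c1, 1:] = monom (of_real c1) 0 + monom (1::complex) 1" by (simp add: monom_altdef)
  show thesis
  proof (rule that[of "[- complex_of_real c1]"])
   show "m = N + length [- complex_of_real c1]" using N m by simp
   have mm: "1 + (m - 1) = m" using m by simp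
   have "(\<Prod>nu\<leftarrow>[- complex_of_real c1]. [:-nu, 1:]) * monom 1 N = [:complex_of_real c1, 1:] * monom (1::complex) N"
    by (simp del: mult_pCons_left mult_pCons_right)
   also have "... = monom 1 m + monom (complex_of_real c1) (m-1) + monom (complex_of_real c2) (m-2)"
    unfolding e by (simp add: c20 N distrib_right mult_monom mm del: One_nat_def)
   finally show "(\<Prod>nu\<leftarrow>[- complex_of_real c1]. [:-nu, 1:]) * monom 1 N = monom 1 m + monom (complex_of_real c1) (m-1) + monom (complex_of_real c2) (m-2)" .
  qed (use t c1 in auto)
 next
  assume t: "theta = 1 & homogeneous_op (m - 2) P2"
  then have N: "N = m - 2" and c2: "c2 > 0" by (auto simp: N_def slow_order_def c2_def homogeneous_op_def)
  obtain nu1 nu2 :: complex where n: "Re nu1 < 0" "Re nu2 < 0" "nu1 + nu2 = - of_real c1" "nu1 * nu2 = of_real c2"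
   using quadratic_roots_negative[OF c1 c2] .
  have "[:-nu1, 1:] * [:-nu2, 1:] = [:nu1 * nu2, - (nu1 + nu2), 1:]" by (simp add: algebra_simps)
  also have "... = monom (of_real c2) 0 + monom (of_real c1) 1 + monom 1 2"
   unfolding n(3,4) by (simp add: monom_altdef power2_eq_square)
  finally have e: "[:-nu1, 1:] * [:-nu2, 1:] = monom (of_real c2) 0 + monom (of_real c1) 1 + monom 1 2" .
  have mm: "0 + (m - 2) = m - 2" "1 + (m - 2) = m - 1" "2 + (m - 2) = m" using m by auto
  show thesis
  proof (rule that[of "[nu1, nu2]"])
   show "m = N + length [nu1, nu2]" using N m by simp
   have "(\<Prod>nu\<leftarrow>[nu1, nu2]. [:-nu, 1:]) * monom 1 N = ([:-nu1, 1:] * [:-nu2, 1:]) * monom 1 N"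
    by (simp del: mult_pCons_left mult_pCons_right)
   also have "... = monom 1 m + monom (of_real c1) (m-1) + monom (of_real c2) (m-2)"
    unfolding e N distrib_right mult_monom mm mult_1_right by (simp only: add_ac)
   finally show "(\<Prod>nu\<leftarrow>[nu1, nu2]. [:-nu, 1:]) * monom 1 N = monom 1 m + monom (of_real c1) (m-1) + monom (of_real c2) (m-2)" .
  qed (use t n in auto)
 qed
 obtain rho0 ca Ca where rho0: "0 < rho0" "rho0 <= 1" and ca: "ca > 0" and Ca: "ALL k. Ca k >= (0::real)" and
  low0: "ALL p p1 p2 rho y k t. coercive_triple m M delta theta p p1 p2 --> p m = 1 --> p1 (m-1) = c1 --> p2 (m-2) = c2 -->
   0 < rho --> rho <= rho0 --> mode_ode m p p1 p2 rho y --> t >= 0 -->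
   cmod (y k t) <= Ca k * (rho ^ k * exp (- ca * rho\<^sup>2 * t) * (\<Sum>j<m. cmod (y j 0) / rho ^ (min j (N-1)))
     + exp (- ca * t) * (\<Sum>j<m. cmod (y j 0)))"
  using low_frequency_bound[OF len m2 N1 delta M nu theta fac] .
 note low = low0[THEN spec, THEN spec, THEN spec, THEN spec, THEN spec, THEN spec, THEN spec, THEN mp, THEN mp, THEN mp, THEN mp, THEN mp, THEN mp, THEN mp, THEN mp]
 obtain cb Cb where cb: "cb > 0" and Cb: "ALL k. Cb k >= (0::real)" and high0: "ALL p p1 p2 theta rho y k t. coercive_triple m M delta theta p p1 p2 --> p m = 1 -->
  rho >= rho0 --> mode_ode m p p1 p2 rho y --> t >= 0 -->
  cmod (y k t) <= Cb k * (exp (- cb * t) * (\<Sum>j<m. rho ^ k / rho ^ j * cmod (y j 0)))"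
  using high_frequency_bound'[OF m2 delta M rho0(1)] .
 note high = high0[THEN spec, THEN spec, THEN spec, THEN spec, THEN spec, THEN spec, THEN spec, THEN spec, THEN mp, THEN mp, THEN mp, THEN mp, THEN mp]
 define c where "c = min ca cb"
 have c: "c > 0" "c <= ca" "c <= cb" using ca cb by (auto simp: c_def)
 define C where "C k = Ca k + Cb k" for k
 have Cnn: "Ca k >= 0" "Cb k >= 0" "Ca k <= C k" "Cb k <= C k" "C k >= 0" for k using Ca Cb by (auto simp: C_def)
 have polar: "mode_ode m (sc P omega) (sc P1 omega) (sc P2 omega) (norm xi) y & omega : sphere 0 1"
  if "0 < norm xi" "smooth_seq y" "ALL l t. (\<Sum>i\<le>m. fsym (%k alpha. P k alpha + P1 k alpha + P2 k alpha) i xi * y (l + i) t) = 0"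
   "omega = (1 / norm xi) *\<^sub>R xi" for xi :: "real^'n" and y omega
 proof -
  have omega: "omega : sphere 0 1" using that by simp
  have "xi = norm xi *\<^sub>R omega" using that by simp
  then have "fsym (%k alpha. P k alpha + P1 k alpha + P2 k alpha) k xi = fsym (%k alpha. P k alpha + P1 k alpha + P2 k alpha) k (norm xi *\<^sub>R omega)" for k
   by (rule arg_cong)
  moreover have "fsym (%k alpha. P k alpha + P1 k alpha + P2 k alpha) k (norm xi *\<^sub>R omega) = mode_coeff m (sc P omega) (sc P1 omega) (sc P2 omega) (norm xi) k" for k
   by (rule F[THEN bspec, OF omega, THEN spec, THEN spec])
  ultimately have "fsym (%k alpha. P k alpha + P1 k alpha + P2 k alpha) k xi = mode_coeff m (sc P omega) (sc P1 omega) (sc P2 omega) (norm xi) k" for k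
   by (rule trans)
  then show ?thesis using that omega by (simp add: mode_ode_def)
 qed
 have top: "sc P omega m = 1" "sc P1 omega (m-1) = c1" "sc P2 omega (m-2) = c2" for omega
  using coeff_symbol_top[OF h(1), of omega] coeff_symbol_top[OF h(2), of omega] coeff_symbol_top[OF h(3), of omega] Pm
  by (simp_all add: sc_def c1_def c2_def)
 show thesis
 proof (rule that[OF rho0 c(1), of C]; intro allI impI)
  show "C k >= 0" for k using Cnn by simp
 next
  fix xi :: "real^'n" and y k and t :: real
  assume h: "0 < norm xi" "norm xi <= rho0" "smooth_seq y" "ALL l t. (\<Sum>i\<le>m. fsym (%k alpha. P k alpha + P1 k alpha + P2 k alpha) i xi * y (l + i) t) = 0" "t >= 0"
  define omega where "omega = (1 / norm xi) *\<^sub>R xi"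
  have po: "mode_ode m (sc P omega) (sc P1 omega) (sc P2 omega) (norm xi) y" "omega : sphere 0 1"
   using polar[OF h(1,3,4) omega_def] by auto
  define A where "A = (\<Sum>j<m. cmod (y j 0) / norm xi ^ (min j (N-1)))"
  define B where "B = (\<Sum>j<m. cmod (y j 0))"
  have nn: "A >= 0" "B >= 0" by (auto simp: A_def B_def intro!: sum_nonneg)
  have "cmod (y k t) <= Ca k * (norm xi ^ k * exp (- ca * (norm xi)^2 * t) * A + exp (- ca * t) * B)"
   unfolding A_def B_def by (rule low[OF T[rule_format, OF po(2)] top h(1,2) po(1) h(5)])
  also have "... <= C k * (norm xi ^ k * exp (- c * (norm xi)^2 * t) * A + exp (- c * t) * B)"
  proof (intro mult_mono add_mono Cnn)
   have "c * ((norm xi)^2 * t) <= ca * ((norm xi)^2 * t)" using c h(5) by (intro mult_right_mono) auto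
   then show "exp (- ca * (norm xi)^2 * t) <= exp (- c * (norm xi)^2 * t)" by (simp add: mult.assoc)
   show "exp (- ca * t) <= exp (- c * t)" using mult_right_mono[OF c(2) h(5)] by simp
  qed (use nn in auto)
  finally show "cmod (y k t) <= C k * (norm xi ^ k * exp (- c * (norm xi)^2 * t) * (\<Sum>j<m. cmod (y j 0) / norm xi ^ (min j (slow_order m theta - 1)))
     + exp (- c * t) * (\<Sum>j<m. cmod (y j 0)))" by (simp only: A_def B_def N_def)
 next
  fix xi :: "real^'n" and y k and t :: real
  assume h: "rho0 <= norm xi" "smooth_seq y" "ALL l t. (\<Sum>i\<le>m. fsym (%k alpha. P k alpha + P1 k alpha + P2 k alpha) i xi * y (l + i) t) = 0" "t >= 0"
  have h0: "0 < norm xi" using h(1) rho0 by linarith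
  define omega where "omega = (1 / norm xi) *\<^sub>R xi"
  have po: "mode_ode m (sc P omega) (sc P1 omega) (sc P2 omega) (norm xi) y" "omega : sphere 0 1"
   using polar[OF h0 h(2,3) omega_def] by auto
  define B where "B = (\<Sum>j<m. norm xi ^ k / norm xi ^ j * cmod (y j 0))"
  have nn: "B >= 0" by (auto simp: B_def intro!: sum_nonneg)
  have "cmod (y k t) <= Cb k * (exp (- cb * t) * B)"
   unfolding B_def by (rule high[OF T[rule_format, OF po(2)] top(1) h(1) po(1) h(4)])
  also have "... <= C k * (exp (- c * t) * B)"
  proof (intro mult_mono Cnn)
   show "exp (- cb * t) <= exp (- c * t)" using mult_right_mono[OF c(3) h(4)] by simp
  qed (use nn in auto)
  finally show "cmod (y k t) <= C k * (exp (- c * t) * (\<Sum>j<m. norm xi ^ k / norm xi ^ j * cmod (y j 0)))"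
   by (simp only: B_def)
 qed
qed

section \<open>Square integrable functions\<close>

lemma Lp2_iff: "f : Lp 2 \<longleftrightarrow> f : borel_measurable lborel & integrable lborel (%x. (norm (f x))^2)"
 by (simp add: Lp_def)

lemma Lp2_measurable: "f : Lp 2 ==> f : borel_measurable lborel"
 by (simp add: Lp_def)

lemma Lp2I:
 assumes "f : borel_measurable lborel" "(\<integral>\<^sup>+x. ennreal ((norm (f x))^2) \<partial>lborel) < \<infinity>"
 shows "f : Lp 2"
 unfolding Lp2_iff by (intro conjI assms integrableI_bounded) (use assms in auto)

lemma Lp2_dominated:
 assumes "f : borel_measurable lborel" "g : Lp 2" "!!x. norm (f x) <= norm (g x)"
 shows "f : Lp 2"
 unfolding Lp2_iff
proof (intro conjI assms(1))
 note [measurable] = assms(1)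
 show "integrable lborel (%x. (norm (f x))^2)"
 proof (rule Bochner_Integration.integrable_bound[rotated])
  show "AE x in lborel. norm ((norm (f x))^2) <= norm ((norm (g x))^2)"
   using power_mono[OF assms(3) norm_ge_zero, of _ 2] by simp
  show "integrable lborel (%x. (norm (g x))^2)" using assms(2) by (simp add: Lp2_iff)
 qed simp
qed

lemma Lp_norm2: "Lp_norm 2 f = sqrt (LINT x|lborel. (norm (f x))^2)"
 by (simp add: Lp_norm_def powr_half_sqrt)

lemma Lp_norm_nonneg [simp]: "Lp_norm p f >= 0"
 by (simp add: Lp_norm_def)

lemma nn_integral_Lp2:
 assumes "f : Lp 2"
 shows "(\<integral>\<^sup>+x. ennreal ((norm (f x))^2) \<partial>lborel) = ennreal ((Lp_norm 2 f)^2)"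
 using assms by (simp add: Lp2_iff nn_integral_eq_integral Lp_norm2)

lemma norm_add_sq: "(norm (a + b))^2 <= 2 * (norm a)^2 + 2 * (norm b)^2" for a b :: "'a::real_normed_vector"
proof -
 have "(norm (a + b))^2 <= (norm a + norm b)^2" by (intro power_mono norm_triangle_ineq) auto
 also have "... <= 2 * (norm a)^2 + 2 * (norm b)^2"
  using sum_squares_bound[of "norm a" "norm b"] by (simp add: power2_sum)
 finally show ?thesis .
qed

lemma Lp2_add:
 assumes f: "f : Lp 2" and g: "g : Lp 2"
 shows "(%x. f x + g x) : Lp 2"
 unfolding Lp2_iff
proof
 note [measurable] = Lp2_measurable[OF f] Lp2_measurable[OF g]
 show "(%x. f x + g x) : borel_measurable lborel" by measurable
 show "integrable lborel (%x. (norm (f x + g x))^2)"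
 proof (rule Bochner_Integration.integrable_bound)
  show "integrable lborel (%x. 2 * (norm (f x))^2 + 2 * (norm (g x))^2)"
   using f g by (simp add: Lp2_iff)
  show "AE x in lborel. norm ((norm (f x + g x))^2) <= norm (2 * (norm (f x))^2 + 2 * (norm (g x))^2)"
   using norm_add_sq by (auto simp: abs_of_nonneg)
 qed measurable
qed

lemma Lp2_cmult: "f : Lp 2 ==> (%x. c * f x) : Lp 2"
 by (auto simp: Lp2_iff norm_mult power_mult_distrib)

lemma Lp2_diff: "f : Lp 2 ==> g : Lp 2 ==> (%x. f x - g x) : Lp 2"
 using Lp2_add[of f "%x. (-1) * g x"] Lp2_cmult[of g "-1"] by simp

lemma Lp2_zero: "(%x. 0) : Lp 2"
 by (simp add: Lp2_iff)

lemma Lp2_cong_AE: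
 assumes "f : Lp 2" "g : borel_measurable lborel" "AE x in lborel. f x = g x"
 shows "g : Lp 2" "Lp_norm 2 g = Lp_norm 2 f"
proof -
 note [measurable] = Lp2_measurable[OF assms(1)] assms(2)
 have a: "AE x in lborel. (norm (f x))^2 = (norm (g x))^2" using assms(3) by eventually_elim simp
 show "g : Lp 2" unfolding Lp2_iff using assms
  by (auto simp: Lp2_iff integrable_cong_AE[OF _ _ a, THEN iffD1])
 show "Lp_norm 2 g = Lp_norm 2 f"
  unfolding Lp_norm2 by (subst integral_cong_AE[OF _ _ a]) auto
qed

lemma Cauchy_Schwarz_Lp2:
 assumes f: "f : Lp 2" and g: "g : Lp 2"
 shows "integrable lborel (%x. f x * g x)"
  and "norm (LINT x|lborel. f x * g x) <= Lp_norm 2 f * Lp_norm 2 g"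
proof -
 note [measurable] = Lp2_measurable[OF f] Lp2_measurable[OF g]
 have "(\<integral>\<^sup>+x. ennreal (norm (f x * g x)) \<partial>lborel)^2 = (\<integral>\<^sup>+x. ennreal (norm (f x)) * ennreal (norm (g x)) \<partial>lborel)^2"
  by (simp add: norm_mult ennreal_mult)
 also have "... <= (\<integral>\<^sup>+x. ennreal (norm (f x)) ^ 2 \<partial>lborel) * (\<integral>\<^sup>+x. ennreal (norm (g x)) ^ 2 \<partial>lborel)"
  by (rule Cauchy_Schwarz_nn_integral) auto
 also have "... = ennreal ((Lp_norm 2 f * Lp_norm 2 g)^2)"
  using nn_integral_Lp2[OF f] nn_integral_Lp2[OF g]
  by (simp add: ennreal_power ennreal_mult power_mult_distrib)
 also have "... = (ennreal (Lp_norm 2 f * Lp_norm 2 g))^2" by (simp add: ennreal_power)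
 finally have sqle: "(\<integral>\<^sup>+x. ennreal (norm (f x * g x)) \<partial>lborel)^2 <= (ennreal (Lp_norm 2 f * Lp_norm 2 g))^2" .
 have le: "(\<integral>\<^sup>+x. ennreal (norm (f x * g x)) \<partial>lborel) <= ennreal (Lp_norm 2 f * Lp_norm 2 g)"
 proof (cases "(\<integral>\<^sup>+x. ennreal (norm (f x * g x)) \<partial>lborel)" rule: ennreal_cases)
  case (real r)
  from sqle have "r\<^sup>2 <= (Lp_norm 2 f * Lp_norm 2 g)^2" using real by (simp add: ennreal_power)
  then have "r <= Lp_norm 2 f * Lp_norm 2 g" by (rule power2_le_imp_le) simp
  then show ?thesis using real by (simp add: ennreal_leI)
 next
  case top
  have "(top::ennreal)^2 <= ennreal ((Lp_norm 2 f * Lp_norm 2 g)^2)"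
   using sqle unfolding top by (simp add: ennreal_power)
  then show ?thesis by (simp add: power2_eq_square top_unique)
 qed
 show i: "integrable lborel (%x. f x * g x)"
  by (rule integrableI_bounded) (use le in \<open>auto intro: le_less_trans\<close>)
 have "ennreal (norm (LINT x|lborel. f x * g x)) <= (\<integral>\<^sup>+x. ennreal (norm (f x * g x)) \<partial>lborel)"
  using integral_norm_bound_ennreal[OF i] .
 also note le
 finally show "norm (LINT x|lborel. f x * g x) <= Lp_norm 2 f * Lp_norm 2 g"
  by (simp add: ennreal_le_iff)
qed

lemma cball_sets_borel [measurable]: "cball (x :: 'a::euclidean_space) R : sets borel"
 by (rule borel_closed) simp

section \<open>The Fourier transform\<close>

lemma borel_measurable_cis [measurable]: "f : borel_measurable M ==> (%x. cis (f x)) : borel_measurable M"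
 by (rule measurable_compose[OF _ borel_measurable_continuous_onI]) (auto intro!: continuous_intros simp: cis_conv_exp)

text \<open>The Fourier integral of an integrable function; the transform on \<open>L^2\<close> is its limit along the cut-off functions \<open>cut\<close>.\<close>

definition ft :: "((real^'n) => complex) => (real^'n) => complex" where
 "ft h xi = (LINT x|lborel. cis (- (x \<bullet> xi)) * h x)"

definition cut :: "real => ((real^'n) => complex) => (real^'n) => complex" where
 "cut R f x = indicator (cball 0 R) x * f x"

lemma fourier_ball_ft: "fourier_ball R f = ft (cut R f)"
 unfolding fourier_ball_def ft_def cut_def set_lebesgue_integral_def
 by (auto simp: fun_eq_iff indicator_def intro!: Bochner_Integration.integral_cong)

lemma integrable_cut:
 assumes "f : Lp 2"
 shows "integrable lborel (cut R f)"
proof -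
 note [measurable] = Lp2_measurable[OF assms]
 have fin: "integrable lborel (indicator (cball (0::real^'a) R) :: _ => real)"
  by (intro integrable_real_indicator) (use emeasure_bounded_finite[OF bounded_cball[of "0::real^'a" R]] in auto)
 show ?thesis
 proof (rule Bochner_Integration.integrable_bound)
  show "integrable lborel (%x. indicator (cball 0 R) x + (norm (f x))^2)"
   using assms fin by (intro Bochner_Integration.integrable_add) (auto simp: Lp2_iff)
  have "norm (f x) <= 1 + (norm (f x))^2" for x
  proof -
   have "2 * norm (f x) <= 1 + (norm (f x))^2" using sum_squares_bound[of 1 "norm (f x)"] by simp
   then show ?thesis using norm_ge_zero[of "f x"] by linarith
  qed
  then show "AE x in lborel. norm (cut R f x) <= norm (indicator (cball 0 R) x + (norm (f x))^2)"
   by (auto simp: cut_def indicator_def norm_mult)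
  show "cut R f : borel_measurable lborel" unfolding cut_def[abs_def] by measurable
 qed
qed

lemma ft_integrable:
 assumes "integrable lborel h"
 shows "integrable lborel (%x. cis (- (x \<bullet> xi)) * h x)"
proof -
 have [measurable]: "h : borel_measurable lborel" using assms by auto
 show ?thesis
  by (rule Bochner_Integration.integrable_bound[OF assms]) (auto simp: norm_mult)
qed

lemma norm_ft_le:
 assumes "integrable lborel h"
 shows "norm (ft h xi) <= (LINT x|lborel. norm (h x))"
 unfolding ft_def by (rule order.trans[OF integral_norm_bound]) (simp add: norm_mult)

lemma ft_measurable [measurable]:
 assumes [measurable]: "h : borel_measurable lborel"
 shows "ft h : borel_measurable lborel"
 unfolding ft_def[abs_def] by measurable

lemma ft_lincomb:
 assumes "integrable lborel f" "integrable lborel g"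
 shows "ft (%x. a * f x + b * g x) xi = a * ft f xi + b * ft g xi"
proof -
 have "ft (%x. a * f x + b * g x) xi = (LINT x|lborel. a * (cis (- (x \<bullet> xi)) * f x) + b * (cis (- (x \<bullet> xi)) * g x))"
  unfolding ft_def by (simp add: algebra_simps)
 also have "... = a * ft f xi + b * ft g xi"
  unfolding ft_def using ft_integrable[OF assms(1)] ft_integrable[OF assms(2)] by simp
 finally show ?thesis .
qed

lemma is_fourier_Lp2: "is_fourier f g ==> f : Lp 2" "is_fourier f g ==> g : Lp 2"
 by (auto simp: is_fourier_def)

lemma fourier_ball_measurable [measurable]:
 assumes "f : Lp 2"
 shows "fourier_ball R f : borel_measurable lborel"
proof -
 note [measurable] = Lp2_measurable[OF assms]
 show ?thesis unfolding fourier_ball_ft cut_def[abs_def] by measurable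
qed

lemma is_fourier_unique:
 assumes 1: "is_fourier f g" and 2: "is_fourier f h"
 shows "AE x in lborel. g x = h x"
proof -
 note [measurable] = Lp2_measurable[OF is_fourier_Lp2(2)[OF 1]] Lp2_measurable[OF is_fourier_Lp2(2)[OF 2]] fourier_ball_measurable[OF is_fourier_Lp2(1)[OF 1]]
 let ?I = "%R g. \<integral>\<^sup>+ xi. ennreal ((norm (fourier_ball R f xi - g xi))^2) \<partial>lborel"
 have le: "(\<integral>\<^sup>+xi. ennreal ((norm (g xi - h xi))^2) \<partial>lborel) <= 2 * ?I R g + 2 * ?I R h" for R
 proof -
  have "(\<integral>\<^sup>+xi. ennreal ((norm (g xi - h xi))^2) \<partial>lborel)
   <= (\<integral>\<^sup>+xi. 2 * ennreal ((norm (fourier_ball R f xi - g xi))^2) + 2 * ennreal ((norm (fourier_ball R f xi - h xi))^2) \<partial>lborel)"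
  proof (rule nn_integral_mono)
   fix xi
   have "(norm (g xi - h xi))^2 <= 2 * (norm (fourier_ball R f xi - g xi))^2 + 2 * (norm (fourier_ball R f xi - h xi))^2"
    using norm_add_sq[of "g xi - fourier_ball R f xi" "fourier_ball R f xi - h xi"] by (simp add: norm_minus_commute)
   then have "ennreal ((norm (g xi - h xi))^2) <= ennreal (2 * (norm (fourier_ball R f xi - g xi))^2 + 2 * (norm (fourier_ball R f xi - h xi))^2)"
    by (rule ennreal_leI)
   then show "ennreal ((norm (g xi - h xi))^2) <= 2 * ennreal ((norm (fourier_ball R f xi - g xi))^2) + 2 * ennreal ((norm (fourier_ball R f xi - h xi))^2)"
    by (simp add: ennreal_mult ennreal_plus)
  qed
  also have "... = 2 * ?I R g + 2 * ?I R h"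
   by (simp add: nn_integral_add nn_integral_cmult)
  finally show ?thesis .
 qed
 have "((%R. 2 * ?I R g + 2 * ?I R h) \<longlongrightarrow> 2 * 0 + 2 * 0) at_top"
  by (intro tendsto_add ennreal_tendsto_cmult) (use 1 2 in \<open>auto simp: is_fourier_def\<close>)
 then have "(\<integral>\<^sup>+xi. ennreal ((norm (g xi - h xi))^2) \<partial>lborel) <= 2 * 0 + 2 * 0"
  by (rule tendsto_lowerbound) (intro always_eventually allI le, simp)
 then have "(\<integral>\<^sup>+xi. ennreal ((norm (g xi - h xi))^2) \<partial>lborel) = 0" by simp
 then have "AE xi in lborel. ennreal ((norm (g xi - h xi))^2) = 0" by (subst (asm) nn_integral_0_iff_AE) auto
 then show ?thesis by eventually_elim simp
qed

lemma is_fourier_lincomb: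
 assumes f: "is_fourier f F" and g: "is_fourier g G"
 shows "is_fourier (%x. a * f x + b * g x) (%x. a * F x + b * G x)"
proof -
 note L = is_fourier_Lp2[OF f] is_fourier_Lp2[OF g]
 note [measurable] = L[THEN Lp2_measurable] fourier_ball_measurable[OF L(1)] fourier_ball_measurable[OF L(3)]
 let ?I = "%R f F. \<integral>\<^sup>+ xi. ennreal ((norm (fourier_ball R f xi - F xi))^2) \<partial>lborel"
 let ?h = "%x. a * f x + b * g x" and ?H = "%x. a * F x + b * G x"
 have fb: "fourier_ball R ?h xi = a * fourier_ball R f xi + b * fourier_ball R g xi" for R xi
 proof -
  have "cut R ?h = (%x. a * cut R f x + b * cut R g x)" by (auto simp: cut_def algebra_simps)
  then show ?thesis unfolding fourier_ball_ft by (simp add: ft_lincomb integrable_cut L)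
 qed
 have le: "?I R ?h ?H <= ennreal (2 * (norm a)^2) * ?I R f F + ennreal (2 * (norm b)^2) * ?I R g G" for R
 proof -
  have "?I R ?h ?H <= (\<integral>\<^sup>+xi. ennreal (2 * (norm a)^2) * ennreal ((norm (fourier_ball R f xi - F xi))^2)
    + ennreal (2 * (norm b)^2) * ennreal ((norm (fourier_ball R g xi - G xi))^2) \<partial>lborel)"
  proof (rule nn_integral_mono)
   fix xi
   have "fourier_ball R ?h xi - ?H xi = a * (fourier_ball R f xi - F xi) + b * (fourier_ball R g xi - G xi)"
    unfolding fb by (simp add: algebra_simps)
   then have "(norm (fourier_ball R ?h xi - ?H xi))^2 <= 2 * (norm a)^2 * (norm (fourier_ball R f xi - F xi))^2 + 2 * (norm b)^2 * (norm (fourier_ball R g xi - G xi))^2"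
    using norm_add_sq[of "a * (fourier_ball R f xi - F xi)" "b * (fourier_ball R g xi - G xi)"]
    by (simp add: norm_mult power_mult_distrib)
   from ennreal_leI[OF this]
   show "ennreal ((norm (fourier_ball R ?h xi - ?H xi))^2) <= ennreal (2 * (norm a)^2) * ennreal ((norm (fourier_ball R f xi - F xi))^2)
    + ennreal (2 * (norm b)^2) * ennreal ((norm (fourier_ball R g xi - G xi))^2)"
    by (simp add: ennreal_mult ennreal_plus)
  qed
  also have "... = ennreal (2 * (norm a)^2) * ?I R f F + ennreal (2 * (norm b)^2) * ?I R g G"
   by (simp add: nn_integral_add nn_integral_cmult)
  finally show ?thesis .
 qed
 have t: "((%R. ennreal (2 * (norm a)^2) * ?I R f F + ennreal (2 * (norm b)^2) * ?I R g G) \<longlongrightarrow>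
   ennreal (2 * (norm a)^2) * 0 + ennreal (2 * (norm b)^2) * 0) at_top"
  by (intro tendsto_add ennreal_tendsto_cmult) (use f g in \<open>auto simp: is_fourier_def\<close>)
 have "((%R. ?I R ?h ?H) \<longlongrightarrow> 0) at_top"
  by (rule tendsto_sandwich[OF _ _ tendsto_const t[simplified]]) (use le in auto)
 then show ?thesis unfolding is_fourier_def using L by (auto intro!: Lp2_add Lp2_cmult)
qed

lemma is_fourier_cong:
 assumes "AE x in lborel. f x = g x" "f : borel_measurable lborel" "g : borel_measurable lborel"
 shows "is_fourier f h \<longleftrightarrow> is_fourier g h"
proof -
 have "fourier_ball R f = fourier_ball R g" for R
  unfolding fourier_ball_def set_lebesgue_integral_def
 proof (rule ext, rule integral_cong_AE)
  note [measurable] = assms(2,3)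
  fix xi
  show "(%x. indicat_real (cball 0 R) x *\<^sub>R (cis (- (x \<bullet> xi)) * f x)) : borel_measurable lborel"
   "(%x. indicat_real (cball 0 R) x *\<^sub>R (cis (- (x \<bullet> xi)) * g x)) : borel_measurable lborel" by measurable
  show "AE x in lborel. indicat_real (cball 0 R) x *\<^sub>R (cis (- (x \<bullet> xi)) * f x) = indicat_real (cball 0 R) x *\<^sub>R (cis (- (x \<bullet> xi)) * g x)"
   using assms(1) by eventually_elim simp
 qed
 moreover have "f : Lp 2 \<longleftrightarrow> g : Lp 2"
 proof -
  have "AE x in lborel. g x = f x" using assms(1) by eventually_elim simp
  then show ?thesis using Lp2_cong_AE(1)[of f g] Lp2_cong_AE(1)[of g f] assms by blast
 qed
 ultimately show ?thesis by (simp add: is_fourier_def)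
qed

lemma fourier_cong_AE:
 assumes "AE x in lborel. f x = g x" "f : borel_measurable lborel" "g : borel_measurable lborel"
 shows "fourier f = fourier g"
 unfolding fourier_def by (rule arg_cong[where f = Eps], rule ext, rule is_fourier_cong[OF assms])

lemma is_fourier_fourier: "is_fourier f g ==> is_fourier f (fourier f)"
 unfolding fourier_def by (rule someI[of "is_fourier f"])

section \<open>The multiplication formula\<close>

lemma ft_multiplication:
 assumes f: "integrable lborel f" and h: "integrable lborel h"
 shows "(LINT xi|lborel. ft f xi * h xi) = (LINT x|lborel. f x * ft h x)"
proof -
 have [measurable]: "f : borel_measurable lborel" "h : borel_measurable lborel" using f h by auto
 define F where "F x xi = cis (- (x \<bullet> xi)) * f x * h xi" for x xi
 have int: "integrable (lborel \<Otimes>\<^sub>M lborel) (case_prod F)"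
 proof (rule lborel_pair.Fubini_integrable)
  show "case_prod F : borel_measurable (lborel \<Otimes>\<^sub>M lborel)" unfolding F_def by measurable
  have "(LINT xi|lborel. norm (case_prod F (x, xi))) = norm (f x) * (LINT xi|lborel. norm (h xi))" for x
   by (simp add: F_def norm_mult)
  then show "integrable lborel (%x. LINT xi|lborel. norm (case_prod F (x, xi)))"
   using f by simp
  show "AE x in lborel. integrable lborel (%xi. case_prod F (x, xi))"
  proof (rule AE_I2)
   fix x
   show "integrable lborel (%xi. case_prod F (x, xi))"
    by (rule Bochner_Integration.integrable_bound[of _ "%xi. norm (f x) * norm (h xi)"])
     (use h in \<open>auto simp: F_def norm_mult\<close>)
  qed
 qed
 have "(LINT xi|lborel. ft f xi * h xi) = (LINT xi|lborel. LINT x|lborel. F x xi)"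
  unfolding ft_def F_def by (simp add: mult.assoc flip: integral_mult_left_zero)
 also have "... = (LINT x|lborel. LINT xi|lborel. F x xi)"
  using lborel_pair.Fubini_integral[OF int] .
 also have "... = (LINT x|lborel. f x * ft h x)"
 proof (rule Bochner_Integration.integral_cong[OF refl])
  fix x
  have "(LINT xi|lborel. F x xi) = (LINT xi|lborel. f x * (cis (- (xi \<bullet> x)) * h xi))"
   by (simp add: F_def inner_commute mult_ac)
  then show "(LINT xi|lborel. F x xi) = f x * ft h x" by (simp add: ft_def)
 qed
 finally show ?thesis .
qed

text \<open>The multiplication formula survives the limit defining the Fourier transform on \<open>L^2\<close>. In this form it moves a test
function \<open>ft h\<close> from the space side to the frequency side.\<close>

lemma is_fourier_pairing:
 assumes u: "is_fourier u V" and h: "integrable lborel h" "h : Lp 2" and uh: "integrable lborel (%x. u x * ft h x)"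
 shows "(LINT x|lborel. u x * ft h x) = (LINT xi|lborel. V xi * h xi)"
proof (rule LIMSEQ_unique)
 note L = is_fourier_Lp2[OF u]
 have [measurable]: "h : borel_measurable lborel" using h by auto
 note [measurable] = L[THEN Lp2_measurable] fourier_ball_measurable[OF L(1)]
 let ?R = "%n::nat. real n"
 have lim: "(%n. \<integral>\<^sup>+ xi. ennreal ((norm (fourier_ball (?R n) u xi - V xi))^2) \<partial>lborel) \<longlonglongrightarrow> 0"
  using u unfolding is_fourier_def
  by (auto intro: filterlim_compose[OF _ filterlim_real_sequentially])
 have eq: "(LINT xi|lborel. fourier_ball (?R n) u xi * h xi) = (LINT x|lborel. cut (?R n) u x * ft h x)" for n
  unfolding fourier_ball_ft by (rule ft_multiplication[OF integrable_cut[OF L(1)] h(1)])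
 show "(%n. LINT xi|lborel. fourier_ball (?R n) u xi * h xi) \<longlonglongrightarrow> (LINT x|lborel. u x * ft h x)"
  unfolding eq
 proof (rule integral_dominated_convergence[where w = "%x. norm (u x * ft h x)"])
  show "AE x in lborel. (%n. cut (?R n) u x * ft h x) \<longlonglongrightarrow> u x * ft h x"
  proof (rule AE_I2)
   fix x :: "real^'a"
   obtain N :: nat where "norm x <= real N" using real_arch_simple by blast
   then have "eventually (%n. cut (?R n) u x * ft h x = u x * ft h x) sequentially"
    by (intro eventually_sequentiallyI[of N]) (auto simp: cut_def)
   then show "(%n. cut (?R n) u x * ft h x) \<longlonglongrightarrow> u x * ft h x" by (rule tendsto_eventually)
  qed
  show "AE x in lborel. norm (cut (?R n) u x * ft h x) <= norm (u x * ft h x)" for n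
   by (auto simp: cut_def indicator_def)
 qed (use uh in \<open>auto simp: cut_def[abs_def]\<close>)
 show "(%n. LINT xi|lborel. fourier_ball (?R n) u xi * h xi) \<longlonglongrightarrow> (LINT xi|lborel. V xi * h xi)"
 proof (rule LIM_zero_cancel, rule Lim_null_comparison)
  have ev: "eventually (%n. (\<integral>\<^sup>+ xi. ennreal ((norm (fourier_ball (?R n) u xi - V xi))^2) \<partial>lborel) < 1) sequentially"
   using order_tendstoD(2)[OF lim, of 1] by simp
  then show "eventually (%n. norm ((LINT xi|lborel. fourier_ball (?R n) u xi * h xi) - (LINT xi|lborel. V xi * h xi))
    <= sqrt (enn2real (\<integral>\<^sup>+ xi. ennreal ((norm (fourier_ball (?R n) u xi - V xi))^2) \<partial>lborel)) * Lp_norm 2 h) sequentially"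
  proof eventually_elim
   case (elim n)
   have D: "(%xi. fourier_ball (?R n) u xi - V xi) : Lp 2"
    by (rule Lp2I) (use elim in \<open>auto intro: order.strict_trans\<close>)
   have Vh: "integrable lborel (%xi. V xi * h xi)" by (rule Cauchy_Schwarz_Lp2(1)[OF L(2) h(2)])
   have Dh: "integrable lborel (%xi. (fourier_ball (?R n) u xi - V xi) * h xi)" by (rule Cauchy_Schwarz_Lp2(1)[OF D h(2)])
   have "integrable lborel (%xi. fourier_ball (?R n) u xi * h xi)"
    using Bochner_Integration.integrable_add[OF Dh Vh] by (simp add: algebra_simps)
   then have "(LINT xi|lborel. fourier_ball (?R n) u xi * h xi) - (LINT xi|lborel. V xi * h xi)
    = (LINT xi|lborel. (fourier_ball (?R n) u xi - V xi) * h xi)"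
    using Vh by (simp add: left_diff_distrib)
   moreover have "norm (LINT xi|lborel. (fourier_ball (?R n) u xi - V xi) * h xi) <= Lp_norm 2 (%xi. fourier_ball (?R n) u xi - V xi) * Lp_norm 2 h"
    by (rule Cauchy_Schwarz_Lp2(2)[OF D h(2)])
   moreover have "sqrt (enn2real (\<integral>\<^sup>+ xi. ennreal ((norm (fourier_ball (?R n) u xi - V xi))^2) \<partial>lborel)) = Lp_norm 2 (%xi. fourier_ball (?R n) u xi - V xi)"
    unfolding nn_integral_Lp2[OF D] by simp
   ultimately show ?case by simp
  qed
  have "(%n. sqrt (enn2real (\<integral>\<^sup>+ xi. ennreal ((norm (fourier_ball (?R n) u xi - V xi))^2) \<partial>lborel)) * Lp_norm 2 h)
   \<longlonglongrightarrow> sqrt 0 * Lp_norm 2 h"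
   by (intro tendsto_mult_right tendsto_real_sqrt tendsto_enn2real) (use lim in simp_all)
  then show "(%n. sqrt (enn2real (\<integral>\<^sup>+ xi. ennreal ((norm (fourier_ball (?R n) u xi - V xi))^2) \<partial>lborel)) * Lp_norm 2 h) \<longlonglongrightarrow> 0"
   by simp
 qed
qed

section \<open>Gaussians\<close>

lemma borel_measurable_cnj' [measurable]: "f : borel_measurable M ==> (%x. cnj (f x)) : borel_measurable M"
 by (rule measurable_compose[OF _ borel_measurable_continuous_onI]) (auto intro!: continuous_intros)

lemma gauss1_integrable:
 fixes delta a :: real
 assumes delta: "delta > 0"
 shows "integrable lborel (%x::real. exp (- delta * x\<^sup>2))"
  and "integrable lborel (%x::real. cis (- (a * x)) * of_real (exp (- delta * x\<^sup>2)))"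
proof -
 define \<sigma> where "\<sigma> = 1 / sqrt (2 * delta)"
 have \<sigma>: "\<sigma> > 0" using delta by (simp add: \<sigma>_def)
 have s2: "\<sigma>\<^sup>2 = 1 / (2 * delta)" using delta by (simp add: \<sigma>_def power_divide)
 have e: "exp (- delta * x\<^sup>2) = sqrt (2 * pi * \<sigma>\<^sup>2) * normal_density 0 \<sigma> x" for x
  using delta \<sigma> by (simp add: normal_density_def s2 field_simps)
 show i: "integrable lborel (%x::real. exp (- delta * x\<^sup>2))"
  unfolding e by (intro integrable_mult_right integrable_normal_density \<sigma>)
 show "integrable lborel (%x::real. cis (- (a * x)) * of_real (exp (- delta * x\<^sup>2)))"
  by (rule Bochner_Integration.integrable_bound[OF i]) (auto simp: norm_mult)
qed

lemma gauss1_integral: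
 fixes delta a :: real
 assumes delta: "delta > 0"
 shows "(LINT x|lborel. cis (- (a * x)) * of_real (exp (- delta * x\<^sup>2))) = of_real (sqrt (pi / delta) * exp (- a\<^sup>2 / (4 * delta)))"
proof -
 define s where "s = sqrt (2 * delta)"
 have s: "s > 0" "s\<^sup>2 = 2 * delta" using delta by (auto simp: s_def)
 define tau where "tau = - a / s"
 have "of_real (exp (- (tau\<^sup>2) / 2)) = char std_normal_distribution tau"
  by (simp add: char_std_normal_distribution)
 also have "... = (LINT x|lborel. std_normal_density x *\<^sub>R iexp (tau * x))"
  unfolding char_def by (subst integral_density) auto
 also have "... = \<bar>s\<bar> *\<^sub>R (LINT x|lborel. std_normal_density (0 + s * x) *\<^sub>R iexp (tau * (0 + s * x)))"
  by (rule lborel_integral_real_affine) (use s in auto)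
 also have "... = s *\<^sub>R (LINT x|lborel. of_real (1 / sqrt (2 * pi)) * (cis (- (a * x)) * of_real (exp (- delta * x\<^sup>2))))"
 proof -
  have "std_normal_density (0 + s * x) *\<^sub>R iexp (tau * (0 + s * x))
   = of_real (1 / sqrt (2 * pi)) * (cis (- (a * x)) * of_real (exp (- delta * x\<^sup>2)))" for x
   using s by (simp add: std_normal_density_def power_mult_distrib tau_def cis_conv_exp scaleR_conv_of_real mult_ac)
  then show ?thesis using s by simp
 qed
 also have "... = of_real (s / sqrt (2 * pi)) * (LINT x|lborel. cis (- (a * x)) * of_real (exp (- delta * x\<^sup>2)))"
  by (simp add: scaleR_conv_of_real)
 finally have "(LINT x|lborel. cis (- (a * x)) * of_real (exp (- delta * x\<^sup>2))) = of_real (sqrt (2 * pi) / s) * of_real (exp (- (tau\<^sup>2) / 2))"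
  using s by (simp add: field_simps)
 also have "- (tau\<^sup>2) / 2 = - a\<^sup>2 / (4 * delta)" using s by (simp add: tau_def power_divide)
 also have "sqrt (2 * pi) / s = sqrt (pi / delta)"
  using delta by (simp add: s_def real_sqrt_divide[symmetric])
 finally show ?thesis by (simp only: of_real_mult)
qed

definition gauss :: "real => real^'n => real" where
 "gauss delta xi = exp (- delta * (norm xi)^2)"

definition gauss_mass :: "'n::finite itself => real => real" where
 "gauss_mass _ delta = sqrt (pi / delta) ^ CARD('n)"

lemma gauss_measurable [measurable]: "gauss delta : borel_measurable borel"
 unfolding gauss_def[abs_def] by measurable

lemma gauss_nonneg [simp]: "gauss delta x >= 0" by (simp add: gauss_def)

lemma gauss_pos: "gauss delta x > 0" by (simp add: gauss_def)

lemma gauss_mass_pos: "delta > 0 ==> gauss_mass T delta > 0"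
 by (simp add: gauss_mass_def)

lemma gauss_ft:
 fixes z :: "real^'n::finite"
 assumes delta: "delta > 0"
 shows "integrable lborel (%x::real^'n. complex_of_real (gauss delta x))"
  and "ft (%x. complex_of_real (gauss delta x)) z = of_real (gauss_mass TYPE('n) delta * gauss (1 / (4 * delta)) z)"
proof -
 let ?B = "Basis :: (real^'n) set"
 interpret product_sigma_finite "%_::real^'n. lborel :: real measure" ..
 define g where "g a x = cis (- (a * x)) * complex_of_real (exp (- delta * x\<^sup>2))" for a x
 have gi: "integrable lborel (g a)" for a unfolding g_def by (rule gauss1_integrable(2)[OF delta])
 have nrm: "(norm x)^2 = (\<Sum>b\<in>?B. (x \<bullet> b)^2)" for x :: "real^'n"
  unfolding power2_norm_eq_inner by (subst euclidean_inner) (simp add: power2_eq_square)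
 define T where "T = (%f. \<Sum>b\<in>?B. f b *\<^sub>R b)"
 have Tm: "T : measurable (\<Pi>\<^sub>M b\<in>?B. lborel) borel" unfolding T_def by measurable
 have Tb: "T f \<bullet> b = f b" if "b : ?B" for f b
  using that by (simp add: T_def inner_sum_left inner_Basis if_distrib sum.delta cong: if_cong)
 have prodf: "cis (- (x \<bullet> z)) * complex_of_real (gauss delta x) = (\<Prod>b\<in>?B. g (z \<bullet> b) (x \<bullet> b))" for x z :: "real^'n"
 proof -
  have "cis (- (x \<bullet> z)) = (\<Prod>b\<in>?B. cis (- ((z \<bullet> b) * (x \<bullet> b))))"
   by (simp add: cis_conv_exp euclidean_inner[of x z] exp_sum[symmetric] sum_negf sum_distrib_left mult.commute)
  moreover have "complex_of_real (gauss delta x) = (\<Prod>b\<in>?B. complex_of_real (exp (- delta * (x \<bullet> b)^2)))"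
   unfolding gauss_def nrm of_real_prod[symmetric] by (simp add: exp_sum[symmetric] sum_distrib_left)
  ultimately show ?thesis by (simp add: g_def prod.distrib)
 qed
 have prodT: "(\<Prod>b\<in>?B. g (z \<bullet> b) (T f \<bullet> b)) = (\<Prod>b\<in>?B. g (z \<bullet> b) (f b))" for f z
  by (rule prod.cong) (simp_all add: Tb)
 have m1: "(%x. cis (- (x \<bullet> z)) * complex_of_real (gauss delta x)) : borel_measurable borel" for z :: "real^'n"
  by measurable
 have lb: "lborel = distr (\<Pi>\<^sub>M b\<in>?B. lborel) borel T" unfolding T_def by (rule lborel_eq)
 have int: "integrable lborel (%x::real^'n. cis (- (x \<bullet> z)) * complex_of_real (gauss delta x))" for z
  unfolding lb
  by (subst integrable_distr_eq[OF Tm m1], unfold prodf prodT, rule product_integrable_prod[OF finite_Basis gi])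
 from int[of 0] show "integrable lborel (%x::real^'n. complex_of_real (gauss delta x))" by simp
 have "ft (%x. complex_of_real (gauss delta x)) z = integral\<^sup>L (\<Pi>\<^sub>M b\<in>?B. lborel) (%f. \<Prod>b\<in>?B. g (z \<bullet> b) (f b))"
  unfolding ft_def by (subst lb, subst integral_distr[OF Tm m1], unfold prodf prodT, rule refl)
 also have "... = (\<Prod>b\<in>?B. LINT x|lborel. g (z \<bullet> b) x)"
  by (rule product_integral_prod[OF finite_Basis gi])
 also have "... = (\<Prod>b\<in>?B. of_real (sqrt (pi / delta) * exp (- (z \<bullet> b)\<^sup>2 / (4 * delta))))"
  unfolding g_def by (subst gauss1_integral[OF delta]) simp
 also have "... = of_real (sqrt (pi / delta) ^ CARD('n) * exp (\<Sum>b\<in>?B. - (z \<bullet> b)\<^sup>2 / (4 * delta)))"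
  unfolding of_real_prod[symmetric] prod.distrib exp_sum[OF finite_Basis] by simp
 also have "(\<Sum>b\<in>?B. - (z \<bullet> b)\<^sup>2 / (4 * delta)) = - (1 / (4 * delta)) * (norm z)^2"
  unfolding nrm by (simp add: sum_distrib_left sum_divide_distrib sum_negf)
 finally show "ft (%x. complex_of_real (gauss delta x)) z = of_real (gauss_mass TYPE('n) delta * gauss (1 / (4 * delta)) z)"
  by (simp add: gauss_mass_def gauss_def)
qed

lemma gauss_integral:
 assumes delta: "delta > 0"
 shows "integrable lborel (gauss delta :: real^'n::finite => real)"
  and "(LINT x::real^'n|lborel. gauss delta x) = gauss_mass TYPE('n) delta"
  and "(\<integral>\<^sup>+x. ennreal (gauss delta (x::real^'n)) \<partial>lborel) = ennreal (gauss_mass TYPE('n) delta)"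
proof -
 show i: "integrable lborel (gauss delta :: real^'n => real)"
  using integrable_norm[OF gauss_ft(1)[OF delta, where 'n='n]] by simp
 have "complex_of_real (LINT x::real^'n|lborel. gauss delta x) = ft (%x. complex_of_real (gauss delta x)) (0::real^'n)"
  by (simp add: ft_def)
 also have "... = of_real (gauss_mass TYPE('n) delta)" unfolding gauss_ft(2)[OF delta] by (simp add: gauss_def)
 finally show 2: "(LINT x::real^'n|lborel. gauss delta x) = gauss_mass TYPE('n) delta" by (simp only: of_real_eq_iff)
 show "(\<integral>\<^sup>+x. ennreal (gauss delta (x::real^'n)) \<partial>lborel) = ennreal (gauss_mass TYPE('n) delta)"
  unfolding 2[symmetric] by (rule nn_integral_eq_integral[OF i]) simp
qed

lemma nn_integral_translate:
 fixes f :: "'a::euclidean_space => ennreal"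
 assumes [measurable]: "f : borel_measurable borel"
 shows "(\<integral>\<^sup>+y. f (y - x) \<partial>lborel) = (\<integral>\<^sup>+y. f y \<partial>lborel)"
proof -
 have "(\<integral>\<^sup>+y. f y \<partial>lborel) = (\<integral>\<^sup>+y. f y \<partial>distr lborel borel ((+) (- x)))" by (simp add: lborel_distr_plus)
 also have "... = (\<integral>\<^sup>+y. f (- x + y) \<partial>lborel)" by (rule nn_integral_distr) auto
 finally show ?thesis by simp
qed

section \<open>Gaussian weights and the Fourier transform on Lebesgue spaces\<close>

lemma integrable_cmult_bound:
 fixes f :: "'a => complex" and g :: "'a => 'b::{banach,second_countable_topology}"
 assumes "integrable M g" "f : borel_measurable M" "!!x. norm (f x) <= c * norm (g x)"
 shows "integrable M f"
 by (rule Bochner_Integration.integrable_bound[OF integrable_mult_right[OF integrable_norm[OF assms(1)], of c] assms(2)])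
  (rule AE_I2, rule order.trans[OF assms(3)], simp)

lemma ft_modulated_gauss:
 fixes x y :: "real^'n::finite"
 assumes delta: "delta > 0"
 shows "ft (%xi. of_real (gauss delta xi) * cis (xi \<bullet> x)) y = of_real (gauss_mass TYPE('n) delta * gauss (1 / (4 * delta)) (y - x))"
  and "integrable lborel (%xi. complex_of_real (gauss delta xi) * cis (xi \<bullet> x))"
proof -
 have "cis (- (xi \<bullet> y)) * (of_real (gauss delta xi) * cis (xi \<bullet> x)) = cis (- (xi \<bullet> (y - x))) * of_real (gauss delta xi)" for xi
 proof -
  have "cis (- (xi \<bullet> (y - x))) = cis (- (xi \<bullet> y)) * cis (xi \<bullet> x)"
   unfolding cis_mult by (simp add: inner_diff_right)
  then show ?thesis by (simp only: mult_ac)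
 qed
 then have "ft (%xi. of_real (gauss delta xi) * cis (xi \<bullet> x)) y = ft (%xi. complex_of_real (gauss delta xi)) (y - x)"
  unfolding ft_def by (simp only:)
 then show "ft (%xi. of_real (gauss delta xi) * cis (xi \<bullet> x)) y = of_real (gauss_mass TYPE('n) delta * gauss (1 / (4 * delta)) (y - x))"
  unfolding gauss_ft(2)[OF delta] .
 show "integrable lborel (%xi. complex_of_real (gauss delta xi) * cis (xi \<bullet> x))"
  by (rule Bochner_Integration.integrable_bound[OF gauss_integral(1)[OF delta]]) (auto simp: norm_mult)
qed

text \<open>Expanding the square and integrating first in the frequency leaves a double integral whose kernel is the transform of a
Gaussian, hence again a Gaussian.\<close>

lemma gauss_pairing_identity:
 fixes f :: "real^'n::finite => complex"
 assumes f: "integrable lborel f" and delta: "delta > 0"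
 defines "K \<equiv> %z::real^'n. gauss_mass TYPE('n) delta * gauss (1 / (4 * delta)) z"
 shows "(\<integral>\<^sup>+xi. ennreal (gauss delta xi * (norm (ft f xi))^2) \<partial>lborel)
  <= (\<integral>\<^sup>+x. \<integral>\<^sup>+y. ennreal (norm (f x) * norm (f y) * K (y - x)) \<partial>lborel \<partial>lborel)"
proof -
 have [measurable]: "f : borel_measurable lborel" using f by auto
 have Knn: "K z >= 0" for z using gauss_mass_pos[OF delta, of "TYPE('n)"] by (simp add: K_def)
 define L where "L = (LINT x|lborel. norm (f x))"
 have fL: "norm (ft f xi) <= L" for xi unfolding L_def by (rule norm_ft_le[OF f])
 have L0: "L >= 0" by (simp add: L_def)
 define h where "h xi = of_real (gauss delta xi) * cnj (ft f xi)" for xi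
 have [measurable]: "h : borel_measurable lborel" unfolding h_def[abs_def] by measurable
 have h: "integrable lborel h"
 proof (rule integrable_cmult_bound[OF gauss_integral(1)[OF delta], where c = L])
  fix xi show "norm (h xi) <= L * norm (gauss delta xi)"
   using mult_right_mono[OF fL[of xi], of "gauss delta xi"] by (simp add: h_def norm_mult mult.commute)
 qed simp
 have fth: "ft h x = cnj (LINT y|lborel. f y * of_real (K (y - x)))" for x
 proof -
  let ?e = "%xi. of_real (gauss delta xi) * cis (xi \<bullet> x)"
  have "cis (- (xi \<bullet> x)) * h xi = cnj (ft f xi * ?e xi)" for xi
   unfolding h_def by (simp add: cis_cnj)
  then have "ft h x = (LINT xi|lborel. cnj (ft f xi * ?e xi))" unfolding ft_def[of h] by (simp only:)
  also have "... = cnj (LINT xi|lborel. ft f xi * ?e xi)" by (rule Bochner_Integration.integral_cnj)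
  also have "(LINT xi|lborel. ft f xi * ?e xi) = (LINT y|lborel. f y * of_real (K (y - x)))"
   unfolding ft_multiplication[OF f ft_modulated_gauss(2)[OF delta]] ft_modulated_gauss(1)[OF delta] K_def ..
  finally show ?thesis .
 qed
 have sq: "ft f xi * h xi = of_real (gauss delta xi * (norm (ft f xi))^2)" for xi
  unfolding h_def using complex_norm_square[of "ft f xi"] by (simp add: mult_ac)
 have ib: "integrable lborel (%xi. gauss delta xi * (norm (ft f xi))^2)"
 proof (rule Bochner_Integration.integrable_bound[OF integrable_mult_right[OF gauss_integral(1)[OF delta], of "L\<^sup>2"]])
  show "AE xi in lborel. norm (gauss delta xi * (norm (ft f xi))^2) <= norm (L\<^sup>2 * gauss delta xi)"
  proof (rule AE_I2)
   fix xi
   have "(norm (ft f xi))^2 <= L\<^sup>2" using fL by (intro power_mono) auto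
   then have "gauss delta xi * (norm (ft f xi))^2 <= gauss delta xi * L\<^sup>2" by (rule mult_left_mono) simp
   then show "norm (gauss delta xi * (norm (ft f xi))^2) <= norm (L\<^sup>2 * gauss delta xi)" by (simp add: abs_mult mult.commute)
  qed
 qed measurable
 have "(\<integral>\<^sup>+xi. ennreal (gauss delta xi * (norm (ft f xi))^2) \<partial>lborel) = ennreal (LINT xi|lborel. gauss delta xi * (norm (ft f xi))^2)"
  by (rule nn_integral_eq_integral[OF ib]) simp
 also have "ennreal (LINT xi|lborel. gauss delta xi * (norm (ft f xi))^2) <= ennreal (norm (LINT xi|lborel. ft f xi * h xi))"
  unfolding sq integral_complex_of_real by (intro ennreal_leI) simp
 also have "(LINT xi|lborel. ft f xi * h xi) = (LINT x|lborel. f x * ft h x)"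
  by (rule ft_multiplication[OF f h])
 also have "ennreal (norm ...) <= (\<integral>\<^sup>+x. ennreal (norm (f x * ft h x)) \<partial>lborel)"
 proof (rule integral_norm_bound_ennreal)
  show "integrable lborel (%x. f x * ft h x)"
  proof (rule integrable_cmult_bound[OF f, where c = "LINT x|lborel. norm (h x)"])
   fix x show "norm (f x * ft h x) <= (LINT x|lborel. norm (h x)) * norm (f x)"
    using mult_right_mono[OF norm_ft_le[OF h, of x], of "norm (f x)"] by (simp add: norm_mult mult.commute)
  qed measurable
 qed
 also have "... <= (\<integral>\<^sup>+x. \<integral>\<^sup>+y. ennreal (norm (f x) * norm (f y) * K (y - x)) \<partial>lborel \<partial>lborel)"
 proof (rule nn_integral_mono)
  fix x
  have [measurable]: "K : borel_measurable borel" unfolding K_def by measurable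
  have Kle: "K z <= gauss_mass TYPE('n) delta" for z
   unfolding K_def using gauss_mass_pos[OF delta, of "TYPE('n)"] delta by (simp add: gauss_def mult_left_le)
  have iK: "integrable lborel (%y. f y * of_real (K (y - x)))"
  proof (rule integrable_cmult_bound[OF f, where c = "gauss_mass TYPE('n) delta"])
   fix y show "norm (f y * of_real (K (y - x))) <= gauss_mass TYPE('n) delta * norm (f y)"
    using mult_right_mono[OF Kle[of "y - x"], of "norm (f y)"] Knn[of "y - x"] by (simp add: norm_mult abs_of_nonneg mult.commute)
  qed measurable
  have "ennreal (norm (f x * ft h x)) = ennreal (norm (f x)) * ennreal (norm (LINT y|lborel. f y * of_real (K (y - x))))"
   unfolding fth by (simp add: norm_mult ennreal_mult)
  also have "... <= ennreal (norm (f x)) * (\<integral>\<^sup>+y. ennreal (norm (f y * of_real (K (y - x)))) \<partial>lborel)"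
   by (intro mult_left_mono integral_norm_bound_ennreal iK) auto
  also have "... = (\<integral>\<^sup>+y. ennreal (norm (f x) * norm (f y) * K (y - x)) \<partial>lborel)"
   using Knn by (subst nn_integral_cmult[symmetric]) (auto simp: norm_mult ennreal_mult abs_of_nonneg mult_ac)
  finally show "ennreal (norm (f x * ft h x)) <= (\<integral>\<^sup>+y. ennreal (norm (f x) * norm (f y) * K (y - x)) \<partial>lborel)" .
 qed
 finally show ?thesis .
qed

text \<open>Weighted AM-GM for the factorization of \<open>a * b * k\<close> into powers of \<open>a^q * b^q\<close>, \<open>a^q * k\<close>, \<open>b^q * k\<close> and \<open>k\<close> with total
exponent 1 in \<open>a\<close>, \<open>b\<close> and \<open>k\<close>. The normalization by \<open>A\<close> and \<open>k1\<close> makes the integral of the bracket equal to 1 when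
\<open>a^q\<close> has integral \<open>A\<close> and the kernel has integral \<open>k1\<close>.\<close>

lemma interpolated_product_bound:
 fixes a b k Km k1 A q :: real
 assumes "a >= 0" "b >= 0" "0 < k" "k <= Km" "k1 > 0" "A > 0" "1 <= q" "q <= 2"
 defines "theta \<equiv> 2 / q - 1"
 shows "a * b * k <= Km powr theta * k1 powr (1 - theta) * A powr (2 / q) *
  (theta / A\<^sup>2 * (a powr q * b powr q) + (1 - theta) / (2 * A * k1) * (a powr q * k) + (1 - theta) / (2 * A * k1) * (b powr q * k))"
proof (cases "a = 0 \<or> b = 0")
 case True
 have theta: "0 <= theta" "theta <= 1" using assms by (auto simp: theta_def field_simps)
 show ?thesis using True assms theta by (auto intro!: mult_nonneg_nonneg add_nonneg_nonneg)
next
 case False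
 then have a: "a > 0" and b: "b > 0" using assms by auto
 have theta: "0 <= theta" "theta <= 1" using assms by (auto simp: theta_def field_simps)
 have q: "q > 0" using assms by simp
 define P where "P = a powr q * b powr q"
 have P: "P > 0" using a b by (simp add: P_def)
 define X where "X = P / A\<^sup>2"
 define Y where "Y = P powr (1/2) * k / (A * k1)"
 have X: "X > 0" using P assms by (simp add: X_def)
 have Y: "Y > 0" using P assms by (simp add: Y_def)
 have young: "X powr theta * Y powr (1 - theta) <= theta * X + (1 - theta) * Y"
  by (rule Youngs_inequality_0) (use theta X Y in auto)
 have Yb: "Y <= (a powr q * k + b powr q * k) / (2 * A * k1)"
 proof -
  have "P powr (1/2) = sqrt (a powr q * b powr q)" using P by (simp add: P_def powr_half_sqrt)
  also have "... <= (a powr q + b powr q) / 2" by (rule arith_geo_mean_sqrt) auto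
  finally have "P powr (1/2) * k / (A * k1) <= (a powr q + b powr q) / 2 * k / (A * k1)"
   using assms by (intro divide_right_mono mult_right_mono) auto
  then show ?thesis unfolding Y_def by (simp add: algebra_simps add_divide_distrib)
 qed
 have lnP: "ln P = q * (ln a + ln b)" using a b by (simp add: P_def ln_mult ln_powr algebra_simps)
 have "k powr theta * k1 powr (1 - theta) * A powr (2 / q) * (X powr theta * Y powr (1 - theta)) = a * b * k"
 proof -
  have lhs: "ln (k powr theta * k1 powr (1 - theta) * A powr (2 / q) * (X powr theta * Y powr (1 - theta)))
   = theta * ln k + (1 - theta) * ln k1 + (2 / q) * ln A + theta * ln X + (1 - theta) * ln Y"
   using assms X Y by (simp add: ln_mult ln_powr)
  have lX: "ln X = ln P - 2 * ln A" using P assms by (simp add: X_def ln_div ln_realpow)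
  have lY: "ln Y = ln P / 2 + ln k - ln A - ln k1" using P assms by (simp add: Y_def ln_div ln_mult ln_powr)
  have tq: "2 / q = 1 + theta" by (simp add: theta_def)
  have tq2: "(1 + theta) / 2 * q = 1" using q by (simp add: theta_def)
  have "theta * ln k + (1 - theta) * ln k1 + (2 / q) * ln A + theta * ln X + (1 - theta) * ln Y = ln k + (1 + theta) / 2 * ln P"
   unfolding tq lX lY by (simp add: field_simps)
  also have "(1 + theta) / 2 * ln P = ln a + ln b" unfolding lnP using tq2 by (simp add: mult.assoc[symmetric])
  finally have "ln (k powr theta * k1 powr (1 - theta) * A powr (2 / q) * (X powr theta * Y powr (1 - theta))) = ln (a * b * k)"
   unfolding lhs using a b assms by (simp add: ln_mult)
  then show ?thesis using a b assms X Y by (subst (asm) ln_inj_iff) auto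
 qed
 then have "a * b * k = k powr theta * (k1 powr (1 - theta) * A powr (2 / q) * (X powr theta * Y powr (1 - theta)))" by (simp add: mult_ac)
 also have "... <= Km powr theta * (k1 powr (1 - theta) * A powr (2 / q) * (X powr theta * Y powr (1 - theta)))"
  using assms theta by (intro mult_right_mono powr_mono2) auto
 also have "... = Km powr theta * k1 powr (1 - theta) * A powr (2 / q) * (X powr theta * Y powr (1 - theta))" by simp
 also have "... <= Km powr theta * k1 powr (1 - theta) * A powr (2 / q) * (theta * X + (1 - theta) * ((a powr q * k + b powr q * k) / (2 * A * k1)))"
  using young mult_left_mono[OF Yb, of "1 - theta"] theta by (intro mult_left_mono) auto
 also have "theta * X + (1 - theta) * ((a powr q * k + b powr q * k) / (2 * A * k1))
  = theta / A\<^sup>2 * (a powr q * b powr q) + (1 - theta) / (2 * A * k1) * (a powr q * k) + (1 - theta) / (2 * A * k1) * (b powr q * k)"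
  by (simp add: X_def P_def algebra_simps add_divide_distrib)
 finally show ?thesis .
qed

text \<open>Twice the decay exponent that is gained from the integrability of the data.\<close>

definition hy_exponent :: "'n::finite itself => real => real" where
 "hy_exponent _ q = real CARD('n) * (1/q - 1/2)"

lemma gauss_mass_dual:
 assumes "delta > 0"
 shows "gauss_mass TYPE('n::finite) delta * gauss_mass TYPE('n) (1 / (4 * delta)) = (2 * pi) ^ CARD('n)"
proof -
 have "sqrt (pi / delta) * sqrt (pi / (1 / (4 * delta))) = sqrt ((2 * pi)^2)"
  unfolding real_sqrt_mult[symmetric] using assms by (simp add: power2_eq_square)
 also have "... = 2 * pi" by (simp only: real_sqrt_abs) simp
 finally show ?thesis unfolding gauss_mass_def power_mult_distrib[symmetric] by (simp only:)
qed

text \<open>Bounds the double integral by interpolating between the supremum and the integral of the Gaussian kernel.\<close>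

lemma gauss_Lq_ft:
 fixes f :: "real^'n::finite => complex"
 assumes f: "integrable lborel f" and delta: "delta > 0" and A: "A > 0" "(\<integral>\<^sup>+x. ennreal (norm (f x) powr q) \<partial>lborel) <= ennreal A"
  and q: "1 <= q" "q <= 2"
 shows "(\<integral>\<^sup>+xi. ennreal (gauss delta xi * (norm (ft f xi))^2) \<partial>lborel)
  <= ennreal (gauss_mass TYPE('n) delta powr (2/q - 1) * ((2 * pi) ^ CARD('n)) powr (1 - (2/q - 1)) * A powr (2 / q))"
proof -
 have [measurable]: "f : borel_measurable lborel" using f by auto
 define theta where "theta = 2/q - 1"
 have theta: "0 <= theta" "theta <= 1" using q by (auto simp: theta_def field_simps)
 define Km where "Km = gauss_mass TYPE('n) delta"
 have Km: "Km > 0" using gauss_mass_pos[OF delta] by (simp add: Km_def)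
 define K where "K z = Km * gauss (1 / (4 * delta)) z" for z :: "real^'n"
 have Kb: "0 < K z" "K z <= Km" for z
  using Km delta gauss_pos[of "1 / (4 * delta)" z] by (auto simp: K_def gauss_def mult_left_le)
 have [measurable]: "K : borel_measurable borel" unfolding K_def by measurable
 define k1 where "k1 = (2 * pi) ^ CARD('n)"
 have k1: "k1 > 0" by (simp add: k1_def)
 have d4: "1 / (4 * delta) > 0" using delta by simp
 have K1: "(\<integral>\<^sup>+z. ennreal (K z) \<partial>lborel) = ennreal k1"
 proof -
  have "(\<integral>\<^sup>+z. ennreal (K z) \<partial>lborel) = ennreal Km * (\<integral>\<^sup>+z. ennreal (gauss (1 / (4 * delta)) (z :: real^'n)) \<partial>lborel)"
   unfolding K_def using Km by (subst nn_integral_cmult[symmetric]) (auto simp: ennreal_mult)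
  also have "... = ennreal k1"
   unfolding gauss_integral(3)[OF d4] k1_def gauss_mass_dual[OF delta, symmetric] Km_def
   by (rule ennreal_mult[symmetric]) (use gauss_mass_pos[OF delta] gauss_mass_pos[OF d4] in \<open>auto intro: less_imp_le\<close>)
  finally show ?thesis .
 qed
 define D where "D = Km powr theta * k1 powr (1 - theta) * A powr (2 / q)"
 have D: "D >= 0" by (simp add: D_def)
 define c1 c2 where "c1 = theta / A\<^sup>2" and "c2 = (1 - theta) / (2 * A * k1)"
 have c: "c1 >= 0" "c2 >= 0" using theta A k1 by (auto simp: c1_def c2_def)
 define phi where "phi x = ennreal (norm (f x) powr q)" for x
 define kappa where "kappa z = ennreal (K z)" for z
 have [measurable]: "phi : borel_measurable borel" "kappa : borel_measurable borel"
  unfolding phi_def kappa_def by measurable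
 define I where "I = (\<integral>\<^sup>+x. phi x \<partial>lborel)"
 have I: "I <= ennreal A" using A by (simp add: I_def phi_def)
 have pt: "ennreal (norm (f x) * norm (f y) * K (y - x))
  <= ennreal (D * c1) * (phi x * phi y) + ennreal (D * c2) * (phi x * kappa (y - x)) + ennreal (D * c2) * (phi y * kappa (y - x))" for x y
 proof -
  have "norm (f x) * norm (f y) * K (y - x) <= D * (c1 * (norm (f x) powr q * norm (f y) powr q)
   + c2 * (norm (f x) powr q * K (y - x)) + c2 * (norm (f y) powr q * K (y - x)))"
   unfolding D_def c1_def c2_def theta_def
   by (rule interpolated_product_bound) (use Kb A k1 q in auto)
  also have "... = (D * c1) * (norm (f x) powr q * norm (f y) powr q)
   + (D * c2) * (norm (f x) powr q * K (y - x)) + (D * c2) * (norm (f y) powr q * K (y - x))"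
   by (simp add: algebra_simps)
  finally have "ennreal (norm (f x) * norm (f y) * K (y - x)) <= ennreal ((D * c1) * (norm (f x) powr q * norm (f y) powr q)
   + (D * c2) * (norm (f x) powr q * K (y - x)) + (D * c2) * (norm (f y) powr q * K (y - x)))"
   by (rule ennreal_leI)
  also have "... = ennreal (D * c1) * (phi x * phi y) + ennreal (D * c2) * (phi x * kappa (y - x)) + ennreal (D * c2) * (phi y * kappa (y - x))"
  proof -
   have n: "D * c1 >= 0" "D * c2 >= 0" "K (y - x) >= 0" using D c Kb(1)[of "y - x"] by auto
   show ?thesis unfolding phi_def kappa_def using n by (simp add: ennreal_plus ennreal_mult)
  qed
  finally show ?thesis .
 qed
 have i1: "(\<integral>\<^sup>+y. kappa (y - x) \<partial>lborel) = ennreal k1" for x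
  using nn_integral_translate[of kappa x] K1 by (simp add: kappa_def)
 have i2: "(\<integral>\<^sup>+x. kappa (y - x) \<partial>lborel) = ennreal k1" for y
 proof -
  have "kappa (y - x) = kappa (x - y)" for x by (simp add: kappa_def K_def gauss_def norm_minus_commute)
  then show ?thesis using i1[of y] by simp
 qed
 have "(\<integral>\<^sup>+xi. ennreal (gauss delta xi * (norm (ft f xi))^2) \<partial>lborel)
  <= (\<integral>\<^sup>+x. \<integral>\<^sup>+y. ennreal (norm (f x) * norm (f y) * K (y - x)) \<partial>lborel \<partial>lborel)"
  using gauss_pairing_identity[OF f delta] unfolding K_def Km_def .
 also have "... <= (\<integral>\<^sup>+x. \<integral>\<^sup>+y. ennreal (D * c1) * (phi x * phi y) + ennreal (D * c2) * (phi x * kappa (y - x)) + ennreal (D * c2) * (phi y * kappa (y - x)) \<partial>lborel \<partial>lborel)"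
  by (intro nn_integral_mono pt)
 also have "... = (\<integral>\<^sup>+x. ennreal (D * c1) * (phi x * I) + ennreal (D * c2) * (phi x * ennreal k1) + ennreal (D * c2) * (\<integral>\<^sup>+y. phi y * kappa (y - x) \<partial>lborel) \<partial>lborel)"
  by (intro nn_integral_cong) (simp add: nn_integral_add nn_integral_cmult i1 I_def)
 also have "... = ennreal (D * c1) * (I * I) + ennreal (D * c2) * (I * ennreal k1) + ennreal (D * c2) * (\<integral>\<^sup>+x. \<integral>\<^sup>+y. phi y * kappa (y - x) \<partial>lborel \<partial>lborel)"
  by (simp add: nn_integral_add nn_integral_cmult nn_integral_multc I_def)
 also have "(\<integral>\<^sup>+x. \<integral>\<^sup>+y. phi y * kappa (y - x) \<partial>lborel \<partial>lborel) = (\<integral>\<^sup>+y. \<integral>\<^sup>+x. phi y * kappa (y - x) \<partial>lborel \<partial>lborel)"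
  by (rule lborel_pair.Fubini') measurable
 also have "... = I * ennreal k1"
  by (simp add: nn_integral_cmult nn_integral_multc i2 I_def)
 also have "ennreal (D * c1) * (I * I) + ennreal (D * c2) * (I * ennreal k1) + ennreal (D * c2) * (I * ennreal k1)
  <= ennreal (D * c1) * (ennreal A * ennreal A) + ennreal (D * c2) * (ennreal A * ennreal k1) + ennreal (D * c2) * (ennreal A * ennreal k1)"
  by (intro add_mono mult_left_mono mult_mono I) auto
 also have "... = ennreal (D * c1 * (A * A) + D * c2 * (A * k1) + D * c2 * (A * k1))"
 proof -
  have n: "D * c1 >= 0" "D * c2 >= 0" "A >= 0" "k1 >= 0" using D c A k1 by auto
  show ?thesis
   by (simp only: ennreal_plus[OF add_nonneg_nonneg] ennreal_plus ennreal_mult mult_nonneg_nonneg add_nonneg_nonneg n)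
 qed
 also have "D * c1 * (A * A) + D * c2 * (A * k1) + D * c2 * (A * k1) = D"
  using A k1 by (simp add: c1_def c2_def field_simps power2_eq_square)
 finally show ?thesis by (simp add: D_def Km_def k1_def theta_def)
qed

lemma is_fourier_zero_AE:
 fixes u V :: "real^'n::finite => complex"
 assumes u: "is_fourier u V" and z: "AE x in lborel. u x = 0"
 shows "AE x in lborel. V x = 0"
proof -
 have "is_fourier (%_. 0) V"
  using is_fourier_cong[of u "%_. 0" V] u z Lp2_measurable[OF is_fourier_Lp2(1)[OF u]] by simp
 moreover have "is_fourier (%_. 0) (%_. 0)"
  by (simp add: is_fourier_def Lp2_zero fourier_ball_def)
 ultimately show ?thesis by (rule is_fourier_unique)
qed

definition hy_constant :: "'n::finite itself => real => real" where
 "hy_constant _ q = 2 * (pi powr (real CARD('n) * (1/q - 1/2)) * ((2 * pi) ^ CARD('n)) powr (1 - (2/q - 1)))"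

text \<open>On an integrable cut-off the preceding lemma applies with a constant that does not depend on the cut-off. The factor 2 in
the constant absorbs the passage to the limit.\<close>

theorem is_fourier_gauss_bound:
 fixes u V :: "real^'n::finite => complex"
 assumes u: "is_fourier u V" "u : Lp q" and delta: "delta > 0" and q: "1 <= q" "q <= 2"
 shows "(\<integral>\<^sup>+xi. ennreal (gauss delta xi * (norm (V xi))^2) \<partial>lborel)
  <= ennreal (hy_constant TYPE('n) q * delta powr (- hy_exponent TYPE('n) q) * (Lp_norm q u)^2)"
proof -
 note L = is_fourier_Lp2[OF u(1)]
 note [measurable] = L[THEN Lp2_measurable] fourier_ball_measurable[OF L(1)]
 define A where "A = (LINT x|lborel. norm (u x) powr q)"
 have iq: "integrable lborel (%x. norm (u x) powr q)" using u(2) by (simp add: Lp_def)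
 have A0: "A >= 0" by (simp add: A_def)
 show ?thesis
 (* The interpolation divides by A, so a vanishing norm is treated apart. *)
 proof (cases "A = 0")
  case True
  then have "AE x in lborel. norm (u x) powr q = 0"
   using integral_nonneg_eq_0_iff_AE[OF iq] by (simp add: A_def)
  then have "AE x in lborel. u x = 0" by eventually_elim simp
  then have "AE x in lborel. V x = 0" by (rule is_fourier_zero_AE[OF u(1)])
  then have "AE xi in lborel. ennreal (gauss delta xi * (norm (V xi))^2) = 0" by eventually_elim simp
  then have "(\<integral>\<^sup>+xi. ennreal (gauss delta xi * (norm (V xi))^2) \<partial>lborel) = 0"
   by (subst nn_integral_0_iff_AE) auto
  then show ?thesis by simp
 next
  case False
  then have A: "A > 0" using A0 by simp
  have An: "(\<integral>\<^sup>+x. ennreal (norm (u x) powr q) \<partial>lborel) = ennreal A"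
   unfolding A_def by (rule nn_integral_eq_integral[OF iq]) simp
  define D where "D = gauss_mass TYPE('n) delta powr (2/q - 1) * ((2 * pi) ^ CARD('n)) powr (1 - (2/q - 1)) * A powr (2 / q)"
  have D: "D >= 0" by (simp add: D_def)
  let ?I = "%R. \<integral>\<^sup>+ xi. ennreal ((norm (fourier_ball R u xi - V xi))^2) \<partial>lborel"
  have cutb: "(\<integral>\<^sup>+xi. ennreal (gauss delta xi * (norm (fourier_ball R u xi))^2) \<partial>lborel) <= ennreal D" for R
   unfolding fourier_ball_ft D_def
  proof (rule gauss_Lq_ft[OF integrable_cut[OF L(1)] delta A _ q])
   have "(\<integral>\<^sup>+x. ennreal (norm (cut R u x) powr q) \<partial>lborel) <= (\<integral>\<^sup>+x. ennreal (norm (u x) powr q) \<partial>lborel)"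
    by (intro nn_integral_mono ennreal_leI powr_mono2) (use q in \<open>auto simp: cut_def indicator_def\<close>)
   then show "(\<integral>\<^sup>+x. ennreal (norm (cut R u x) powr q) \<partial>lborel) <= ennreal A" unfolding An .
  qed
  have le: "(\<integral>\<^sup>+xi. ennreal (gauss delta xi * (norm (V xi))^2) \<partial>lborel) <= 2 * ennreal D + 2 * ?I R" for R
  proof -
   have "(\<integral>\<^sup>+xi. ennreal (gauss delta xi * (norm (V xi))^2) \<partial>lborel)
    <= (\<integral>\<^sup>+xi. 2 * ennreal (gauss delta xi * (norm (fourier_ball R u xi))^2) + 2 * ennreal ((norm (fourier_ball R u xi - V xi))^2) \<partial>lborel)"
   proof (rule nn_integral_mono)
    fix xi :: "real^'n"
    have g1: "gauss delta xi <= 1" using delta by (simp add: gauss_def)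
    have "(norm (V xi))^2 <= 2 * (norm (fourier_ball R u xi))^2 + 2 * (norm (fourier_ball R u xi - V xi))^2"
     using norm_add_sq[of "fourier_ball R u xi" "V xi - fourier_ball R u xi"] by (simp add: norm_minus_commute)
    then have "gauss delta xi * (norm (V xi))^2 <= gauss delta xi * (2 * (norm (fourier_ball R u xi))^2 + 2 * (norm (fourier_ball R u xi - V xi))^2)"
     by (rule mult_left_mono) simp
    also have "... <= 2 * (gauss delta xi * (norm (fourier_ball R u xi))^2) + 2 * (norm (fourier_ball R u xi - V xi))^2"
     using mult_right_mono[OF g1, of "2 * (norm (fourier_ball R u xi - V xi))^2"] by (simp add: algebra_simps)
    finally have "ennreal (gauss delta xi * (norm (V xi))^2) <= ennreal (2 * (gauss delta xi * (norm (fourier_ball R u xi))^2) + 2 * (norm (fourier_ball R u xi - V xi))^2)"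
     by (rule ennreal_leI)
    then show "ennreal (gauss delta xi * (norm (V xi))^2) <= 2 * ennreal (gauss delta xi * (norm (fourier_ball R u xi))^2) + 2 * ennreal ((norm (fourier_ball R u xi - V xi))^2)"
     by (simp add: ennreal_plus ennreal_mult)
   qed
   also have "... = 2 * (\<integral>\<^sup>+xi. ennreal (gauss delta xi * (norm (fourier_ball R u xi))^2) \<partial>lborel) + 2 * ?I R"
    by (simp add: nn_integral_add nn_integral_cmult)
   also have "... <= 2 * ennreal D + 2 * ?I R" by (intro add_right_mono mult_left_mono cutb) auto
   finally show ?thesis .
  qed
  have "((%R. 2 * ennreal D + 2 * ?I R) \<longlongrightarrow> 2 * ennreal D + 2 * 0) at_top"
   by (intro tendsto_add tendsto_const ennreal_tendsto_cmult) (use u(1) in \<open>auto simp: is_fourier_def\<close>)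
  then have "(\<integral>\<^sup>+xi. ennreal (gauss delta xi * (norm (V xi))^2) \<partial>lborel) <= 2 * ennreal D + 2 * 0"
   by (rule tendsto_lowerbound) (intro always_eventually allI le, simp)
  also have "... = ennreal (2 * D)" using D by (simp add: ennreal_mult)
  also have "2 * D = hy_constant TYPE('n) q * delta powr (- hy_exponent TYPE('n) q) * (Lp_norm q u)^2"
  proof -
   have g: "gauss_mass TYPE('n) delta powr (2/q - 1) = pi powr (real CARD('n) * (1/q - 1/2)) * delta powr (- hy_exponent TYPE('n) q)"
   proof -
    have "gauss_mass TYPE('n) delta = (pi / delta) powr (1/2 * real CARD('n))"
    proof -
     have "(pi / delta) powr (1/2 * real CARD('n)) = ((pi / delta) powr (1/2)) powr real CARD('n)"
      by (simp only: powr_powr)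
     also have "... = ((pi / delta) powr (1/2)) ^ CARD('n)" by (rule powr_realpow) (use delta in simp)
     finally show ?thesis using delta by (simp add: gauss_mass_def powr_half_sqrt)
    qed
    then have "gauss_mass TYPE('n) delta powr (2/q - 1) = (pi / delta) powr (1/2 * real CARD('n) * (2/q - 1))"
     by (simp only: powr_powr)
    also have "1/2 * real CARD('n) * (2/q - 1) = hy_exponent TYPE('n) q"
     using q by (simp add: hy_exponent_def field_simps)
    finally show ?thesis using delta by (simp add: powr_divide powr_minus_divide hy_exponent_def)
   qed
   have "(Lp_norm q u)^2 = A powr (2 / q)"
    unfolding Lp_norm_def A_def[symmetric] power2_eq_square powr_add[symmetric] by simp
   then show ?thesis unfolding D_def g hy_constant_def by (simp add: mult_ac)
  qed
  finally show ?thesis .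
 qed
qed

lemma powr_exp_bounded: 
 fixes a :: real
 obtains C where "C >= 0" "ALL x>0. x powr a * exp (- 2 * x) <= C * exp (- x) \<or> a < 0"
proof -
 define n where "n = nat \<lceil>a\<rceil>"
 have "x powr a * exp (- 2 * x) <= (1 + fact n) * exp (- x)" if a: "a >= 0" and x: "x > 0" for x
 proof -
  have "x powr a <= (1 + fact n) * exp x"
  proof (cases "x <= 1")
   case True
   have "x powr a <= 1" using True x a by (simp add: powr_le1)
   also have "1 <= (1 + fact n :: real) * 1" by simp
   also have "... <= (1 + fact n) * exp x" using x by (intro mult_left_mono) auto
   finally show ?thesis .
  next
   case False
   have an: "a <= real n" using a by (simp add: n_def)
   have "x powr a <= x powr real n" using False an by (intro powr_mono) auto
   also have "... = x ^ n" using x by (simp add: powr_realpow)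
   also have "... = fact n * (x ^ n / fact n)" by simp
   also have "... <= fact n * exp x"
   proof (intro mult_left_mono)
    have "x ^ n /\<^sub>R fact n <= (\<Sum>k. x ^ k /\<^sub>R fact k)"
     using sum_le_suminf[OF summable_exp_generic[of x], of "{n}"] x by simp
    then show "x ^ n / fact n <= exp x" by (simp add: exp_def divide_inverse mult.commute)
   qed simp
   also have "... <= (1 + fact n) * exp x" by (intro mult_right_mono) auto
   finally show ?thesis .
  qed
  then have "x powr a * exp (- 2 * x) <= (1 + fact n) * exp x * exp (- 2 * x)" by (rule mult_right_mono) simp
  also have "... = (1 + fact n) * exp (- x)" by (simp add: mult.assoc exp_add[symmetric])
  finally show ?thesis .
 qed
 then show thesis by (intro that[of "1 + fact n"]) (auto simp: not_less)
qed

text \<open>A singular power is dominated by exponentials of dyadic rates: the term with \<open>2^i * x\<close> between 1 and 2 suffices. The weights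
are summable against \<open>(2^i)^(-gamma)\<close> if \<open>gamma + a > 0\<close>. Powers with \<open>a \<ge> 0\<close> need a single exponential.\<close>

lemma dyadic_weights:
 fixes a gamma :: real
 assumes "a >= 0 \<or> gamma + a > 0"
 obtains w :: "nat => real" where "ALL i. w i >= 0" "summable (%i. w i * (2 ^ i) powr (- gamma))"
  "ALL x>0. EX i. x powr a * exp (- 2 * x) <= w i * exp (- (2 ^ i) * x)"
proof (cases "a >= 0")
 case True
 obtain C where C: "C >= 0" "ALL x>0. x powr a * exp (- 2 * x) <= C * exp (- x) \<or> a < 0" using powr_exp_bounded[of a] .
 show thesis
 proof (rule that[of "%i. if i = 0 then C else 0"])
  have "(%i. (if i = 0 then C else 0) * (2 ^ i) powr (- gamma)) = (%i::nat. if i = 0 then C else 0)" by auto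
  then show "summable (%i. (if i = 0 then C else 0) * (2 ^ i) powr (- gamma))"
   using summable_single[of 0 "%_. C"] by (simp only:)
  show "ALL x>0. EX i. x powr a * exp (- 2 * x) <= (if i = 0 then C else 0) * exp (- (2 ^ i) * x)"
   using C True by (intro allI impI exI[of _ 0]) auto
 qed (use C in auto)
next
 case False
 define b where "b = - a"
 have b: "b > 0" "b < gamma" using False assms by (auto simp: b_def)
 show thesis
 proof (rule that[of "%i. exp 2 * (2 ^ i) powr b"])
  have "(%i. exp 2 * (2 ^ i) powr b * (2 ^ i) powr (- gamma)) = (%i. exp 2 * (2 powr (b - gamma)) ^ i)"
  proof
   fix i :: nat
   have "(2 ^ i) powr b * (2 ^ i) powr (- gamma) = (2 ^ i) powr (b - gamma)" by (simp add: powr_add[symmetric])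
   also have "... = (2 powr (b - gamma)) ^ i"
    by (simp add: powr_realpow[symmetric] powr_powr mult.commute)
   finally show "exp 2 * (2 ^ i) powr b * (2 ^ i) powr (- gamma) = exp 2 * (2 powr (b - gamma)) ^ i" by (simp add: mult.assoc)
  qed
  moreover have "norm (2 powr (b - gamma) :: real) < 1" using b powr_less_mono[of "b - gamma" 0 2] by simp
  ultimately show "summable (%i. exp 2 * (2 ^ i) powr b * (2 ^ i) powr (- gamma))"
   by (simp add: summable_mult summable_geometric)
  show "ALL x>0. EX i. x powr a * exp (- 2 * x) <= exp 2 * (2 ^ i) powr b * exp (- (2 ^ i) * x)"
  proof (intro allI impI)
   fix x :: real assume x: "x > 0"
   obtain j where "1 / x < 2 ^ j" using real_arch_pow[of 2 "1 / x"] by auto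
   then have "1 <= 2 ^ j * x" using x by (simp add: field_simps)
   define i where "i = (LEAST i. 1 <= 2 ^ i * x)"
   have i: "1 <= 2 ^ i * x" unfolding i_def by (rule LeastI) (rule \<open>1 <= 2 ^ j * x\<close>)
   have p: "x powr a <= (2 ^ i) powr b"
   proof -
    have "x powr a = (2 ^ i * x) powr a * (2 ^ i) powr b"
     using x by (simp add: powr_mult b_def powr_minus)
    also have "... <= 1 * (2 ^ i) powr b"
     using i x False powr_mono[of a 0 "2 ^ i * x"] by (intro mult_right_mono) auto
    finally show ?thesis by simp
   qed
   have e: "exp (- 2 * x) <= exp 2 * exp (- (2 ^ i) * x)"
   proof (cases "i = 0")
    case True
    have "- 2 * x <= 2 + - (2 ^ i) * x" using True x by simp
    then show ?thesis by (simp add: exp_add[symmetric])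
   next
    case False
    then obtain i' where i': "i = Suc i'" by (cases i) auto
    have "\<not> 1 <= 2 ^ i' * x" by (rule not_less_Least) (simp add: i_def[symmetric] i')
    then have "2 ^ i * x < 2" by (simp add: i')
    then have "- 2 * x <= 2 + - (2 ^ i) * x" using x by simp
    then show ?thesis by (simp add: exp_add[symmetric])
   qed
   have "x powr a * exp (- 2 * x) <= (2 ^ i) powr b * (exp 2 * exp (- (2 ^ i) * x))"
    by (intro mult_mono p e) auto
   then show "EX i. x powr a * exp (- 2 * x) <= exp 2 * (2 ^ i) powr b * exp (- (2 ^ i) * x)"
    by (intro exI[of _ i]) (simp add: mult_ac)
  qed
 qed auto
qed

text \<open>Each dyadic Gaussian contributes a power of its width, and the weights make the sum converge.\<close>

theorem low_frequency_integral:
 fixes a c q :: real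
 assumes q: "1 <= q" "q <= 2" and c: "c > 0" and a: "a >= 0 \<or> hy_exponent TYPE('n::finite) q + a > 0"
 shows "EX C>=0. ALL u V t. is_fourier u V --> u : Lp q --> t >= 0 -->
  (\<integral>\<^sup>+xi. indicator {xi. 0 < norm xi & norm xi <= 1} (xi::real^'n) * ennreal (norm xi powr (2 * a) * exp (- 2 * c * (norm xi)^2 * t) * (norm (V xi))^2) \<partial>lborel)
   <= ennreal (C * (1 + t) powr (- (hy_exponent TYPE('n) q + a)) * (Lp_norm q u)^2)"
proof -
 define gamma where "gamma = hy_exponent TYPE('n) q"
 define C0 where "C0 = hy_constant TYPE('n) q"
 have C0: "C0 >= 0" by (simp add: C0_def hy_constant_def)
 obtain w :: "nat => real" where w: "ALL i. w i >= 0" and sw: "summable (%i. w i * (2 ^ i) powr (- gamma))"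
  and wx: "ALL x>0. EX i. x powr a * exp (- 2 * x) <= w i * exp (- (2 ^ i) * x)"
  using dyadic_weights[OF a[folded gamma_def]] .
 define S where "S = (\<Sum>i. w i * (2 ^ i) powr (- gamma))"
 define C where "C = exp (2 * c) * c powr (- (gamma + a)) * C0 * S"
 have wnn: "w i * (2 ^ i) powr (- gamma) >= 0" for i using w by simp
 have S: "S >= 0" unfolding S_def by (rule suminf_nonneg[OF sw wnn])
 have C: "C >= 0" using C0 S by (simp add: C_def)
 show ?thesis
 proof (rule exI[of _ C], rule conjI[OF C], intro allI impI)
  fix u V :: "real^'n => complex" and t :: real
  assume u: "is_fourier u V" "u : Lp q" and t: "t >= 0"
  have [measurable]: "V : borel_measurable lborel" by (rule Lp2_measurable[OF is_fourier_Lp2(2)[OF u(1)]])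
  (* For norm xi <= 1, replacing t by 1 + t costs only the factor exp (2 * c) and avoids a singularity at t = 0. *)
  define r where "r = c * (1 + t)"
  have r: "r > 0" using c t by (simp add: r_def)
  define B where "B = exp (2 * c) * r powr (- a)"
  have B: "B >= 0" by (simp add: B_def)
  have pt: "indicator {xi. 0 < norm xi & norm xi <= 1} xi * ennreal (norm xi powr (2 * a) * exp (- 2 * c * (norm xi)^2 * t) * (norm (V xi))^2)
   <= (\<Sum>i. ennreal (B * w i) * ennreal (gauss (2 ^ i * r) xi * (norm (V xi))^2))" for xi
  proof (cases "0 < norm xi & norm xi <= 1")
   case True
   define x where "x = r * (norm xi)^2"
   have x: "x > 0" using r True by (simp add: x_def)
   obtain i where i: "x powr a * exp (- 2 * x) <= w i * exp (- (2 ^ i) * x)" using wx x by blast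
   have "norm xi powr (2 * a) = x powr a * r powr (- a)"
   proof -
    have "norm xi powr (2 * a) = ((norm xi)^2) powr a"
     using True by (simp add: powr_powr[symmetric])
    moreover have "x powr a = r powr a * ((norm xi)^2) powr a" unfolding x_def using r by (simp add: powr_mult)
    moreover have "r powr a * r powr (- a) = 1" using r by (simp add: powr_add[symmetric])
    ultimately show ?thesis by (simp add: mult_ac)
   qed
   moreover have "exp (- 2 * c * (norm xi)^2 * t) <= exp (2 * c) * exp (- 2 * x)"
   proof -
    have "(norm xi)^2 <= 1" using True by (simp add: power_le_one)
    then have "c * (norm xi)^2 <= c" using c mult_left_mono[of "(norm xi)^2" 1 c] by simp
    then have "- 2 * c * (norm xi)^2 * t <= 2 * c + - 2 * x" by (simp add: x_def r_def algebra_simps)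
    then show ?thesis by (simp add: exp_add[symmetric])
   qed
   ultimately have "norm xi powr (2 * a) * exp (- 2 * c * (norm xi)^2 * t) <= x powr a * r powr (- a) * (exp (2 * c) * exp (- 2 * x))"
    by (simp add: mult_left_mono)
   also have "... = B * (x powr a * exp (- 2 * x))" by (simp add: B_def)
   also have "... <= B * (w i * exp (- (2 ^ i) * x))" by (intro mult_left_mono i B)
   also have "... = B * w i * gauss (2 ^ i * r) xi" by (simp add: gauss_def x_def mult_ac)
   finally have "norm xi powr (2 * a) * exp (- 2 * c * (norm xi)^2 * t) * (norm (V xi))^2 <= B * w i * gauss (2 ^ i * r) xi * (norm (V xi))^2"
    by (rule mult_right_mono) simp
   then have "ennreal (norm xi powr (2 * a) * exp (- 2 * c * (norm xi)^2 * t) * (norm (V xi))^2) <= ennreal (B * w i * (gauss (2 ^ i * r) xi * (norm (V xi))^2))"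
    by (intro ennreal_leI) (simp add: mult.assoc)
   also have "... = ennreal (B * w i) * ennreal (gauss (2 ^ i * r) xi * (norm (V xi))^2)"
    using B w by (simp add: ennreal_mult)
   also have "... <= (\<Sum>i. ennreal (B * w i) * ennreal (gauss (2 ^ i * r) xi * (norm (V xi))^2))"
    using sum_le_suminf[of "%i. ennreal (B * w i) * ennreal (gauss (2 ^ i * r) xi * (norm (V xi))^2)" "{i}"] by simp
   finally show ?thesis using True by simp
  qed simp
  have "(\<integral>\<^sup>+xi. indicator {xi. 0 < norm xi & norm xi <= 1} xi * ennreal (norm xi powr (2 * a) * exp (- 2 * c * (norm xi)^2 * t) * (norm (V xi))^2) \<partial>lborel)
   <= (\<integral>\<^sup>+xi. (\<Sum>i. ennreal (B * w i) * ennreal (gauss (2 ^ i * r) xi * (norm (V xi))^2)) \<partial>lborel)"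
   by (intro nn_integral_mono pt)
  also have "... = (\<Sum>i. ennreal (B * w i) * (\<integral>\<^sup>+xi. ennreal (gauss (2 ^ i * r) xi * (norm (V xi))^2) \<partial>lborel))"
   by (subst nn_integral_suminf) (auto simp: nn_integral_cmult)
  also have "... <= (\<Sum>i. ennreal (B * r powr (- gamma) * C0 * (Lp_norm q u)^2 * (w i * (2 ^ i) powr (- gamma))))"
  proof (rule suminf_le)
   fix i
   have "ennreal (B * w i) * (\<integral>\<^sup>+xi. ennreal (gauss (2 ^ i * r) xi * (norm (V xi))^2) \<partial>lborel)
    <= ennreal (B * w i) * ennreal (C0 * (2 ^ i * r) powr (- gamma) * (Lp_norm q u)^2)"
    unfolding C0_def gamma_def by (intro mult_left_mono is_fourier_gauss_bound u q) (use r in auto)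
   also have "... = ennreal (B * w i * (C0 * (2 ^ i * r) powr (- gamma) * (Lp_norm q u)^2))"
    using B w C0 by (simp add: ennreal_mult)
   also have "B * w i * (C0 * (2 ^ i * r) powr (- gamma) * (Lp_norm q u)^2) = B * r powr (- gamma) * C0 * (Lp_norm q u)^2 * (w i * (2 ^ i) powr (- gamma))"
    using r by (simp add: powr_mult mult_ac)
   finally show "ennreal (B * w i) * (\<integral>\<^sup>+xi. ennreal (gauss (2 ^ i * r) xi * (norm (V xi))^2) \<partial>lborel)
    <= ennreal (B * r powr (- gamma) * C0 * (Lp_norm q u)^2 * (w i * (2 ^ i) powr (- gamma)))" .
  qed auto
  also have "... = ennreal (\<Sum>i. B * r powr (- gamma) * C0 * (Lp_norm q u)^2 * (w i * (2 ^ i) powr (- gamma)))"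
   by (rule suminf_ennreal2) (use B C0 w in \<open>auto intro!: summable_mult sw\<close>)
  also have "(\<Sum>i. B * r powr (- gamma) * C0 * (Lp_norm q u)^2 * (w i * (2 ^ i) powr (- gamma))) = B * r powr (- gamma) * C0 * (Lp_norm q u)^2 * S"
   unfolding S_def by (rule suminf_mult[OF sw])
  also have "... = C * (1 + t) powr (- (gamma + a)) * (Lp_norm q u)^2"
  proof -
   have "B * r powr (- gamma) = exp (2 * c) * r powr (- (gamma + a))"
    by (simp add: B_def powr_add[symmetric] mult.assoc add.commute)
   also have "r powr (- (gamma + a)) = c powr (- (gamma + a)) * (1 + t) powr (- (gamma + a))"
    unfolding r_def using c t by (simp add: powr_mult)
   finally show ?thesis by (simp add: C_def mult_ac)
  qed
  finally show "(\<integral>\<^sup>+xi. indicator {xi. 0 < norm xi & norm xi <= 1} xi * ennreal (norm xi powr (2 * a) * exp (- 2 * c * (norm xi)^2 * t) * (norm (V xi))^2) \<partial>lborel)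
   <= ennreal (C * (1 + t) powr (- (hy_exponent TYPE('n) q + a)) * (Lp_norm q u)^2)" unfolding gamma_def .
 qed
qed

section \<open>Injectivity of the Fourier transform\<close>

lemma integral_dilation:
 fixes f :: "'a::euclidean_space => 'b::{banach,second_countable_topology}"
 assumes [measurable]: "f : borel_measurable borel" and c: "c > 0"
 shows "(LINT x|lborel. f x) = c ^ DIM('a) *\<^sub>R (LINT z|lborel. f (t + c *\<^sub>R z))"
proof -
 have "(LINT x|lborel. f x) = integral\<^sup>L (density (distr lborel borel (%x. t + c *\<^sub>R x)) (%_. ennreal (c ^ DIM('a)))) f"
  using lborel_affine[of c t] c by (simp add: ennreal_power)
 also have "... = integral\<^sup>L (distr lborel borel (%x. t + c *\<^sub>R x)) (%x. c ^ DIM('a) *\<^sub>R f x)"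
  using c by (intro integral_density) auto
 also have "... = (LINT z|lborel. c ^ DIM('a) *\<^sub>R f (t + c *\<^sub>R z))"
  by (rule integral_distr) auto
 finally show ?thesis by simp
qed

text \<open>Testing with modulated Gaussians shows that all convolutions of \<open>g\<close> with Gaussians vanish. Letting their width shrink,
\<open>g\<close> is orthogonal to all bounded continuous functions, then to all bounded measurable ones.\<close>

lemma ft_injective:
 fixes g :: "real^'n::finite => complex"
 assumes g: "integrable lborel g" and z: "!!y. (LINT xi|lborel. g xi * cis (xi \<bullet> y)) = 0"
 shows "AE xi in lborel. g xi = 0"
proof -
 have [measurable]: "g : borel_measurable borel" using borel_measurable_integrable[OF g] by simp
 have ftg: "ft g y = 0" for y using z[of "- y"] by (simp add: ft_def mult.commute)
 have gz: "(LINT xi|lborel. g xi * of_real (gauss delta (xi - eta))) = 0" if delta: "delta > 0" for delta eta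
 proof -
  define d where "d = 1 / (4 * delta)"
  have d: "d > 0" "1 / (4 * d) = delta" using delta by (auto simp: d_def)
  have "0 = (LINT xi|lborel. ft g xi * (of_real (gauss d xi) * cis (xi \<bullet> eta)))" by (simp add: ftg)
  also have "... = (LINT xi|lborel. g xi * of_real (gauss_mass TYPE('n) d * gauss delta (xi - eta)))"
   unfolding ft_multiplication[OF g ft_modulated_gauss(2)[OF d(1)]] ft_modulated_gauss(1)[OF d(1)] d(2) ..
  also have "... = (LINT xi|lborel. of_real (gauss_mass TYPE('n) d) * (g xi * of_real (gauss delta (xi - eta))))"
   by (simp add: mult_ac)
  also have "... = of_real (gauss_mass TYPE('n) d) * (LINT xi|lborel. g xi * of_real (gauss delta (xi - eta)))" by simp
  finally show ?thesis using gauss_mass_pos[OF d(1), of "TYPE('n)"] by simp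
 qed
 define M where "M = gauss_mass TYPE('n) 1"
 have M: "M > 0" by (simp add: M_def gauss_mass_pos)
 have cont: "(LINT xi|lborel. g xi * f xi) = 0" if fc: "continuous_on UNIV f" and f1: "!!x. norm (f x) <= 1" for f :: "real^'n => complex"
 proof -
  have fm [measurable]: "f : borel_measurable borel" using fc by (rule borel_measurable_continuous_onI)
  (* A mollification of f, rescaled to a fixed Gaussian so that dominated convergence applies. *)
  define F where "F N xi = (LINT z|lborel. of_real (gauss 1 z) * f (xi + (1 / real (Suc N)) *\<^sub>R z))" for N xi
  have FN: "(LINT xi|lborel. g xi * F N xi) = 0" for N
  proof -
   define r where "r = real (Suc N)"
   have r: "r > 0" by (simp add: r_def)
   define G where "G xi eta = g xi * (of_real (gauss (r\<^sup>2) (eta - xi)) * f eta)" for xi eta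
   have FG: "g xi * F N xi = of_real (r ^ CARD('n)) * (LINT eta|lborel. G xi eta)" for xi
   proof -
    have "(LINT eta|lborel. of_real (gauss (r\<^sup>2) (eta - xi)) * f eta) = (1 / r) ^ DIM(real^'n) *\<^sub>R (LINT z|lborel. of_real (gauss (r\<^sup>2) ((xi + (1 / r) *\<^sub>R z) - xi)) * f (xi + (1 / r) *\<^sub>R z))"
     by (rule integral_dilation) (use r in auto)
    moreover have "gauss (r\<^sup>2) ((xi + (1 / r) *\<^sub>R z) - xi) = gauss 1 z" for z :: "real^'n"
     using r by (simp add: gauss_def power_divide)
    ultimately have "(LINT eta|lborel. of_real (gauss (r\<^sup>2) (eta - xi)) * f eta) = of_real ((1 / r) ^ CARD('n)) * F N xi"
     by (simp add: F_def r_def scaleR_conv_of_real)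
    then have "of_real (r ^ CARD('n)) * (LINT eta|lborel. of_real (gauss (r\<^sup>2) (eta - xi)) * f eta) = of_real (r ^ CARD('n) * (1 / r) ^ CARD('n)) * F N xi"
     by simp
    also have "r ^ CARD('n) * (1 / r) ^ CARD('n) = 1" by (subst power_mult_distrib[symmetric]) (use r in simp)
    finally have e: "F N xi = of_real (r ^ CARD('n)) * (LINT eta|lborel. of_real (gauss (r\<^sup>2) (eta - xi)) * f eta)" by simp
    show ?thesis unfolding G_def integral_mult_right_zero e by (simp only: mult_ac)
   qed
   have int: "integrable (lborel \<Otimes>\<^sub>M lborel) (case_prod G)"
   proof (rule lborel_pair.Fubini_integrable)
    show "case_prod G : borel_measurable (lborel \<Otimes>\<^sub>M lborel)" unfolding G_def by measurable
    have r2: "r\<^sup>2 > 0" using r by simp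
    have tr: "integrable lborel (%eta. gauss (r\<^sup>2) (eta - xi))" and trI: "(LINT eta|lborel. gauss (r\<^sup>2) (eta - xi)) = gauss_mass TYPE('n) (r\<^sup>2)" for xi :: "real^'n"
    proof -
     have nn: "(\<integral>\<^sup>+eta. ennreal (gauss (r\<^sup>2) (eta - xi)) \<partial>lborel) = ennreal (gauss_mass TYPE('n) (r\<^sup>2))"
      using nn_integral_translate[of "%x. ennreal (gauss (r\<^sup>2) x)" xi] gauss_integral(3)[OF r2, where 'n='n] by simp
     show "integrable lborel (%eta. gauss (r\<^sup>2) (eta - xi))" by (rule integrableI_bounded) (use nn in auto)
     show "(LINT eta|lborel. gauss (r\<^sup>2) (eta - xi)) = gauss_mass TYPE('n) (r\<^sup>2)"
      using nn gauss_mass_pos[OF r2, of "TYPE('n)"] by (subst integral_eq_nn_integral) auto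
    qed
    have Gi: "integrable lborel (%eta. G xi eta)" for xi
    proof (rule integrable_cmult_bound[OF tr, where c = "norm (g xi)"])
     fix eta show "norm (G xi eta) <= norm (g xi) * norm (gauss (r\<^sup>2) (eta - xi))"
      using mult_left_le[OF f1[of eta], of "gauss (r\<^sup>2) (eta - xi)"] by (simp add: G_def norm_mult mult_left_mono)
    qed (simp add: G_def)
    then show "AE xi in lborel. integrable lborel (%eta. case_prod G (xi, eta))" by simp
    have [measurable]: "(%(xi, eta). G xi eta) : borel_measurable (lborel \<Otimes>\<^sub>M lborel)" unfolding G_def by measurable
    have "integrable lborel (%xi. LINT eta|lborel. norm (G xi eta))"
    proof (rule Bochner_Integration.integrable_bound[OF integrable_mult_right[OF integrable_norm[OF g], of "gauss_mass TYPE('n) (r\<^sup>2)"]])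
     show "AE xi in lborel. norm (LINT eta|lborel. norm (G xi eta)) <= norm (gauss_mass TYPE('n) (r\<^sup>2) * norm (g xi))"
     proof (rule AE_I2)
      fix xi
      have "(LINT eta|lborel. norm (G xi eta)) <= (LINT eta|lborel. norm (g xi) * gauss (r\<^sup>2) (eta - xi))"
      proof (rule integral_mono[OF integrable_norm[OF Gi] integrable_mult_right[OF tr]])
       fix eta show "norm (G xi eta) <= norm (g xi) * gauss (r\<^sup>2) (eta - xi)"
        using mult_left_le[OF f1[of eta], of "gauss (r\<^sup>2) (eta - xi)"] by (simp add: G_def norm_mult mult_left_mono)
      qed
      also have "... = gauss_mass TYPE('n) (r\<^sup>2) * norm (g xi)" by (simp add: trI)
      finally have "(LINT eta|lborel. norm (G xi eta)) <= gauss_mass TYPE('n) (r\<^sup>2) * norm (g xi)" .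
      moreover have "0 <= (LINT eta|lborel. norm (G xi eta))" by simp
      ultimately show "norm (LINT eta|lborel. norm (G xi eta)) <= norm (gauss_mass TYPE('n) (r\<^sup>2) * norm (g xi))" unfolding real_norm_def by linarith
     qed
    qed measurable
    then show "integrable lborel (%xi. LINT eta|lborel. norm (case_prod G (xi, eta)))" by simp
   qed
   have "(LINT xi|lborel. g xi * F N xi) = of_real (r ^ CARD('n)) * (LINT xi|lborel. LINT eta|lborel. G xi eta)"
    unfolding FG by simp
   also have "(LINT xi|lborel. LINT eta|lborel. G xi eta) = (LINT eta|lborel. LINT xi|lborel. G xi eta)"
    using lborel_pair.Fubini_integral[OF int] by simp
   finally have sw: "(LINT xi|lborel. g xi * F N xi) = of_real (r ^ CARD('n)) * (LINT eta|lborel. LINT xi|lborel. G xi eta)" .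
   have "(LINT xi|lborel. G xi eta) = 0" for eta
   proof -
    have "G xi eta = g xi * of_real (gauss (r\<^sup>2) (xi - eta)) * f eta" for xi
     by (simp add: G_def gauss_def norm_minus_commute mult_ac)
    then show ?thesis using gz[of "r\<^sup>2" eta] r by simp
   qed
   then show ?thesis unfolding sw by simp
  qed
  have g1: "integrable lborel (%z::real^'n. gauss 1 z)" using gauss_integral(1)[of 1, where 'n='n] by simp
  have gM: "(LINT z|lborel. complex_of_real (gauss 1 (z::real^'n))) = of_real M"
   using gauss_integral(2)[of 1, where 'n='n] by (simp add: M_def)
  have Flim: "(%N. F N xi) \<longlonglongrightarrow> of_real M * f xi" for xi
  proof -
   have "(%N. F N xi) \<longlonglongrightarrow> (LINT z|lborel. of_real (gauss 1 (z::real^'n)) * f xi)"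
    unfolding F_def
   proof (rule integral_dominated_convergence[OF _ _ g1])
    show "AE z in lborel. (%N. complex_of_real (gauss 1 z) * f (xi + (1 / real (Suc N)) *\<^sub>R z)) \<longlonglongrightarrow> of_real (gauss 1 z) * f xi"
    proof (intro AE_I2 tendsto_mult tendsto_const)
     fix z :: "real^'n"
     have "(%N. 1 / real (Suc N)) \<longlonglongrightarrow> 0" by (rule LIMSEQ_Suc[OF lim_1_over_n])
     then have "(%N. xi + (1 / real (Suc N)) *\<^sub>R z) \<longlonglongrightarrow> xi + 0 *\<^sub>R z" by (intro tendsto_intros)
     then show "(%N. f (xi + (1 / real (Suc N)) *\<^sub>R z)) \<longlonglongrightarrow> f xi"
      using fc by (intro isCont_tendsto_compose[of xi f]) (auto simp: continuous_on_eq_continuous_at)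
    qed
    show "AE z in lborel. norm (complex_of_real (gauss 1 z) * f (xi + (1 / real (Suc N)) *\<^sub>R z)) <= gauss 1 z" for N
     using f1 by (intro AE_I2) (simp add: norm_mult mult_left_le)
   qed measurable
   also have "(LINT z|lborel. of_real (gauss 1 (z::real^'n)) * f xi) = of_real M * f xi" using gM by simp
   finally show ?thesis .
  qed
  have Fb: "norm (F N xi) <= M" for N xi
  proof -
   have "norm (F N xi) <= (LINT z|lborel. norm (complex_of_real (gauss 1 z) * f (xi + (1 / real (Suc N)) *\<^sub>R z)))"
    unfolding F_def by (rule integral_norm_bound)
   also have "... <= (LINT z::real^'n|lborel. gauss 1 z)"
    by (rule Bochner_Integration.integral_mono'[OF g1]) (use f1 in \<open>auto simp: norm_mult mult_left_le\<close>)
   also have "... = M" using gauss_integral(2)[of 1, where 'n='n] by (simp add: M_def)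
   finally show ?thesis .
  qed
  have [measurable]: "F N : borel_measurable borel" for N
   unfolding F_def[abs_def] by measurable
  have "(%N. LINT xi|lborel. g xi * F N xi) \<longlonglongrightarrow> (LINT xi|lborel. g xi * (of_real M * f xi))"
  proof (rule integral_dominated_convergence[OF _ _ integrable_mult_left[OF integrable_norm[OF g], of M]])
   show "AE xi in lborel. (%N. g xi * F N xi) \<longlonglongrightarrow> g xi * (of_real M * f xi)"
    by (intro AE_I2 tendsto_mult tendsto_const Flim)
   show "AE xi in lborel. norm (g xi * F N xi) <= norm (g xi) * M" for N
    by (intro AE_I2) (simp add: norm_mult Fb mult_left_mono)
  qed measurable
  then have "(LINT xi|lborel. g xi * (of_real M * f xi)) = 0" unfolding FN by (simp add: LIMSEQ_const_iff)
  moreover have "(LINT xi|lborel. g xi * (of_real M * f xi)) = of_real M * (LINT xi|lborel. g xi * f xi)"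
   by (subst integral_mult_right_zero[symmetric]) (simp add: mult_ac)
  ultimately show ?thesis using M by simp
 qed
 (* A bounded substitute for cnj g: the integral of g * f vanishes only if g = 0. *)
 define f where "f xi = cnj (g xi) / (1 + norm (g xi))" for xi
 have [measurable]: "f : borel_measurable borel" unfolding f_def[abs_def] by measurable
 have f1: "norm (f xi) <= 1" for xi
 proof -
  have "norm (1 + complex_of_real (norm (g xi))) = 1 + norm (g xi)"
   using norm_of_real[of "1 + norm (g xi)", where 'a=complex] by simp
  moreover have "1 + norm (g xi) > 0" using norm_ge_zero[of "g xi"] by linarith
  ultimately show ?thesis by (simp add: f_def norm_divide)
 qed
 have "f measurable_on UNIV"
  by (rule lebesgue_measurable_imp_measurable_on) (auto intro: measurable_completion)
 then obtain Z and h :: "nat => real^'n => complex" where Z: "negligible Z" and hc: "!!n. continuous_on UNIV (h n)"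
  and hl: "!!x. x \<notin> Z ==> (%n. h n x) \<longlonglongrightarrow> f x"
  unfolding measurable_on_def by auto
 (* Projecting to the unit disc keeps the approximations continuous and makes them bounded. *)
 define k where "k n x = h n x / of_real (max 1 (norm (h n x)))" for n x
 have kc: "continuous_on UNIV (k n)" for n
  unfolding k_def by (intro continuous_intros hc) (auto simp: max_def)
 have k1: "norm (k n x) <= 1" for n x by (simp add: k_def norm_divide abs_of_pos max_def)
 have [measurable]: "k n : borel_measurable borel" for n using kc by (rule borel_measurable_continuous_onI)
 have kl: "(%n. k n x) \<longlonglongrightarrow> f x" if "x \<notin> Z" for x
 proof -
  have "(%n. k n x) \<longlonglongrightarrow> f x / of_real (max 1 (norm (f x)))"
   unfolding k_def by (intro tendsto_intros hl that) (auto simp: max_def)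
  moreover have "max 1 (norm (f x)) = 1" using f1[of x] by simp
  ultimately show ?thesis by simp
 qed
 have "AE x in lborel. x \<notin> Z"
 proof -
  have "AE x in lebesgue. x \<notin> Z" using Z by (intro AE_not_in) (simp add: negligible_iff_null_sets)
  then show ?thesis using AE_completion_iff by blast
 qed
 then have ael: "AE x in lborel. (%n. g x * k n x) \<longlonglongrightarrow> g x * f x"
  by eventually_elim (intro tendsto_intros kl)
 have "(%n. LINT x|lborel. g x * k n x) \<longlonglongrightarrow> (LINT x|lborel. g x * f x)"
  by (rule integral_dominated_convergence[OF _ _ integrable_norm[OF g] ael])
   (use k1 in \<open>auto simp: norm_mult mult_left_le\<close>)
 then have "(LINT x|lborel. g x * f x) = 0" unfolding cont[OF kc k1] by (simp add: LIMSEQ_const_iff)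
 moreover have gf: "g x * f x = of_real ((norm (g x))^2 / (1 + norm (g x)))" for x
  using complex_norm_square[of "g x"] by (simp add: f_def)
 ultimately have z0: "(LINT x|lborel. (norm (g x))^2 / (1 + norm (g x))) = 0"
  unfolding gf integral_complex_of_real by simp
 have i2: "integrable lborel (%x. (norm (g x))^2 / (1 + norm (g x)))"
 proof (rule Bochner_Integration.integrable_bound[OF integrable_norm[OF g]])
  show "AE x in lborel. norm ((norm (g x))^2 / (1 + norm (g x))) <= norm (norm (g x))"
   by (intro AE_I2) (auto simp: divide_le_eq power2_eq_square algebra_simps add_pos_nonneg)
 qed measurable
 have "AE x in lborel. (norm (g x))^2 / (1 + norm (g x)) = 0"
  using integral_nonneg_eq_0_iff_AE[OF i2] z0 by (simp add: add_nonneg_nonneg)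
 then show ?thesis
 proof eventually_elim
  case (elim x)
  have "1 + norm (g x) ~= 0" using norm_ge_zero[of "g x"] by linarith
  then show ?case using elim by simp
 qed
qed

section \<open>Gaussian test functions\<close>

text \<open>Gaussian decay that is stable under multiplication by exponentials. The rate \<open>1/16\<close> is arbitrary below that of the
Gaussians in use; the slack absorbs translations and the exponentials.\<close>

definition decay :: "(real^'n => complex) => bool" where
 "decay g \<longleftrightarrow> g : borel_measurable borel & (ALL c. EX C>=0. ALL x. norm (g x) * exp (c * norm x) <= C * gauss (1/16) x)"

lemma decay_measurable: "decay g ==> g : borel_measurable borel"
 by (simp add: decay_def)

lemma decay_mult:
 assumes g: "decay g" and [measurable]: "f : borel_measurable borel" and b: "!!x. norm (f x) <= B * exp (b * norm x) * norm (g x)"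
 shows "decay f"
 unfolding decay_def
proof (intro conjI allI)
 fix c
 obtain C where C: "C >= 0" "ALL x. norm (g x) * exp ((b + c) * norm x) <= C * gauss (1/16) x"
  using g by (auto simp: decay_def)
 have "norm (f x) * exp (c * norm x) <= \<bar>B\<bar> * C * gauss (1/16) x" for x
 proof -
  have "norm (f x) <= \<bar>B\<bar> * exp (b * norm x) * norm (g x)"
   by (rule order.trans[OF b]) (intro mult_right_mono, auto)
  then have "norm (f x) * exp (c * norm x) <= \<bar>B\<bar> * exp (b * norm x) * norm (g x) * exp (c * norm x)"
   by (rule mult_right_mono) simp
  also have "... = \<bar>B\<bar> * (norm (g x) * exp ((b + c) * norm x))" by (simp add: exp_add distrib_right)
  also have "... <= \<bar>B\<bar> * (C * gauss (1/16) x)" using C(2) by (intro mult_left_mono) auto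
  finally show ?thesis by (simp add: mult.assoc)
 qed
 then show "EX C>=0. ALL x. norm (f x) * exp (c * norm x) <= C * gauss (1/16) x"
  using C(1) by (intro exI[of _ "\<bar>B\<bar> * C"]) auto
qed measurable

lemma decay_bound:
 assumes "decay g"
 shows "EX C>=0. ALL x. norm (g x) <= C * gauss (1/16) x"
proof -
 obtain C where C: "C >= 0" "ALL x. norm (g x) * exp (0 * norm x) <= C * gauss (1/16) x"
  using assms unfolding decay_def by blast
 then show ?thesis by auto
qed

lemma decay_integrable:
 fixes g :: "real^'n::finite => complex"
 assumes g: "decay g"
 shows "integrable lborel g" "g : Lp 2"
proof -
 have [measurable]: "g : borel_measurable borel" by (rule decay_measurable[OF g])
 obtain C where C: "C >= 0" "!!x. norm (g x) <= C * gauss (1/16) x" using decay_bound[OF g] by auto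
 have i: "integrable lborel (gauss delta :: real^'n => real)" if "delta > 0" for delta using gauss_integral(1)[OF that] .
 show "integrable lborel g"
  by (rule integrable_cmult_bound[OF i[of "1/16"], where c = C]) (use C in auto)
 have "integrable lborel (%x. (norm (g x))^2)"
 proof (rule Bochner_Integration.integrable_bound[OF integrable_mult_right[OF i[of "1/8"], of "C\<^sup>2"]])
  show "AE x in lborel. norm ((norm (g x))^2) <= norm (C\<^sup>2 * gauss (1/8) x)"
  proof (rule AE_I2)
   fix x
   have "(norm (g x))^2 <= (C * gauss (1/16) x)^2" by (intro power_mono C) auto
   also have "... = C\<^sup>2 * gauss (1/8) x"
    by (simp add: gauss_def power_mult_distrib exp_of_nat_mult[symmetric])
   finally show "norm ((norm (g x))^2) <= norm (C\<^sup>2 * gauss (1/8) x)" by (simp add: abs_mult)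
  qed
 qed auto
 then show "g : Lp 2" by (simp add: Lp2_iff)
qed

text \<open>The multiples of \<open>b\<close> by polynomials, in a form that suits proofs by induction.\<close>

inductive poly_span :: "(real^'n => complex) => (real^'n => complex) => bool" for b where
 base: "poly_span b b"
| coord: "poly_span b g ==> poly_span b (%x. of_real (x $ i) * g x)"
| add: "poly_span b g ==> poly_span b h ==> poly_span b (%x. g x + h x)"
| scale: "poly_span b g ==> poly_span b (%x. c * g x)"

lemma norm_le_exp: "norm x <= exp (norm x)"
 using exp_ge_add_one_self[of "norm x"] by linarith

lemma decay_add:
 assumes "decay g" "decay h"
 shows "decay (%x. g x + h x)"
 unfolding decay_def
proof (intro conjI allI)
 note [measurable] = assms[THEN decay_measurable]
 show "(%x. g x + h x) : borel_measurable borel" by measurable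
 fix c
 obtain C where C: "C >= 0" "ALL x. norm (g x) * exp (c * norm x) <= C * gauss (1/16) x"
  using assms(1) by (auto simp: decay_def)
 obtain D where D: "D >= 0" "ALL x. norm (h x) * exp (c * norm x) <= D * gauss (1/16) x"
  using assms(2) by (auto simp: decay_def)
 have "norm (g x + h x) * exp (c * norm x) <= (C + D) * gauss (1/16) x" for x
 proof -
  have "norm (g x + h x) * exp (c * norm x) <= (norm (g x) + norm (h x)) * exp (c * norm x)"
   by (intro mult_right_mono norm_triangle_ineq) simp
  also have "... <= (C + D) * gauss (1/16) x" using C(2)[rule_format, of x] D(2)[rule_format, of x] by (simp add: algebra_simps)
  finally show ?thesis .
 qed
 then show "EX C>=0. ALL x. norm (g x + h x) * exp (c * norm x) <= C * gauss (1/16) x"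
  using C(1) D(1) by (intro exI[of _ "C + D"]) auto
qed

lemma poly_span_decay:
 assumes "poly_span b g" "decay b"
 shows "decay g"
 using assms
proof (induction rule: poly_span.induct)
 case (coord g i)
 then have g: "decay g" by simp
 note [measurable] = decay_measurable[OF g]
 show ?case
 proof (rule decay_mult[OF g, where B = 1 and b = 1])
  fix x :: "real^'a"
  have "\<bar>x $ i\<bar> <= exp (norm x)" using component_le_norm_cart[of x i] norm_le_exp[of x] by linarith
  then show "norm (of_real (x $ i) * g x) <= 1 * exp (1 * norm x) * norm (g x)"
   by (simp add: norm_mult mult_right_mono)
 qed measurable
next
 case (scale g c)
 then have g: "decay g" by simp
 note [measurable] = decay_measurable[OF g]
 show ?case by (rule decay_mult[OF g, where B = "norm c" and b = 0]) (auto simp: norm_mult)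
qed (auto intro: decay_add)

text \<open>The exponent \<open>1/2\<close> makes the Gaussian its own Fourier transform up to a constant, so modulated Gaussians are transformed to
translated ones.\<close>

definition modulated :: "real^'n => real^'n => complex" where
 "modulated y xi = of_real (gauss (1/2) xi) * cis (xi \<bullet> y)"

definition translated :: "real^'n => real^'n => complex" where
 "translated y x = of_real (gauss (1/2) (x - y))"

lemma decay_translated: "decay (translated y)"
 unfolding decay_def
proof (intro conjI allI)
 show "translated y : borel_measurable borel" unfolding translated_def[abs_def] by measurable
 fix c
 have "norm (translated y x) * exp (c * norm x) <= exp ((norm y)^2 / 2 + 4 * c\<^sup>2) * gauss (1/16) x" for x
 proof -
  have "(norm x)^2 <= 2 * (norm (x - y))^2 + 2 * (norm y)^2" using norm_add_sq[of "x - y" y] by simp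
  moreover have "0 <= (norm x / 4 - 2 * c)^2" by simp
  then have "0 <= (norm x)^2 / 16 - c * norm x + 4 * c\<^sup>2" by (simp add: power2_diff power_divide mult.commute)
  moreover have "0 <= (norm x)^2" by simp
  ultimately have "- (1/2) * (norm (x - y))^2 + c * norm x <= (norm y)^2 / 2 + 4 * c\<^sup>2 + - (1/16) * (norm x)^2"
   by linarith
  then show ?thesis by (simp add: translated_def gauss_def exp_add[symmetric])
 qed
 then show "EX C>=0. ALL x. norm (translated y x) * exp (c * norm x) <= C * gauss (1/16) x"
  by (intro exI[of _ "exp ((norm y)^2 / 2 + 4 * c\<^sup>2)"]) auto
qed

lemma decay_modulated: "decay (modulated y)"
proof (rule decay_mult[OF decay_translated[of 0], where B = 1 and b = 0])
 show "modulated y : borel_measurable borel" unfolding modulated_def[abs_def] by measurable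
qed (simp add: modulated_def translated_def norm_mult)

lemma ft_modulated:
 fixes y :: "real^'n::finite"
 shows "ft (modulated y) = (%x. of_real (gauss_mass TYPE('n) (1/2)) * translated y x)"
proof
 fix x
 show "ft (modulated y) x = of_real (gauss_mass TYPE('n) (1/2)) * translated y x"
  using ft_modulated_gauss(1)[of "1/2" y x] by (simp add: modulated_def[abs_def] translated_def)
qed

lemma partial_deriv_eq:
 assumes "(f has_derivative f') (at x)"
 shows "partial_deriv i f x = f' (axis i 1)"
proof -
 have "((%h::real. x + h *\<^sub>R axis i 1) has_derivative (%h. h *\<^sub>R axis i 1)) (at 0)"
  by (auto intro!: derivative_eq_intros)
 moreover have "(f has_derivative f') (at (x + 0 *\<^sub>R axis i 1))" using assms by simp
 ultimately have "((%h::real. f (x + h *\<^sub>R axis i 1)) has_derivative (%h. f' (h *\<^sub>R axis i 1))) (at 0)"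
  by (rule has_derivative_compose)
 moreover have "f' (h *\<^sub>R axis i 1) = h *\<^sub>R f' (axis i 1)" for h
  using has_derivative_linear[OF assms] by (rule linear_scale)
 ultimately have "((%h::real. f (x + h *\<^sub>R axis i 1)) has_vector_derivative f' (axis i 1)) (at 0)"
  by (simp add: has_vector_derivative_def)
 then show ?thesis unfolding partial_deriv_def by (rule vector_derivative_at)
qed

lemma poly_span_translated_derivative:
 assumes "poly_span (translated y) g"
 shows "EX g'. (ALL x. (g has_derivative g' x) (at x)) & (ALL i. poly_span (translated y) (%x. g' x (axis i 1)))"
 using assms
proof (induction rule: poly_span.induct)
 case base
 let ?g = "%x h. complex_of_real (- (gauss (1/2) (x - y)) * ((x - y) \<bullet> h))"
 have d1: "(translated y has_derivative ?g x) (at x)" for x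
 proof -
  have "((%x. gauss (1/2) (x - y)) has_derivative (%h. - (gauss (1/2) (x - y)) * ((x - y) \<bullet> h))) (at x)"
   unfolding gauss_def power2_norm_eq_inner
   by (auto intro!: derivative_eq_intros simp: inner_commute algebra_simps)
  from bounded_linear.has_derivative[OF bounded_linear_of_real this]
  show ?thesis by (simp add: translated_def[abs_def])
 qed
 have d2: "poly_span (translated y) (%x. ?g x (axis i 1))" for i
 proof -
  have "?g x (axis i 1) = (- 1) * (of_real (x $ i) * translated y x) + of_real (y $ i) * translated y x" for x
   by (simp add: translated_def inner_axis algebra_simps)
  then show ?thesis by (simp only:) (intro poly_span.intros)
 qed
 show ?case by (intro exI[of _ ?g] conjI allI d1 d2)
next
 case (coord g i)
 then obtain g' where g': "ALL x. (g has_derivative g' x) (at x)" "ALL i. poly_span (translated y) (%x. g' x (axis i 1))"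
  by blast
 let ?h = "%x h. of_real (x $ i) * g' x h + of_real (h $ i) * g x"
 have d1: "((%x. of_real (x $ i) * g x) has_derivative ?h x) (at x)" for x
 proof -
  have "((%x. complex_of_real (x $ i)) has_derivative (%h. of_real (h $ i))) (at x)"
   by (intro bounded_linear.has_derivative[OF bounded_linear_of_real] bounded_linear.has_derivative[OF bounded_linear_vec_nth] has_derivative_ident)
  from has_derivative_mult[OF this g'(1)[rule_format]] show ?thesis .
 qed
 have d2: "poly_span (translated y) (%x. ?h x (axis j 1))" for j
  by (intro poly_span.intros g'(2)[rule_format] coord)
 show ?case by (intro exI[of _ ?h] conjI allI d1 d2)
next
 case (add g h)
 then obtain g' h' where "ALL x. (g has_derivative g' x) (at x)" "ALL i. poly_span (translated y) (%x. g' x (axis i 1))"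
  "ALL x. (h has_derivative h' x) (at x)" "ALL i. poly_span (translated y) (%x. h' x (axis i 1))"
  by blast
 then show ?case
  by (intro exI[of _ "%x v. g' x v + h' x v"] conjI allI has_derivative_add poly_span.intros) auto
next
 case (scale g c)
 then obtain g' where "ALL x. (g has_derivative g' x) (at x)" "ALL i. poly_span (translated y) (%x. g' x (axis i 1))"
  by blast
 then show ?case
  by (intro exI[of _ "%x v. c * g' x v"] conjI allI has_derivative_mult_right poly_span.intros) auto
qed

lemma poly_span_partial_deriv:
 assumes "poly_span (translated y) g"
 shows "poly_span (translated y) (partial_deriv i g)" "g differentiable (at x)"
proof -
 obtain g' where g': "ALL x. (g has_derivative g' x) (at x)" "ALL i. poly_span (translated y) (%x. g' x (axis i 1))"
  using poly_span_translated_derivative[OF assms] by blast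
 have "partial_deriv i g = (%x. g' x (axis i 1))" using partial_deriv_eq g'(1) by blast
 then show "poly_span (translated y) (partial_deriv i g)" using g'(2) by simp
 show "g differentiable (at x)" using g'(1) by (auto simp: differentiable_def)
qed

lemma schwartz_poly_span:
 assumes "poly_span (translated y) g"
 shows "schwartz g"
 unfolding schwartz_def
proof (intro allI conjI)
 fix "is" x and N :: nat
 have s: "poly_span (translated y) (foldr partial_deriv is g)"
  by (induction "is") (auto intro: poly_span_partial_deriv(1) assms)
 show "foldr partial_deriv is g differentiable at x" by (rule poly_span_partial_deriv(2)[OF s])
 let ?h = "foldr partial_deriv is g"
 have "decay ?h" by (rule poly_span_decay[OF s decay_translated])
 then obtain C where C: "C >= 0" "ALL x. norm (?h x) * exp (real N * norm x) <= C * gauss (1/16) x"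
  unfolding decay_def by blast
 have "(1 + norm x) ^ N * norm (?h x) <= C" for x
 proof -
  have "(1 + norm x) ^ N <= exp (norm x) ^ N" by (intro power_mono exp_ge_add_one_self) auto
  then have "(1 + norm x) ^ N <= exp (real N * norm x)" by (simp add: exp_of_nat_mult)
  then have "(1 + norm x) ^ N * norm (?h x) <= exp (real N * norm x) * norm (?h x)" by (rule mult_right_mono) simp
  also have "... <= C * gauss (1/16) x" using C(2) by (simp add: mult.commute)
  also have "... <= C" using C(1) by (simp add: gauss_def mult_left_le)
  finally show ?thesis .
 qed
 then show "bounded (range (%x. (1 + norm x) ^ N * norm (?h x)))"
  unfolding bounded_iff by (intro exI[of _ C]) (auto simp: abs_mult)
qed

lemma cis_remainder: "norm (cis theta - 1 - \<i> * of_real theta) <= theta\<^sup>2 / 2"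
 using iexp_approx1[of theta 1] by (simp add: cis_conv_exp algebra_simps power2_eq_square)

text \<open>Differentiation under the integral sign, with the second order remainder of the exponential as the error.\<close>

lemma partial_deriv_ft:
 assumes phi: "decay phi"
 shows "partial_deriv i (ft phi) x = ft (%xi. - \<i> * of_real (xi $ i) * phi xi) x"
proof -
 note [measurable] = decay_measurable[OF phi]
 have d1: "decay (%xi. - \<i> * of_real (xi $ i) * phi xi)"
 proof (rule decay_mult[OF phi, where B = 1 and b = 1])
  fix x :: "real^'a"
  have "\<bar>x $ i\<bar> <= exp (norm x)" using component_le_norm_cart[of x i] norm_le_exp[of x] by linarith
  then show "norm (- \<i> * of_real (x $ i) * phi x) <= 1 * exp (1 * norm x) * norm (phi x)"
   by (simp add: norm_mult mult_right_mono)
 qed measurable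
 have d2: "decay (%xi. of_real ((xi $ i)^2) * phi xi)"
 proof (rule decay_mult[OF phi, where B = 1 and b = 2])
  fix x :: "real^'a"
  have "\<bar>x $ i\<bar> <= exp (norm x)" using component_le_norm_cart[of x i] norm_le_exp[of x] by linarith
  then have "\<bar>x $ i\<bar>\<^sup>2 <= (exp (norm x))^2" by (rule power_mono) simp
  then show "norm (of_real ((x $ i)^2) * phi x) <= 1 * exp (2 * norm x) * norm (phi x)"
   by (simp add: norm_mult mult_right_mono exp_double norm_power)
 qed measurable
 define M where "M = (LINT xi|lborel. norm (of_real ((xi $ i)^2) * phi xi))"
 let ?d = "ft (%xi. - \<i> * of_real (xi $ i) * phi xi) x"
 have est: "norm (ft phi (x + h *\<^sub>R axis i 1) - ft phi x - h *\<^sub>R ?d) <= M / 2 * h\<^sup>2" for h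
 proof -
  have i0: "integrable lborel (%xi. cis (- (xi \<bullet> y)) * phi xi)" for y
   by (rule ft_integrable[OF decay_integrable(1)[OF phi]])
  have i1: "integrable lborel (%xi. cis (- (xi \<bullet> x)) * (- \<i> * of_real (xi $ i) * phi xi))"
   by (rule ft_integrable[OF decay_integrable(1)[OF d1]])
  have "ft phi (x + h *\<^sub>R axis i 1) - ft phi x - h *\<^sub>R ?d
   = (LINT xi|lborel. cis (- (xi \<bullet> (x + h *\<^sub>R axis i 1))) * phi xi - cis (- (xi \<bullet> x)) * phi xi - h *\<^sub>R (cis (- (xi \<bullet> x)) * (- \<i> * of_real (xi $ i) * phi xi)))"
   unfolding ft_def using i0 i1
   by (simp only: Bochner_Integration.integral_diff Bochner_Integration.integrable_diff integrable_scaleR_right integral_scaleR_right)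
  also have "... = (LINT xi|lborel. cis (- (xi \<bullet> x)) * (cis (- (h * xi $ i)) - 1 - \<i> * of_real (- (h * xi $ i))) * phi xi)"
  proof (rule Bochner_Integration.integral_cong[OF refl])
   fix xi
   have "cis (- (xi \<bullet> (x + h *\<^sub>R axis i 1))) = cis (- (xi \<bullet> x)) * cis (- (h * xi $ i))"
    unfolding cis_mult by (simp add: inner_add_right inner_axis)
   then show "cis (- (xi \<bullet> (x + h *\<^sub>R axis i 1))) * phi xi - cis (- (xi \<bullet> x)) * phi xi - h *\<^sub>R (cis (- (xi \<bullet> x)) * (- \<i> * of_real (xi $ i) * phi xi))
    = cis (- (xi \<bullet> x)) * (cis (- (h * xi $ i)) - 1 - \<i> * of_real (- (h * xi $ i))) * phi xi"
    by (simp add: algebra_simps scaleR_conv_of_real)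
  qed
  also have "norm ... <= (LINT xi|lborel. norm (cis (- (xi \<bullet> x)) * (cis (- (h * xi $ i)) - 1 - \<i> * of_real (- (h * xi $ i))) * phi xi))"
   by (rule integral_norm_bound)
  also have "... <= (LINT xi|lborel. h\<^sup>2 / 2 * norm (of_real ((xi $ i)^2) * phi xi))"
  proof (rule Bochner_Integration.integral_mono')
   show "integrable lborel (%xi. h\<^sup>2 / 2 * norm (of_real ((xi $ i)^2) * phi xi))"
    by (intro integrable_mult_right integrable_norm decay_integrable(1)[OF d2])
   fix xi :: "real^'a"
   have "norm (cis (- (h * xi $ i)) - 1 - \<i> * of_real (- (h * xi $ i))) * norm (phi xi) <= (- (h * xi $ i))^2 / 2 * norm (phi xi)"
    by (intro mult_right_mono cis_remainder) simp
   then show "norm (cis (- (xi \<bullet> x)) * (cis (- (h * xi $ i)) - 1 - \<i> * of_real (- (h * xi $ i))) * phi xi) <= h\<^sup>2 / 2 * norm (of_real ((xi $ i)^2) * phi xi)"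
    by (simp add: norm_mult norm_power power_mult_distrib mult.assoc)
   show "0 <= h\<^sup>2 / 2 * norm (of_real ((xi $ i)^2) * phi xi)" by simp
  qed
  also have "... = M / 2 * h\<^sup>2" by (simp add: M_def)
  finally show ?thesis .
 qed
 have "((%h. ft phi (x + h *\<^sub>R axis i 1)) has_vector_derivative ?d) (at 0)"
  unfolding has_vector_derivative_def has_derivative_at
 proof (intro conjI bounded_linear_scaleR_left)
  show "(%h. norm (ft phi (x + (0 + h) *\<^sub>R axis i 1) - ft phi (x + 0 *\<^sub>R axis i 1) - h *\<^sub>R ?d) / norm h) \<midarrow>0\<rightarrow> 0"
  proof (rule Lim_null_comparison)
   show "\<forall>\<^sub>F h in at 0. norm (norm (ft phi (x + (0 + h) *\<^sub>R axis i 1) - ft phi (x + 0 *\<^sub>R axis i 1) - h *\<^sub>R ?d) / norm h) <= M / 2 * \<bar>h\<bar>"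
   proof (rule eventually_at_topological[THEN iffD2], intro exI[of _ UNIV] conjI ballI impI)
    fix h :: real assume "h ~= 0"
    then have "norm (ft phi (x + h *\<^sub>R axis i 1) - ft phi x - h *\<^sub>R ?d) / \<bar>h\<bar> <= M / 2 * h\<^sup>2 / \<bar>h\<bar>"
     by (intro divide_right_mono est) auto
    also have "... = M / 2 * \<bar>h\<bar>" using \<open>h ~= 0\<close> by (simp add: power2_eq_square abs_if)
    finally show "norm (norm (ft phi (x + (0 + h) *\<^sub>R axis i 1) - ft phi (x + 0 *\<^sub>R axis i 1) - h *\<^sub>R ?d) / norm h) <= M / 2 * \<bar>h\<bar>"
     by simp
   qed auto
   have "((%h::real. M / 2 * \<bar>h\<bar>) \<longlongrightarrow> M / 2 * \<bar>0\<bar>) (at 0)" by (intro tendsto_intros)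
   then show "((%h::real. M / 2 * \<bar>h\<bar>) \<longlongrightarrow> 0) (at 0)" by simp
  qed
 qed
 then show ?thesis unfolding partial_deriv_def by (rule vector_derivative_at)
qed

lemma ft_cmult: "ft (%xi. c * phi xi) x = c * ft phi x"
 unfolding ft_def by (simp add: mult.left_commute)

text \<open>Polynomials on one side are derivatives on the other, and derivatives of translated Gaussians are polynomial multiples. So
the test functions on the frequency side correspond to Schwartz functions.\<close>

lemma ft_poly_span:
 assumes "poly_span (modulated y) phi"
 shows "poly_span (translated y) (ft phi)"
 using assms
proof (induction rule: poly_span.induct)
 case base
 show ?case unfolding ft_modulated by (intro poly_span.intros)
next
 case (coord phi i)
 have d: "decay phi" by (rule poly_span_decay[OF coord.hyps decay_modulated])
 have "ft (%xi. of_real (xi $ i) * phi xi) x = \<i> * partial_deriv i (ft phi) x" for x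
  unfolding partial_deriv_ft[OF d] ft_cmult[symmetric] by (simp add: mult.assoc[symmetric])
 then have "ft (%xi. of_real (xi $ i) * phi xi) = (%x. \<i> * partial_deriv i (ft phi) x)" by blast
 then show ?case using poly_span.scale[OF poly_span_partial_deriv(1)[OF coord.IH]] by simp
next
 case (add g h)
 have "ft (%x. g x + h x) = (%x. ft g x + ft h x)"
  using ft_lincomb[of g h 1 1] add.hyps[THEN poly_span_decay, OF decay_modulated, THEN decay_integrable(1)] by auto
 then show ?case using poly_span.add[OF add.IH] by simp
next
 case (scale g c)
 have "ft (%x. c * g x) = (%x. c * ft g x)" using ft_cmult by blast
 then show ?case using poly_span.scale[OF scale.IH] by simp
qed

lemma poly_span_monomial:
 fixes alpha :: "'n::finite mindex"
 assumes "poly_span b phi"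
 shows "poly_span b (%xi. c * of_real (mpow xi alpha) * phi xi)"
proof -
 have pw: "poly_span b (%xi. of_real (xi $ i) ^ k * g xi)" if "poly_span b g" for g k i
  using that
 proof (induction k)
  case (Suc k)
  from poly_span.coord[OF Suc.IH[OF Suc.prems], of i] show ?case by (simp add: mult.assoc)
 qed simp
 have "poly_span b (%xi. of_real (\<Prod>i\<in>I. (xi $ i) ^ alpha i) * phi xi)" if "finite I" for I
  using that
 proof (induction I)
  case (insert i I)
  from pw[OF insert.IH, of i "alpha i"] insert.hyps show ?case by (simp add: mult.assoc)
 qed (use assms in simp)
 from poly_span.scale[OF this[OF finite], of c UNIV] show ?thesis by (simp add: mpow_def mult.assoc)
qed

lemma foldr_partial_deriv_ft:
 assumes "poly_span (modulated y) phi"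
 shows "foldr partial_deriv is (ft phi) = ft (%xi. (\<Prod>i\<leftarrow>is. - \<i> * of_real (xi $ i)) * phi xi)
  & poly_span (modulated y) (%xi. (\<Prod>i\<leftarrow>is. - \<i> * of_real (xi $ i)) * phi xi)"
proof (induction "is")
 case (Cons i "is")
 let ?h = "%xi. (\<Prod>i\<leftarrow>is. - \<i> * of_real (xi $ i)) * phi xi"
 have "partial_deriv i (ft ?h) x = ft (%xi. - \<i> * of_real (xi $ i) * ?h xi) x" for x
  by (rule partial_deriv_ft[OF poly_span_decay[OF conjunct2[OF Cons.IH] decay_modulated]])
 moreover have "poly_span (modulated y) (%xi. - \<i> * (of_real (xi $ i) * ?h xi))"
  by (intro poly_span.intros conjunct2[OF Cons.IH])
 ultimately show ?case using conjunct1[OF Cons.IH] by (auto simp: mult.assoc)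
qed (use assms in auto)

text \<open>The list of differentiations chosen in \<open>multi_deriv\<close> is irrelevant, because multiplications commute.\<close>

lemma multi_deriv_ft:
 fixes phi :: "real^'n::finite => complex"
 assumes "poly_span (modulated y) phi"
 shows "multi_deriv alpha (ft phi) = ft (%xi. (- \<i>) ^ msize alpha * of_real (mpow xi alpha) * phi xi)"
proof -
 define js where "js = (SOME is. ALL i. count_list is i = alpha i)"
 have "EX is. ALL i. count_list is i = alpha i"
 proof -
  obtain xs where "mset xs = Abs_multiset alpha" using ex_mset by blast
  then have "count_list xs i = alpha i" for i
   by (metis count_mset Abs_multiset_inverse finite mem_Collect_eq)
  then show ?thesis by blast
 qed
 then have js: "ALL i. count_list js i = alpha i" unfolding js_def by (rule someI_ex)
 have pr: "(\<Prod>i\<leftarrow>is. f i) = (\<Prod>i\<in>UNIV. f i ^ count_list is i)" for f :: "'n => complex" and "is"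
 proof (induction "is")
  case (Cons a "is")
  have "(\<Prod>i\<in>UNIV. f i ^ count_list (a # is) i) = (\<Prod>i\<in>UNIV. (if i = a then f i else 1) * f i ^ count_list is i)"
   by (intro prod.cong) auto
  also have "... = f a * (\<Prod>i\<in>UNIV. f i ^ count_list is i)" by (simp add: prod.distrib prod.delta)
  finally show ?case using Cons by simp
 qed simp
 have "(\<Prod>i\<leftarrow>js. - \<i> * complex_of_real (xi $ i)) = (- \<i>) ^ msize alpha * of_real (mpow xi alpha)" for xi
  unfolding pr using js by (simp only: power_mult_distrib prod.distrib msize_def mpow_def power_sum of_real_prod of_real_power)
 then show ?thesis
  unfolding multi_deriv_def js_def[symmetric] using foldr_partial_deriv_ft[OF assms, of js] by simp
qed

section \<open>Power series solutions\<close>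

text \<open>Taylor's formula with one-sided derivatives at zero, for a sequence of functions each of which is the derivative of its
predecessor.\<close>

lemma taylor_bound:
 fixes h :: "nat => real => complex"
 assumes d: "!!k t. t >= 0 ==> (h k has_vector_derivative h (Suc k) t) (at t within {0..})"
  and M: "!!s. 0 <= s ==> s <= T ==> norm (h N s) <= M" and t: "0 <= t" "t <= T"
 shows "norm (h 0 t - (\<Sum>k<N. of_real t ^ k / fact k * h k 0)) <= M * t ^ N / fact N"
 using d M t
proof (induction N arbitrary: h t)
 case 0
 then show ?case by simp
next
 case (Suc N)
 show ?case
 proof (cases "t = 0")
  case True
  then show ?thesis by (simp add: sum.lessThan_Suc_shift power_0_left sum.neutral del: sum.lessThan_Suc)
 next
  case False
  then have t: "0 < t" using Suc.prems by simp
  let ?f = "%s. h 0 s - (\<Sum>k<Suc N. of_real s ^ k / fact k * h k 0)"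
  let ?f' = "%s. h 1 s - (\<Sum>k<N. of_real s ^ k / fact k * h (Suc k) 0)"
  have IH: "norm (?f' s) <= M * s ^ N / fact N" if "0 <= s" "s <= T" for s
   using Suc.IH[of "%k. h (Suc k)" s] Suc.prems that by simp
  have pd: "((%s. \<Sum>k<Suc N. of_real s ^ k / fact k * h k 0) has_vector_derivative (\<Sum>k<N. of_real s ^ k / fact k * h (Suc k) 0)) (at s within S)" for s S
  proof -
   have "((%s. \<Sum>k<N. of_real s ^ Suc k / fact (Suc k) * h (Suc k) 0) has_vector_derivative (\<Sum>k<N. of_real s ^ k / fact k * h (Suc k) 0)) (at s within S)"
   proof (rule has_vector_derivative_sum)
    fix k
    have "((%z::complex. z ^ Suc k / fact (Suc k) * h (Suc k) 0) has_field_derivative (of_real s ^ k / fact k * h (Suc k) 0)) (at (of_real s))"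
     by (rule derivative_eq_intros refl | simp add: field_simps del: of_nat_Suc)+
    then show "((%s. of_real s ^ Suc k / fact (Suc k) * h (Suc k) 0) has_vector_derivative (of_real s ^ k / fact k * h (Suc k) 0)) (at s within S)"
     by (rule has_vector_derivative_real_field)
   qed
   then have "((%s. h 0 0 + (\<Sum>k<N. of_real s ^ Suc k / fact (Suc k) * h (Suc k) 0)) has_vector_derivative 0 + (\<Sum>k<N. of_real s ^ k / fact k * h (Suc k) 0)) (at s within S)"
    by (intro has_vector_derivative_add has_vector_derivative_const)
   moreover have "(\<Sum>k<Suc N. of_real s ^ k / fact k * h k 0) = h 0 0 + (\<Sum>k<N. of_real s ^ Suc k / fact (Suc k) * h (Suc k) 0)" for s
    by (simp only: sum.lessThan_Suc_shift power_0 fact_0 div_by_1 mult_1_left)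
   ultimately show ?thesis by (simp only: add_0_left)
  qed
  have fd: "(?f has_vector_derivative ?f' s) (at s within {0..})" if "0 <= s" for s
   using has_vector_derivative_diff[OF Suc.prems(1)[of s 0] pd[of s "{0..}"]] that by simp
  have "norm (?f t - ?f 0) <= M * t ^ Suc N / fact (Suc N) - M * 0 ^ Suc N / fact (Suc N)"
  proof (rule differentiable_bound_general[OF t, where f' = ?f' and \<phi>' = "%s. M * s ^ N / fact N"])
   show "continuous_on {0..t} ?f"
    by (rule continuous_on_vector_derivative[where f' = ?f'])
     (rule has_vector_derivative_within_subset[OF fd], auto)
   show "continuous_on {0..t} (%s. M * s ^ Suc N / fact (Suc N))" by (intro continuous_intros) auto
   fix s assume s: "0 < s" "s < t"
   show "(?f has_vector_derivative ?f' s) (at s)"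
    using fd[of s] at_within_interior[of s "{0..}"] s by (simp only: interior_real_atLeast) simp
   have "((%s. M * s ^ Suc N / fact (Suc N)) has_field_derivative M * s ^ N / fact N) (at s)"
    by (rule derivative_eq_intros refl | simp add: field_simps del: of_nat_Suc)+
   then show "((%s. M * s ^ Suc N / fact (Suc N)) has_vector_derivative M * s ^ N / fact N) (at s)"
    by (simp add: has_real_derivative_iff_has_vector_derivative)
   show "norm (?f' s) <= M * s ^ N / fact N" using IH[of s] s Suc.prems by simp
  qed
  moreover have "?f 0 = 0" by (simp add: sum.lessThan_Suc_shift power_0_left sum.neutral del: sum.lessThan_Suc)
  ultimately show ?thesis by simp
 qed
qed

text \<open>The \<open>j\<close>-th derivative of the power series with Taylor coefficients \<open>W\<close>.\<close>

definition mode_series :: "(nat => complex) => nat => real => complex" where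
 "mode_series W j t = (\<Sum>k. W (j + k) / fact k * of_real t ^ k)"

lemma mode_series_summable:
 fixes W :: "nat => complex" and z :: complex
 assumes W: "!!k. norm (W k) <= K * R ^ k" and R: "R >= 0"
 shows "summable (%k. W (j + k) / fact k * z ^ k)"
proof (rule summable_comparison_test)
 have "summable (%k. inverse (fact k) * (R * norm z) ^ k)" by (rule summable_exp)
 then show "summable (%k. K * R ^ j * (inverse (fact k) * (R * norm z) ^ k))" by (rule summable_mult)
 show "EX N. ALL k>=N. norm (W (j + k) / fact k * z ^ k) <= K * R ^ j * (inverse (fact k) * (R * norm z) ^ k)"
 proof (intro exI allI impI)
  fix k
  have "norm (W (j + k) / fact k * z ^ k) = norm (W (j + k)) * (inverse (fact k) * norm z ^ k)"
   by (simp add: norm_mult norm_divide norm_power field_simps)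
  also have "... <= K * R ^ (j + k) * (inverse (fact k) * norm z ^ k)" by (intro mult_right_mono W) auto
  also have "... = K * R ^ j * (inverse (fact k) * (R * norm z) ^ k)" by (simp add: power_add power_mult_distrib)
  finally show "norm (W (j + k) / fact k * z ^ k) <= K * R ^ j * (inverse (fact k) * (R * norm z) ^ k)" .
 qed
qed

lemma mode_series_smooth:
 assumes W: "!!k. norm (W k) <= K * R ^ k" and R: "R >= 0"
 shows "smooth_seq (mode_series W)"
 unfolding smooth_seq_def
proof (intro allI)
 fix j t
 have s: "summable (%k. W (j + k) / fact k * z ^ k)" for z by (rule mode_series_summable[OF W R])
 have df: "diffs (%k. W (j + k) / fact k) = (%k. W (Suc j + k) / fact k)"
  by (rule ext) (simp add: diffs_def field_simps del: of_nat_Suc)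
 have "((%z. \<Sum>k. W (j + k) / fact k * z ^ k) has_field_derivative (\<Sum>k. W (Suc j + k) / fact k * of_real t ^ k)) (at (of_real t))"
  using termdiffs_strong_converges_everywhere[OF s, of "of_real t"] unfolding df .
 from has_vector_derivative_real_field[OF this]
 show "(mode_series W j has_vector_derivative mode_series W (Suc j) t) (at t)"
  unfolding mode_series_def[abs_def] .
qed

lemma mode_series_zero: "mode_series W j 0 = W j"
proof -
 have "(%k. W (j + k) / fact k * of_real 0 ^ k) sums (W (j + 0) / fact 0)"
  using sums_single[of 0 "%k. W (j + k) / fact k"] by (auto elim!: back_subst[of "%f. f sums _"] simp: fun_eq_iff power_0_left)
 then show ?thesis unfolding mode_series_def by (simp add: sums_iff)
qed

lemma mode_series_recurrence:
 assumes W: "!!k. norm (W k) <= K * R ^ k" and R: "R >= 0"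
  and rec: "!!l. (\<Sum>i\<le>m. a i * W (l + i)) = 0"
 shows "(\<Sum>i\<le>m. a i * mode_series W (l + i) t) = 0"
proof -
 have s: "summable (%k. W (j + k) / fact k * of_real t ^ k)" for j by (rule mode_series_summable[OF W R])
 have "a i * mode_series W (l + i) t = (\<Sum>k. a i * (W (l + i + k) / fact k * of_real t ^ k))" for i
  unfolding mode_series_def by (rule suminf_mult[OF s, symmetric])
 then have "(\<Sum>i\<le>m. a i * mode_series W (l + i) t) = (\<Sum>i\<le>m. \<Sum>k. a i * (W (l + i + k) / fact k * of_real t ^ k))"
  by (simp only:)
 also have "... = (\<Sum>k. \<Sum>i\<le>m. a i * (W (l + i + k) / fact k * of_real t ^ k))"
  by (rule suminf_sum[symmetric]) (rule summable_mult[OF s])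
 also have "(%k. \<Sum>i\<le>m. a i * (W (l + i + k) / fact k * of_real t ^ k)) = (%k. 0)"
 proof
  fix k
  have "(\<Sum>i\<le>m. a i * (W (l + i + k) / fact k * of_real t ^ k)) = (\<Sum>i\<le>m. a i * W (l + k + i)) * (of_real t ^ k / fact k)"
   unfolding sum_distrib_right by (intro sum.cong) (auto simp: add_ac)
  then show "(\<Sum>i\<le>m. a i * (W (l + i + k) / fact k * of_real t ^ k)) = 0" using rec[of "l + k"] by simp
 qed
 finally show ?thesis by simp
qed

text \<open>The Taylor coefficients that are forced by the equation \<open>(\<Sum>i<=m. a i * W (l + i)) = 0\<close> with \<open>a m = 1\<close> and the first
\<open>m\<close> of them.\<close>

function recur :: "nat => (nat => complex) => (nat => complex) => nat => complex" where
 "recur m a W k = (if k < m then W k else - (\<Sum>i<m. a i * recur m a W (k - m + i)))"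
 by pat_completeness auto
termination by (relation "Wellfounded.measure (%(m, a, W, k). k)") auto

declare recur.simps [simp del]

lemma recur_low: "k < m ==> recur m a W k = W k"
 by (subst recur.simps) simp

lemma recur_high: "recur m a W (m + l) = - (\<Sum>i<m. a i * recur m a W (l + i))"
 by (subst recur.simps) simp

lemma recur_equation:
 assumes "a m = 1"
 shows "(\<Sum>i\<le>m. a i * recur m a W (l + i)) = 0"
proof -
 have "(\<Sum>i\<le>m. a i * recur m a W (l + i)) = (\<Sum>i<m. a i * recur m a W (l + i)) + recur m a W (m + l)"
  using assms by (simp add: lessThan_Suc_atMost[symmetric] add.commute)
 then show ?thesis unfolding recur_high by simp
qed

text \<open>The growth of \<open>a i\<close> like \<open>R^(m - i)\<close> is that of the symbols in the frequency. It makes the coefficients grow only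
geometrically, at a rate linear in the frequency; this is what Gaussians can absorb.\<close>

lemma recur_bound:
 fixes R A :: real
 assumes a: "!!i. i < m ==> norm (a i) <= A * R ^ (m - i)" and m: "m >= 1" and A: "A >= 1" and R: "R >= 1"
 shows "norm (recur m a W k) <= (real m * A * R) ^ k * (\<Sum>j<m. norm (W j))"
proof (induction k rule: less_induct)
 case (less k)
 let ?S = "\<Sum>j<m. norm (W j)"
 have B: "1 <= real m * A * R" using mult_mono[of 1 "real m * A" 1 R] mult_mono[of 1 "real m" 1 A] m A R by simp
 have S: "0 <= ?S" by (simp add: sum_nonneg)
 show ?case
 proof (cases "k < m")
  case True
  have "norm (W k) <= ?S" using True by (intro member_le_sum) auto
  also have "... <= (real m * A * R) ^ k * ?S" using mult_right_mono[OF one_le_power[OF B, of k] S] by simp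
  finally show ?thesis using True by (simp add: recur_low)
 next
  case False
  define l where "l = k - m"
  have k: "k = m + l" using False by (simp add: l_def)
  have "norm (recur m a W k) <= (\<Sum>i<m. norm (a i * recur m a W (l + i)))"
   unfolding k recur_high norm_minus_cancel by (rule norm_sum)
  also have "... <= (\<Sum>i<m. A * ((real m * A) ^ (k - 1) * R ^ k * ?S))"
  proof (rule sum_mono)
   fix i assume "i : {..<m}"
   then have i: "i < m" by simp
   have "norm (a i * recur m a W (l + i)) <= (A * R ^ (m - i)) * ((real m * A * R) ^ (l + i) * ?S)"
    unfolding norm_mult by (intro mult_mono a less.IH) (use i A R k in auto)
   also have "... = A * ((real m * A) ^ (l + i) * R ^ (m - i + (l + i)) * ?S)"
    by (simp only: power_mult_distrib power_add mult_ac)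
   also have "m - i + (l + i) = k" using i k by simp
   also have "A * ((real m * A) ^ (l + i) * R ^ k * ?S) <= A * ((real m * A) ^ (k - 1) * R ^ k * ?S)"
   proof (intro mult_left_mono mult_right_mono power_increasing)
    show "1 <= real m * A" using mult_mono[of 1 "real m" 1 A] m A by simp
   qed (use i k A R S in auto)
   finally show "norm (a i * recur m a W (l + i)) <= A * ((real m * A) ^ (k - 1) * R ^ k * ?S)" .
  qed
  also have "... = (real m * A) ^ Suc (k - 1) * R ^ k * ?S" by simp
  also have "Suc (k - 1) = k" using m False by simp
  finally show ?thesis by (simp add: power_mult_distrib)
 qed
qed

lemma recur_measurable:
 assumes "!!i. i < m ==> (%x. a x i) : borel_measurable M" "!!i. i < m ==> (%x. W x i) : borel_measurable M"
 shows "(%x. recur m (a x) (W x) k) : borel_measurable M"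
proof (induction k rule: less_induct)
 case (less k)
 show ?case
 proof (cases "k < m")
  case False
  have "(%x. - (\<Sum>i<m. a x i * recur m (a x) (W x) (k - m + i))) : borel_measurable M"
  proof (intro borel_measurable_uminus borel_measurable_sum borel_measurable_times)
   fix i assume "i : {..<m}"
   then have i: "i < m" by simp
   show "(%x. a x i) : borel_measurable M" by (rule assms(1)[OF i])
   show "(%x. recur m (a x) (W x) (k - m + i)) : borel_measurable M" by (rule less.IH) (use i False in simp)
  qed
  moreover have "recur m (a x) (W x) k = - (\<Sum>i<m. a x i * recur m (a x) (W x) (k - m + i))" for x
   using recur_high[of m "a x" "W x" "k - m"] False by simp
  ultimately show ?thesis by simp
 qed (simp add: recur_low assms(2))
qed

section \<open>Weak solutions on the frequency side\<close>

lemma Lp_norm2_mono: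
 assumes "f : borel_measurable lborel" "g : Lp 2" "!!x. norm (f x) <= norm (g x)"
 shows "Lp_norm 2 f <= Lp_norm 2 g"
 unfolding Lp_norm2
proof (rule real_sqrt_le_mono, rule Bochner_Integration.integral_mono')
 show "integrable lborel (%x. (norm (g x))^2)" using assms(2) by (simp add: Lp2_iff)
 fix x show "(norm (f x))^2 <= (norm (g x))^2" by (intro power_mono assms) simp
qed simp

lemma Cauchy_Schwarz_norm:
 assumes f: "f : Lp 2" and g: "g : Lp 2"
 shows "integrable lborel (%x. norm (f x) * norm (g x))"
  and "(LINT x|lborel. norm (f x) * norm (g x)) <= Lp_norm 2 f * Lp_norm 2 g"
proof -
 let ?f = "%x. complex_of_real (norm (f x))" and ?g = "%x. complex_of_real (norm (g x))"
 note [measurable] = Lp2_measurable[OF f] Lp2_measurable[OF g]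
 have f': "?f : Lp 2" and g': "?g : Lp 2" using f g by (auto simp: Lp2_iff)
 show "integrable lborel (%x. norm (f x) * norm (g x))"
  using integrable_norm[OF Cauchy_Schwarz_Lp2(1)[OF f g]] by (simp add: norm_mult)
 have "norm (LINT x|lborel. ?f x * ?g x) = (LINT x|lborel. norm (f x) * norm (g x))"
  unfolding of_real_mult[symmetric] integral_complex_of_real by simp
 moreover have "Lp_norm 2 ?f = Lp_norm 2 f" "Lp_norm 2 ?g = Lp_norm 2 g" by (simp_all add: Lp_norm2)
 ultimately show "(LINT x|lborel. norm (f x) * norm (g x)) <= Lp_norm 2 f * Lp_norm 2 g"
  using Cauchy_Schwarz_Lp2(2)[OF f' g'] by simp
qed

lemma exp_partial_sum_le:
 fixes x :: real
 assumes "x >= 0"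
 shows "(\<Sum>k<N. x ^ k / fact k) <= exp x"
proof -
 have s: "(%k. x ^ k / fact k) sums exp x" using exp_converges[of x] by (simp add: field_simps)
 show ?thesis using sum_le_suminf[OF sums_summable[OF s], of "{..<N}"] s assms by (simp add: sums_iff)
qed

lemma power_fact_le_exp:
 fixes x :: real
 assumes "x >= 0"
 shows "x ^ n / fact n <= exp x"
proof -
 have "x ^ n / fact n <= (\<Sum>k<Suc n. x ^ k / fact k)" using assms by (simp add: sum_nonneg)
 also have "... <= exp x" by (rule exp_partial_sum_le[OF assms])
 finally show ?thesis .
qed

lemma decay_exp_weight:
 assumes phi: "decay phi"
 shows "decay (%xi. of_real (exp (c * (1 + norm xi))) * phi xi)"
proof (rule decay_mult[OF phi, where B = "exp c" and b = c])
 note [measurable] = decay_measurable[OF phi]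
 show "(%xi. of_real (exp (c * (1 + norm xi))) * phi xi) : borel_measurable borel" by measurable
qed (simp add: norm_mult distrib_left exp_add)

text \<open>The weak form, on the frequency side, of an equation with the coefficients \<open>a i\<close>. The function \<open>V k t\<close> stands for the
transform of the \<open>k\<close>-th time derivative. In the last assumption \<open>recur\<close> yields \<open>V (Suc k)\<close> for \<open>Suc k < m\<close> and the
right-hand side of the equation for \<open>Suc k = m\<close>.\<close>

locale mode_problem =
 fixes m :: nat and a :: "nat => real^'n::finite => complex"
  and V :: "nat => real => real^'n => complex" and A :: real
 assumes m: "m >= 1" and a_meas: "!!i. i < m ==> a i : borel_measurable borel"
  and A: "A >= 1" and a_le: "!!i xi. i < m ==> norm (a i xi) <= A * (1 + norm xi) ^ (m - i)"
  and a_span: "!!i y phi. i < m ==> poly_span (modulated y) phi ==> poly_span (modulated y) (%xi. a i xi * phi xi)"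
  and V_Lp2: "!!k t. k < m ==> t >= 0 ==> V k t : Lp 2"
  and V_bound: "!!T. EX M>=0. ALL k<m. ALL t. 0 <= t --> t <= T --> Lp_norm 2 (V k t) <= M"
  and V_deriv: "!!y phi k t. poly_span (modulated y) phi ==> k < m ==> t >= 0 ==>
   ((%t. LINT xi|lborel. V k t xi * phi xi) has_vector_derivative
    (LINT xi|lborel. recur m (%i. a i xi) (%j. V j t xi) (Suc k) * phi xi)) (at t within {0..})"
begin

definition E :: "nat => real => real^'n => complex" where
 "E k t xi = recur m (%i. a i xi) (%j. V j t xi) k"

definition B :: real where "B = real m * A"

definition S :: "real => real^'n => real" where "S t xi = (\<Sum>j<m. norm (V j t xi))"

lemma B: "B >= 1" using mult_mono[of 1 "real m" 1 A] m A by (simp add: B_def)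

lemma S_nonneg [simp]: "S t xi >= 0" by (simp add: S_def sum_nonneg)

lemma E_low: "k < m ==> E k t xi = V k t xi" by (simp add: E_def recur_low)

lemma E_high: "E (m + l) t xi = - (\<Sum>i<m. a i xi * E (l + i) t xi)" by (simp add: E_def recur_high)

lemma E_bound: "norm (E k t xi) <= (B * (1 + norm xi)) ^ k * S t xi"
 unfolding E_def B_def S_def by (rule recur_bound) (use a_le m A in auto)

lemma E_meas [measurable]: "t >= 0 ==> E k t : borel_measurable borel"
 unfolding E_def[abs_def] by (rule recur_measurable) (use a_meas Lp2_measurable[OF V_Lp2] in auto)

lemma S_pair:
 assumes psi: "decay psi" and t: "t >= 0"
 shows "integrable lborel (%xi. S t xi * norm (psi xi))"
  and "(LINT xi|lborel. S t xi * norm (psi xi)) <= (\<Sum>j<m. Lp_norm 2 (V j t)) * Lp_norm 2 psi"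
proof -
 note i = Cauchy_Schwarz_norm[OF V_Lp2 decay_integrable(2)[OF psi]]
 have e: "S t xi * norm (psi xi) = (\<Sum>j<m. norm (V j t xi) * norm (psi xi))" for xi
  by (simp add: S_def sum_distrib_right)
 show "integrable lborel (%xi. S t xi * norm (psi xi))"
  unfolding e by (intro Bochner_Integration.integrable_sum i(1) t) simp
 have "(LINT xi|lborel. S t xi * norm (psi xi)) = (\<Sum>j<m. LINT xi|lborel. norm (V j t xi) * norm (psi xi))"
  unfolding e by (intro Bochner_Integration.integral_sum i(1) t) simp
 also have "... <= (\<Sum>j<m. Lp_norm 2 (V j t) * Lp_norm 2 psi)"
  by (intro sum_mono i(2) t) simp
 finally show "(LINT xi|lborel. S t xi * norm (psi xi)) <= (\<Sum>j<m. Lp_norm 2 (V j t)) * Lp_norm 2 psi"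
  by (simp add: sum_distrib_right)
qed

lemma weight_power_le: "(B * (1 + norm (xi::real^'n))) ^ k <= exp (real k * B * (1 + norm xi))"
proof -
 have "B * (1 + norm xi) <= exp (B * (1 + norm xi))" using exp_ge_add_one_self[of "B * (1 + norm xi)"] by linarith
 then have "(B * (1 + norm xi)) ^ k <= exp (B * (1 + norm xi)) ^ k" using B by (intro power_mono) auto
 then show ?thesis by (simp add: exp_of_nat_mult[symmetric] mult.assoc)
qed

lemma E_integrable:
 assumes phi: "decay phi" and t: "t >= 0"
 shows "integrable lborel (%xi. E k t xi * phi xi)"
proof (rule Bochner_Integration.integrable_bound[OF S_pair(1)[OF decay_exp_weight[OF phi, of "real k * B"] t]])
 note [measurable] = decay_measurable[OF phi] E_meas[OF t]
 show "(%xi. E k t xi * phi xi) : borel_measurable lborel" by measurable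
 have "norm (E k t xi * phi xi) <= S t xi * (exp (real k * B * (1 + norm xi)) * norm (phi xi))" for xi
 proof -
  have "norm (E k t xi * phi xi) <= (B * (1 + norm xi)) ^ k * S t xi * norm (phi xi)"
   unfolding norm_mult by (intro mult_right_mono E_bound) simp
  also have "... <= exp (real k * B * (1 + norm xi)) * S t xi * norm (phi xi)"
   by (intro mult_right_mono weight_power_le) auto
  finally show ?thesis by (simp add: mult_ac)
 qed
 then show "AE xi in lborel. norm (E k t xi * phi xi) <= norm (S t xi * norm (of_real (exp (real k * B * (1 + norm xi))) * phi xi))"
  by (intro AE_I2) (simp add: norm_mult abs_mult)
qed

lemma E_high_integral:
 assumes phi: "poly_span (modulated y) phi" and t: "t >= 0"
 shows "(LINT xi|lborel. E (m + l) t xi * phi xi) = - (\<Sum>i<m. LINT xi|lborel. E (l + i) t xi * (a i xi * phi xi))"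
proof -
 have "E (m + l) t xi * phi xi = - (\<Sum>i<m. E (l + i) t xi * (a i xi * phi xi))" for xi
  unfolding E_high by (simp add: sum_distrib_left sum_distrib_right mult_ac)
 then have "(LINT xi|lborel. E (m + l) t xi * phi xi) = - (LINT xi|lborel. (\<Sum>i<m. E (l + i) t xi * (a i xi * phi xi)))" by simp
 also have "(LINT xi|lborel. (\<Sum>i<m. E (l + i) t xi * (a i xi * phi xi))) = (\<Sum>i<m. LINT xi|lborel. E (l + i) t xi * (a i xi * phi xi))"
  by (intro Bochner_Integration.integral_sum E_integrable t poly_span_decay[OF a_span[OF _ phi] decay_modulated]) simp
 finally show ?thesis .
qed

text \<open>Beyond the order of the equation, \<open>E k\<close> need not be square integrable. After the coefficients are moved to the test
function the derivatives reduce to those of lower order.\<close>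

lemma E_deriv:
 assumes "poly_span (modulated y) phi" "t >= 0"
 shows "((%t. LINT xi|lborel. E k t xi * phi xi) has_vector_derivative (LINT xi|lborel. E (Suc k) t xi * phi xi)) (at t within {0..})"
 using assms
proof (induction k arbitrary: phi rule: less_induct)
 case (less k)
 show ?case
 proof (cases "k < m")
  case True
  show ?thesis using V_deriv[OF less.prems(1) True less.prems(2)] unfolding E_low[OF True] E_def[symmetric] .
 next
  case False
  define l where "l = k - m"
  have k: "k = m + l" "Suc k = m + Suc l" using False by (auto simp: l_def)
  have "((%t. - (\<Sum>i<m. LINT xi|lborel. E (l + i) t xi * (a i xi * phi xi))) has_vector_derivative
    - (\<Sum>i<m. LINT xi|lborel. E (Suc (l + i)) t xi * (a i xi * phi xi))) (at t within {0..})"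
  proof (intro has_vector_derivative_minus has_vector_derivative_sum less.IH a_span less.prems)
   fix i assume "i : {..<m}"
   then show "l + i < k" "i < m" by (auto simp: k)
  qed
  also have "(\<Sum>i<m. LINT xi|lborel. E (Suc (l + i)) t xi * (a i xi * phi xi)) = - (LINT xi|lborel. E (Suc k) t xi * phi xi)"
   unfolding k(2) E_high_integral[OF less.prems] by simp
  finally have d: "((%t. - (\<Sum>i<m. LINT xi|lborel. E (l + i) t xi * (a i xi * phi xi))) has_vector_derivative (LINT xi|lborel. E (Suc k) t xi * phi xi)) (at t within {0..})"
   by simp
  show ?thesis
  proof (rule has_vector_derivative_transform[OF _ _ d])
   show "t : {0..}" using less.prems(2) by simp
   fix x :: real assume "x : {0..}"
   then show "(LINT xi|lborel. E k x xi * phi xi) = - (\<Sum>i<m. LINT xi|lborel. E (l + i) x xi * (a i xi * phi xi))"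
    unfolding k(1) by (intro E_high_integral[OF less.prems(1)]) simp
  qed
 qed
qed

lemma series_bounds: "norm (E k 0 xi) <= S 0 xi * (B * (1 + norm xi)) ^ k" "0 <= B * (1 + norm xi)"
 using E_bound[of k 0 xi] B by (auto simp: mult.commute)

text \<open>The remainder of the Taylor polynomial of order \<open>N\<close> is bounded by \<open>t^N / N!\<close> times a power of the frequency paired with
the test function, which tends to zero because the test function absorbs every exponential.\<close>

lemma taylor_series_limit:
 assumes phi: "poly_span (modulated y) phi" and t: "t >= 0"
 shows "(%N. \<Sum>k<N. of_real t ^ k / fact k * (LINT xi|lborel. E (j + k) 0 xi * phi xi)) \<longlonglongrightarrow> (LINT xi|lborel. E j t xi * phi xi)"
proof -
 have d: "decay phi" by (rule poly_span_decay[OF phi decay_modulated])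
 define h where "h k s = (LINT xi|lborel. E (j + k) s xi * phi xi)" for k s
 have hd: "(h k has_vector_derivative h (Suc k) s) (at s within {0..})" if "s >= 0" for k s
  using E_deriv[OF phi that, of "j + k"] by (simp add: h_def[abs_def])
 obtain M0 where M0: "M0 >= 0" "ALL k<m. ALL s. 0 <= s --> s <= t --> Lp_norm 2 (V k s) <= M0" using V_bound by blast
 (* The factor 2 in c below produces (1/2)^N; tau replaces t so that dividing by tau^N is harmless at t = 0. *)
 define tau where "tau = t + 1"
 have tau: "tau > 0" using t by (simp add: tau_def)
 define c where "c = real j * B + 2 * tau * B"
 define psi where "psi xi = of_real (exp (c * (1 + norm xi))) * phi xi" for xi
 have psi: "decay psi" unfolding psi_def[abs_def] by (rule decay_exp_weight[OF d])
 define K where "K = (\<Sum>i<m. M0) * Lp_norm 2 psi"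
 have hb: "norm (h N s) <= (1/2) ^ N * (fact N / tau ^ N) * K" if s: "0 <= s" "s <= t" for N s
 proof -
  have "norm (h N s) <= (LINT xi|lborel. norm (E (j + N) s xi * phi xi))" unfolding h_def by (rule integral_norm_bound)
  also have "... <= (LINT xi|lborel. (1/2) ^ N * (fact N / tau ^ N) * (S s xi * norm (psi xi)))"
  proof (rule Bochner_Integration.integral_mono')
   show "integrable lborel (%xi. (1/2) ^ N * (fact N / tau ^ N) * (S s xi * norm (psi xi)))"
    by (intro integrable_mult_right S_pair(1)[OF psi s(1)])
   fix xi :: "real^'n"
   show "0 <= (1/2) ^ N * (fact N / tau ^ N) * (S s xi * norm (psi xi))" using tau by simp
   let ?r = "1 + norm xi"
   have "(B * ?r) ^ N = (1/2) ^ N * (fact N / tau ^ N) * ((2 * tau * B * ?r) ^ N / fact N)"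
    using tau by (simp add: power_mult_distrib power_divide)
   also have "... <= (1/2) ^ N * (fact N / tau ^ N) * exp (2 * tau * B * ?r)"
    using tau B by (intro mult_left_mono power_fact_le_exp) auto
   finally have "(B * ?r) ^ j * (B * ?r) ^ N <= exp (real j * B * ?r) * ((1/2) ^ N * (fact N / tau ^ N) * exp (2 * tau * B * ?r))"
    using B by (intro mult_mono weight_power_le) auto
   also have "... = (1/2) ^ N * (fact N / tau ^ N) * exp (c * ?r)"
    by (simp add: c_def distrib_right exp_add)
   finally have w: "(B * ?r) ^ (j + N) <= (1/2) ^ N * (fact N / tau ^ N) * exp (c * ?r)" by (simp add: power_add)
   have "norm (E (j + N) s xi * phi xi) <= (B * ?r) ^ (j + N) * S s xi * norm (phi xi)"
    unfolding norm_mult by (intro mult_right_mono E_bound) simp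
   also have "... <= (1/2) ^ N * (fact N / tau ^ N) * exp (c * ?r) * S s xi * norm (phi xi)"
    by (intro mult_right_mono w) auto
   finally show "norm (E (j + N) s xi * phi xi) <= (1/2) ^ N * (fact N / tau ^ N) * (S s xi * norm (psi xi))"
    by (simp add: psi_def norm_mult mult_ac)
  qed
  also have "... = (1/2) ^ N * (fact N / tau ^ N) * (LINT xi|lborel. S s xi * norm (psi xi))" by simp
  also have "... <= (1/2) ^ N * (fact N / tau ^ N) * K"
  proof (intro mult_left_mono)
   have "(LINT xi|lborel. S s xi * norm (psi xi)) <= (\<Sum>j<m. Lp_norm 2 (V j s)) * Lp_norm 2 psi" by (rule S_pair(2)[OF psi s(1)])
   also have "... <= K" unfolding K_def by (intro mult_right_mono sum_mono) (use M0 s in auto)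
   finally show "(LINT xi|lborel. S s xi * norm (psi xi)) <= K" .
  qed (use tau in auto)
  finally show ?thesis .
 qed
 have K: "K >= 0" using M0 by (simp add: K_def)
 have tb: "norm (h 0 t - (\<Sum>k<N. of_real t ^ k / fact k * h k 0)) <= K * (1/2) ^ N" for N
 proof -
  have "norm (h 0 t - (\<Sum>k<N. of_real t ^ k / fact k * h k 0)) <= (1/2) ^ N * (fact N / tau ^ N) * K * t ^ N / fact N"
   by (rule taylor_bound[where h = h, OF hd hb]) (use t in auto)
  also have "... = K * (1/2) ^ N * (t / tau) ^ N" by (simp add: power_divide)
  also have "... <= K * (1/2) ^ N * 1"
   using t tau K by (intro mult_left_mono power_le_one) (auto simp: tau_def)
  finally show ?thesis by simp
 qed
 have "(%N. K * (1/2) ^ N) \<longlonglongrightarrow> K * 0" by (intro tendsto_mult_left LIMSEQ_power_zero) simp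
 then have "(%N. h 0 t - (\<Sum>k<N. of_real t ^ k / fact k * h k 0)) \<longlonglongrightarrow> 0"
  by (intro Lim_null_comparison[OF always_eventually[OF allI[OF tb]]]) simp
 then have "(%N. h 0 t - (h 0 t - (\<Sum>k<N. of_real t ^ k / fact k * h k 0))) \<longlonglongrightarrow> h 0 t - 0"
  by (intro tendsto_diff tendsto_const)
 then show ?thesis by (simp add: h_def)
qed

lemma mode_series_pairing:
 assumes phi: "poly_span (modulated y) phi" and t: "t >= 0"
 shows "integrable lborel (%xi. mode_series (%k. E k 0 xi) j t * phi xi)"
  and "(LINT xi|lborel. mode_series (%k. E k 0 xi) j t * phi xi) = (LINT xi|lborel. E j t xi * phi xi)"
proof -
 have d: "decay phi" by (rule poly_span_decay[OF phi decay_modulated])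
 note [measurable] = decay_measurable[OF d] E_meas[OF order_refl]
 define c where "c = real j * B + t * B"
 define psi where "psi xi = of_real (exp (c * (1 + norm xi))) * phi xi" for xi
 have psi: "decay psi" unfolding psi_def[abs_def] by (rule decay_exp_weight[OF d])
 let ?s = "%N xi. (\<Sum>k<N. of_real t ^ k / fact k * (E (j + k) 0 xi * phi xi))"
 have lim: "AE xi in lborel. (%N. ?s N xi) \<longlonglongrightarrow> mode_series (%k. E k 0 xi) j t * phi xi"
 proof (rule AE_I2)
  fix xi :: "real^'n"
  have "(%k. E (j + k) 0 xi / fact k * of_real t ^ k) sums mode_series (%k. E k 0 xi) j t"
   unfolding mode_series_def by (rule summable_sums, rule mode_series_summable[OF series_bounds])
  then have "(%k. E (j + k) 0 xi / fact k * of_real t ^ k * phi xi) sums (mode_series (%k. E k 0 xi) j t * phi xi)"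
   by (rule sums_mult2)
  then show "(%N. ?s N xi) \<longlonglongrightarrow> mode_series (%k. E k 0 xi) j t * phi xi"
   unfolding sums_def by (simp add: mult_ac)
 qed
 have bd: "AE xi in lborel. norm (?s N xi) <= S 0 xi * norm (psi xi)" for N
 proof (rule AE_I2)
  fix xi :: "real^'n"
  let ?R = "B * (1 + norm xi)"
  have R: "?R >= 0" using B by simp
  have "norm (?s N xi) <= (\<Sum>k<N. norm (of_real t ^ k / fact k * (E (j + k) 0 xi * phi xi)))" by (rule norm_sum)
  also have "... <= (\<Sum>k<N. (t * ?R) ^ k / fact k * (?R ^ j * S 0 xi * norm (phi xi)))"
  proof (rule sum_mono)
   fix k
   have "norm (of_real t ^ k / fact k * (E (j + k) 0 xi * phi xi)) = t ^ k / fact k * (norm (E (j + k) 0 xi) * norm (phi xi))"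
    using t by (simp add: norm_mult norm_divide norm_power)
   also have "... <= t ^ k / fact k * (?R ^ (j + k) * S 0 xi * norm (phi xi))"
    using t by (intro mult_left_mono mult_right_mono E_bound) auto
   finally show "norm (of_real t ^ k / fact k * (E (j + k) 0 xi * phi xi)) <= (t * ?R) ^ k / fact k * (?R ^ j * S 0 xi * norm (phi xi))"
    by (simp only: power_add power_mult_distrib times_divide_eq_left times_divide_eq_right mult_ac)
  qed
  also have "... = (\<Sum>k<N. (t * ?R) ^ k / fact k) * (?R ^ j * S 0 xi * norm (phi xi))" by (simp only: sum_distrib_right)
  also have "... <= exp (t * ?R) * (exp (real j * B * (1 + norm xi)) * S 0 xi * norm (phi xi))"
   by (intro mult_mono exp_partial_sum_le mult_right_mono weight_power_le) (use t R in auto)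
  also have "... = S 0 xi * norm (psi xi)"
  proof -
   have ee: "exp (c * (1 + norm xi)) = exp (t * ?R) * exp (real j * B * (1 + norm xi))"
    unfolding c_def exp_add[symmetric] by (simp add: algebra_simps)
   show ?thesis unfolding psi_def norm_mult norm_of_real ee by (simp add: mult_ac)
  qed
  finally show "norm (?s N xi) <= S 0 xi * norm (psi xi)" .
 qed
 have m1: "(%xi. mode_series (%k. E k 0 xi) j t * phi xi) : borel_measurable lborel"
  unfolding mode_series_def by measurable
 have m2: "?s N : borel_measurable lborel" for N by measurable
 note w = S_pair(1)[OF psi order_refl]
 show "integrable lborel (%xi. mode_series (%k. E k 0 xi) j t * phi xi)"
  by (rule integrable_dominated_convergence[OF m1 m2 w lim bd])
 have "(%N. LINT xi|lborel. ?s N xi) \<longlonglongrightarrow> (LINT xi|lborel. mode_series (%k. E k 0 xi) j t * phi xi)"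
  by (rule integral_dominated_convergence[OF m1 m2 w lim bd])
 moreover have "(LINT xi|lborel. ?s N xi) = (\<Sum>k<N. of_real t ^ k / fact k * (LINT xi|lborel. E (j + k) 0 xi * phi xi))" for N
  by (subst Bochner_Integration.integral_sum) (auto intro!: integrable_mult_right E_integrable d)
 ultimately show "(LINT xi|lborel. mode_series (%k. E k 0 xi) j t * phi xi) = (LINT xi|lborel. E j t xi * phi xi)"
  using LIMSEQ_unique taylor_series_limit[OF phi t] by (simp only:) blast
qed

end

lemma modulated_pairing_injective:
 fixes D :: "real^'n::finite => complex"
 assumes i: "!!y. integrable lborel (%xi. D xi * modulated y xi)" and z: "!!y. (LINT xi|lborel. D xi * modulated y xi) = 0"
 shows "AE xi in lborel. D xi = 0"
proof -
 have "AE xi in lborel. D xi * of_real (gauss (1/2) xi) = 0"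
 proof (rule ft_injective)
  show "integrable lborel (%xi. D xi * of_real (gauss (1/2) xi))" using i[of 0] by (simp add: modulated_def)
  show "(LINT xi|lborel. D xi * of_real (gauss (1/2) xi) * cis (xi \<bullet> y)) = 0" for y
   using z[of y] by (simp add: modulated_def mult.assoc)
 qed
 then show ?thesis by eventually_elim (use gauss_pos in \<open>auto simp: less_le\<close>)
qed

context mode_problem begin

theorem E_series:
 assumes t: "t >= 0"
 shows "AE xi in lborel. E j t xi = mode_series (%k. E k 0 xi) j t"
proof -
 have "AE xi in lborel. E j t xi - mode_series (%k. E k 0 xi) j t = 0"
 proof (rule modulated_pairing_injective)
  fix y
  note b = poly_span.base[of "modulated y"]
  note i = E_integrable[OF decay_modulated[of y] t, of j] mode_series_pairing(1)[OF b t, of j]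
  show "integrable lborel (%xi. (E j t xi - mode_series (%k. E k 0 xi) j t) * modulated y xi)"
   using Bochner_Integration.integrable_diff[OF i] by (simp add: left_diff_distrib)
  show "(LINT xi|lborel. (E j t xi - mode_series (%k. E k 0 xi) j t) * modulated y xi) = 0"
   using i mode_series_pairing(2)[OF b t, of j] by (simp add: left_diff_distrib)
 qed
 then show ?thesis by simp
qed

end

section \<open>From the Cauchy problem to ordinary differential equations\<close>

text \<open>Membership in the Sobolev space with an explicit representative \<open>F\<close> of the Fourier transform; unlike for
\<open>fourier\<close>, linear combinations hold exactly and not only almost everywhere.\<close>

definition sobolev_ft :: "real => (real^'n => complex) => (real^'n => complex) => bool" where
 "sobolev_ft \<sigma> f F \<longleftrightarrow> is_fourier f F & bessel_weighted \<sigma> F : Lp 2"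

lemma bessel_weighted_measurable [measurable]:
 "g : borel_measurable borel ==> bessel_weighted \<sigma> g : borel_measurable borel"
 unfolding bessel_weighted_def[abs_def] by measurable

lemma norm_bessel_weighted: "norm (bessel_weighted \<sigma> g xi) = (1 + (norm xi)^2) powr (\<sigma> / 2) * norm (g xi)"
 by (simp add: bessel_weighted_def norm_mult)

lemma bessel_weighted_mono: "\<sigma>' <= \<sigma> ==> norm (bessel_weighted \<sigma>' g xi) <= norm (bessel_weighted \<sigma> g xi)"
 unfolding norm_bessel_weighted by (intro mult_right_mono powr_mono) auto

lemma bessel_weighted_zero: "bessel_weighted 0 g = g"
proof
 fix xi :: "real^'a"
 have "1 + (norm xi)^2 > 0" by (rule add_pos_nonneg) auto
 then show "bessel_weighted 0 g xi = g xi" by (simp add: bessel_weighted_def)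
qed

lemma sobolev_sobolev_ft:
 assumes f: "f : sobolev \<sigma>" and le: "\<sigma>' <= \<sigma>"
 shows "sobolev_ft \<sigma>' f (fourier f)"
proof -
 have h: "is_fourier f (fourier f)" "bessel_weighted \<sigma> (fourier f) : Lp 2" using f by (auto simp: sobolev_def)
 have m: "fourier f : borel_measurable borel" using Lp2_measurable[OF is_fourier_Lp2(2)[OF h(1)]] by simp
 have "bessel_weighted \<sigma>' (fourier f) : Lp 2"
  by (rule Lp2_dominated[OF _ h(2) bessel_weighted_mono[OF le]]) (use m in simp)
 then show ?thesis using h by (simp add: sobolev_ft_def)
qed

lemma sobolev_ft_lincomb:
 assumes "sobolev_ft \<sigma> f F" "sobolev_ft \<sigma> g G"
 shows "sobolev_ft \<sigma> (%x. a * f x + b * g x) (%x. a * F x + b * G x)"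
proof -
 have "bessel_weighted \<sigma> (%x. a * F x + b * G x) = (%x. a * bessel_weighted \<sigma> F x + b * bessel_weighted \<sigma> G x)"
  by (auto simp: bessel_weighted_def algebra_simps)
 then show ?thesis using assms unfolding sobolev_ft_def by (auto intro!: is_fourier_lincomb Lp2_add Lp2_cmult)
qed

lemma sobolev_norm_eq:
 assumes "sobolev_ft \<sigma> f F"
 shows "sobolev_norm \<sigma> f = Lp_norm 2 (bessel_weighted \<sigma> F)"
proof -
 have F: "is_fourier f F" "bessel_weighted \<sigma> F : Lp 2" using assms by (auto simp: sobolev_ft_def)
 have G: "is_fourier f (fourier f)" by (rule is_fourier_fourier[OF F(1)])
 have [measurable]: "fourier f : borel_measurable borel" using Lp2_measurable[OF is_fourier_Lp2(2)[OF G]] by simp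
 have "AE x in lborel. F x = fourier f x" by (rule is_fourier_unique[OF F(1) G])
 then have "AE x in lborel. bessel_weighted \<sigma> F x = bessel_weighted \<sigma> (fourier f) x"
  by eventually_elim (simp add: bessel_weighted_def)
 from Lp2_cong_AE(2)[OF F(2) _ this] show ?thesis by (simp add: sobolev_norm_def)
qed

lemma Lp_norm_le_sobolev_norm:
 assumes F: "sobolev_ft \<sigma> f F" and \<sigma>: "\<sigma> >= 0"
 shows "Lp_norm 2 F <= sobolev_norm \<sigma> f"
 unfolding sobolev_norm_eq[OF F]
proof (rule Lp_norm2_mono)
 show "F : borel_measurable lborel" by (rule Lp2_measurable[OF is_fourier_Lp2(2)[of f]]) (use F in \<open>simp add: sobolev_ft_def\<close>)
 show "bessel_weighted \<sigma> F : Lp 2" using F by (simp add: sobolev_ft_def)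
 fix x show "norm (F x) <= norm (bessel_weighted \<sigma> F x)"
  using bessel_weighted_mono[OF \<sigma>, of F x] by (simp add: bessel_weighted_zero)
qed

lemma eventually_within: "(!!x. x : S ==> x ~= a ==> P x) ==> eventually P (at a within S)"
 by (auto simp: eventually_at_filter)

lemma at_within_atLeast_neq_bot:
 fixes t :: real
 assumes "t >= 0"
 shows "at t within {0..} ~= bot"
proof
 assume "at t within {0..} = bot"
 moreover have "at_right t <= at t within {0..}" using assms by (intro at_le) auto
 ultimately have "at_right t = bot" by (simp add: bot_unique)
 then show False by simp
qed

text \<open>Consequences of \<open>time_derivatives\<close> for the Fourier transforms: since the weights are at least 1, continuity and
differentiability hold in \<open>L^2\<close>.\<close>

locale time_family =
 fixes s0 :: real and u :: "real => real^'n::finite => complex" and U :: "nat => real => real^'n => complex"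
 assumes td: "time_derivatives s0 u U"
begin

definition V :: "nat => real => real^'n => complex" where "V k t = fourier (U k t)"

lemma U_sobolev: "real k <= s0 ==> t >= 0 ==> U k t : sobolev (s0 - real k)"
 using td unfolding time_derivatives_def by blast

lemma V_ft: "real k <= s0 ==> t >= 0 ==> \<sigma> <= s0 - real k ==> sobolev_ft \<sigma> (U k t) (V k t)"
 unfolding V_def by (rule sobolev_sobolev_ft[OF U_sobolev])

lemma V_fourier: "real k <= s0 ==> t >= 0 ==> is_fourier (U k t) (V k t)"
 using V_ft[of k t "s0 - real k"] by (simp add: sobolev_ft_def)

lemma V_Lp2: "real k <= s0 ==> t >= 0 ==> V k t : Lp 2"
 by (rule is_fourier_Lp2(2)[OF V_fourier])

lemma V_continuous:
 assumes k: "real k <= s0" and t: "t >= 0"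
 shows "((%tau. Lp_norm 2 (%xi. V k tau xi - V k t xi)) \<longlongrightarrow> 0) (at t within {0..})"
proof (rule Lim_null_comparison)
 show "((%tau. sobolev_norm (s0 - real k) (%x. U k tau x - U k t x)) \<longlongrightarrow> 0) (at t within {0..})"
  using td k t unfolding time_derivatives_def by blast
 show "\<forall>\<^sub>F tau in at t within {0..}. norm (Lp_norm 2 (%xi. V k tau xi - V k t xi)) <= sobolev_norm (s0 - real k) (%x. U k tau x - U k t x)"
 proof (rule eventually_within)
  fix tau :: real assume "tau : {0..}"
  then have tau: "tau >= 0" by simp
  have "sobolev_ft (s0 - real k) (%x. 1 * U k tau x + (-1) * U k t x) (%xi. 1 * V k tau xi + (-1) * V k t xi)"
   by (intro sobolev_ft_lincomb V_ft k t tau) auto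
  then have "sobolev_ft (s0 - real k) (%x. U k tau x - U k t x) (%xi. V k tau xi - V k t xi)" by simp
  from Lp_norm_le_sobolev_norm[OF this] k
  show "norm (Lp_norm 2 (%xi. V k tau xi - V k t xi)) <= sobolev_norm (s0 - real k) (%x. U k tau x - U k t x)" by simp
 qed
qed

lemma V_quotient:
 assumes k: "real (Suc k) <= s0" and t: "t >= 0"
 shows "((%tau. Lp_norm 2 (%xi. (V k tau xi - V k t xi) / of_real (tau - t) - V (Suc k) t xi)) \<longlongrightarrow> 0) (at t within {0..})"
proof (rule Lim_null_comparison)
 let ?\<sigma> = "s0 - real (Suc k)"
 show "((%tau. sobolev_norm ?\<sigma> (%x. (U k tau x - U k t x) / of_real (tau - t) - U (Suc k) t x)) \<longlongrightarrow> 0) (at t within {0..})"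
  using td k t unfolding time_derivatives_def by blast
 show "\<forall>\<^sub>F tau in at t within {0..}. norm (Lp_norm 2 (%xi. (V k tau xi - V k t xi) / of_real (tau - t) - V (Suc k) t xi))
   <= sobolev_norm ?\<sigma> (%x. (U k tau x - U k t x) / of_real (tau - t) - U (Suc k) t x)"
 proof (rule eventually_within)
  fix tau :: real assume "tau : {0..}"
  then have tau: "tau >= 0" by simp
  define r where "r = 1 / complex_of_real (tau - t)"
  have k': "real k <= s0" "?\<sigma> <= s0 - real k" using k by auto
  have "sobolev_ft ?\<sigma> (%x. 1 * (r * U k tau x + (- r) * U k t x) + (-1) * U (Suc k) t x)
   (%xi. 1 * (r * V k tau xi + (- r) * V k t xi) + (-1) * V (Suc k) t xi)"
   by (intro sobolev_ft_lincomb V_ft k k' t tau) auto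
  moreover have "1 * (r * x + (- r) * y) + (-1) * z = (x - y) / complex_of_real (tau - t) - z" for x y z
   by (simp add: r_def diff_divide_distrib)
  ultimately have "sobolev_ft ?\<sigma> (%x. (U k tau x - U k t x) / of_real (tau - t) - U (Suc k) t x) (%xi. (V k tau xi - V k t xi) / of_real (tau - t) - V (Suc k) t xi)"
   by (simp only:)
  from Lp_norm_le_sobolev_norm[OF this] k
  show "norm (Lp_norm 2 (%xi. (V k tau xi - V k t xi) / of_real (tau - t) - V (Suc k) t xi))
   <= sobolev_norm ?\<sigma> (%x. (U k tau x - U k t x) / of_real (tau - t) - U (Suc k) t x)" by simp
 qed
qed

lemma V_weak_deriv:
 assumes k: "real (Suc k) <= s0" and t: "t >= 0" and phi: "phi : Lp 2"
 shows "((%t. LINT xi|lborel. V k t xi * phi xi) has_vector_derivative (LINT xi|lborel. V (Suc k) t xi * phi xi)) (at t within {0..})"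
 unfolding has_vector_derivative_def has_derivative_iff_norm
proof (intro conjI bounded_linear_scaleR_left)
 let ?f = "%t. LINT xi|lborel. V k t xi * phi xi" and ?D = "LINT xi|lborel. V (Suc k) t xi * phi xi"
 let ?Q = "%tau xi. (V k tau xi - V k t xi) / of_real (tau - t) - V (Suc k) t xi"
 have k': "real k <= s0" using k by simp
 show "((%tau. norm (?f tau - ?f t - (tau - t) *\<^sub>R ?D) / norm (tau - t)) \<longlongrightarrow> 0) (at t within {0..})"
 proof (rule Lim_null_comparison)
  show "((%tau. Lp_norm 2 (?Q tau) * Lp_norm 2 phi) \<longlongrightarrow> 0) (at t within {0..})"
   using tendsto_mult_right[OF V_quotient[OF k t], of "Lp_norm 2 phi"] by simp
  show "\<forall>\<^sub>F tau in at t within {0..}. norm (norm (?f tau - ?f t - (tau - t) *\<^sub>R ?D) / norm (tau - t)) <= Lp_norm 2 (?Q tau) * Lp_norm 2 phi"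
  proof (rule eventually_within)
   fix tau :: real assume "tau : {0..}" and ne: "tau ~= t"
   then have tau: "tau >= 0" by simp
   have Q: "?Q tau : Lp 2"
   proof -
    have "?Q tau = (%xi. (1 / of_real (tau - t)) * (V k tau xi - V k t xi) - V (Suc k) t xi)" by (simp add: divide_inverse mult.commute)
    then show ?thesis by (simp only:) (intro Lp2_diff Lp2_cmult V_Lp2 k k' t tau)
   qed
   note i = Cauchy_Schwarz_Lp2(1)[OF V_Lp2[OF k' tau] phi] Cauchy_Schwarz_Lp2(1)[OF V_Lp2[OF k' t] phi] Cauchy_Schwarz_Lp2(1)[OF V_Lp2[OF k t] phi]
   have "?f tau - ?f t - (tau - t) *\<^sub>R ?D = (LINT xi|lborel. V k tau xi * phi xi - V k t xi * phi xi - (tau - t) *\<^sub>R (V (Suc k) t xi * phi xi))"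
    using i by (simp only: Bochner_Integration.integral_diff Bochner_Integration.integrable_diff integrable_scaleR_right integral_scaleR_right)
   also have "... = (LINT xi|lborel. (tau - t) *\<^sub>R (?Q tau xi * phi xi))"
    using ne by (intro Bochner_Integration.integral_cong) (auto simp: scaleR_conv_of_real field_simps)
   also have "... = (tau - t) *\<^sub>R (LINT xi|lborel. ?Q tau xi * phi xi)" by (rule integral_scaleR_right)
   finally have "norm (?f tau - ?f t - (tau - t) *\<^sub>R ?D) / norm (tau - t) = norm (LINT xi|lborel. ?Q tau xi * phi xi)"
    using ne by (simp only: norm_scaleR) simp
   also have "... <= Lp_norm 2 (?Q tau) * Lp_norm 2 phi" by (rule Cauchy_Schwarz_Lp2(2)[OF Q phi])
   finally show "norm (norm (?f tau - ?f t - (tau - t) *\<^sub>R ?D) / norm (tau - t)) <= Lp_norm 2 (?Q tau) * Lp_norm 2 phi" by simp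
  qed
 qed
qed

lemma V_locally_bounded:
 assumes k: "real k <= s0"
 shows "EX M>=0. ALL t. 0 <= t --> t <= T --> Lp_norm 2 (V k t) <= M"
proof -
 have "EX delta>(0::real). ALL t:{0..T}. Lp_norm 2 (V k t) <= 1 / delta"
 proof (rule compact_uniform[OF compact_Icc])
  fix x :: real assume x: "x : {0..T}"
  let ?c = "Lp_norm 2 (V k x)"
  have "\<forall>\<^sub>F tau in at x within {0..}. Lp_norm 2 (%xi. V k tau xi - V k x xi) < 1"
   using order_tendstoD(2)[OF V_continuous[OF k, of x], of 1] x by simp
  then obtain e where e: "e > 0" "ALL tau:{0..}. tau ~= x & dist tau x < e --> Lp_norm 2 (%xi. V k tau xi - V k x xi) < 1"
   unfolding eventually_at by blast
  have "Lp_norm 2 (V k tau) <= 2 + 2 * ?c" if tau: "tau : {0..T}" "dist x tau < e" for tau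
  proof (cases "tau = x")
   case True
   then show ?thesis using Lp_norm_nonneg[of 2 "V k x"] by simp
  next
   case False
   let ?d = "Lp_norm 2 (%xi. V k tau xi - V k x xi)"
   have d: "?d < 1" using e(2) tau False by (simp add: dist_commute)
   have L: "V k tau : Lp 2" "V k x : Lp 2" "(%xi. V k tau xi - V k x xi) : Lp 2"
    using tau x by (auto intro!: Lp2_diff V_Lp2 k)
   have "(Lp_norm 2 (V k tau))^2 = (LINT xi|lborel. (norm (V k tau xi))^2)" by (simp add: Lp_norm2)
   also have "... <= (LINT xi|lborel. 2 * (norm (V k tau xi - V k x xi))^2 + 2 * (norm (V k x xi))^2)"
   proof (rule Bochner_Integration.integral_mono)
    fix xi show "(norm (V k tau xi))^2 <= 2 * (norm (V k tau xi - V k x xi))^2 + 2 * (norm (V k x xi))^2"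
     using norm_add_sq[of "V k tau xi - V k x xi" "V k x xi"] by simp
   qed (use L in \<open>auto simp: Lp2_iff\<close>)
   also have "... = 2 * ?d\<^sup>2 + 2 * ?c\<^sup>2" using L by (simp add: Lp_norm2 Lp2_iff)
   also have "... <= (2 + 2 * ?c)^2"
   proof -
    have "?d\<^sup>2 <= 1" using d by (simp add: power_le_one)
    moreover have "0 <= ?c" by simp
    moreover have "0 <= ?c\<^sup>2" by simp
    moreover have "(2 + 2 * ?c)^2 = 4 + 8 * ?c + 4 * ?c\<^sup>2" by (simp add: power2_eq_square algebra_simps)
    ultimately show ?thesis by linarith
   qed
   finally show ?thesis by (rule power2_le_imp_le) simp
  qed
  moreover have "2 + 2 * ?c > 0" by (simp add: add_pos_nonneg)
  ultimately show "EX delta>0. EX \<epsilon>>0. ALL y:{0..T}. dist x y < \<epsilon> --> Lp_norm 2 (V k y) <= 1 / delta"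
   using e(1) by (intro exI[of _ "1 / (2 + 2 * ?c)"] exI[of _ e] conjI) auto
 next
  fix delta delta' y assume "Lp_norm 2 (V k y) <= 1 / delta" "0 < delta'" "delta' <= (delta::real)"
  moreover have "1 / delta <= 1 / delta'" using calculation by (intro divide_left_mono) auto
  ultimately show "Lp_norm 2 (V k y) <= 1 / delta'" by linarith
 qed
 then obtain delta where "delta > 0" "ALL t:{0..T}. Lp_norm 2 (V k t) <= 1 / delta" by blast
 then show ?thesis by (intro exI[of _ "1 / delta"]) auto
qed

lemma time_deriv_pairing:
 assumes phi: "poly_span (modulated y) phi" and k: "real k <= s0" and t: "t >= 0"
 shows "time_deriv k (pairing u (ft phi)) t = (LINT xi|lborel. V k t xi * phi xi)"
 using k t
proof (induction k arbitrary: t)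
 case 0
 have d: "decay phi" "decay (ft phi)"
  using poly_span_decay[OF phi decay_modulated] poly_span_decay[OF ft_poly_span[OF phi] decay_translated] by auto
 have u: "u = U 0" using td by (simp add: time_derivatives_def)
 note F = V_fourier[of 0, OF _ 0(2)]
 show ?case
  unfolding time_deriv_def pairing_def u using 0
  by (simp, intro is_fourier_pairing[OF F] decay_integrable d Cauchy_Schwarz_Lp2(1)[OF is_fourier_Lp2(1)[OF F]]) auto
next
 case (Suc k)
 have phi2: "phi : Lp 2" using decay_integrable(2)[OF poly_span_decay[OF phi decay_modulated]] .
 have "(time_deriv k (pairing u (ft phi)) has_vector_derivative (LINT xi|lborel. V (Suc k) t xi * phi xi)) (at t within {0..})"
  by (rule has_vector_derivative_transform[OF _ _ V_weak_deriv[OF _ _ phi2]]) (use Suc in auto)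
 from vector_derivative_within[OF at_within_atLeast_neq_bot[OF Suc.prems(2)] this]
 show ?case by (simp add: time_deriv_def)
qed

end

lemma poly_span_sum:
 assumes "finite I" "!!i. i : I ==> poly_span b (f i)"
 shows "poly_span b (%xi. \<Sum>i\<in>I. f i xi)"
 using assms
proof (induction I)
 case empty
 show ?case using poly_span.scale[OF poly_span.base, of b 0] by simp
next
 case (insert i I)
 then show ?case using poly_span.add[of b "f i" "%xi. \<Sum>i\<in>I. f i xi"] by simp
qed

lemma norm_mpow_le: "\<bar>mpow xi alpha\<bar> <= norm xi ^ msize (alpha :: 'n::finite mindex)"
proof -
 have "\<bar>mpow xi alpha\<bar> = (\<Prod>i\<in>UNIV. \<bar>xi $ i\<bar> ^ alpha i)" by (simp add: mpow_def abs_prod power_abs)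
 also have "... <= (\<Prod>i\<in>UNIV. norm xi ^ alpha i)"
  by (intro prod_mono conjI power_mono component_le_norm_cart) auto
 also have "... = norm xi ^ msize alpha" by (simp add: msize_def power_sum)
 finally show ?thesis .
qed

lemma fsym_span:
 assumes Q: "finite (opsupp Q)" and phi: "poly_span b phi"
 shows "poly_span b (%xi. fsym Q i xi * phi xi)"
proof -
 have "fsym Q i xi * phi xi = (\<Sum>p\<in>opsupp Q. (if fst p = i then Q (fst p) (snd p) * \<i> ^ msize (snd p) else 0) * of_real (mpow xi (snd p)) * phi xi)" for xi
  unfolding fsym_def opsupp_def sum_distrib_right by (intro sum.cong) auto
 then show ?thesis by (simp only:) (intro poly_span_sum Q poly_span_monomial phi)
qed

lemma fsym_measurable [measurable]: "fsym Q i : borel_measurable borel"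
proof -
 have [measurable]: "(%xi. mpow xi alpha) : borel_measurable borel" for alpha :: "'n::finite mindex"
  unfolding mpow_def by measurable
 show ?thesis unfolding fsym_def[abs_def] case_prod_beta' by measurable
qed

lemma fsym_bound:
 fixes Q :: "'n::finite operator"
 assumes Q: "finite (opsupp Q)" and ord: "!!k alpha. Q k alpha ~= 0 ==> k + msize alpha <= m"
 shows "norm (fsym Q i xi) <= (1 + (\<Sum>(j, alpha)\<in>opsupp Q. norm (Q j alpha))) * (1 + norm xi) ^ (m - i)"
proof -
 have "norm (fsym Q i xi) <= (\<Sum>(j, alpha)\<in>opsupp Q. norm (Q j alpha) * (1 + norm xi) ^ (m - i))"
  unfolding fsym_def opsupp_def
 proof (rule order.trans[OF norm_sum], rule sum_mono, clarsimp)
  fix alpha assume "Q i alpha ~= 0"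
  then have "msize alpha <= m - i" using ord[of i alpha] by simp
  then have "(1 + norm xi) ^ msize alpha <= (1 + norm xi) ^ (m - i)" by (rule power_increasing) simp
  moreover have "norm xi ^ msize alpha <= (1 + norm xi) ^ msize alpha" by (intro power_mono) auto
  ultimately have "\<bar>mpow xi alpha\<bar> <= (1 + norm xi) ^ (m - i)" using norm_mpow_le[of xi alpha] by linarith
  then show "norm (Q i alpha * \<i> ^ msize alpha * complex_of_real (mpow xi alpha)) <= norm (Q i alpha) * (1 + norm xi) ^ (m - i)"
   by (simp add: norm_mult norm_power mult_left_mono)
 qed
 also have "... = (\<Sum>(j, alpha)\<in>opsupp Q. norm (Q j alpha)) * (1 + norm xi) ^ (m - i)"
  by (simp add: sum_distrib_right case_prod_beta')
 also have "... <= (1 + (\<Sum>(j, alpha)\<in>opsupp Q. norm (Q j alpha))) * (1 + norm xi) ^ (m - i)"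
  by (intro mult_right_mono) auto
 finally show ?thesis .
qed

lemma msize_zero_iff: "msize alpha = 0 \<longleftrightarrow> alpha = (%_. 0)"
 by (auto simp: msize_def)

lemma fsym_top:
 fixes Q :: "'n::finite operator"
 assumes Q: "finite (opsupp Q)" and ord: "!!k alpha. Q k alpha ~= 0 ==> k + msize alpha <= m" and top: "Q m (%_. 0) = 1"
 shows "fsym Q m xi = 1"
proof -
 have "fsym Q m xi = (\<Sum>p\<in>opsupp Q. if p = (m, %_. 0) then 1 else 0)"
  unfolding fsym_def opsupp_def
 proof (rule sum.cong[OF refl])
  fix p assume "p : {(k, alpha). Q k alpha ~= 0}"
  then obtain k alpha where p: "p = (k, alpha)" and nz: "Q k alpha ~= 0" by (cases p) auto
  have "alpha = (%_. 0)" if "k = m" using ord[OF nz] that msize_zero_iff[of alpha] by simp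
  then show "(case p of (j, alpha) => if j = m then Q j alpha * \<i> ^ msize alpha * of_real (mpow xi alpha) else 0) = (if p = (m, %_. 0) then 1 else 0)"
   unfolding p using top by (cases "k = m") (auto simp: msize_def mpow_def)
 qed
 also have "... = 1" using Q top by (simp add: opsupp_def sum.delta)
 finally show ?thesis .
qed

context time_family begin

text \<open>The signs \<open>(-1)^|alpha|\<close> of the transposed operator and the factors \<open>(- \<i> xi)^alpha\<close> from differentiating the test function
combine to \<open>(\<i> xi)^alpha\<close>, the symbol on the frequency side.\<close>

lemma pde_weak:
 fixes Q :: "'n operator"
 assumes m: "m >= 1" and s0: "s0 >= real m - 1" and Q: "finite (opsupp Q)"
  and ord: "!!k alpha. Q k alpha ~= 0 ==> k + msize alpha <= m" and top: "Q m (%_. 0) = 1"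
  and pde: "satisfies_pde m Q u" and phi: "poly_span (modulated y) phi" and t: "t >= 0"
 shows "((%t. LINT xi|lborel. V (m - 1) t xi * phi xi) has_vector_derivative
  - (\<Sum>i<m. LINT xi|lborel. V i t xi * (fsym Q i xi * phi xi))) (at t within {0..})"
proof -
 let ?g = "pairing u (ft phi)"
 have sch: "schwartz (ft phi)" by (rule schwartz_poly_span[OF ft_poly_span[OF phi]])
 have ks: "real k <= s0" if "k < m" for k using that s0 by simp
 define d where "d = time_deriv m ?g t"
 have diff: "time_deriv (m - 1) ?g differentiable (at t within {0..})"
  using pde sch t m unfolding satisfies_pde_def by auto
 have msuc: "m = Suc (m - 1)" using m by simp
 have hv: "(time_deriv (m - 1) ?g has_vector_derivative d) (at t within {0..})"
 proof -
  have "d = vector_derivative (time_deriv (m - 1) ?g) (at t within {0..})"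
   unfolding d_def by (subst msuc) (simp add: time_deriv_def)
  then show ?thesis using diff vector_derivative_works by blast
 qed
 have "real (m - 1) <= s0" using m by (intro ks) simp
 note tp = time_deriv_pairing[OF phi this]
 have hd: "((%t. LINT xi|lborel. V (m - 1) t xi * phi xi) has_vector_derivative d) (at t within {0..})"
  by (rule has_vector_derivative_transform[OF _ _ hv]) (use t tp in auto)
 define I where "I j alpha = (LINT xi|lborel. V j t xi * (of_real (mpow xi alpha) * phi xi))" for j alpha
 have mono: "poly_span (modulated y) (%xi. (- \<i>) ^ msize alpha * of_real (mpow xi alpha) * phi xi)" for alpha
  by (rule poly_span_monomial[OF phi])
 (* Of the terms of order m in time only the pure derivative remains; d is its value. *)
 have tm: "Q k alpha * (- 1) ^ msize alpha * time_deriv k (pairing u (multi_deriv alpha (ft phi))) t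
  = (if k < m then Q k alpha * \<i> ^ msize alpha * I k alpha else 0) + (if (k, alpha) = (m, %_. 0) then d else 0)" if nz: "Q k alpha ~= 0" for k alpha
 proof (cases "k < m")
  case True
  have "time_deriv k (pairing u (multi_deriv alpha (ft phi))) t = (LINT xi|lborel. V k t xi * ((- \<i>) ^ msize alpha * of_real (mpow xi alpha) * phi xi))"
   unfolding multi_deriv_ft[OF phi] by (rule time_deriv_pairing[OF mono ks[OF True] t])
  also have "... = (LINT xi|lborel. (- \<i>) ^ msize alpha * (V k t xi * (of_real (mpow xi alpha) * phi xi)))"
   by (simp only: mult_ac)
  also have "... = (- \<i>) ^ msize alpha * I k alpha" unfolding I_def by simp
  finally have e: "time_deriv k (pairing u (multi_deriv alpha (ft phi))) t = (- \<i>) ^ msize alpha * I k alpha" .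
  have i: "\<i> ^ msize alpha = (- 1 :: complex) ^ msize alpha * (- \<i>) ^ msize alpha" by (subst power_mult_distrib[symmetric]) simp
  have "Q k alpha * (- 1) ^ msize alpha * ((- \<i>) ^ msize alpha * I k alpha) = Q k alpha * \<i> ^ msize alpha * I k alpha"
   unfolding i by (simp only: mult_ac)
  then show ?thesis using True unfolding e by simp
 next
  case False
  then have k: "k = m" "msize alpha = 0" using ord[OF nz] by auto
  then have alpha: "alpha = (%_. 0)" by (simp add: msize_zero_iff)
  have "multi_deriv (%_. 0) (ft phi) = ft phi"
   using multi_deriv_ft[OF phi, of "%_. 0"] by (simp add: msize_def mpow_def)
  then show ?thesis using k alpha top by (simp add: d_def msize_def)
 qed
 have "0 = (\<Sum>(k, alpha)\<in>opsupp Q. Q k alpha * (- 1) ^ msize alpha * time_deriv k (pairing u (multi_deriv alpha (ft phi))) t)"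
  using pde sch t unfolding satisfies_pde_def opsupp_def by auto
 also have "... = (\<Sum>p\<in>opsupp Q. (if fst p < m then Q (fst p) (snd p) * \<i> ^ msize (snd p) * I (fst p) (snd p) else 0) + (if p = (m, %_. 0) then d else 0))"
 proof (rule sum.cong[OF refl])
  fix p assume "p : opsupp Q"
  then obtain k alpha where p: "p = (k, alpha)" and nz: "Q k alpha ~= 0" by (cases p) (auto simp: opsupp_def)
  show "(case p of (k, alpha) => Q k alpha * (- 1) ^ msize alpha * time_deriv k (pairing u (multi_deriv alpha (ft phi))) t)
   = (if fst p < m then Q (fst p) (snd p) * \<i> ^ msize (snd p) * I (fst p) (snd p) else 0) + (if p = (m, %_. 0) then d else 0)"
   using tm[OF nz] unfolding p by simp
 qed
 also have "... = (\<Sum>p\<in>opsupp Q. if fst p < m then Q (fst p) (snd p) * \<i> ^ msize (snd p) * I (fst p) (snd p) else 0) + d"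
  using Q top by (simp add: sum.distrib sum.delta opsupp_def)
 also have "(\<Sum>p\<in>opsupp Q. if fst p < m then Q (fst p) (snd p) * \<i> ^ msize (snd p) * I (fst p) (snd p) else 0)
  = (\<Sum>p\<in>opsupp Q. \<Sum>i<m. if fst p = i then Q (fst p) (snd p) * \<i> ^ msize (snd p) * I i (snd p) else 0)"
  by (intro sum.cong refl) (simp add: sum.delta)
 also have "... = (\<Sum>i<m. \<Sum>p\<in>opsupp Q. if fst p = i then Q (fst p) (snd p) * \<i> ^ msize (snd p) * I i (snd p) else 0)"
  by (rule sum.swap)
 also have "... = (\<Sum>i<m. LINT xi|lborel. V i t xi * (fsym Q i xi * phi xi))"
 proof (rule sum.cong[OF refl])
  fix i assume "i : {..<m}"
  then have i: "i < m" by simp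
  let ?c = "%p. if fst p = i then Q (fst p) (snd p) * \<i> ^ msize (snd p) else 0"
  have int: "integrable lborel (%xi. V i t xi * (of_real (mpow xi alpha) * phi xi))" for alpha
   using Cauchy_Schwarz_Lp2(1)[OF V_Lp2[OF ks[OF i] t] decay_integrable(2)[OF poly_span_decay[OF poly_span_monomial[OF phi, of 1 alpha] decay_modulated]]]
   by simp
  have "V i t xi * (fsym Q i xi * phi xi) = (\<Sum>p\<in>opsupp Q. ?c p * (V i t xi * (of_real (mpow xi (snd p)) * phi xi)))" for xi
   unfolding fsym_def opsupp_def sum_distrib_left sum_distrib_right by (intro sum.cong) auto
  then have "(LINT xi|lborel. V i t xi * (fsym Q i xi * phi xi)) = (LINT xi|lborel. (\<Sum>p\<in>opsupp Q. ?c p * (V i t xi * (of_real (mpow xi (snd p)) * phi xi))))"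
   by (simp only:)
  also have "... = (\<Sum>p\<in>opsupp Q. LINT xi|lborel. ?c p * (V i t xi * (of_real (mpow xi (snd p)) * phi xi)))"
   by (intro Bochner_Integration.integral_sum integrable_mult_right int)
  also have "... = (\<Sum>p\<in>opsupp Q. ?c p * I i (snd p))" unfolding I_def by (simp only: integral_mult_right_zero)
  finally show "(\<Sum>p\<in>opsupp Q. if fst p = i then Q (fst p) (snd p) * \<i> ^ msize (snd p) * I i (snd p) else 0) = (LINT xi|lborel. V i t xi * (fsym Q i xi * phi xi))"
   by (simp only: if_distrib[of "%c. c * _"] mult_zero_left cong: if_cong)
 qed
 finally have "d = - (\<Sum>i<m. LINT xi|lborel. V i t xi * (fsym Q i xi * phi xi))" by (simp add: eq_neg_iff_add_eq_0 add.commute)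
 then show ?thesis using hd by simp
qed

end

text \<open>Beyond order \<open>m - 1\<close> the equation does not provide the time derivatives as functions. They are identified inductively, as
weak derivatives of the preceding ones.\<close>

theorem solution_modes:
 fixes Q :: "'n::finite operator"
 assumes m: "m >= 1" and s0: "s0 >= real m - 1" and Q: "finite (opsupp Q)"
  and ord: "!!k alpha. Q k alpha ~= 0 ==> k + msize alpha <= m" and top: "Q m (%_. 0) = 1"
  and u0: "!!j. j < m ==> u0 j : borel_measurable lborel" and sol: "cauchy_solution s0 m Q u0 u U"
 shows "EX y :: real^'n => nat => real => complex. (ALL xi. smooth_seq (y xi)) &
  (ALL xi l t. (\<Sum>i\<le>m. fsym Q i xi * y xi (l + i) t) = 0) &
  (ALL j<m. AE xi in lborel. y xi j 0 = fourier (u0 j) xi) &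
  (ALL j t. real j <= s0 --> t >= 0 --> (AE xi in lborel. fourier (U j t) xi = y xi j t))"
proof -
 have td: "time_derivatives s0 u U" and pde: "satisfies_pde m Q u" and ini: "!!j. j < m ==> AE x in lborel. U j 0 x = u0 j x"
  using sol by (auto simp: cauchy_solution_def)
 interpret time_family s0 u U by unfold_locales (rule td)
 have ks: "real k <= s0" if "k < m" for k using that s0 by simp
 interpret M: mode_problem m "fsym Q" V "1 + (\<Sum>(j, alpha)\<in>opsupp Q. norm (Q j alpha))"
 proof
  show "1 <= m" by (rule m)
  show "fsym Q i : borel_measurable borel" for i by measurable
  show "1 <= 1 + (\<Sum>(j, alpha)\<in>opsupp Q. norm (Q j alpha))" by (simp add: sum_nonneg case_prod_beta')
  show "norm (fsym Q i xi) <= (1 + (\<Sum>(j, alpha)\<in>opsupp Q. norm (Q j alpha))) * (1 + norm xi) ^ (m - i)" for i xi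
   by (rule fsym_bound[OF Q ord])
  show "poly_span (modulated y) (%xi. fsym Q i xi * phi xi)" if "poly_span (modulated y) phi" for i y phi
   by (rule fsym_span[OF Q that])
  show "V k t : Lp 2" if "k < m" "t >= 0" for k t by (rule V_Lp2[OF ks[OF that(1)] that(2)])
  show "EX M>=0. ALL k<m. ALL t. 0 <= t --> t <= T --> Lp_norm 2 (V k t) <= M" for T
  proof -
   have "ALL k:{..<m}. EX M>=0. ALL t. 0 <= t --> t <= T --> Lp_norm 2 (V k t) <= M"
    using V_locally_bounded[OF ks] by simp
   from bchoice[OF this] obtain M where M: "ALL k:{..<m}. M k >= 0 & (ALL t. 0 <= t --> t <= T --> Lp_norm 2 (V k t) <= M k)"
    by (elim exE)
   show ?thesis
   proof (intro exI[of _ "\<Sum>k<m. M k"] conjI allI impI)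
    show "0 <= (\<Sum>k<m. M k)" using M by (intro sum_nonneg) auto
    fix k t assume k: "k < m" and t: "0 <= t" "t <= T"
    have "Lp_norm 2 (V k t) <= M k" using M k t by simp
    also have "M k <= (\<Sum>k<m. M k)" using M k by (intro member_le_sum) auto
    finally show "Lp_norm 2 (V k t) <= (\<Sum>k<m. M k)" .
   qed
  qed
  show "((%t. LINT xi|lborel. V k t xi * phi xi) has_vector_derivative
    (LINT xi|lborel. recur m (%i. fsym Q i xi) (%j. V j t xi) (Suc k) * phi xi)) (at t within {0..})"
   if phi: "poly_span (modulated y) phi" and k: "k < m" and t: "t >= 0" for y phi k t
  proof (cases "Suc k < m")
   case True
   show ?thesis unfolding recur_low[OF True]
    by (rule V_weak_deriv[OF ks[OF True] t decay_integrable(2)[OF poly_span_decay[OF phi decay_modulated]]])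
  next
   case False
   then have km: "Suc k = m + 0" "k = m - 1" using k by auto
   have "recur m (%i. fsym Q i xi) (%j. V j t xi) (Suc k) * phi xi = - (\<Sum>i<m. V i t xi * (fsym Q i xi * phi xi))" for xi
    unfolding km(1) recur_high by (simp add: recur_low sum_distrib_left sum_distrib_right mult_ac)
   then have "(LINT xi|lborel. recur m (%i. fsym Q i xi) (%j. V j t xi) (Suc k) * phi xi) = - (LINT xi|lborel. (\<Sum>i<m. V i t xi * (fsym Q i xi * phi xi)))"
    by simp
   also have "(LINT xi|lborel. (\<Sum>i<m. V i t xi * (fsym Q i xi * phi xi))) = (\<Sum>i<m. LINT xi|lborel. V i t xi * (fsym Q i xi * phi xi))"
    by (intro Bochner_Integration.integral_sum Cauchy_Schwarz_Lp2(1) V_Lp2 ks t decay_integrable(2) poly_span_decay[OF fsym_span[OF Q phi] decay_modulated]) simp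
   finally show ?thesis
    using pde_weak[OF m s0 Q ord top pde phi t] unfolding km(2) by simp
  qed
 qed
 define y where "y xi = mode_series (%k. M.E k 0 xi)" for xi
 have E: "AE xi in lborel. V j t xi = M.E j t xi" if "real j <= s0" "t >= 0" for j t
  using that
 proof (induction j arbitrary: t rule: less_induct)
  case (less j)
  show ?case
  proof (cases "j < m")
   case True
   then show ?thesis by (simp add: M.E_low)
  next
   case False
   then obtain i where j: "j = Suc i" using m by (cases j) auto
   have V2: "V j t : Lp 2" by (rule V_Lp2[OF less.prems])
   have "AE xi in lborel. V j t xi - M.E j t xi = 0"
   proof (rule modulated_pairing_injective)
    fix y
    note d = decay_modulated[of y] and d2 = decay_integrable(2)[OF decay_modulated[of y]]
    note i1 = Cauchy_Schwarz_Lp2(1)[OF V2 d2] M.E_integrable[OF d less.prems(2), of j]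
    show "integrable lborel (%xi. (V j t xi - M.E j t xi) * modulated y xi)"
     using Bochner_Integration.integrable_diff[OF i1] by (simp add: left_diff_distrib)
    have eq: "(LINT xi|lborel. M.E i tau xi * modulated y xi) = (LINT xi|lborel. V i tau xi * modulated y xi)" if "tau : {0..}" for tau
    proof (rule integral_cong_AE)
     have tau: "tau >= 0" "real i <= s0" using that less.prems(1) j by auto
     note [measurable] = M.E_meas[OF tau(1)] Lp2_measurable[OF V_Lp2[OF tau(2,1)]] decay_measurable[OF d]
     show "(%xi. M.E i tau xi * modulated y xi) : borel_measurable lborel" "(%xi. V i tau xi * modulated y xi) : borel_measurable lborel"
      by measurable
     have "AE xi in lborel. V i tau xi = M.E i tau xi" by (rule less.IH) (use tau j in auto)
     then show "AE xi in lborel. M.E i tau xi * modulated y xi = V i tau xi * modulated y xi" by eventually_elim simp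
    qed
    have "((%t. LINT xi|lborel. M.E i t xi * modulated y xi) has_vector_derivative (LINT xi|lborel. V j t xi * modulated y xi)) (at t within {0..})"
     unfolding j
     by (rule has_vector_derivative_transform[OF _ eq V_weak_deriv[OF _ _ d2]]) (use less.prems j in auto)
    moreover have "((%t. LINT xi|lborel. M.E i t xi * modulated y xi) has_vector_derivative (LINT xi|lborel. M.E j t xi * modulated y xi)) (at t within {0..})"
     unfolding j by (rule M.E_deriv[OF poly_span.base less.prems(2)])
    ultimately have "(LINT xi|lborel. V j t xi * modulated y xi) = (LINT xi|lborel. M.E j t xi * modulated y xi)"
     by (rule vector_derivative_unique_within[OF at_within_atLeast_neq_bot[OF less.prems(2)]])
    then show "(LINT xi|lborel. (V j t xi - M.E j t xi) * modulated y xi) = 0"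
     using i1 by (simp add: left_diff_distrib)
   qed
   then show ?thesis by simp
  qed
 qed
 show ?thesis
 proof (intro exI[of _ y] conjI allI impI)
  show "smooth_seq (y xi)" for xi unfolding y_def by (rule mode_series_smooth[OF M.series_bounds])
  show "(\<Sum>i\<le>m. fsym Q i xi * y xi (l + i) t) = 0" for xi l t
   unfolding y_def
  proof (rule mode_series_recurrence[OF M.series_bounds])
   show "(\<Sum>i\<le>m. fsym Q i xi * M.E (l + i) 0 xi) = 0" for l
    unfolding M.E_def by (rule recur_equation[of "%i. fsym Q i xi"]) (rule fsym_top[OF Q ord top])
  qed
  show "AE xi in lborel. y xi j 0 = fourier (u0 j) xi" if j: "j < m" for j
  proof -
   have "U j 0 : borel_measurable lborel" using Lp2_measurable[OF is_fourier_Lp2(1)[OF V_fourier[OF ks[OF j] order_refl]]] .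
   then have "fourier (U j 0) = fourier (u0 j)" by (rule fourier_cong_AE[OF ini[OF j] _ u0[OF j]])
   then show ?thesis using j by (simp add: y_def mode_series_zero M.E_low V_def)
  qed
  show "AE xi in lborel. fourier (U j t) xi = y xi j t" if "real j <= s0" "t >= 0" for j t
   using E[OF that] M.E_series[OF that(2), of j] unfolding y_def V_def[symmetric] by eventually_elim simp
 qed
qed

section \<open>Decay of the solution\<close>

lemma bessel_weight_low:
 fixes r \<sigma> :: real
 assumes "0 <= r" "r <= 1"
 shows "1 <= 2 powr (\<bar>\<sigma>\<bar> / 2) * (1 + r\<^sup>2) powr (\<sigma> / 2)"
proof (cases "\<sigma> >= 0")
 case True
 have "1 * 1 <= 2 powr (\<bar>\<sigma>\<bar> / 2) * (1 + r\<^sup>2) powr (\<sigma> / 2)"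
  using True by (intro mult_mono ge_one_powr_ge_zero) auto
 then show ?thesis by simp
next
 case False
 have "r\<^sup>2 <= 1" using assms by (simp add: power_le_one)
 then have "2 powr (\<sigma> / 2) <= (1 + r\<^sup>2) powr (\<sigma> / 2)"
  using False by (intro powr_mono2') (auto simp: add_pos_nonneg)
 then have "2 powr (- (\<sigma> / 2)) * 2 powr (\<sigma> / 2) <= 2 powr (\<bar>\<sigma>\<bar> / 2) * (1 + r\<^sup>2) powr (\<sigma> / 2)"
  using False by (intro mult_mono) auto
 then show ?thesis unfolding powr_add[symmetric] by simp
qed

text \<open>Away from the origin homogeneous and inhomogeneous weights are comparable; the sign of \<open>sigma\<close> decides which of the two
inequalities needs the lower bound for \<open>r\<close>.\<close>

lemma bessel_weight_high:
 fixes r r0 \<sigma> :: real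
 assumes r0: "0 < r0" "r0 <= r"
 shows "r powr \<sigma> <= (r0\<^sup>2 / (1 + r0\<^sup>2)) powr (- \<bar>\<sigma>\<bar> / 2) * (1 + r\<^sup>2) powr (\<sigma> / 2)"
proof -
 define kappa where "kappa = r0\<^sup>2 / (1 + r0\<^sup>2)"
 have d: "1 + r0\<^sup>2 > 0" by (intro add_pos_nonneg) auto
 have kappa: "0 < kappa" "kappa <= 1" using r0 d by (auto simp: kappa_def divide_le_eq_1)
 have r: "r > 0" using r0 by simp
 have rp: "r powr \<sigma> = (r\<^sup>2) powr (\<sigma> / 2)" using r by (simp add: powr_powr flip: powr_numeral)
 show ?thesis
 proof (cases "\<sigma> >= 0")
  case True
  have "(r\<^sup>2) powr (\<sigma> / 2) <= (1 + r\<^sup>2) powr (\<sigma> / 2)" using True by (intro powr_mono2) auto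
  also have "... = 1 * (1 + r\<^sup>2) powr (\<sigma> / 2)" by simp
  also have "... <= kappa powr (- \<bar>\<sigma>\<bar> / 2) * (1 + r\<^sup>2) powr (\<sigma> / 2)"
  proof (rule mult_right_mono)
   have "1 powr (- \<bar>\<sigma>\<bar> / 2) <= kappa powr (- \<bar>\<sigma>\<bar> / 2)" using kappa by (intro powr_mono2') auto
   then show "1 <= kappa powr (- \<bar>\<sigma>\<bar> / 2)" by simp
  qed simp
  finally show ?thesis unfolding rp kappa_def .
 next
  case False
  have "r0\<^sup>2 <= r\<^sup>2" using r0 by (intro power_mono) auto
  then have "kappa * (1 + r\<^sup>2) <= r\<^sup>2" using d by (simp add: kappa_def field_simps)
  then have "(r\<^sup>2) powr (\<sigma> / 2) <= (kappa * (1 + r\<^sup>2)) powr (\<sigma> / 2)"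
   using False kappa by (intro powr_mono2') (auto simp: add_pos_nonneg)
  also have "... = kappa powr (\<sigma> / 2) * (1 + r\<^sup>2) powr (\<sigma> / 2)" using kappa by (simp add: powr_mult)
  finally show ?thesis using False unfolding rp kappa_def by simp
 qed
qed

lemma exp_le_powr:
 fixes c b :: real
 assumes c: "c > 0"
 shows "EX C>=0. ALL t>=0. exp (- 2 * c * t) <= C * (1 + t) powr (- b)"
proof (cases "b >= 0")
 case False
 have "exp (- 2 * c * t) <= 1 * (1 + t) powr (- b)" if "t >= 0" for t
 proof -
  have "exp (- 2 * c * t) <= 1" using that c by simp
  also have "1 <= (1 + t) powr (- b)" using that False by (intro ge_one_powr_ge_zero) auto
  finally show ?thesis by simp
 qed
 then show ?thesis by (intro exI[of _ 1]) auto
next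
 case True
 obtain D where D: "D >= 0" "ALL x>0. x powr b * exp (- 2 * x) <= D * exp (- x) \<or> b < 0" using powr_exp_bounded[of b] .
 define C where "C = exp (2 * c) * D * c powr (- b)"
 have "exp (- 2 * c * t) <= C * (1 + t) powr (- b)" if t: "t >= 0" for t
 proof -
  let ?x = "c * (1 + t)"
  have x: "?x > 0" using c t by simp
  have "?x powr b * exp (- 2 * ?x) <= D * exp (- ?x)" using D x True by force
  also have "... <= D * 1" using D x by (intro mult_left_mono) auto
  finally have "?x powr b * exp (- 2 * ?x) <= D" by simp
  then have "(exp (2 * c) * ?x powr (- b)) * (?x powr b * exp (- 2 * ?x)) <= (exp (2 * c) * ?x powr (- b)) * D"
   by (rule mult_left_mono) simp
  moreover have "(exp (2 * c) * ?x powr (- b)) * (?x powr b * exp (- 2 * ?x)) = exp (- 2 * c * t)"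
  proof -
   have "?x powr (- b) * ?x powr b = 1" using c t unfolding powr_add[symmetric] by simp
   moreover have "exp (2 * c) * exp (- 2 * ?x) = exp (- 2 * c * t)" unfolding exp_add[symmetric] by (simp add: algebra_simps)
   ultimately show ?thesis by (metis mult.assoc mult.commute mult_1)
  qed
  moreover have "?x powr (- b) = c powr (- b) * (1 + t) powr (- b)" using c t by (simp add: powr_mult)
  ultimately show ?thesis by (simp add: C_def mult_ac)
 qed
 moreover have "C >= 0" using D by (simp add: C_def)
 ultimately show ?thesis by blast
qed

lemma operator_sum_properties:
 fixes P P1 P2 :: "'n::finite operator"
 assumes I: "interlacing_operators m theta P P1 P2"
 defines "Q \<equiv> %k alpha. P k alpha + P1 k alpha + P2 k alpha"
 shows "finite (opsupp Q)" "!!k alpha. Q k alpha ~= 0 ==> k + msize alpha <= m" "Q m (%_. 0) = 1"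
proof -
 have m: "m >= 3" and P: "homog_coeffs m P" "homog_coeffs (m - 1) P1" "homog_coeffs (m - 2) P2" and top: "P m (%_. 0) = 1"
  using I unfolding interlacing_operators_def homogeneous_op_def homog_coeffs_def by auto
 have "finite (opsupp P \<union> opsupp P1 \<union> opsupp P2)" using P finite_opsupp by blast
 then show "finite (opsupp Q)" by (rule rev_finite_subset) (auto simp: opsupp_def Q_def)
 show "k + msize alpha <= m" if "Q k alpha ~= 0" for k alpha
 proof -
  have "P k alpha ~= 0 \<or> P1 k alpha ~= 0 \<or> P2 k alpha ~= 0" using that by (auto simp: Q_def)
  then show ?thesis using P m unfolding homog_coeffs_def by (elim disjE) force+
 qed
 have "P1 m (%_. 0) = 0" "P2 m (%_. 0) = 0"
  using P(2,3) m unfolding homog_coeffs_def msize_def by force+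
 then show "Q m (%_. 0) = 1" using top by (simp add: Q_def)
qed

text \<open>Combines the regimes of small and large frequencies. The first term is present only for \<open>norm xi \<le> 1\<close>; all exponentially
decaying terms are expressed in the weights of the Sobolev norms of the data.\<close>

lemma weighted_frequency_estimate:
 fixes P P1 P2 :: "'n::finite operator" and s :: real and k :: nat
 assumes I: "interlacing_operators m theta P P1 P2" and s: "s >= 0"
 defines "mu \<equiv> %j. real (min j (slow_order m theta - 1))"
 shows "EX c>0. EX K>=0. ALL xi::real^'n. ALL y t. 0 < norm xi --> smooth_seq y -->
   (ALL l t. (\<Sum>i\<le>m. fsym (%k alpha. P k alpha + P1 k alpha + P2 k alpha) i xi * y (l + i) t) = 0) --> t >= 0 -->
   norm xi powr s * cmod (y k t) <= (\<Sum>j<m. K * (indicator {0<..1} (norm xi) * (norm xi powr (real k + s - mu j) * exp (- c * (norm xi)^2 * t) * cmod (y j 0)))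
     + K * (exp (- c * t) * ((1 + (norm xi)^2) powr ((real k + s - real j) / 2) * cmod (y j 0))))"
proof -
 obtain rho0 c and C :: "nat => real" where rho0: "0 < rho0" "rho0 <= 1" and c: "c > 0" and C: "ALL k. C k >= 0"
  and low0: "ALL xi::real^'n. ALL y k t. 0 < norm xi --> norm xi <= rho0 --> smooth_seq y -->
   (ALL l t. (\<Sum>i\<le>m. fsym (%k alpha. P k alpha + P1 k alpha + P2 k alpha) i xi * y (l + i) t) = 0) --> t >= 0 -->
   cmod (y k t) <= C k * (norm xi ^ k * exp (- c * (norm xi)^2 * t) * (\<Sum>j<m. cmod (y j 0) / norm xi ^ (min j (slow_order m theta - 1)))
     + exp (- c * t) * (\<Sum>j<m. cmod (y j 0)))"
  and high0: "ALL xi::real^'n. ALL y k t. rho0 <= norm xi --> smooth_seq y -->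
   (ALL l t. (\<Sum>i\<le>m. fsym (%k alpha. P k alpha + P1 k alpha + P2 k alpha) i xi * y (l + i) t) = 0) --> t >= 0 -->
   cmod (y k t) <= C k * (exp (- c * t) * (\<Sum>j<m. norm xi ^ k / norm xi ^ j * cmod (y j 0)))"
  using frequency_estimates[OF I] .
 define \<sigma> where "\<sigma> j = real k + s - real j" for j
 define kappa where "kappa = rho0\<^sup>2 / (1 + rho0\<^sup>2)"
 define W where "W j = 1 + 2 powr (\<bar>\<sigma> j\<bar> / 2) + kappa powr (- \<bar>\<sigma> j\<bar> / 2)" for j
 define K where "K = C k * (1 + (\<Sum>j<m. W j))"
 have Wnn: "W j >= 0" for j by (simp add: W_def)
 have Wle: "W j <= 1 + (\<Sum>j<m. W j)" if "j < m" for j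
  using member_le_sum[of j "{..<m}" W] that Wnn by simp
 have CK: "C k * W j <= K" if "j < m" for j
  unfolding K_def using C Wle[OF that] by (intro mult_left_mono) auto
 have K: "K >= 0" using C Wnn by (simp add: K_def sum_nonneg)
 have CK1: "C k <= K" using mult_left_mono[of 1 "1 + (\<Sum>j<m. W j)" "C k"] C Wnn by (simp add: K_def sum_nonneg)
 show ?thesis
 proof (rule exI[of _ c], rule conjI[OF c], rule exI[of _ K], rule conjI[OF K], intro allI impI)
  fix xi :: "real^'n" and y t
  assume r: "0 < norm xi" and y: "smooth_seq y" and
   rec: "ALL l t. (\<Sum>i\<le>m. fsym (%k alpha. P k alpha + P1 k alpha + P2 k alpha) i xi * y (l + i) t) = 0" and t: "(t::real) >= 0"
  let ?r = "norm xi"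
  let ?e = "exp (- c * ?r\<^sup>2 * t)" and ?f = "exp (- c * t)"
  let ?b = "%j. (1 + ?r\<^sup>2) powr (\<sigma> j / 2)"
  have rk: "?r ^ i = ?r powr real i" for i using r by (simp add: powr_realpow)
  show "?r powr s * cmod (y k t) <= (\<Sum>j<m. K * (indicator {0<..1} ?r * (?r powr (real k + s - mu j) * ?e * cmod (y j 0)))
     + K * (?f * ((1 + ?r\<^sup>2) powr ((real k + s - real j) / 2) * cmod (y j 0))))"
  proof (cases "?r <= rho0")
   case True
   then have r1: "?r <= 1" using rho0 by simp
   have "?r powr s * cmod (y k t) <= ?r powr s * (C k * (?r ^ k * ?e * (\<Sum>j<m. cmod (y j 0) / ?r ^ (min j (slow_order m theta - 1))) + ?f * (\<Sum>j<m. cmod (y j 0))))"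
    by (intro mult_left_mono low0[rule_format] r True y rec[rule_format] t) simp
   also have "... = (\<Sum>j<m. C k * (?r powr s * ?r ^ k / ?r ^ (min j (slow_order m theta - 1)) * ?e * cmod (y j 0)) + C k * (?f * (?r powr s * cmod (y j 0))))"
    by (simp add: sum.distrib sum_distrib_left distrib_left mult_ac)
   also have "... <= (\<Sum>j<m. K * (indicator {0<..1} ?r * (?r powr (real k + s - mu j) * ?e * cmod (y j 0))) + K * (?f * (?b j * cmod (y j 0))))"
   proof (intro sum_mono add_mono)
    fix j assume "j : {..<m}"
    then have j: "j < m" by simp
    have "?r powr s * ?r ^ k / ?r ^ (min j (slow_order m theta - 1)) = ?r powr (real k + s - mu j)"
     unfolding rk mu_def powr_add[symmetric] powr_diff[symmetric] by (simp add: add.commute)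
    moreover have "C k * (?r powr (real k + s - mu j) * ?e * cmod (y j 0)) <= K * (?r powr (real k + s - mu j) * ?e * cmod (y j 0))"
     by (intro mult_right_mono CK1) auto
    moreover have "indicator {0<..1} ?r = (1::real)" using r r1 by simp
    ultimately show "C k * (?r powr s * ?r ^ k / ?r ^ (min j (slow_order m theta - 1)) * ?e * cmod (y j 0))
     <= K * (indicator {0<..1} ?r * (?r powr (real k + s - mu j) * ?e * cmod (y j 0)))"
     by (simp only: mult_1_left)
    have "?r powr s <= 1" using r1 s by (simp add: powr_le1)
    also have "1 <= 2 powr (\<bar>\<sigma> j\<bar> / 2) * ?b j" by (rule bessel_weight_low) (use r1 in auto)
    also have "... <= W j * ?b j" by (intro mult_right_mono) (auto simp: W_def)
    finally have "C k * (?f * (?r powr s * cmod (y j 0))) <= C k * (?f * (W j * ?b j * cmod (y j 0)))"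
     using C by (intro mult_left_mono mult_right_mono) auto
    also have "... = (C k * W j) * (?f * (?b j * cmod (y j 0)))" by (simp only: mult_ac)
    also have "... <= K * (?f * (?b j * cmod (y j 0)))" by (intro mult_right_mono CK j) auto
    finally show "C k * (?f * (?r powr s * cmod (y j 0))) <= K * (?f * (?b j * cmod (y j 0)))" .
   qed
   finally show ?thesis unfolding \<sigma>_def .
  next
   case False
   then have r0: "rho0 <= ?r" by simp
   have "?r powr s * cmod (y k t) <= ?r powr s * (C k * (?f * (\<Sum>j<m. ?r ^ k / ?r ^ j * cmod (y j 0))))"
    by (intro mult_left_mono high0[rule_format] r0 y rec[rule_format] t) simp
   also have "... = (\<Sum>j<m. C k * (?f * (?r powr s * ?r ^ k / ?r ^ j * cmod (y j 0))))"
    by (simp add: sum_distrib_left mult_ac)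
   also have "... <= (\<Sum>j<m. K * (indicator {0<..1} ?r * (?r powr (real k + s - mu j) * ?e * cmod (y j 0))) + K * (?f * (?b j * cmod (y j 0))))"
   proof (rule sum_mono)
    fix j assume "j : {..<m}"
    then have j: "j < m" by simp
    have "?r powr s * ?r ^ k / ?r ^ j = ?r powr \<sigma> j"
     unfolding rk \<sigma>_def powr_add[symmetric] powr_diff[symmetric] by (simp add: add.commute)
    also have "... <= kappa powr (- \<bar>\<sigma> j\<bar> / 2) * ?b j" unfolding kappa_def by (rule bessel_weight_high[OF rho0(1) r0])
    also have "... <= W j * ?b j" by (intro mult_right_mono) (auto simp: W_def)
    finally have "C k * (?f * (?r powr s * ?r ^ k / ?r ^ j * cmod (y j 0))) <= C k * (?f * (W j * ?b j * cmod (y j 0)))"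
     using C by (intro mult_left_mono mult_right_mono) auto
    also have "... = (C k * W j) * (?f * (?b j * cmod (y j 0)))" by (simp only: mult_ac)
    also have "... <= K * (?f * (?b j * cmod (y j 0)))" by (intro mult_right_mono CK j) auto
    also have "... <= K * (indicator {0<..1} ?r * (?r powr (real k + s - mu j) * ?e * cmod (y j 0))) + K * (?f * (?b j * cmod (y j 0)))"
     using K by (simp add: indicator_def)
    finally show "C k * (?f * (?r powr s * ?r ^ k / ?r ^ j * cmod (y j 0))) <= K * (indicator {0<..1} ?r * (?r powr (real k + s - mu j) * ?e * cmod (y j 0))) + K * (?f * (?b j * cmod (y j 0)))" .
   qed
   finally show ?thesis unfolding \<sigma>_def .
  qed
 qed
qed

lemma square_sum_pairs_le:
 fixes x z :: "nat => real"
 shows "(\<Sum>j<m. K * (x j + z j))^2 <= (\<Sum>j<m. 2 * real m * K\<^sup>2 * (x j)^2 + 2 * real m * K\<^sup>2 * (z j)^2)"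
proof -
 have "(\<Sum>j<m. K * (x j + z j))^2 <= (\<Sum>j<m. (K * (x j + z j))^2) * real (card {..<m})"
  by (rule sum_squared_le_sum_of_squares)
 also have "... = (\<Sum>j<m. real m * K\<^sup>2 * (x j + z j)^2)"
  unfolding sum_distrib_right by (intro sum.cong) (auto simp: power_mult_distrib)
 also have "... <= (\<Sum>j<m. real m * K\<^sup>2 * (2 * (x j)^2 + 2 * (z j)^2))"
 proof (intro sum_mono mult_left_mono)
  show "(x j + z j)^2 <= 2 * (x j)^2 + 2 * (z j)^2" for j using norm_add_sq[of "x j" "z j"] by simp
 qed simp
 finally show ?thesis by (simp add: algebra_simps)
qed

lemma AE_norm_pos: "AE xi in lborel. 0 < norm (xi :: 'a::euclidean_space)"
proof -
 have "AE xi in lborel. xi \<notin> {0 :: 'a}" by (intro AE_not_in) (auto simp: null_sets_def)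
 then show ?thesis by eventually_elim simp
qed

text \<open>The square of the pointwise estimate is integrated term by term: the first terms by \<open>low_frequency_integral\<close>, the others
by the definition of the Sobolev norms, where the exponential is better than any power.\<close>

theorem decay_estimate:
 fixes P P1 P2 :: "'n::finite operator" and s s0 q :: real and k :: nat
 assumes I: "interlacing_operators m theta P P1 P2" and s0: "s0 >= real m - 1" and q: "1 <= q" "q <= 2"
  and s: "0 <= s" and ks: "real k + s <= s0"
  and cond: "real k + s >= real (slow_order m theta - 1) \<or> hy_exponent TYPE('n) q + (real k + s) > real (slow_order m theta - 1)"
 defines "mu \<equiv> %j. real (min j (slow_order m theta - 1))"
 shows "EX C>0. ALL u0 u U.
  (ALL j<m. u0 j : sobolev (s0 - real j) \<inter> Lp q) & cauchy_solution s0 m (%k alpha. P k alpha + P1 k alpha + P2 k alpha) u0 u U -->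
  (ALL t>=0. U k t : hom_sobolev s & hom_sobolev_norm s (U k t)
   <= C * (\<Sum>j<m. (1 + t) powr (- (hy_exponent TYPE('n) q + (real k + s - mu j)) / 2) * (Lp_norm q (u0 j) + sobolev_norm (real k + s - real j) (u0 j))))"
proof -
 define d where "d = hy_exponent TYPE('n) q"
 define a where "a j = real k + s - mu j" for j
 define \<sigma> where "\<sigma> j = real k + s - real j" for j
 let ?Q = "%k alpha. P k alpha + P1 k alpha + P2 k alpha"
 have m1: "m >= 1" using I by (simp add: interlacing_operators_def)
 note Qp = operator_sum_properties[OF I]
 have "EX c>0. EX K>=0. ALL xi::real^'n. ALL y t. 0 < norm xi --> smooth_seq y -->
   (ALL l t. (\<Sum>i\<le>m. fsym ?Q i xi * y (l + i) t) = 0) --> t >= 0 -->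
   norm xi powr s * cmod (y k t) <= (\<Sum>j<m. K * (indicator {0<..1} (norm xi) * (norm xi powr a j * exp (- c * (norm xi)^2 * t) * cmod (y j 0)))
     + K * (exp (- c * t) * ((1 + (norm xi)^2) powr (\<sigma> j / 2) * cmod (y j 0))))"
  unfolding a_def \<sigma>_def mu_def by (rule weighted_frequency_estimate[OF I s])
 then obtain c K where c: "c > 0" and K: "K >= 0" and est: "ALL xi::real^'n. ALL y t. 0 < norm xi --> smooth_seq y -->
   (ALL l t. (\<Sum>i\<le>m. fsym ?Q i xi * y (l + i) t) = 0) --> t >= 0 -->
   norm xi powr s * cmod (y k t) <= (\<Sum>j<m. K * (indicator {0<..1} (norm xi) * (norm xi powr a j * exp (- c * (norm xi)^2 * t) * cmod (y j 0)))
     + K * (exp (- c * t) * ((1 + (norm xi)^2) powr (\<sigma> j / 2) * cmod (y j 0))))"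
  by (elim exE conjE)
 have "EX C>=0. ALL u V t. is_fourier u V --> u : Lp q --> t >= 0 -->
  (\<integral>\<^sup>+xi. indicator {xi. 0 < norm xi & norm xi <= 1} (xi::real^'n) * ennreal (norm xi powr (2 * a j) * exp (- 2 * c * (norm xi)^2 * t) * (norm (V xi))^2) \<partial>lborel)
   <= ennreal (C * (1 + t) powr (- (d + a j)) * (Lp_norm q u)^2)" for j
 proof -
  have "mu j <= real (slow_order m theta - 1)" by (simp add: mu_def)
  then have aj: "a j >= 0 \<or> hy_exponent TYPE('n) q + a j > 0" using cond unfolding a_def by linarith
  show ?thesis unfolding d_def by (rule low_frequency_integral[OF q c aj])
 qed
 then have "ALL j. EX C>=0. ALL u V t. is_fourier u V --> u : Lp q --> t >= 0 -->
  (\<integral>\<^sup>+xi. indicator {xi. 0 < norm xi & norm xi <= 1} (xi::real^'n) * ennreal (norm xi powr (2 * a j) * exp (- 2 * c * (norm xi)^2 * t) * (norm (V xi))^2) \<partial>lborel)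
   <= ennreal (C * (1 + t) powr (- (d + a j)) * (Lp_norm q u)^2)" by (rule allI)
 from choice[OF this] obtain CL where CL0: "ALL j. CL j >= 0 & (ALL u V t. is_fourier u V --> u : Lp q --> t >= 0 -->
  (\<integral>\<^sup>+xi. indicator {xi. 0 < norm xi & norm xi <= 1} (xi::real^'n) * ennreal (norm xi powr (2 * a j) * exp (- 2 * c * (norm xi)^2 * t) * (norm (V xi))^2) \<partial>lborel)
   <= ennreal (CL j * (1 + t) powr (- (d + a j)) * (Lp_norm q u)^2))"
  by (elim exE)
 note CL = CL0[THEN spec, THEN conjunct1]
 note low = CL0[THEN spec, THEN conjunct2, THEN spec, THEN spec, THEN spec, THEN mp, THEN mp, THEN mp]
 have "ALL j. EX C>=0. ALL t>=0. exp (- 2 * c * t) <= C * (1 + t) powr (- (d + a j))"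
  by (intro allI exp_le_powr c)
 from choice[OF this] obtain CE where CE0: "ALL j. CE j >= 0 & (ALL t>=0. exp (- 2 * c * t) <= CE j * (1 + t) powr (- (d + a j)))"
  by (elim exE)
 note CE = CE0[THEN spec, THEN conjunct1] CE0[THEN spec, THEN conjunct2, rule_format]
 (* The factor that arises from squaring a sum of m pairs. *)
 define H where "H = 2 * real m * K\<^sup>2"
 have H: "H >= 0" by (simp add: H_def)
 define D where "D = 1 + H * (\<Sum>j<m. CL j + CE j)"
 have D: "D >= 1" using H CL CE by (simp add: D_def sum_nonneg)
 have HD: "H * CL j <= D" "H * CE j <= D" if "j < m" for j
 proof -
  have "CL j + CE j <= (\<Sum>j<m. CL j + CE j)"
   using member_le_sum[of j "{..<m}" "%j. CL j + CE j"] that CL CE by simp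
  then have "H * (CL j + CE j) <= H * (\<Sum>j<m. CL j + CE j)" using H by (rule mult_left_mono)
  moreover have "H * CL j >= 0" "H * CE j >= 0" using H CL CE by auto
  ultimately show "H * CL j <= D" "H * CE j <= D" by (auto simp: D_def distrib_left)
 qed
 show ?thesis
 proof (intro exI[of _ "sqrt D"] conjI allI impI)
  show "0 < sqrt D" using D by simp
  fix u0 :: "nat => real^'n => complex" and u U and t :: real
  assume hyp: "(ALL j<m. u0 j : sobolev (s0 - real j) \<inter> Lp q) & cauchy_solution s0 m ?Q u0 u U" and t: "0 <= t"
  have u0: "u0 j : sobolev (s0 - real j)" "u0 j : Lp q" if "j < m" for j using hyp that by auto
  have sol: "cauchy_solution s0 m ?Q u0 u U" using hyp by simp
  define F where "F j = fourier (u0 j)" for j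
  have F: "sobolev_ft (\<sigma> j) (u0 j) (F j)" if "j < m" for j
   unfolding F_def by (rule sobolev_sobolev_ft[OF u0(1)[OF that]]) (use ks in \<open>simp add: \<sigma>_def\<close>)
  have Ff: "is_fourier (u0 j) (F j)" and Fb: "bessel_weighted (\<sigma> j) (F j) : Lp 2" if "j < m" for j
   using F[OF that] by (auto simp: sobolev_ft_def)
  have Fm: "F j : borel_measurable borel" if "j < m" for j
   using Lp2_measurable[OF is_fourier_Lp2(2)[OF Ff[OF that]]] by simp
  have "EX y :: real^'n => nat => real => complex. (ALL xi. smooth_seq (y xi)) &
  (ALL xi l t. (\<Sum>i\<le>m. fsym ?Q i xi * y xi (l + i) t) = 0) &
  (ALL j<m. AE xi in lborel. y xi j 0 = fourier (u0 j) xi) &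
  (ALL j t. real j <= s0 --> t >= 0 --> (AE xi in lborel. fourier (U j t) xi = y xi j t))"
  proof (rule solution_modes[OF m1 s0 Qp _ sol])
   show "u0 j : borel_measurable lborel" if "j < m" for j using u0(2)[OF that] by (simp add: Lp_def)
  qed
  then obtain y :: "real^'n => nat => real => complex" where y: "ALL xi. smooth_seq (y xi)"
   "ALL xi l t. (\<Sum>i\<le>m. fsym ?Q i xi * y xi (l + i) t) = 0"
   "ALL j<m. AE xi in lborel. y xi j 0 = fourier (u0 j) xi"
   "ALL j t. real j <= s0 --> t >= 0 --> (AE xi in lborel. fourier (U j t) xi = y xi j t)"
   by (elim exE conjE)
  have k0: "real k <= s0" using ks s by simp
  interpret time_family s0 u U using sol by unfold_locales (simp add: cauchy_solution_def)
  have Vf: "is_fourier (U k t) (V k t)" by (rule V_fourier[OF k0 t])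
  have Vm: "V k t : borel_measurable borel" using Lp2_measurable[OF is_fourier_Lp2(2)[OF Vf]] by simp
  define X where "X j xi = indicator {xi. 0 < norm xi & norm xi <= 1} (xi::real^'n) * ennreal (norm xi powr (2 * a j) * exp (- 2 * c * (norm xi)^2 * t) * (norm (F j xi))^2)" for j xi
  define Z where "Z j xi = ennreal ((norm (bessel_weighted (\<sigma> j) (F j) xi))^2)" for j xi
  let ?R = "riesz_weighted s (V k t)"
  have pt: "AE xi in lborel. ennreal ((norm (?R xi))^2) <= (\<Sum>j<m. ennreal H * X j xi + ennreal (H * exp (- 2 * c * t)) * Z j xi)"
  proof -
   have "AE xi in lborel. ALL j:{..<m}. y xi j 0 = F j xi"
    by (rule AE_finite_allI) (use y(3) in \<open>auto simp: F_def\<close>)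
   moreover have "AE xi in lborel. V k t xi = y xi k t" using y(4) k0 t by (simp add: V_def)
   ultimately show ?thesis using AE_norm_pos
   proof eventually_elim
    case (elim xi)
    let ?x = "%j. indicator {0<..1} (norm xi) * (norm xi powr a j * exp (- c * (norm xi)^2 * t) * cmod (F j xi))"
    let ?z = "%j. exp (- c * t) * ((1 + (norm xi)^2) powr (\<sigma> j / 2) * cmod (F j xi))"
    have x2: "(?x j)^2 = indicator {0<..1} (norm xi) * (norm xi powr (2 * a j) * exp (- 2 * c * (norm xi)^2 * t) * (norm (F j xi))^2)" for j
    proof -
     have "(norm xi powr a j)^2 = norm xi powr (2 * a j)" unfolding power2_eq_square powr_add[symmetric] by simp
     moreover have "(exp (- c * (norm xi)^2 * t))^2 = exp (- 2 * c * (norm xi)^2 * t)" unfolding power2_eq_square[of "exp _"] exp_add[symmetric] by simp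
     ultimately show ?thesis by (simp add: power_mult_distrib indicator_def)
    qed
    have z2: "(?z j)^2 = exp (- 2 * c * t) * (norm (bessel_weighted (\<sigma> j) (F j) xi))^2" for j
    proof -
     have "(exp (- c * t))^2 = exp (- 2 * c * t)" unfolding power2_eq_square exp_add[symmetric] by simp
     then show ?thesis unfolding norm_bessel_weighted by (simp only: power_mult_distrib)
    qed
    have "norm xi powr s * cmod (y xi k t) <= (\<Sum>j<m. K * (indicator {0<..1} (norm xi) * (norm xi powr a j * exp (- c * (norm xi)^2 * t) * cmod (y xi j 0)))
      + K * (exp (- c * t) * ((1 + (norm xi)^2) powr (\<sigma> j / 2) * cmod (y xi j 0))))"
     using est[rule_format, OF elim(3) y(1)[rule_format] y(2)[rule_format] t] .
    also have "... = (\<Sum>j<m. K * (?x j + ?z j))"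
     using elim(1) by (intro sum.cong) (auto simp: distrib_left)
    finally have le: "norm (?R xi) <= (\<Sum>j<m. K * (?x j + ?z j))"
     using elim(2) by (simp add: riesz_weighted_def norm_mult)
    have "(norm (?R xi))^2 <= (\<Sum>j<m. K * (?x j + ?z j))^2" by (rule power_mono[OF le]) simp
    also have "... <= (\<Sum>j<m. H * (?x j)^2 + H * (?z j)^2)" unfolding H_def by (rule square_sum_pairs_le)
    finally have "ennreal ((norm (?R xi))^2) <= ennreal (\<Sum>j<m. H * (?x j)^2 + H * (?z j)^2)" by (rule ennreal_leI)
    also have "... = (\<Sum>j<m. ennreal (H * (?x j)^2 + H * (?z j)^2))" using H by (intro sum_ennreal[symmetric]) simp
    also have "... = (\<Sum>j<m. ennreal H * X j xi + ennreal (H * exp (- 2 * c * t)) * Z j xi)"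
    proof (rule sum.cong[OF refl])
     fix j
     have "ennreal (H * (?x j)^2 + H * (?z j)^2) = ennreal H * ennreal ((?x j)^2) + ennreal (H * (?z j)^2)"
      using H by (simp add: ennreal_plus ennreal_mult)
     also have "ennreal ((?x j)^2) = X j xi" unfolding x2 X_def by (auto simp: indicator_def)
     also have "ennreal (H * (?z j)^2) = ennreal (H * exp (- 2 * c * t)) * Z j xi"
      unfolding z2 Z_def by (subst mult.assoc[symmetric], rule ennreal_mult) (use H in auto)
     finally show "ennreal (H * (?x j)^2 + H * (?z j)^2) = ennreal H * X j xi + ennreal (H * exp (- 2 * c * t)) * Z j xi" .
    qed
    finally show ?case .
   qed
  qed
  let ?L = "%j. Lp_norm q (u0 j)" and ?S = "%j. sobolev_norm (\<sigma> j) (u0 j)"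
  let ?w = "%j. (1 + t) powr (- (d + a j) / 2)"
  have w2: "(?w j)^2 = (1 + t) powr (- (d + a j))" for j unfolding power2_eq_square powr_add[symmetric] by simp
  have Snn: "?S j >= 0" for j by (simp add: sobolev_norm_def)
  have main: "(\<integral>\<^sup>+xi. ennreal ((norm (?R xi))^2) \<partial>lborel) <= ennreal (D * (\<Sum>j<m. ?w j * (?L j + ?S j))^2)"
  proof -
   have Xm: "X j : borel_measurable lborel" and Zm: "Z j : borel_measurable lborel" if "j < m" for j
   proof -
    note [measurable] = Fm[OF that]
    have [measurable]: "{xi::real^'n. 0 < norm xi & norm xi <= 1} : sets borel" by measurable
    show "X j : borel_measurable lborel" unfolding X_def[abs_def] by measurable
    show "Z j : borel_measurable lborel" unfolding Z_def[abs_def] by measurable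
   qed
   have "(\<integral>\<^sup>+xi. ennreal ((norm (?R xi))^2) \<partial>lborel) <= (\<integral>\<^sup>+xi. (\<Sum>j<m. ennreal H * X j xi + ennreal (H * exp (- 2 * c * t)) * Z j xi) \<partial>lborel)"
    by (rule nn_integral_mono_AE[OF pt])
   also have "... = (\<Sum>j<m. \<integral>\<^sup>+xi. (ennreal H * X j xi + ennreal (H * exp (- 2 * c * t)) * Z j xi) \<partial>lborel)"
    using Xm Zm by (intro nn_integral_sum) auto
   also have "... = (\<Sum>j<m. ennreal H * (\<integral>\<^sup>+xi. X j xi \<partial>lborel) + ennreal (H * exp (- 2 * c * t)) * (\<integral>\<^sup>+xi. Z j xi \<partial>lborel))"
    using Xm Zm by (intro sum.cong) (auto simp: nn_integral_add nn_integral_cmult)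
   also have "... <= (\<Sum>j<m. ennreal (D * (?w j)^2 * (?L j)^2 + D * (?w j)^2 * (?S j)^2))"
   proof (rule sum_mono)
    fix j assume "j : {..<m}"
    then have j: "j < m" by simp
    have "ennreal H * (\<integral>\<^sup>+xi. X j xi \<partial>lborel) <= ennreal H * ennreal (CL j * (1 + t) powr (- (d + a j)) * (?L j)^2)"
     unfolding X_def by (intro mult_left_mono low Ff u0 j t) simp
    also have "... = ennreal ((H * CL j) * ((?w j)^2 * (?L j)^2))"
     unfolding w2 using H CL by (subst ennreal_mult[symmetric]) (auto simp: mult_ac)
    also have "... <= ennreal (D * ((?w j)^2 * (?L j)^2))" by (intro ennreal_leI mult_right_mono HD j) auto
    finally have A: "ennreal H * (\<integral>\<^sup>+xi. X j xi \<partial>lborel) <= ennreal (D * (?w j)^2 * (?L j)^2)" by (simp only: mult.assoc)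
    have "ennreal (H * exp (- 2 * c * t)) * (\<integral>\<^sup>+xi. Z j xi \<partial>lborel) = ennreal (H * exp (- 2 * c * t)) * ennreal ((?S j)^2)"
     unfolding Z_def nn_integral_Lp2[OF Fb[OF j]] sobolev_norm_eq[OF F[OF j]] ..
    also have "... = ennreal (H * exp (- 2 * c * t) * (?S j)^2)" using H by (intro ennreal_mult[symmetric]) auto
    also have "... <= ennreal (D * (?w j)^2 * (?S j)^2)"
    proof (intro ennreal_leI mult_right_mono)
     have "H * exp (- 2 * c * t) <= H * (CE j * (?w j)^2)" unfolding w2 by (intro mult_left_mono CE t H)
     also have "... = (H * CE j) * (?w j)^2" by simp
     also have "... <= D * (?w j)^2" by (intro mult_right_mono HD j) auto
     finally show "H * exp (- 2 * c * t) <= D * (?w j)^2" .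
    qed simp
    finally have B: "ennreal (H * exp (- 2 * c * t)) * (\<integral>\<^sup>+xi. Z j xi \<partial>lborel) <= ennreal (D * (?w j)^2 * (?S j)^2)" .
    show "ennreal H * (\<integral>\<^sup>+xi. X j xi \<partial>lborel) + ennreal (H * exp (- 2 * c * t)) * (\<integral>\<^sup>+xi. Z j xi \<partial>lborel)
     <= ennreal (D * (?w j)^2 * (?L j)^2 + D * (?w j)^2 * (?S j)^2)"
     using add_mono[OF A B] D by (subst ennreal_plus) auto
   qed
   also have "... = ennreal (\<Sum>j<m. D * (?w j)^2 * (?L j)^2 + D * (?w j)^2 * (?S j)^2)"
    using D by (intro sum_ennreal) auto
   also have "... <= ennreal (D * (\<Sum>j<m. ?w j * (?L j + ?S j))^2)"
   proof (rule ennreal_leI)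
    have "(\<Sum>j<m. D * (?w j)^2 * (?L j)^2 + D * (?w j)^2 * (?S j)^2) <= (\<Sum>j<m. D * (?w j * (?L j + ?S j))^2)"
    proof (rule sum_mono)
     fix j
     have "(?L j)^2 + (?S j)^2 <= (?L j + ?S j)^2" using Snn[of j] by (simp add: power2_sum)
     then have "D * (?w j)^2 * ((?L j)^2 + (?S j)^2) <= D * (?w j)^2 * (?L j + ?S j)^2"
      using D by (intro mult_left_mono) auto
     then show "D * (?w j)^2 * (?L j)^2 + D * (?w j)^2 * (?S j)^2 <= D * (?w j * (?L j + ?S j))^2"
      by (simp only: power_mult_distrib) (simp only: distrib_left mult.assoc)
    qed
    also have "... = D * (\<Sum>j<m. (?w j * (?L j + ?S j))^2)" by (simp only: sum_distrib_left)
    also have "... <= D * (\<Sum>j<m. ?w j * (?L j + ?S j))^2"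
    proof (rule mult_left_mono)
     have "(\<Sum>j\<in>I. (f j)^2) <= (\<Sum>j\<in>I. f j)^2" if "finite I" "!!j. f j >= 0" for f :: "nat => real" and I
      using that(1)
     proof (induction I)
      case (insert x I)
      have "0 <= f x * (\<Sum>j\<in>I. f j)" using that(2) by (intro mult_nonneg_nonneg sum_nonneg) auto
      then show ?case using insert by (simp add: power2_sum)
     qed simp
     then show "(\<Sum>j<m. (?w j * (?L j + ?S j))^2) <= (\<Sum>j<m. ?w j * (?L j + ?S j))^2" using Snn by simp
    qed (use D in simp)
    finally show "(\<Sum>j<m. D * (?w j)^2 * (?L j)^2 + D * (?w j)^2 * (?S j)^2) <= D * (\<Sum>j<m. ?w j * (?L j + ?S j))^2" .
   qed
   finally show ?thesis .
  qed
  have Rm: "?R : borel_measurable lborel" unfolding riesz_weighted_def[abs_def] using Vm by measurable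
  have R2: "?R : Lp 2" by (rule Lp2I[OF Rm]) (rule le_less_trans[OF main], simp)
  show "U k t : hom_sobolev s" unfolding hom_sobolev_def using Vf R2 by (simp add: V_def)
  have "(Lp_norm 2 ?R)^2 <= D * (\<Sum>j<m. ?w j * (?L j + ?S j))^2"
   using main D unfolding nn_integral_Lp2[OF R2] by (subst (asm) ennreal_le_iff) auto
  also have "... = (sqrt D * (\<Sum>j<m. ?w j * (?L j + ?S j)))^2" using D by (simp add: power_mult_distrib)
  finally have "Lp_norm 2 ?R <= sqrt D * (\<Sum>j<m. ?w j * (?L j + ?S j))"
   by (rule power2_le_imp_le) (use D Snn in \<open>auto intro!: mult_nonneg_nonneg sum_nonneg add_nonneg_nonneg\<close>)
  then show "hom_sobolev_norm s (U k t) <= sqrt D * (\<Sum>j<m. (1 + t) powr (- (hy_exponent TYPE('n) q + (real k + s - mu j)) / 2) * (Lp_norm q (u0 j) + sobolev_norm (real k + s - real j) (u0 j)))"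
   unfolding hom_sobolev_norm_def V_def[symmetric] d_def a_def \<sigma>_def .
 qed
qed

text \<open>Separates the data of order at least \<open>p\<close>, which all share one decay rate.\<close>

lemma split_data_sum:
 fixes g h :: "nat => real"
 assumes "p <= m"
 shows "(\<Sum>j<m. h (min j p) * g j) = h p * (\<Sum>j\<in>{p..<m}. g j) + (\<Sum>j<p. h j * g j)"
proof -
 have "(\<Sum>j<m. h (min j p) * g j) = (\<Sum>j\<in>{..<p} \<union> {p..<m}. h (min j p) * g j)"
  using assms by (intro sum.cong) auto
 also have "... = (\<Sum>j<p. h (min j p) * g j) + (\<Sum>j\<in>{p..<m}. h (min j p) * g j)"
  by (rule sum.union_disjoint) auto
 also have "(\<Sum>j<p. h (min j p) * g j) = (\<Sum>j<p. h j * g j)" by (intro sum.cong) auto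
 also have "(\<Sum>j\<in>{p..<m}. h (min j p) * g j) = h p * (\<Sum>j\<in>{p..<m}. g j)" by (simp add: sum_distrib_left)
 finally show ?thesis by simp
qed

lemma decay_estimate_split:
 fixes P P1 P2 :: "'n::finite operator" and s s0 q :: real and k :: nat
 assumes I: "interlacing_operators m theta P P1 P2" and p: "p = slow_order m theta - 1"
  and s0: "s0 >= real m - 1" and q: "1 <= q" "q <= 2" and s: "0 <= s" and ks: "real k + s <= s0"
  and cond: "real k + s >= real p \<or> hy_exponent TYPE('n) q + (real k + s) > real p"
 shows "EX C>0. ALL u0 u U.
  (ALL j<m. u0 j : sobolev (s0 - real j) \<inter> Lp q) & cauchy_solution s0 m (%k alpha. P k alpha + P1 k alpha + P2 k alpha) u0 u U -->
  (ALL t>=0. U k t : hom_sobolev s & hom_sobolev_norm s (U k t)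
   <= C * (1 + t) powr (- (real CARD('n) / 2) * (1/q - 1/2) - (real k + s - real p) / 2)
     * (\<Sum>j\<in>{p..<m}. Lp_norm q (u0 j) + sobolev_norm (real k + s - real j) (u0 j))
    + C * (\<Sum>j<p. (1 + t) powr (- (real CARD('n) / 2) * (1/q - 1/2) - (real k + s - real j) / 2)
     * (Lp_norm q (u0 j) + sobolev_norm (real k + s - real j) (u0 j))))"
proof -
 have rw: "- (real CARD('n) / 2) * (1/q - 1/2) - (real k + s - x) / 2 = - (hy_exponent TYPE('n) q + (real k + s - x)) / 2" for x
  by (simp add: hy_exponent_def field_simps)
 have "p <= m" by (simp add: p slow_order_def)
 then have sp: "(\<Sum>j<m. (1 + t) powr (- (hy_exponent TYPE('n) q + (real k + s - real (min j p))) / 2) * g j)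
  = (1 + t) powr (- (hy_exponent TYPE('n) q + (real k + s - real p)) / 2) * (\<Sum>j\<in>{p..<m}. g j)
   + (\<Sum>j<p. (1 + t) powr (- (hy_exponent TYPE('n) q + (real k + s - real j)) / 2) * g j)" for t g
  by (rule split_data_sum)
 show ?thesis
  using decay_estimate[OF I s0 q s ks cond[unfolded p]]
  unfolding rw p[symmetric] sp by (simp only: distrib_left mult.assoc)
qed

theorem theorem1:
  fixes m :: nat and s0 q :: real
    and Pm Pm1 Pm2 :: "'n::finite operator"
  assumes "m \<ge> 3"
    and "strictly_hyperbolic m Pm" and "Pm m (\<lambda>_. 0) = 1"
    and "strictly_hyperbolic (m - 1) Pm1"
    and "\<forall>\<xi>\<in>sphere 0 1. strictly_interlace (symbol Pm1 \<xi>) (symbol Pm \<xi>)"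
    and "s0 \<ge> real m - 1" and "1 \<le> q" and "q \<le> 2"
  shows
   "(\<forall>(k::nat) (s::real).
       0 \<le> s \<and> real k + s \<le> s0 \<and>
       (if q = 2 then real k + s \<ge> real m - 2
        else real CARD('n) * (1/q - 1/2) + real k + s > real m - 2) \<longrightarrow>
       (\<exists>C>0. \<forall>u0 u U.
          (\<forall>j<m. u0 j \<in> sobolev (s0 - real j) \<inter> Lp q) \<and>
          cauchy_solution s0 m (\<lambda>k \<alpha>. Pm k \<alpha> + Pm1 k \<alpha>) u0 u U \<longrightarrow>
          (\<forall>t\<ge>0. U k t \<in> hom_sobolev s \<and>
             hom_sobolev_norm s (U k t)
             \<le> C * (1 + t) powr (- (real CARD('n) / 2) * (1/q - 1/2) - (real k + s - (real m - 2)) / 2)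
                 * (\<Sum>j\<in>{m-2, m-1}. Lp_norm q (u0 j) + sobolev_norm (real k + s - real j) (u0 j))
               + C * (\<Sum>j<m-2. (1 + t) powr (- (real CARD('n) / 2) * (1/q - 1/2) - (real k + s - real j) / 2)
                 * (Lp_norm q (u0 j) + sobolev_norm (real k + s - real j) (u0 j))))))
    \<and>
    (strictly_hyperbolic (m - 2) Pm2 \<and>
     (\<forall>\<xi>\<in>sphere 0 1. strictly_interlace (symbol Pm2 \<xi>) (symbol Pm1 \<xi>)) \<longrightarrow>
     (\<forall>(k::nat) (s::real).
       0 \<le> s \<and> real k + s \<le> s0 \<and>
       (if q = 2 then real k + s \<ge> real m - 3
        else real CARD('n) * (1/q - 1/2) + real k + s > real m - 3) \<longrightarrow>
       (\<exists>C>0. \<forall>u0 u U.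
          (\<forall>j<m. u0 j \<in> sobolev (s0 - real j) \<inter> Lp q) \<and>
          cauchy_solution s0 m (\<lambda>k \<alpha>. Pm k \<alpha> + Pm1 k \<alpha> + Pm2 k \<alpha>) u0 u U \<longrightarrow>
          (\<forall>t\<ge>0. U k t \<in> hom_sobolev s \<and>
             hom_sobolev_norm s (U k t)
             \<le> C * (1 + t) powr (- (real CARD('n) / 2) * (1/q - 1/2) - (real k + s - (real m - 3)) / 2)
                 * (\<Sum>j\<in>{m-3..m-1}. Lp_norm q (u0 j) + sobolev_norm (real k + s - real j) (u0 j))
               + C * (\<Sum>j<m-3. (1 + t) powr (- (real CARD('n) / 2) * (1/q - 1/2) - (real k + s - real j) / 2)
                 * (Lp_norm q (u0 j) + sobolev_norm (real k + s - real j) (u0 j)))))))"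
proof (intro conjI impI allI, goal_cases)
 have hom: "homogeneous_op m Pm" "homogeneous_op (m - 1) Pm1"
  using assms(2,4) by (auto simp: strictly_hyperbolic_def hyperbolic_def)
 {
  case (1 k s)
  have I: "interlacing_operators m 0 Pm Pm1 (%_ _. 0)"
   unfolding interlacing_operators_def using assms hom by simp
  have N: "m - 2 = slow_order m 0 - 1" and r: "real m - 2 = real (m - 2)" and set: "{m-2, m-1} = {m-2..<m}"
   using assms(1) by (auto simp: slow_order_def)
  have cond: "real k + s >= real (m - 2) \<or> hy_exponent TYPE('n) q + (real k + s) > real (m - 2)"
   unfolding hy_exponent_def r[symmetric] using 1 by (auto split: if_splits)
  show ?case
   using decay_estimate_split[OF I N assms(6,7,8) 1[THEN conjunct1] 1[THEN conjunct2, THEN conjunct1] cond]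
   unfolding r set add_0_right .
 next
  case (2 k s)
  have I: "interlacing_operators m 1 Pm Pm1 Pm2"
   unfolding interlacing_operators_def using assms hom 2(1) by (simp add: strictly_hyperbolic_def hyperbolic_def)
  have N: "m - 3 = slow_order m 1 - 1" and r: "real m - 3 = real (m - 3)" and set: "{m-3..m-1} = {m-3..<m}"
   using assms(1) by (auto simp: slow_order_def)
  have cond: "real k + s >= real (m - 3) \<or> hy_exponent TYPE('n) q + (real k + s) > real (m - 3)"
   unfolding hy_exponent_def r[symmetric] using 2(2) by (auto split: if_splits)
  show ?case
   using decay_estimate_split[OF I N assms(6,7,8) 2(2)[THEN conjunct1] 2(2)[THEN conjunct2, THEN conjunct1] cond]
   unfolding r set .
 }
qed

end
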